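(* There is a universal constant $C>0$ such that the following holds. Let $m_0\in B^{1/2}_{2,1}(\mathbb{T})$ and let $\lambda>0$ satisfy $$\lambda\ \ge\ \frac{6C^3}{\ln 2}\Big(\|m_0\|_{B^{1/2}_{2,1}}+\frac{4C^3}{\lambda}\|m_0\|^3_{B^{1/2}_{2,1}}\Big)^2 e^{4C^3\|m_0\|^2_{B^{1/2}_{2,1}}/\lambda}.$$ Then the Cauchy problem for the weakly dissipative FORQ/MCH equation $$\begin{cases} m_t+\big[(u^2-u_x^2)m\big]_x+\lambda m=0, & t>0,\ x\in\mathbb{T},\\ m(0,x)=m_0(x), & x\in\mathbb{T},\end{cases}\qquad m=u-u_{xx},$$ has a unique global strong solution $m\in C([0,T];B^{1/2}_{2,1}(\mathbb{T}))$ (for every $T>0$).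
   Context: $\mathbb{T}=\mathbb{R}/\mathbb{Z}$. $B^{s}_{p,r}(\mathbb{T})$ is the nonhomogeneous Besov space with norm $\|f\|_{B^s_{p,r}}=\big\|(2^{qs}\|\Delta_q f\|_{L^p})_{q\ge-1}\big\|_{\ell^r}$, where $(\Delta_q)_{q\ge -1}$ are the nonhomogeneous Littlewood–Paley dyadic blocks on $\mathbb{T}$. Here $u=(1-\partial_x^2)^{-1}m$ on $\mathbb{T}$, and $\lambda$ is the dissipative parameter. *)

theory Defs
  imports "HOL-Analysis.Analysis"
begin

section \<open>Real periodic distributions on the circle\<close>

definition smooth :: "(real \<Rightarrow> real) \<Rightarrow> bool" where
  "smooth f \<longleftrightarrow> (\<forall>n x. (deriv ^^ n) f differentiable (at x))"

text \<open>Functions on \<open>\<real>/\<int>\<close> are represented by functions on the line of period 1.\<close>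

definition test_fun :: "(real \<Rightarrow> real) set" where
  "test_fun = {f. smooth f \<and> (\<forall>x. f (x + 1) = f x)}"

text \<open>
  The first two conditions are linearity, the third is continuity with respect to the
  \<open>C\<^sup>N\<close>-norms.  The value 0 off the space of test functions is a convention that makes equality
  of functionals coincide with equality of distributions.
\<close>

definition is_pdistr :: "((real \<Rightarrow> real) \<Rightarrow> real) \<Rightarrow> bool" where
  "is_pdistr T \<longleftrightarrow>
     (\<forall>f\<in>test_fun. \<forall>g\<in>test_fun. T (\<lambda>x. f x + g x) = T f + T g) \<and>
     (\<forall>c. \<forall>f\<in>test_fun. T (\<lambda>x. c * f x) = c * T f) \<and>
     (\<exists>C N. \<forall>f\<in>test_fun. \<forall>B. (\<forall>j\<le>N. \<forall>x. \<bar>(deriv ^^ j) f x\<bar> \<le> B) \<longrightarrow> \<bar>T f\<bar> \<le> C * B) \<and>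
     (\<forall>f. f \<notin> test_fun \<longrightarrow> T f = 0)"

typedef pdistr = "{T. is_pdistr T}"
  morphisms pairing Abs_pdistr
  by (rule exI[of _ "\<lambda>_. 0"]) (auto simp: is_pdistr_def intro!: exI[of _ 0])

setup_lifting type_definition_pdistr

lemma is_pdistr_lincomb:
  assumes S: "is_pdistr S" and T: "is_pdistr T"
  shows "is_pdistr (\<lambda>f. a * S f + b * T f)"
proof -
  obtain C N where C: "\<And>f B. f \<in> test_fun \<Longrightarrow> (\<forall>j\<le>N. \<forall>x. \<bar>(deriv ^^ j) f x\<bar> \<le> B) \<Longrightarrow> \<bar>S f\<bar> \<le> C * B"
    using S unfolding is_pdistr_def by metis
  obtain D M where D: "\<And>f B. f \<in> test_fun \<Longrightarrow> (\<forall>j\<le>M. \<forall>x. \<bar>(deriv ^^ j) f x\<bar> \<le> B) \<Longrightarrow> \<bar>T f\<bar> \<le> D * B"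
    using T unfolding is_pdistr_def by metis
  have "\<bar>a * S f + b * T f\<bar> \<le> (\<bar>a\<bar> * C + \<bar>b\<bar> * D) * B"
    if f: "f \<in> test_fun" and B: "\<forall>j\<le>max N M. \<forall>x. \<bar>(deriv ^^ j) f x\<bar> \<le> B" for f B
  proof -
    have "\<bar>S f\<bar> \<le> C * B" "\<bar>T f\<bar> \<le> D * B"
      using B by (auto intro!: C[OF f] D[OF f])
    hence "\<bar>a\<bar> * \<bar>S f\<bar> \<le> \<bar>a\<bar> * (C * B)" "\<bar>b\<bar> * \<bar>T f\<bar> \<le> \<bar>b\<bar> * (D * B)"
      by (auto intro: mult_left_mono)
    moreover have "\<bar>a * S f + b * T f\<bar> \<le> \<bar>a\<bar> * \<bar>S f\<bar> + \<bar>b\<bar> * \<bar>T f\<bar>"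
      by (metis abs_mult abs_triangle_ineq)
    ultimately show ?thesis by (simp add: algebra_simps)
  qed
  hence "\<exists>C N. \<forall>f\<in>test_fun. \<forall>B. (\<forall>j\<le>N. \<forall>x. \<bar>(deriv ^^ j) f x\<bar> \<le> B) \<longrightarrow>
      \<bar>a * S f + b * T f\<bar> \<le> C * B"
    by blast
  thus ?thesis
    using S T unfolding is_pdistr_def by (simp add: algebra_simps)
qed

instantiation pdistr :: real_vector
begin

lift_definition zero_pdistr :: pdistr is "\<lambda>_. 0"
  by (auto simp: is_pdistr_def intro!: exI[of _ 0])

lift_definition plus_pdistr :: "pdistr \<Rightarrow> pdistr \<Rightarrow> pdistr" is "\<lambda>S T f. S f + T f"
  using is_pdistr_lincomb[of _ _ 1 1] by simp

lift_definition minus_pdistr :: "pdistr \<Rightarrow> pdistr \<Rightarrow> pdistr" is "\<lambda>S T f. S f - T f"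
  using is_pdistr_lincomb[of _ _ 1 "-1"] by simp

lift_definition uminus_pdistr :: "pdistr \<Rightarrow> pdistr" is "\<lambda>T f. - T f"
  using is_pdistr_lincomb[of _ _ "-1" 0] by fastforce

lift_definition scaleR_pdistr :: "real \<Rightarrow> pdistr \<Rightarrow> pdistr" is "\<lambda>c T f. c * T f"
  using is_pdistr_lincomb[of _ _ _ 0] by fastforce

instance
  by standard (transfer; simp add: algebra_simps fun_eq_iff)+

end

lemma smooth_deriv:
  assumes "smooth f"
  shows "smooth (deriv f)"
  unfolding smooth_def
proof (intro allI)
  fix n x
  show "(deriv ^^ n) (deriv f) differentiable (at x)"
    using assms[unfolded smooth_def, rule_format, of "Suc n" x] by (simp add: funpow_swap1)
qed

lemma smooth_has_deriv:
  assumes "smooth f"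
  shows "(f has_real_derivative deriv f x) (at x)"
  using assms[unfolded smooth_def, rule_format, of 0 x]
  by (simp add: DERIV_deriv_iff_real_differentiable)

lemma test_fun_deriv:
  assumes f: "f \<in> test_fun"
  shows "deriv f \<in> test_fun"
proof -
  have sm: "smooth f" and per: "f (x + 1) = f x" for x
    using f by (auto simp: test_fun_def)
  have "deriv f (x + 1) = deriv f x" for x
  proof -
    have "((\<lambda>y. f (y + 1)) has_real_derivative deriv f (x + 1)) (at x)"
      using smooth_has_deriv[OF sm, of "x + 1"] by (simp add: DERIV_shift)
    hence "(f has_real_derivative deriv f (x + 1)) (at x)"
      by (simp add: per)
    thus ?thesis using smooth_has_deriv[OF sm, of x] DERIV_unique by blast
  qed
  thus ?thesis using smooth_deriv[OF sm] by (simp add: test_fun_def)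
qed

lemma deriv_test_fun_add:
  "f \<in> test_fun \<Longrightarrow> g \<in> test_fun \<Longrightarrow> deriv (\<lambda>x. f x + g x) = (\<lambda>x. deriv f x + deriv g x)"
  by (auto simp: test_fun_def intro!: DERIV_imp_deriv derivative_eq_intros smooth_has_deriv)

lemma deriv_test_fun_scale:
  "f \<in> test_fun \<Longrightarrow> deriv (\<lambda>x. c * f x) = (\<lambda>x. c * deriv f x)"
  by (auto simp: test_fun_def intro!: DERIV_imp_deriv derivative_eq_intros smooth_has_deriv)

lemma test_fun_add:
  assumes f: "f \<in> test_fun" and g: "g \<in> test_fun"
  shows "(\<lambda>x. f x + g x) \<in> test_fun"
proof -
  have eq: "(deriv ^^ n) (\<lambda>x. f x + g x) = (\<lambda>x. (deriv ^^ n) f x + (deriv ^^ n) g x)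
      \<and> (deriv ^^ n) f \<in> test_fun \<and> (deriv ^^ n) g \<in> test_fun" for n
    by (induction n) (simp_all add: f g deriv_test_fun_add test_fun_deriv)
  have "smooth (\<lambda>x. f x + g x)"
    using eq f g by (auto simp: smooth_def test_fun_def intro: differentiable_add)
  thus ?thesis using f g by (simp add: test_fun_def)
qed

lemma test_fun_scale:
  assumes f: "f \<in> test_fun"
  shows "(\<lambda>x. c * f x) \<in> test_fun"
proof -
  have eq: "(deriv ^^ n) (\<lambda>x. c * f x) = (\<lambda>x. c * (deriv ^^ n) f x)
      \<and> (deriv ^^ n) f \<in> test_fun" for n
    by (induction n) (simp_all add: f deriv_test_fun_scale test_fun_deriv)
  have "smooth (\<lambda>x. c * f x)"
    using eq f by (auto simp: smooth_def test_fun_def intro!: derivative_intros)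
  thus ?thesis using f by (simp add: test_fun_def)
qed

lift_definition pderivative :: "pdistr \<Rightarrow> pdistr"
  is "\<lambda>T f. if f \<in> test_fun then - T (deriv f) else 0"
proof -
  fix T assume T: "is_pdistr T"
  obtain C N where C: "\<And>f B. f \<in> test_fun \<Longrightarrow> (\<forall>j\<le>N. \<forall>x. \<bar>(deriv ^^ j) f x\<bar> \<le> B) \<Longrightarrow> \<bar>T f\<bar> \<le> C * B"
    using T unfolding is_pdistr_def by metis
  have bound: "\<bar>T (deriv f)\<bar> \<le> C * B"
    if f: "f \<in> test_fun" and B: "\<forall>j\<le>Suc N. \<forall>x. \<bar>(deriv ^^ j) f x\<bar> \<le> B" for f B
  proof (rule C[OF test_fun_deriv[OF f]], intro allI impI)
    fix j x assume "j \<le> N"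
    thus "\<bar>(deriv ^^ j) (deriv f) x\<bar> \<le> B"
      using B[rule_format, of "Suc j" x] by (simp add: funpow_swap1)
  qed
  show "is_pdistr (\<lambda>f. if f \<in> test_fun then - T (deriv f) else 0)"
    unfolding is_pdistr_def
  proof (intro conjI)
    show "\<exists>C N. \<forall>f\<in>test_fun. \<forall>B. (\<forall>j\<le>N. \<forall>x. \<bar>(deriv ^^ j) f x\<bar> \<le> B) \<longrightarrow>
        \<bar>if f \<in> test_fun then - T (deriv f) else 0\<bar> \<le> C * B"
      using bound by (intro exI[of _ C] exI[of _ "Suc N"]) auto
  qed (use T in \<open>auto simp: is_pdistr_def deriv_test_fun_add deriv_test_fun_scale test_fun_add test_fun_scale test_fun_deriv\<close>)
qed

lemma test_fun_bounded:
  assumes "f \<in> test_fun"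
  shows "\<exists>B. \<forall>x\<in>{0..1}. \<bar>f x\<bar> \<le> B"
proof -
  have "continuous_on {0..1} f"
    using assms by (auto simp: test_fun_def intro!: DERIV_continuous_on[OF has_field_derivative_at_within] smooth_has_deriv)
  hence "bounded (f ` {0..1})"
    by (intro compact_imp_bounded compact_continuous_image) auto
  thus ?thesis
    by (auto simp: bounded_iff)
qed

lemma test_fun_measurable:
  assumes "f \<in> test_fun"
  shows "f \<in> borel_measurable borel"
proof -
  have "continuous_on UNIV f"
    using assms by (auto simp: test_fun_def intro!: DERIV_continuous_on[OF has_field_derivative_at_within] smooth_has_deriv)
  thus ?thesis by (rule borel_measurable_continuous_onI)
qed

lemma set_integrable_times_test_fun:
  assumes g: "set_integrable lborel {0..1} g" and f: "f \<in> test_fun"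
  shows "set_integrable lborel {0..1} (\<lambda>x. g x * f x)"
proof -
  obtain B where B: "\<forall>x\<in>{0..1}. \<bar>f x\<bar> \<le> B"
    using test_fun_bounded[OF f] by blast
  have "integrable lborel (\<lambda>x. (indicator {0..1} x *\<^sub>R g x) * f x)"
  proof (rule Bochner_Integration.integrable_bound)
    show "integrable lborel (\<lambda>x. B * (indicator {0..1} x *\<^sub>R g x))"
      using g unfolding set_integrable_def by (rule integrable_mult_right)
    show "(\<lambda>x. indicator {0..1} x *\<^sub>R g x * f x) \<in> borel_measurable lborel"
      using g test_fun_measurable[OF f] unfolding set_integrable_def
      by (intro borel_measurable_times) auto
    have "\<bar>g x * f x\<bar> \<le> \<bar>B * g x\<bar>" if "x \<in> {0..1}" for x
    proof -
      have "\<bar>f x\<bar> \<le> \<bar>B\<bar>" using B that by force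
      thus ?thesis by (simp add: abs_mult mult.commute[of "\<bar>g x\<bar>"] mult_right_mono)
    qed
    thus "AE x in lborel. norm (indicator {0..1} x *\<^sub>R g x * f x) \<le> norm (B * (indicator {0..1} x *\<^sub>R g x))"
      by (intro AE_I2) (auto simp: indicator_def)
  qed
  thus ?thesis
    by (simp add: set_integrable_def algebra_simps)
qed

lemma is_pdistr_of_fun:
  assumes g: "set_integrable lborel {0..1} g"
  shows "is_pdistr (\<lambda>f. if f \<in> test_fun then (LINT x:{0..1}|lborel. g x * f x) else 0)"
proof -
  define T where "T f = (LINT x:{0..1}|lborel. g x * f x)" for f
  note int = set_integrable_times_test_fun[OF g]
  have add: "T (\<lambda>x. f x + h x) = T f + T h" if "f \<in> test_fun" "h \<in> test_fun" for f h
    unfolding T_def using set_integral_add(2)[OF int int, OF that] by (simp add: algebra_simps)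
  have scale: "T (\<lambda>x. c * f x) = c * T f" for c f
    unfolding T_def by (subst set_integral_mult_right[symmetric]) (simp add: algebra_simps)
  have bound: "\<bar>T f\<bar> \<le> (LINT x:{0..1}|lborel. \<bar>g x\<bar>) * B"
    if f: "f \<in> test_fun" and B: "\<forall>j\<le>0. \<forall>x. \<bar>(deriv ^^ j) f x\<bar> \<le> B" for f B
  proof -
    have ga: "set_integrable lborel {0..1} (\<lambda>x. \<bar>g x\<bar>)"
      using set_integrable_abs[OF g] .
    have "\<bar>T f\<bar> \<le> (LINT x:{0..1}|lborel. \<bar>g x * f x\<bar>)"
      unfolding T_def using set_integral_norm_bound[OF int[OF f]] by simp
    also have "\<dots> \<le> (LINT x:{0..1}|lborel. \<bar>g x\<bar> * B)"
      by (rule set_integral_mono)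
         (use B ga set_integrable_abs[OF int[OF f]] in \<open>auto simp: abs_mult intro!: mult_left_mono\<close>)
    finally show ?thesis by simp
  qed
  have closed: "(\<lambda>x. f x + h x) \<in> test_fun" "(\<lambda>x. c * f x) \<in> test_fun"
    if "f \<in> test_fun" "h \<in> test_fun" for f h c
    using that test_fun_add test_fun_scale by auto
  show ?thesis
    unfolding is_pdistr_def T_def[symmetric]
  proof (intro conjI)
    show "\<exists>C N. \<forall>f\<in>test_fun. \<forall>B. (\<forall>j\<le>N. \<forall>x. \<bar>(deriv ^^ j) f x\<bar> \<le> B) \<longrightarrow>
        \<bar>if f \<in> test_fun then T f else 0\<bar> \<le> C * B"
      using bound by (intro exI[of _ "LINT x:{0..1}|lborel. \<bar>g x\<bar>"] exI[of _ 0]) auto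
  qed (auto simp: add scale closed)
qed

lift_definition pdistr_of_fun :: "(real \<Rightarrow> real) \<Rightarrow> pdistr"
  is "\<lambda>g f. if set_integrable lborel {0..1} g
          then if f \<in> test_fun then (LINT x:{0..1}|lborel. g x * f x) else 0
          else 0"
  subgoal for g
    using is_pdistr_of_fun[of g] zero_pdistr.rsp
    by (cases "set_integrable lborel {0..1} g") (auto simp: eq_onp_def)
  done

text \<open>
  A representative of a regular distribution, unique almost everywhere on \<open>[0,1]\<close>.
\<close>

definition fun_of_pdistr :: "pdistr \<Rightarrow> real \<Rightarrow> real" where
  "fun_of_pdistr T = (SOME g. set_integrable lborel {0..1} g \<and> pdistr_of_fun g = T)"


section \<open>Littlewood--Paley blocks and Besov spaces\<close>

definition littlewood_paley_pair :: "(real \<Rightarrow> real) \<Rightarrow> (real \<Rightarrow> real) \<Rightarrow> bool" where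
  "littlewood_paley_pair chi phi \<longleftrightarrow>
     smooth chi \<and> smooth phi \<and>
     (\<forall>\<xi>. chi (-\<xi>) = chi \<xi> \<and> phi (-\<xi>) = phi \<xi>) \<and>
     (\<forall>\<xi>. 0 \<le> chi \<xi> \<and> chi \<xi> \<le> 1 \<and> 0 \<le> phi \<xi> \<and> phi \<xi> \<le> 1) \<and>
     (\<forall>\<xi>. chi \<xi> \<noteq> 0 \<longrightarrow> \<bar>\<xi>\<bar> \<le> 4/3) \<and>
     (\<forall>\<xi>. phi \<xi> \<noteq> 0 \<longrightarrow> 3/4 \<le> \<bar>\<xi>\<bar> \<and> \<bar>\<xi>\<bar> \<le> 8/3) \<and>
     (\<forall>\<xi>. (\<lambda>q::nat. phi (\<xi> / 2 ^ q)) sums (1 - chi \<xi>))"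

definition fourier_coeff :: "pdistr \<Rightarrow> int \<Rightarrow> complex" where
  "fourier_coeff T k =
     Complex (pairing T (\<lambda>x. cos (2 * pi * k * x))) (- pairing T (\<lambda>x. sin (2 * pi * k * x)))"

definition lp_symbol :: "(real \<Rightarrow> real) \<Rightarrow> (real \<Rightarrow> real) \<Rightarrow> int \<Rightarrow> real \<Rightarrow> real" where
  "lp_symbol chi phi q \<xi> = (if q = -1 then chi \<xi> else phi (2 powi (-q) * \<xi>))"

text \<open>
  The symbol is evaluated at the index \<open>k\<close> of the mode \<open>exp (2 \<pi> \<i> k x)\<close>.  Only finitely many
  terms of the sum are nonzero.
\<close>

definition lp_block :: "(real \<Rightarrow> real) \<Rightarrow> (real \<Rightarrow> real) \<Rightarrow> int \<Rightarrow> pdistr \<Rightarrow> real \<Rightarrow> complex" where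
  "lp_block chi phi q T x =
     (\<Sum>\<^sub>\<infinity>k\<in>UNIV. of_real (lp_symbol chi phi q (of_int k)) * fourier_coeff T k * cis (2 * pi * of_int k * x))"

definition Lp_norm :: "real \<Rightarrow> (real \<Rightarrow> complex) \<Rightarrow> real" where
  "Lp_norm p f = (LINT x:{0..1}|lborel. norm (f x) powr p) powr (1 / p)"

definition besov_term ::
    "(real \<Rightarrow> real) \<Rightarrow> (real \<Rightarrow> real) \<Rightarrow> real \<Rightarrow> real \<Rightarrow> pdistr \<Rightarrow> int \<Rightarrow> real" where
  "besov_term chi phi s p T q = 2 powr (q * s) * Lp_norm p (lp_block chi phi q T)"

text \<open>
  \<open>B\<^sup>s\<^sub>p\<^sub>,\<^sub>r\<close> for finite \<open>p, r \<ge> 1\<close>.  The value of the norm is meaningful only on the space.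
\<close>

definition besov_space ::
    "(real \<Rightarrow> real) \<Rightarrow> (real \<Rightarrow> real) \<Rightarrow> real \<Rightarrow> real \<Rightarrow> real \<Rightarrow> pdistr set" where
  "besov_space chi phi s p r = {T. (\<lambda>q. besov_term chi phi s p T q powr r) summable_on {-1..}}"

definition besov_norm ::
    "(real \<Rightarrow> real) \<Rightarrow> (real \<Rightarrow> real) \<Rightarrow> real \<Rightarrow> real \<Rightarrow> real \<Rightarrow> pdistr \<Rightarrow> real" where
  "besov_norm chi phi s p r T = (\<Sum>\<^sub>\<infinity>q\<in>{-1..}. besov_term chi phi s p T q powr r) powr (1 / r)"

definition besov_continuous ::
    "(real \<Rightarrow> real) \<Rightarrow> (real \<Rightarrow> real) \<Rightarrow> real \<Rightarrow> real \<Rightarrow> real \<Rightarrow> real set \<Rightarrow> (real \<Rightarrow> pdistr) \<Rightarrow> bool" where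
  "besov_continuous chi phi s p r I m \<longleftrightarrow>
     (\<forall>t\<in>I. m t \<in> besov_space chi phi s p r \<and>
        ((\<lambda>\<tau>. besov_norm chi phi s p r (m \<tau> - m t)) \<longlongrightarrow> 0) (at t within I))"

definition besov_C1_deriv ::
    "(real \<Rightarrow> real) \<Rightarrow> (real \<Rightarrow> real) \<Rightarrow> real \<Rightarrow> real \<Rightarrow> real \<Rightarrow> real set \<Rightarrow>
     (real \<Rightarrow> pdistr) \<Rightarrow> (real \<Rightarrow> pdistr) \<Rightarrow> bool" where
  "besov_C1_deriv chi phi s p r I m m' \<longleftrightarrow>
     besov_continuous chi phi s p r I m \<and> besov_continuous chi phi s p r I m' \<and>
     (\<forall>t\<in>I. ((\<lambda>\<tau>. besov_norm chi phi s p r ((1 / (\<tau> - t)) *\<^sub>R (m \<tau> - m t) - m' t)) \<longlongrightarrow> 0)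
        (at t within I))"


section \<open>The weakly dissipative FORQ/MCH equation\<close>

text \<open>\<open>u = (1 - \<partial>\<^sub>x\<^sup>2)\<^sup>-\<^sup>1 m\<close>; the operator is bijective on periodic distributions.\<close>

definition helmholtz_inv :: "pdistr \<Rightarrow> pdistr" where
  "helmholtz_inv m = (THE u. u - pderivative (pderivative u) = m)"

text \<open>
  The product \<open>(u\<^sup>2 - u\<^sub>x\<^sup>2) m\<close> is the pointwise one of the representing functions: for
  \<open>m \<in> B\<^sup>1\<^sup>/\<^sup>2\<^sub>2\<^sub>,\<^sub>1\<close>, a subspace of \<open>L\<^sup>2\<close>, the distributions \<open>m\<close>, \<open>u\<close>, \<open>u\<^sub>x\<close> are regular and the
  product is square integrable.
\<close>

definition mch_flux :: "pdistr \<Rightarrow> pdistr" where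
  "mch_flux m =
     (let u = helmholtz_inv m in
      pdistr_of_fun (\<lambda>x. ((fun_of_pdistr u x)\<^sup>2 - (fun_of_pdistr (pderivative u) x)\<^sup>2) * fun_of_pdistr m x))"

text \<open>
  The flux derivative lies only in \<open>B\<^sup>-\<^sup>1\<^sup>/\<^sup>2\<^sub>2\<^sub>,\<^sub>1\<close>, so that is the space in which
  the time derivative of a strong solution is taken.
\<close>

definition mch_strong_solution ::
    "(real \<Rightarrow> real) \<Rightarrow> (real \<Rightarrow> real) \<Rightarrow> real \<Rightarrow> pdistr \<Rightarrow> real \<Rightarrow> (real \<Rightarrow> pdistr) \<Rightarrow> bool" where
  "mch_strong_solution chi phi lam m0 T m \<longleftrightarrow>
     besov_continuous chi phi (1/2) 2 1 {0..T} m \<and>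
     m 0 = m0 \<and>
     (\<exists>m'. besov_C1_deriv chi phi (-1/2) 2 1 {0..T} m m' \<and>
        (\<forall>t\<in>{0..T}. m' t + pderivative (mch_flux (m t)) + lam *\<^sub>R m t = 0))"

end

(*
  The equation transports the density m along the velocity v = u^2 - u_x^2, so along the flow X of v one has
  m(t, X) X_y = exp(-lam t) m_0, and X_y grows only through 2 exp(-lam t) u_x(t, X) m_0. Since u_x is bounded by
  exp(-lam t) |m_0|, the total distortion of the flow is controlled by |m_0|^2 / lam; for large lam the flow is a global
  fixed point of a contraction and m(t) = exp(-lam t) (m_0 / X_y) o X^{-1}. Membership in B^{1/2}_{2,1} is preserved because
  this space is the interpolation space between L^2 and H^1 with second index 1, hence an algebra stable under composition
  with bi-Lipschitz maps. Uniqueness is a Gronwall estimate for the H^1 norm of the difference of two functions u. Only the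
  smallness of |m_0|^2 / lam is used, and the constant C of the theorem is simply taken large.
*)
theory Submission
  imports Defs "HOL-Real_Asymp.Real_Asymp"
begin


section \<open>Fourier series of continuous periodic functions\<close>

text \<open>The fixed point is sought for exp(lam t) u_x along the flow rather than for m: this
  function is continuous and controlled by the sup norm of m_0, and in the Jacobian it is multiplied
  by exp(-2 lam t), whose integral over the half line is finite. The obstacle is regularity in time:
  composition with a moving diffeomorphism is continuous on B^{1/2}_{2,1}, but without a rate. Time
  derivatives are therefore taken of Fourier coefficients, where in Lagrangian coordinates only a
  smooth mode and a scalar depend on time, and are lifted to B^{-1/2}_{2,1} by a mean value
  inequality for the norm. For the same reason the uniqueness estimate is carried out on Fourier
  sums truncated at K, with an error of order K^{-1/2}. No paraproducts occur: sup, L2 and H^1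
  bounds of a single atom survive products and bi-Lipschitz substitutions, so each property is
  checked on atoms and summed. The constants are products of the cost 8 of an atom, the cost 20 of a
  decomposition into atoms, and crude kernel bounds; the largest arises in the Neumann series for
  the inverse Jacobian and leads to C = 10^4.\<close>

definition cper :: "(real \<Rightarrow> 'a::real_normed_vector) \<Rightarrow> bool" where
  "cper f \<longleftrightarrow> continuous_on UNIV f \<and> (\<forall>x. f (x + 1) = f x)"

definition ee :: "int \<Rightarrow> real \<Rightarrow> complex" where
  "ee k x = cis (2 * pi * of_int k * x)"

definition fc :: "(real \<Rightarrow> complex) \<Rightarrow> int \<Rightarrow> complex" where
  "fc f k = integral {0..1} (\<lambda>x. f x * ee (-k) x)"

abbreviation rfc :: "(real \<Rightarrow> real) \<Rightarrow> int \<Rightarrow> complex" where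
  "rfc f \<equiv> fc (\<lambda>x. complex_of_real (f x))"

lemma cperD: "cper f \<Longrightarrow> continuous_on S f" "cper f \<Longrightarrow> f (x + 1) = f x"
  by (auto simp: cper_def intro: continuous_on_subset)

lemma cper_minus1: "cper f \<Longrightarrow> f (x - 1) = f x"
  using cperD(2)[of f "x - 1"] by simp

lemma cper_of_real: "cper f \<Longrightarrow> cper (\<lambda>x. complex_of_real (f x))"
  by (auto simp: cper_def intro!: continuous_intros)

lemma cper_add: "cper f \<Longrightarrow> cper g \<Longrightarrow> cper (\<lambda>x. f x + g x)"
  by (auto simp: cper_def intro!: continuous_intros)
lemma cper_diff: "cper f \<Longrightarrow> cper g \<Longrightarrow> cper (\<lambda>x. f x - g x)"
  by (auto simp: cper_def intro!: continuous_intros)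
lemma cper_mult:
  fixes f g :: "real \<Rightarrow> 'a::real_normed_algebra"
  shows "cper f \<Longrightarrow> cper g \<Longrightarrow> cper (\<lambda>x. f x * g x)"
  by (auto simp: cper_def intro!: continuous_intros)
lemma cper_const: "cper (\<lambda>x. c)"
  by (auto simp: cper_def)
lemma cper_sum: "(\<And>i. i \<in> I \<Longrightarrow> cper (f i)) \<Longrightarrow> cper (\<lambda>x. \<Sum>i\<in>I. f i x)"
  by (auto simp: cper_def intro!: continuous_intros)

lemma ee_simps:
  "ee 0 x = 1" "ee k 0 = 1" "norm (ee k x) = 1" "cnj (ee k x) = ee (-k) x"
  "ee j x * ee k x = ee (j + k) x" "ee k (x + y) = ee k x * ee k y"
  by (simp_all add: ee_def cis_cnj cis_mult algebra_simps)

lemma ee_int [simp]: "ee k 1 = 1"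
  by (simp add: ee_def cis_multiple_2pi)

lemma ee_per: "ee k (x + 1) = ee k x"
  by (simp add: ee_simps)

lemma ee_deriv [derivative_intros]:
  "(ee k has_vector_derivative (2 * pi * of_int k) *\<^sub>R (\<i> * ee k x)) (at x within S)"
proof -
  have "((\<lambda>x. cis (2 * pi * of_int k * x)) has_vector_derivative (2 * pi * of_int k) *\<^sub>R (\<i> * cis (2 * pi * of_int k * x))) (at x within S)"
    unfolding has_vector_derivative_complex_iff
    by (auto simp: has_real_derivative_iff_has_vector_derivative[symmetric] intro!: derivative_eq_intros)
  thus ?thesis by (simp add: ee_def[abs_def])
qed

lemma ee_cont [continuous_intros]: "continuous_on S (ee k)"
  by (rule continuous_on_vector_derivative[OF ee_deriv])

lemma cper_ee: "cper (ee k)"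
  by (simp add: cper_def ee_per continuous_intros)

lemma integral_ee: "integral {0..1} (ee k) = (if k = 0 then 1 else 0)"
proof (cases "k = 0")
  case False
  have "((\<lambda>x. (2 * pi * of_int k) *\<^sub>R (\<i> * ee k x)) has_integral (ee k 1 - ee k 0)) {0..1}"
    by (intro fundamental_theorem_of_calculus ee_deriv) auto
  from integral_unique[OF this] show ?thesis using False by (simp add: ee_simps)
qed (simp add: ee_def[abs_def])

section \<open>Antiderivatives on the line and integrals over a period\<close>

lemma antiderivative_UNIV:
  fixes f :: "real \<Rightarrow> 'a::euclidean_space"
  assumes "continuous_on UNIV f"
  obtains G where "\<And>x. (G has_vector_derivative f x) (at x)"
    "\<And>a b. a \<le> b \<Longrightarrow> integral {a..b} f = G b - G a"
proof -
  note c = continuous_on_subset[OF assms subset_UNIV]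
  \<comment> \<open>One of the two integrals always runs over an empty or one-point interval, so
    this is the oriented integral from 0 to \<open>x\<close>.\<close>
  define G where "G x = integral {0..x} f - integral {x..0} f" for x
  have i: "f integrable_on {a..b}" for a b
    using c by (rule integrable_continuous_real)
  \<comment> \<open>Seen from a base point \<open>-R\<close> to the left of \<open>x\<close>,
    \<open>G\<close> is an ordinary indefinite integral minus a constant, so the derivative at
    \<open>x\<close> is two-sided even for \<open>x\<close> at or below 0.\<close>
  have G: "G x = integral {-R..x} f - integral {-R..0} f" if "- R \<le> x" "0 \<le> R" for x R
  proof (cases "0 \<le> x")
    case True
    show ?thesis
      using Henstock_Kurzweil_Integration.integral_combine[where a="-R" and c=0 and b=x and f=f] i that True
      by (cases "x = 0") (auto simp: G_def algebra_simps)
  next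
    case False
    thus ?thesis
      using Henstock_Kurzweil_Integration.integral_combine[where a="-R" and c=x and b=0 and f=f] i that
      by (simp add: G_def algebra_simps)
  qed
  have D: "(G has_vector_derivative f x) (at x)" for x
  proof -
    define R where "R = \<bar>x\<bar> + 1"
    have "((\<lambda>u. integral {-R..u} f) has_vector_derivative f x) (at x within {-R..R})"
      by (rule integral_has_vector_derivative[OF c]) (auto simp: R_def)
    hence "((\<lambda>u. integral {-R..u} f - integral {-R..0} f) has_vector_derivative f x - 0) (at x within {-R..R})"
      by (intro has_vector_derivative_diff has_vector_derivative_const)
    hence "((\<lambda>u. integral {-R..u} f - integral {-R..0} f) has_vector_derivative f x) (at x)"
      by (subst (asm) at_within_interior) (auto simp: R_def)
    thus ?thesis
      by (rule has_vector_derivative_transform_within_open[where S="{-R<..<R}"])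
         (auto simp: R_def G[of R])
  qed
  have "integral {a..b} f = G b - G a" if "a \<le> b" for a b
    by (rule integral_unique, rule fundamental_theorem_of_calculus[OF that])
       (rule has_vector_derivative_at_within[OF D])
  thus ?thesis using that D by blast
qed

text \<open>For an antiderivative \<open>G\<close>, the increment \<open>G (x + 1) - G x\<close> has
  derivative \<open>f (x + 1) - f x = 0\<close>, so it takes the same value at \<open>a\<close> and
  at 0.\<close>

lemma integral_period:
  fixes f :: "real \<Rightarrow> 'a::euclidean_space"
  assumes "cper f"
  shows "integral {a..a+1} f = integral {0..1} f"
proof -
  obtain G where G: "\<And>x. (G has_vector_derivative f x) (at x)"
    "\<And>a b. a \<le> b \<Longrightarrow> integral {a..b} f = G b - G a"
    using antiderivative_UNIV assms[unfolded cper_def] by blast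
  have "((\<lambda>x. G (x + 1) - G x) has_vector_derivative 0) (at x within UNIV)" for x
  proof -
    have "((G \<circ> (\<lambda>x. x + 1)) has_vector_derivative 1 *\<^sub>R f (x + 1)) (at x)"
      by (rule vector_diff_chain_at) (auto intro!: derivative_eq_intros G(1) simp: has_real_derivative_iff_has_vector_derivative[symmetric])
    from has_vector_derivative_diff[OF this G(1)[of x]]
    show ?thesis using cperD(2)[OF assms] by (simp add: o_def)
  qed
  hence "G (a + 1) - G a = G (0 + 1) - G 0"
    using has_vector_derivative_zero_constant[of UNIV "\<lambda>x. G (x + 1) - G x"] by (metis convex_UNIV UNIV_I)
  thus ?thesis using G(2)[of a "a+1"] G(2)[of 0 1] by simp
qed

lemma integral_translate:
  fixes f :: "real \<Rightarrow> 'a::euclidean_space"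
  assumes "cper f"
  shows "integral {0..1} (\<lambda>x. f (x + a)) = integral {0..1} f"
  using integral_shift[of 0 a 1 f, OF cperD(1)[OF assms]] integral_period[OF assms, of a]
  by (simp add: o_def add.commute[of 1 a])

lemma integrable_cper:
  fixes f :: "real \<Rightarrow> 'a::euclidean_space"
  shows "cper f \<Longrightarrow> f integrable_on {a..b}"
  by (rule integrable_continuous_real) (rule cperD)

lemma fc_integrable: "cper f \<Longrightarrow> (\<lambda>x. f x * ee k x) integrable_on {a..b}"
  by (rule integrable_cper[OF cper_mult[OF _ cper_ee]])

lemma fc_add: "cper f \<Longrightarrow> cper g \<Longrightarrow> fc (\<lambda>x. f x + g x) k = fc f k + fc g k"
  by (simp add: fc_def distrib_right integral_add fc_integrable)

lemma fc_diff: "cper f \<Longrightarrow> cper g \<Longrightarrow> fc (\<lambda>x. f x - g x) k = fc f k - fc g k"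
  by (simp add: fc_def left_diff_distrib integral_diff fc_integrable)

lemma fc_cmult: "fc (\<lambda>x. c * f x) k = c * fc f k"
  by (simp add: fc_def mult.assoc)

lemma fc_ee: "fc (ee j) k = (if j = k then 1 else 0)"
  by (simp add: fc_def ee_simps(5) integral_ee)

lemma fc_sum:
  assumes "finite I" "\<And>i. i \<in> I \<Longrightarrow> cper (f i)"
  shows "fc (\<lambda>x. \<Sum>i\<in>I. f i x) k = (\<Sum>i\<in>I. fc (f i) k)"
  unfolding fc_def sum_distrib_right
  by (rule integral_sum) (use assms fc_integrable in auto)

section \<open>Trigonometric polynomials, orthogonality and Bessel's inequality\<close>

lemma cper_trig: "cper (\<lambda>x. \<Sum>j\<in>K. c j * ee j x)"
  by (rule cper_sum) (rule cper_mult[OF cper_const cper_ee])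

lemma fc_trig_poly:
  assumes "finite K"
  shows "fc (\<lambda>x. \<Sum>j\<in>K. c j * ee j x) k = (if k \<in> K then c k else 0)"
proof -
  have "fc (\<lambda>x. \<Sum>j\<in>K. c j * ee j x) k = (\<Sum>j\<in>K. fc (\<lambda>x. c j * ee j x) k)"
    by (rule fc_sum[OF assms]) (rule cper_mult[OF cper_const cper_ee])
  also have "\<dots> = (\<Sum>j\<in>K. if j = k then c j else 0)"
    by (rule sum.cong) (simp_all add: fc_cmult fc_ee)
  finally show ?thesis using assms by simp
qed

lemma integral_times_trig:
  assumes "cper f" "finite K"
  shows "integral {0..1} (\<lambda>x. f x * cnj (\<Sum>j\<in>K. c j * ee j x)) = (\<Sum>j\<in>K. cnj (c j) * fc f j)"
proof -
  have "integral {0..1} (\<lambda>x. f x * cnj (\<Sum>j\<in>K. c j * ee j x)) =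
      integral {0..1} (\<lambda>x. \<Sum>j\<in>K. cnj (c j) * (f x * ee (-j) x))"
    by (rule integral_cong) (simp add: sum_distrib_left ee_simps(4) mult.left_commute)
  also have "\<dots> = (\<Sum>j\<in>K. cnj (c j) * fc f j)"
    by (subst integral_sum) (auto simp: fc_def assms intro!: integrable_cper cper_mult[OF cper_const] cper_mult[OF _ cper_ee])
  finally show ?thesis .
qed

lemma parseval_trig:
  assumes "finite K"
  shows "integral {0..1} (\<lambda>x. (norm (\<Sum>j\<in>K. c j * ee j x))\<^sup>2) = (\<Sum>j\<in>K. (norm (c j))\<^sup>2)"
proof -
  define S where "S x = (\<Sum>j\<in>K. c j * ee j x)" for x
  have S: "cper S" unfolding S_def[abs_def] by (rule cper_trig)
  have i: "(\<lambda>x. S x * cnj (S x)) integrable_on {0..1}"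
    by (intro integrable_continuous_real continuous_intros cperD[OF S])
  have "integral {0..1} (\<lambda>x. (norm (S x))\<^sup>2) = integral {0..1} (\<lambda>x. Re (S x * cnj (S x)))"
    by (simp add: complex_norm_square[symmetric] del: of_real_power)
  also have "\<dots> = Re (integral {0..1} (\<lambda>x. S x * cnj (S x)))"
    using integral_linear[OF i bounded_linear_Re] by (simp add: o_def)
  also have "integral {0..1} (\<lambda>x. S x * cnj (S x)) = (\<Sum>j\<in>K. cnj (c j) * fc S j)"
    using integral_times_trig[OF S assms, of c] unfolding S_def .
  also have "\<dots> = (\<Sum>j\<in>K. of_real ((norm (c j))\<^sup>2))"
    by (rule sum.cong) (simp_all add: S_def[abs_def] fc_trig_poly[OF assms] complex_norm_square mult.commute del: of_real_power)
  also have "Re \<dots> = (\<Sum>j\<in>K. (norm (c j))\<^sup>2)"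
    by (simp del: of_real_power)
  finally show ?thesis by (simp add: S_def)
qed

text \<open>The remainder has vanishing coefficients on \<open>K\<close>, so it is orthogonal to the
  partial sum and the cross term integrates to zero. Keeping the remainder, instead of only an
  inequality, later bounds an L2 norm by a truncated sum plus an error.\<close>

lemma bessel_identity:
  assumes f: "cper f" and K: "finite K"
  shows "integral {0..1} (\<lambda>x. (norm (f x))\<^sup>2) = integral {0..1} (\<lambda>x. (norm (f x - (\<Sum>j\<in>K. fc f j * ee j x)))\<^sup>2)
     + (\<Sum>j\<in>K. (norm (fc f j))\<^sup>2)"
proof -
  define S where "S x = (\<Sum>j\<in>K. fc f j * ee j x)" for x
  have S: "cper S" unfolding S_def[abs_def] by (rule cper_trig)
  define d where "d x = f x - S x" for x
  have d: "cper d" unfolding d_def[abs_def] by (rule cper_diff[OF f S])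
  have i: "(\<lambda>x. d x * cnj (S x)) integrable_on {0..1}"
    by (intro integrable_continuous_real continuous_intros cperD[OF S] cperD[OF d])
  have "integral {0..1} (\<lambda>x. d x * cnj (S x)) = (\<Sum>j\<in>K. cnj (fc f j) * fc d j)"
    using integral_times_trig[OF d K, of "fc f"] by (simp add: S_def)
  also have "\<dots> = 0"
    using fc_trig_poly[OF K, of "fc f"] fc_diff[OF f S]
    by (auto intro!: sum.neutral simp: d_def[abs_def] S_def[abs_def])
  finally have "((\<lambda>x. d x * cnj (S x)) has_integral 0) {0..1}"
    using i by (simp add: has_integral_iff)
  from has_integral_linear[OF this bounded_linear_Re]
  have 0: "((\<lambda>x. Re (d x * cnj (S x))) has_integral 0) {0..1}" by (simp add: o_def)
  have i: "(\<lambda>x. (norm (d x))\<^sup>2) integrable_on {0..1}" "(\<lambda>x. (norm (S x))\<^sup>2) integrable_on {0..1}"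
    by (intro integrable_continuous_real continuous_intros cperD[OF S] cperD[OF d])+
  have "(norm (f x))\<^sup>2 = (norm (d x))\<^sup>2 + (norm (S x))\<^sup>2 + 2 * Re (d x * cnj (S x))" for x
    unfolding d_def by (simp only: cmod_power2) (simp add: algebra_simps power2_eq_square)
  hence "integral {0..1} (\<lambda>x. (norm (f x))\<^sup>2) =
    integral {0..1} (\<lambda>x. (norm (d x))\<^sup>2 + (norm (S x))\<^sup>2 + 2 * Re (d x * cnj (S x)))" by simp
  also have "\<dots> = integral {0..1} (\<lambda>x. (norm (d x))\<^sup>2) + integral {0..1} (\<lambda>x. (norm (S x))\<^sup>2) + 2 * 0"
    by (intro integral_unique has_integral_add has_integral_mult_right 0 integrable_integral i)
  also have "integral {0..1} (\<lambda>x. (norm (S x))\<^sup>2) = (\<Sum>j\<in>K. (norm (fc f j))\<^sup>2)"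
    by (simp add: parseval_trig K S_def)
  finally show ?thesis by (simp add: d_def S_def)
qed

lemma bessel:
  assumes f: "cper f" and K: "finite K"
  shows "(\<Sum>j\<in>K. (norm (fc f j))\<^sup>2) \<le> integral {0..1} (\<lambda>x. (norm (f x))\<^sup>2)"
  unfolding bessel_identity[OF assms]
  by (simp, intro integral_nonneg integrable_continuous_real continuous_intros cperD[OF f]) auto

lemma cper_int: "cper f \<Longrightarrow> f (x + of_int n) = f x"
proof (induction n rule: int_induct[where k=0])
  case (step1 i) thus ?case using cperD(2)[of f "x + of_int i"] by (simp add: algebra_simps)
next
  case (step2 i) thus ?case using cper_minus1[of f "x + of_int i"] by (simp add: algebra_simps)
qed simp

section \<open>Functions of class C^1 and the convergence of their Fourier series\<close>

definition C1p :: "(real \<Rightarrow> 'a::real_normed_vector) \<Rightarrow> (real \<Rightarrow> 'a) \<Rightarrow> bool" where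
  "C1p f f' \<longleftrightarrow> cper f \<and> cper f' \<and> (\<forall>x. (f has_vector_derivative f' x) (at x))"

lemma C1pD:
  assumes "C1p f f'"
  shows "cper f" "cper f'" "(f has_vector_derivative f' x) (at x within S)"
  using assms by (auto simp: C1p_def intro: has_vector_derivative_at_within)

lemma C1p_of_real: "C1p f f' \<Longrightarrow> C1p (\<lambda>x. complex_of_real (f x)) (\<lambda>x. complex_of_real (f' x))"
  by (auto simp: C1p_def cper_of_real has_real_derivative_iff_has_vector_derivative[symmetric] intro: has_vector_derivative_of_real)

lemma fc_deriv:
  assumes "C1p f f'"
  shows "fc f' k = 2 * pi * \<i> * of_int k * fc f k"
proof -
  note f = C1pD[OF assms]
  have "((\<lambda>x. f x * ((2 * pi * of_int (-k)) *\<^sub>R (\<i> * ee (-k) x)) + f' x * ee (-k) x) has_integral f 1 * ee (-k) 1 - f 0 * ee (-k) 0) {0..1}"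
    by (intro fundamental_theorem_of_calculus has_vector_derivative_mult f ee_deriv) auto
  moreover have "(\<lambda>x. f x * ((2 * pi * of_int (-k)) *\<^sub>R (\<i> * ee (-k) x)) + f' x * ee (-k) x) =
      (\<lambda>x. (- (2 * pi * \<i> * of_int k)) * (f x * ee (-k) x) + f' x * ee (-k) x)"
    by (auto simp: scaleR_conv_of_real algebra_simps)
  ultimately have "integral {0..1} (\<lambda>x. (- (2 * pi * \<i> * of_int k)) * (f x * ee (-k) x) + f' x * ee (-k) x) = 0"
    using cperD(2)[OF f(1), of 0] by (simp only: integral_unique) (simp add: ee_simps)
  thus ?thesis
    by (subst (asm) integral_add[OF integrable_on_mult_right[OF fc_integrable[OF f(1)]] fc_integrable[OF f(2)]])
       (simp only: integral_mult_right fc_def, simp)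
qed

text \<open>Bessel's inequality makes the squared coefficients summable along any injective
  enumeration of frequencies. The two enumerations are those of the end terms left by the
  telescoping sum in \<open>fourier_converges\<close>.\<close>

lemma fc_square_tendsto:
  assumes "cper g"
  shows "(\<lambda>n. fc g (int n)) \<longlonglongrightarrow> 0" "(\<lambda>n. fc g (- int n - 1)) \<longlonglongrightarrow> 0"
proof -
  have *: "(\<lambda>n. fc g (h n)) \<longlonglongrightarrow> 0" if "inj h" for h :: "nat \<Rightarrow> int"
  proof -
    have "summable (\<lambda>n. (norm (fc g (h n)))\<^sup>2)"
    proof (rule summableI_nonneg_bounded)
      fix n
      have "(\<Sum>i<n. (norm (fc g (h i)))\<^sup>2) = (\<Sum>k\<in>h ` {..<n}. (norm (fc g k))\<^sup>2)"
        using that by (subst sum.reindex) (auto simp: inj_on_def)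
      also have "\<dots> \<le> integral {0..1} (\<lambda>x. (norm (g x))\<^sup>2)"
        by (rule bessel[OF assms]) simp
      finally show "(\<Sum>i<n. (norm (fc g (h i)))\<^sup>2) \<le> integral {0..1} (\<lambda>x. (norm (g x))\<^sup>2)" .
    qed simp
    hence "(\<lambda>n. sqrt ((norm (fc g (h n)))\<^sup>2)) \<longlonglongrightarrow> sqrt 0"
      by (intro tendsto_real_sqrt summable_LIMSEQ_zero)
    thus ?thesis by (simp add: tendsto_norm_zero_iff)
  qed
  show "(\<lambda>n. fc g (int n)) \<longlonglongrightarrow> 0" "(\<lambda>n. fc g (- int n - 1)) \<longlonglongrightarrow> 0"
    by (rule *; simp add: inj_def)+
qed

lemma sym_Suc: "{- int (Suc K)..int (Suc K)} = insert (int K + 1) (insert (- int K - 1) {- int K..int K})"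
  by auto

lemma ee1_eq_1:
  assumes "ee 1 y = 1"
  obtains n where "y = of_int n"
proof -
  have "cos (2 * pi * y) = 1" using assms by (auto simp: ee_def complex_eq_iff)
  then obtain n :: int where "2 * pi * y = of_int n * 2 * pi" using cos_one_2pi_int by auto
  thus ?thesis using that[of n] by simp
qed

text \<open>The difference quotient is the form in which \<open>besov_C1_deriv\<close> expresses
  differentiability in time.\<close>

lemma has_vector_derivative_iff_quotient:
  "(f has_vector_derivative f') (at x within S) \<longleftrightarrow>
    ((\<lambda>y. (1 / (y - x)) *\<^sub>R (f y - f x)) \<longlongrightarrow> f') (at x within S)"
proof -
  have "\<forall>\<^sub>F y in at x within S. norm (f y - f x - (y - x) *\<^sub>R f') / norm (y - x) =
      norm ((1 / (y - x)) *\<^sub>R (f y - f x) - f')"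
    unfolding eventually_at_filter
  proof (intro always_eventually allI impI)
    fix y assume "y \<noteq> x"
    hence "(1 / (y - x)) *\<^sub>R (f y - f x) - f' = (1 / (y - x)) *\<^sub>R (f y - f x - (y - x) *\<^sub>R f')"
      by (simp add: scaleR_diff_right)
    thus "norm (f y - f x - (y - x) *\<^sub>R f') / norm (y - x) = norm ((1 / (y - x)) *\<^sub>R (f y - f x) - f')"
      by simp
  qed
  from tendsto_cong[OF this, of 0] show ?thesis
    by (simp add: has_vector_derivative_def has_derivative_iff_norm bounded_linear_scaleR_left
        tendsto_norm_zero_iff Lim_null[symmetric])
qed

text \<open>
  Chernoff's argument: dividing \<open>f (x + y) - f x\<close> by \<open>ee 1 y - 1\<close> leaves a continuous function \<open>g\<close>,
  and the partial sum of the Fourier series at \<open>x\<close> telescopes to two coefficients of \<open>g\<close>.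
\<close>

lemma fourier_converges:
  assumes "C1p f f'"
  shows "(\<lambda>K. \<Sum>k\<in>{- int K..int K}. fc f k * ee k x) \<longlonglongrightarrow> f x"
proof -
  note f = C1pD[OF assms]
  define h where "h y = f (x + y) - f x" for y
  define g where "g y = (if ee 1 y = 1 then f' (x + y) / (2 * pi * \<i>) else h y / (ee 1 y - 1))" for y
  have fx: "cper (\<lambda>y. f (x + y))"
    using cperD(2)[OF f(1)] by (auto simp: cper_def add.assoc[symmetric] intro!: continuous_on_compose2[OF cperD(1)[OF f(1), of UNIV]] continuous_intros)
  have h: "cper h" unfolding h_def by (rule cper_diff[OF fx cper_const])
  have h0: "h y = 0" if "ee 1 y = 1" for y
    using ee1_eq_1[OF that] cper_int[OF f(1), of x] by (metis diff_self h_def)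
  have hg: "h y = ee 1 y * g y - g y" for y
    using h0[of y] by (auto simp: g_def field_simps)
  have "isCont g y" for y
  proof (cases "ee 1 y = 1")
    case False
    have o: "open {y. ee 1 y \<noteq> 1}"
      by (intro open_Collect_neq continuous_intros)
    have "isCont (\<lambda>y. h y / (ee 1 y - 1)) y"
    proof -
      have "continuous_on {y. ee 1 y \<noteq> 1} (\<lambda>y. h y / (ee 1 y - 1))"
        by (intro continuous_intros cperD(1)[OF h]) auto
      thus ?thesis using o False by (simp add: continuous_on_eq_continuous_at)
    qed
    moreover have "\<forall>\<^sub>F z in nhds y. g z = h z / (ee 1 z - 1)"
      using eventually_nhds_in_open[OF o, of y] False by (auto simp: g_def elim!: eventually_mono)
    ultimately show ?thesis by (simp add: isCont_cong)
  next
    case True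
    \<comment> \<open>At a zero of \<open>ee 1 y - 1\<close> numerator and denominator both vanish,
      and \<open>g\<close> is the quotient of their difference quotients; the limit of the lower one
      is nonzero, which explains the value given to \<open>g\<close> there.\<close>
    have d1: "((\<lambda>z. (1 / (z - y)) *\<^sub>R (ee 1 z - 1)) \<longlongrightarrow> 2 * pi * \<i>) (at y)"
      using ee_deriv[of 1 y UNIV] True
      by (simp add: has_vector_derivative_iff_quotient scaleR_conv_of_real)
    have "((\<lambda>y. f (x + y)) has_vector_derivative 1 *\<^sub>R f' (x + y)) (at y)"
      by (rule vector_diff_chain_at[unfolded o_def]) (auto intro!: derivative_eq_intros C1pD(3)[OF assms] simp: has_real_derivative_iff_has_vector_derivative[symmetric])
    hence "((\<lambda>z. (1 / (z - y)) *\<^sub>R (f (x + z) - f (x + y))) \<longlongrightarrow> f' (x + y)) (at y)"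
      by (simp add: has_vector_derivative_iff_quotient)
    hence d2: "((\<lambda>z. (1 / (z - y)) *\<^sub>R h z) \<longlongrightarrow> f' (x + y)) (at y)"
      using h0[OF True] by (simp add: h_def)
    have ne: "\<forall>\<^sub>F z in at y. (1 / (z - y)) *\<^sub>R (ee 1 z - 1) \<noteq> 0"
      by (rule tendsto_imp_eventually_ne[OF d1]) simp
    have "((\<lambda>z. ((1 / (z - y)) *\<^sub>R h z) / ((1 / (z - y)) *\<^sub>R (ee 1 z - 1))) \<longlongrightarrow> g y) (at y)"
      using True tendsto_divide[OF d2 d1] by (simp add: g_def)
    moreover have "\<forall>\<^sub>F z in at y. ((1 / (z - y)) *\<^sub>R h z) / ((1 / (z - y)) *\<^sub>R (ee 1 z - 1)) = g z"
      using ne eventually_neq_at_within[of y y UNIV]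
      by eventually_elim (auto simp: g_def scaleR_conv_of_real)
    ultimately show ?thesis
      unfolding isCont_def by (rule Lim_transform_eventually)
  qed
  hence "cper g"
    unfolding cper_def using ee_per cperD(2)[OF f(2)] cperD(2)[OF h]
    by (auto intro: continuous_at_imp_continuous_on) (auto simp: g_def add.assoc[symmetric])
  note g = this
  have fch: "fc h k = fc g (k - 1) - fc g k" for k
  proof -
    have "fc h k = fc (\<lambda>y. ee 1 y * g y) k - fc g k"
      unfolding hg[abs_def] by (rule fc_diff[OF cper_mult[OF cper_ee g] g])
    also have "fc (\<lambda>y. ee 1 y * g y) k = fc g (k - 1)"
      unfolding fc_def by (rule integral_cong) (simp add: ee_simps(5) mult.assoc mult.left_commute[of _ "g _"])
    finally show ?thesis .
  qed
  have "(\<Sum>k\<in>{- int K..int K}. fc h k) = fc g (- int K - 1) - fc g (int K)" for K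
  proof (induction K)
    case (Suc K)
    have "(\<Sum>k\<in>{- int (Suc K)..int (Suc K)}. fc h k) =
        fc h (int K + 1) + fc h (- int K - 1) + (\<Sum>k\<in>{- int K..int K}. fc h k)"
      unfolding sym_Suc by simp
    also have "\<dots> = (fc g (int K) - fc g (int K + 1)) + (fc g (- (int K + 1) - 1) - fc g (- int K - 1)) +
        (fc g (- int K - 1) - fc g (int K))"
      unfolding Suc.IH by (simp add: fch)
    finally show ?case unfolding of_nat_Suc add.commute[of 1 "int K"] by simp
  qed (simp add: fch)
  moreover have "fc h k = fc f k * ee k x - (if k = 0 then f x else 0)" for k
  proof -
    have "fc (\<lambda>y. f (x + y)) k = integral {0..1} (\<lambda>y. ee k x * (f (y + x) * ee (-k) (y + x)))"
      unfolding fc_def by (rule integral_cong) (simp add: ee_simps(6), simp add: ee_simps(1,5) mult_ac add.commute[of x])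
    also have "\<dots> = ee k x * fc f k"
      using integral_translate[OF cper_mult[OF f(1) cper_ee[of "-k"]], of x] by (simp add: fc_def)
    finally have "fc (\<lambda>y. f (x + y)) k = ee k x * fc f k" .
    moreover have "fc (\<lambda>y. f x) k = (if k = 0 then f x else 0)"
      using fc_cmult[of "f x" "ee 0" k] fc_ee[of 0 k] by (simp add: ee_simps(1))
    ultimately show ?thesis
      unfolding h_def[abs_def] fc_diff[OF fx cper_const] by (simp add: mult.commute)
  qed
  ultimately have "(\<Sum>k\<in>{- int K..int K}. fc f k * ee k x) = f x + (fc g (- int K - 1) - fc g (int K))" for K
    by (simp add: sum_subtractf algebra_simps)
  moreover have "(\<lambda>K. f x + (fc g (- int K - 1) - fc g (int K))) \<longlonglongrightarrow> f x + (0 - 0)"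
    by (intro tendsto_intros fc_square_tendsto g)
  ultimately show ?thesis by simp
qed

text \<open>Each new pair of terms is controlled by
  \<open>1 / (L + 1)\<^sup>2 \<le> 1 / L - 1 / (L + 1)\<close>. The negative term
  \<open>- 2 / L\<close> in the bound is what lets the induction on \<open>L\<close> close.\<close>

lemma sum_inverse_squares_tail:
  assumes "1 \<le> K" "K \<le> L"
  shows "(\<Sum>k\<in>{- int L..int L} - {- int K..int K}. (1 / (of_int k)\<^sup>2 :: real)) \<le> 2 / K - 2 / L"
  using \<open>K \<le> L\<close>
proof (induction L rule: dec_induct)
  case (step L)
  have eq: "{- int (Suc L)..int (Suc L)} - {- int K..int K} =
     insert (int L + 1) (insert (- int L - 1) ({- int L..int L} - {- int K..int K}))"
    using step by auto
  have "1 / (real L + 1)\<^sup>2 \<le> 1 / L - 1 / (real L + 1)"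
  proof -
    have "1 / L - 1 / (real L + 1) = 1 / (L * (real L + 1))"
      using step assms by (simp add: field_simps)
    moreover have "L * (real L + 1) \<le> (real L + 1)\<^sup>2"
      by (simp add: power2_eq_square algebra_simps)
    moreover have "0 < L * (real L + 1)"
      by (rule mult_pos_pos) (use step assms in auto)
    ultimately show ?thesis by (metis divide_left_mono frac_le order_refl zero_le_one)
  qed
  moreover have "(- real L - 1)\<^sup>2 = (real L + 1)\<^sup>2" by (simp add: power2_eq_square algebra_simps)
  ultimately show ?case unfolding eq using step.IH by (simp add: algebra_simps)
qed simp

text \<open>Cauchy-Schwarz splits the tail of the series into the sum of the squares of
  \<open>1 / k\<close>, at most \<open>2 / K\<close>, and the sum of the squares of
  \<open>k * norm (fc f k)\<close>, which Bessel's inequality for \<open>f'\<close> controls. The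
  uniform rate serves both the density of trigonometric polynomials and the truncation in the
  uniqueness proof.\<close>

lemma fourier_rate:
  assumes f: "C1p f f'" and M: "\<And>x. norm (f' x) \<le> M" and K: "1 \<le> K"
  shows "norm (f x - (\<Sum>k\<in>{- int K..int K}. fc f k * ee k x)) \<le> M / sqrt K"
proof -
  define S where "S L = (\<Sum>k\<in>{- int L..int L}. fc f k * ee k x)" for L
  have M0: "0 \<le> M" using M[of 0] norm_ge_zero order_trans by blast
  have "norm (S L - S K) \<le> M / sqrt K" if "K \<le> L" for L
  proof -
    define A where "A = {- int L..int L} - {- int K..int K}"
    have A0: "k \<noteq> 0" if "k \<in> A" for k using that K by (auto simp: A_def)
    have "S L - S K = (\<Sum>k\<in>A. fc f k * ee k x)"
      unfolding S_def A_def using that by (subst sum_diff) auto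
    also have "norm \<dots> \<le> (\<Sum>k\<in>A. \<bar>1 / of_int k\<bar> * \<bar>of_int k * norm (fc f k)\<bar>)"
      by (rule order_trans[OF norm_sum], rule sum_mono) (use A0 in \<open>auto simp: norm_mult ee_simps(3) abs_mult\<close>)
    also have "\<dots> \<le> L2_set (\<lambda>k. 1 / of_int k) A * L2_set (\<lambda>k. of_int k * norm (fc f k)) A"
      by (rule L2_set_mult_ineq)
    also have "L2_set (\<lambda>k. 1 / of_int k) A \<le> sqrt (2 / K)"
    proof -
      have "0 \<le> 2 / real L" by simp
      hence "(\<Sum>k\<in>A. 1 / (real_of_int k)\<^sup>2) \<le> 2 / K"
        using sum_inverse_squares_tail[OF K that] unfolding A_def by linarith
      thus ?thesis unfolding L2_set_def by (intro real_sqrt_le_mono) (simp add: power_divide)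
    qed
    \<comment> \<open>The gain of 1/2 comes from \<open>2 \<le> 2 * pi\<close> in the formula for
      the coefficients of \<open>f'\<close>; it absorbs the factor \<open>sqrt 2\<close> of the
      other sum.\<close>
    also have "L2_set (\<lambda>k. of_int k * norm (fc f k)) A \<le> M / 2"
    proof -
      have "(\<Sum>k\<in>A. (norm (fc f' k))\<^sup>2) \<le> integral {0..1} (\<lambda>x. (norm (f' x))\<^sup>2)"
        by (rule bessel) (auto simp: A_def C1pD[OF f])
      also have "\<dots> \<le> integral {0..1} (\<lambda>x::real. M\<^sup>2)"
        by (intro integral_le integrable_continuous_real continuous_intros cperD(1)[OF C1pD(2)[OF f]]) (auto intro!: power_mono M)
      finally have 1: "(\<Sum>k\<in>A. (norm (fc f' k))\<^sup>2) \<le> M\<^sup>2" by simp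
      have "(2 * (of_int k * norm (fc f k)))\<^sup>2 \<le> (norm (fc f' k))\<^sup>2" for k
      proof -
        have "norm (fc f' k) = 2 * pi * \<bar>of_int k\<bar> * norm (fc f k)"
          by (simp add: fc_deriv[OF f] norm_mult)
        moreover have "2 * \<bar>of_int k\<bar> * norm (fc f k) \<le> 2 * pi * \<bar>of_int k\<bar> * norm (fc f k)"
          using pi_gt3 by (intro mult_right_mono) auto
        ultimately have "\<bar>2 * (of_int k * norm (fc f k))\<bar> \<le> \<bar>norm (fc f' k)\<bar>" by (simp add: abs_mult)
        thus ?thesis by (rule abs_le_square_iff[THEN iffD1])
      qed
      hence "(\<Sum>k\<in>A. (2 * (of_int k * norm (fc f k)))\<^sup>2) \<le> (\<Sum>k\<in>A. (norm (fc f' k))\<^sup>2)"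
        by (rule sum_mono)
      with 1 have "L2_set (\<lambda>k. 2 * (of_int k * norm (fc f k))) A \<le> sqrt (M\<^sup>2)"
        unfolding L2_set_def by (intro real_sqrt_le_mono) simp
      thus ?thesis using M0 by (simp flip: L2_set_right_distrib)
    qed
    also have "sqrt (2 / K) * (M / 2) \<le> M / sqrt K"
    proof -
      have "sqrt 2 \<le> 2" by (simp add: real_le_lsqrt real_sqrt_le_iff sqrt_le_D)
      hence "sqrt 2 * M \<le> 2 * M" using M0 by (rule mult_right_mono)
      thus ?thesis using K by (simp add: real_sqrt_divide field_simps)
    qed
    finally show ?thesis using M0 by (simp add: L2_set_nonneg mult_left_mono mult_right_mono)
  qed
  moreover have "S \<longlonglongrightarrow> f x" unfolding S_def[abs_def] by (rule fourier_converges[OF f])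
  hence "(\<lambda>L. norm (S L - S K)) \<longlonglongrightarrow> norm (f x - S K)"
    by (intro tendsto_intros)
  ultimately have "norm (f x - S K) \<le> M / sqrt K"
    by (auto intro: LIMSEQ_le_const2)
  thus ?thesis by (simp add: S_def)
qed


lemma cper_bounded:
  fixes f :: "real \<Rightarrow> 'a::real_normed_vector"
  assumes "cper f"
  obtains B where "0 \<le> B" "\<And>x. norm (f x) \<le> B"
proof -
  have "bounded (f ` {0..1})"
    by (intro compact_imp_bounded compact_continuous_image cperD(1)[OF assms]) auto
  then obtain B where B: "\<forall>y\<in>f ` {0..1}. norm y \<le> B" unfolding bounded_iff by blast
  have "norm (f x) \<le> \<bar>B\<bar>" for x
  proof -
    have "f x = f (frac x)"
      using cper_int[OF assms, of "frac x" "\<lfloor>x\<rfloor>"] by (simp add: frac_def)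
    moreover have "frac x \<in> {0..1}" using frac_lt_1[of x] by (simp add: less_imp_le)
    ultimately have "norm (f x) \<le> B" using B by (metis imageI)
    thus ?thesis by linarith
  qed
  thus ?thesis using that[of "\<bar>B\<bar>"] by simp
qed

section \<open>Periodic distributions and their Fourier coefficients\<close>

text \<open>Test functions are real, so the modes are handled as real combinations of a cosine and a
  sine. Allowing both amplitudes makes each frequency closed under differentiation, which is how
  smoothness is proved.\<close>

definition trig :: "real \<Rightarrow> real \<Rightarrow> int \<Rightarrow> real \<Rightarrow> real" where
  "trig a b k x = a * cos (2 * pi * k * x) + b * sin (2 * pi * k * x)"

lemma trig_has_derivative:
  "(trig a b k has_real_derivative trig (2 * pi * k * b) (- 2 * pi * k * a) k x) (at x)"
  unfolding trig_def[abs_def] by (auto intro!: derivative_eq_intros simp: algebra_simps)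

lemma deriv_trig: "deriv (trig a b k) = trig (2 * pi * k * b) (- 2 * pi * k * a) k"
  using trig_has_derivative by (intro ext DERIV_imp_deriv)

lemma trig_test_fun: "trig a b k \<in> test_fun"
proof -
  have "\<exists>a' b'. (deriv ^^ n) (trig a b k) = trig a' b' k" for n
  proof (induction n)
    case (Suc n)
    thus ?case using deriv_trig by (metis comp_apply funpow.simps(2))
  qed auto
  moreover have "trig a b k differentiable (at x)" for a b x
    using trig_has_derivative real_differentiable_def by blast
  ultimately have "smooth (trig a b k)"
    unfolding smooth_def by metis
  moreover have "trig a b k (x + 1) = trig a b k x" for x
  proof -
    have "2 * pi * of_int k * (x + 1) = 2 * pi * of_int k * x + 2 * pi * of_int k" by (simp add: algebra_simps)
    moreover have "cos (y + 2 * pi * of_int k) = cos y" "sin (y + 2 * pi * of_int k) = sin y" for y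
      using cis_multiple_2pi[of "of_int k"] by (simp_all add: cos_add sin_add cis.ctr complex_eq_iff)
    ultimately show ?thesis by (simp add: trig_def)
  qed
  ultimately show ?thesis by (simp add: test_fun_def)
qed

lemma cos_sin_trig:
  "(\<lambda>x. cos (2 * pi * of_int k * x)) = trig 1 0 k" "(\<lambda>x. sin (2 * pi * of_int k * x)) = trig 0 1 k"
  by (simp_all add: trig_def fun_eq_iff)

lemma fourier_coeff_trig:
  "fourier_coeff T k = Complex (pairing T (trig 1 0 k)) (- pairing T (trig 0 1 k))"
  by (simp add: fourier_coeff_def cos_sin_trig)

lemma pairing_is_pdistr: "is_pdistr (pairing T)"
  using pairing[of T] by simp

lemma pairing_add: "f \<in> test_fun \<Longrightarrow> g \<in> test_fun \<Longrightarrow> pairing T (\<lambda>x. f x + g x) = pairing T f + pairing T g"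
  using pairing_is_pdistr[of T] by (auto simp: is_pdistr_def)

lemma pairing_scale: "f \<in> test_fun \<Longrightarrow> pairing T (\<lambda>x. c * f x) = c * pairing T f"
  using pairing_is_pdistr[of T] by (auto simp: is_pdistr_def)

lemma fourier_coeff_linear:
  "fourier_coeff (S + T) k = fourier_coeff S k + fourier_coeff T k"
  "fourier_coeff (S - T) k = fourier_coeff S k - fourier_coeff T k"
  "fourier_coeff (- T) k = - fourier_coeff T k"
  "fourier_coeff (c *\<^sub>R T) k = of_real c * fourier_coeff T k"
  by (simp_all add: fourier_coeff_def plus_pdistr.rep_eq minus_pdistr.rep_eq uminus_pdistr.rep_eq
      scaleR_pdistr.rep_eq complex_eq_iff)

lemma fourier_coeff_deriv:
  "fourier_coeff (pderivative T) k = 2 * pi * \<i> * of_int k * fourier_coeff T k"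
proof -
  have "deriv (trig 1 0 k) = (\<lambda>x. (- 2 * pi * k) * trig 0 1 k x)"
       "deriv (trig 0 1 k) = (\<lambda>x. (2 * pi * k) * trig 1 0 k x)"
    by (simp_all add: deriv_trig trig_def fun_eq_iff)
  hence "pairing T (deriv (trig 1 0 k)) = (- 2 * pi * k) * pairing T (trig 0 1 k)"
        "pairing T (deriv (trig 0 1 k)) = (2 * pi * k) * pairing T (trig 1 0 k)"
    by (simp_all only: pairing_scale[OF trig_test_fun])
  thus ?thesis
    by (simp add: fourier_coeff_trig pderivative.rep_eq trig_test_fun complex_eq_iff)
qed

lemma test_fun_C1p:
  assumes "f \<in> test_fun"
  shows "C1p f (deriv f)"
proof -
  have d: "(g has_vector_derivative deriv g x) (at x)" if "g \<in> test_fun" for g x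
    using that smooth_has_deriv[of g x] by (auto simp: test_fun_def has_real_derivative_iff_has_vector_derivative)
  have c: "cper g" if "g \<in> test_fun" for g
    using that d[OF that] by (auto simp: cper_def test_fun_def intro!: continuous_at_imp_continuous_on has_vector_derivative_continuous)
  show ?thesis using assms c test_fun_deriv d by (auto simp: C1p_def)
qed

definition tpoly :: "(int \<Rightarrow> complex) \<Rightarrow> nat \<Rightarrow> real \<Rightarrow> real" where
  "tpoly c K x = (\<Sum>k\<in>{- int K..int K}. trig (Re (c k)) (- Im (c k)) k x)"

lemma tpoly_eq: "tpoly c K x = Re (\<Sum>k\<in>{- int K..int K}. c k * ee k x)"
  by (simp add: tpoly_def trig_def ee_def)

lemma test_fun_sum:
  assumes "finite I" "\<And>i. i \<in> I \<Longrightarrow> f i \<in> test_fun"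
  shows "(\<lambda>x. \<Sum>i\<in>I. f i x) \<in> test_fun \<and> pairing T (\<lambda>x. \<Sum>i\<in>I. f i x) = (\<Sum>i\<in>I. pairing T (f i))
     \<and> deriv (\<lambda>x. \<Sum>i\<in>I. f i x) = (\<lambda>x. \<Sum>i\<in>I. deriv (f i) x)"
  using assms
proof (induction I rule: finite_induct)
  case empty
  have "(\<lambda>x. 0 * trig 0 0 0 x) \<in> test_fun \<and> pairing T (\<lambda>x. 0 * trig 0 0 0 x) = 0 * pairing T (trig 0 0 0)"
    using test_fun_scale[OF trig_test_fun] pairing_scale[OF trig_test_fun] by blast
  thus ?case by simp
next
  case (insert i I)
  thus ?case using test_fun_add[of "f i" "\<lambda>x. \<Sum>i\<in>I. f i x"] pairing_add[of "f i" "\<lambda>x. \<Sum>i\<in>I. f i x" T]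
      deriv_test_fun_add[of "f i" "\<lambda>x. \<Sum>i\<in>I. f i x"]
    by auto
qed

lemma tpoly_test_fun: "tpoly c K \<in> test_fun"
  unfolding tpoly_def[abs_def] using test_fun_sum[of "{- int K..int K}" "\<lambda>k. trig (Re (c k)) (- Im (c k)) k"] trig_test_fun by blast

lemma deriv_tpoly: "deriv (tpoly c K) = tpoly (\<lambda>k. 2 * pi * \<i> * of_int k * c k) K"
  unfolding tpoly_def[abs_def]
  by (subst conjunct2[OF conjunct2[OF test_fun_sum]])
     (auto simp: trig_test_fun deriv_trig intro!: ext sum.cong arg_cong2[of _ _ _ _ "\<lambda>a b. trig a b _ _"])

lemma rfc_deriv: "C1p f f' \<Longrightarrow> rfc f' k = 2 * pi * \<i> * of_int k * rfc f k"
  by (rule fc_deriv[OF C1p_of_real])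

lemma real_fourier_rate:
  assumes f: "C1p f f'" and M: "\<And>x. \<bar>f' x\<bar> \<le> M" and K: "1 \<le> K"
  shows "\<bar>f x - tpoly (rfc f) K x\<bar> \<le> M / sqrt K"
proof -
  have "\<bar>Re (of_real (f x) - (\<Sum>k\<in>{- int K..int K}. rfc f k * ee k x))\<bar> \<le> M / sqrt K"
    by (rule order_trans[OF abs_Re_le_cmod fourier_rate[OF C1p_of_real[OF f] _ K]]) (simp add: M)
  thus ?thesis by (simp add: tpoly_eq)
qed

text \<open>A periodic distribution is continuous for finitely many derivatives, and the Fourier
  partial sums of a test function converge uniformly together with each derivative. A distribution
  that vanishes on all modes therefore vanishes on every test function.\<close>

lemma pdistr_eqI:
  assumes "\<And>k. fourier_coeff S k = fourier_coeff T k"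
  shows "S = T"
proof -
  define D where "D = S - T"
  have "fourier_coeff D k = 0" for k by (simp add: D_def fourier_coeff_linear assms)
  hence 0: "pairing D (trig 1 0 k) = 0" "pairing D (trig 0 1 k) = 0" for k
    by (auto simp: fourier_coeff_trig complex_eq_iff)
  have tr: "pairing D (trig a b k) = 0" for a b k
  proof -
    have "trig a b k = (\<lambda>x. a * trig 1 0 k x + b * trig 0 1 k x)" by (simp add: trig_def fun_eq_iff)
    thus ?thesis
      using pairing_add[OF test_fun_scale[OF trig_test_fun] test_fun_scale[OF trig_test_fun]] pairing_scale[OF trig_test_fun] 0
      by simp
  qed
  have tp: "pairing D (tpoly c K) = 0" for c K
    using test_fun_sum[of "{- int K..int K}" "\<lambda>k. trig (Re (c k)) (- Im (c k)) k" D] trig_test_fun tr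
    by (simp add: tpoly_def[abs_def])
  obtain C N where C: "\<And>f B. f \<in> test_fun \<Longrightarrow> (\<forall>j\<le>N. \<forall>x. \<bar>(deriv ^^ j) f x\<bar> \<le> B) \<Longrightarrow> \<bar>pairing D f\<bar> \<le> C * B"
    using pairing_is_pdistr[of D] unfolding is_pdistr_def by metis
  have "pairing D f = 0" if f: "f \<in> test_fun" for f
  proof -
    have fj: "(deriv ^^ j) f \<in> test_fun" for j by (induction j) (auto simp: f test_fun_deriv)
    have "\<exists>M. \<forall>x. \<bar>(deriv ^^ Suc j) f x\<bar> \<le> M" for j
      using cper_bounded[OF C1pD(1)[OF test_fun_C1p[OF fj[of "Suc j"]]]] by (metis real_norm_def)
    then obtain M where M: "\<And>j x. \<bar>(deriv ^^ Suc j) f x\<bar> \<le> M j" by metis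
    define B where "B = (\<Sum>j\<le>N. M j)"
    have M0: "0 \<le> M j" for j using M[of j 0] by linarith
    have MB: "M j \<le> B" if "j \<le> N" for j
      unfolding B_def using that M0 by (intro member_le_sum) auto
    \<comment> \<open>Differentiation commutes with truncation of the Fourier series, so the rate
      for C^1 functions applies to each derivative of the error separately.\<close>
    have dj: "(deriv ^^ j) (\<lambda>x. f x + (-1) * tpoly (rfc f) K x) = (\<lambda>x. (deriv ^^ j) f x + (-1) * tpoly (rfc ((deriv ^^ j) f)) K x)" for j K
    proof (induction j)
      case (Suc j)
      have "rfc (deriv ((deriv ^^ j) f)) = (\<lambda>k. 2 * pi * \<i> * of_int k * rfc ((deriv ^^ j) f) k)"
        by (rule ext, rule rfc_deriv[OF test_fun_C1p[OF fj]])
      thus ?case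
        using Suc deriv_test_fun_add[OF fj test_fun_scale[OF tpoly_test_fun], of j "-1"] deriv_test_fun_scale[OF tpoly_test_fun, of "-1"]
        by (simp add: deriv_tpoly)
    qed simp
    have "\<bar>pairing D f\<bar> \<le> C * (B / sqrt (real (Suc K)))" for K
    proof -
      have "\<bar>pairing D (\<lambda>x. f x + (-1) * tpoly (rfc f) (Suc K) x)\<bar> \<le> C * (B / sqrt (real (Suc K)))"
      proof (rule C)
        show "(\<lambda>x. f x + - 1 * tpoly (rfc f) (Suc K) x) \<in> test_fun"
          by (rule test_fun_add[OF f test_fun_scale[OF tpoly_test_fun]])
        have "\<bar>(deriv ^^ j) f x + (-1) * tpoly (rfc ((deriv ^^ j) f)) (Suc K) x\<bar> \<le> B / sqrt (real (Suc K))" if "j \<le> N" for j x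
        proof -
          have "\<bar>(deriv ^^ j) f x - tpoly (rfc ((deriv ^^ j) f)) (Suc K) x\<bar> \<le> M j / sqrt (real (Suc K))"
            by (rule real_fourier_rate[OF test_fun_C1p[OF fj]]) (use M in auto)
          also have "\<dots> \<le> B / sqrt (real (Suc K))" by (intro divide_right_mono MB that) auto
          finally show ?thesis by simp
        qed
        thus "\<forall>j\<le>N. \<forall>x. \<bar>(deriv ^^ j) (\<lambda>x. f x + - 1 * tpoly (rfc f) (Suc K) x) x\<bar> \<le> B / sqrt (real (Suc K))"
          unfolding dj by blast
      qed
      moreover have "pairing D (\<lambda>x. f x + (-1) * tpoly (rfc f) (Suc K) x) = pairing D f"
        using pairing_add[OF f test_fun_scale[OF tpoly_test_fun], of D "-1"] pairing_scale[OF tpoly_test_fun, of D "-1"] tp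
        by simp
      ultimately show ?thesis by simp
    qed
    moreover have "(\<lambda>K. C * (B / sqrt (real (Suc K)))) \<longlonglongrightarrow> C * 0"
      by (intro tendsto_mult tendsto_const) real_asymp
    ultimately have "\<bar>pairing D f\<bar> \<le> C * 0" by (rule_tac LIMSEQ_le_const) auto
    thus ?thesis by simp
  qed
  moreover have "pairing D f = 0" if "f \<notin> test_fun" for f
    using that pairing_is_pdistr[of D] by (auto simp: is_pdistr_def)
  ultimately have "pairing D = pairing 0" by (auto simp: zero_pdistr.rep_eq)
  hence "D = 0" by (simp add: pairing_inject)
  thus ?thesis by (simp add: D_def)
qed


section \<open>Regular distributions and their representatives\<close>

lemma cper_set_integrable:
  fixes f :: "real \<Rightarrow> 'a::euclidean_space"
  shows "cper f \<Longrightarrow> set_integrable lborel {0..1} f"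
  by (rule borel_integrable_atLeastAtMost') (rule cperD)

lemma cper_measurable:
  fixes f :: "real \<Rightarrow> 'a::euclidean_space"
  shows "cper f \<Longrightarrow> f \<in> borel_measurable borel"
  by (rule borel_measurable_continuous_onI) (rule cperD)

lemma pairing_pdistr_of_fun:
  assumes "cper g" "f \<in> test_fun"
  shows "pairing (pdistr_of_fun g) f = integral {0..1} (\<lambda>x. g x * f x)"
  using set_borel_integral_eq_integral(2)[OF cper_set_integrable[OF cper_mult[OF assms(1) C1pD(1)[OF test_fun_C1p[OF assms(2)]]]]]
  by (simp add: pdistr_of_fun.rep_eq assms cper_set_integrable)

lemma fourier_coeff_of_fun:
  assumes "cper f"
  shows "fourier_coeff (pdistr_of_fun f) k = rfc f k"
proof -
  have i: "(\<lambda>x. of_real (f x) * ee (-k) x) integrable_on {0..1}"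
    by (rule fc_integrable[OF cper_of_real[OF assms]])
  have "Re (rfc f k) = integral {0..1} (\<lambda>x. f x * trig 1 0 k x)"
    unfolding fc_def using integral_linear[OF i bounded_linear_Re, symmetric]
    by (simp add: o_def ee_def trig_def)
  moreover have "Im (rfc f k) = integral {0..1} (\<lambda>x. - (f x * trig 0 1 k x))"
    unfolding fc_def using integral_linear[OF i bounded_linear_Im, symmetric]
    by (simp add: o_def ee_def trig_def)
  ultimately show ?thesis
    by (simp add: fourier_coeff_trig pairing_pdistr_of_fun[OF assms trig_test_fun] complex_eq_iff)
qed

lemma pdistr_of_fun_lincomb:
  assumes "cper f" "cper g"
  shows "pdistr_of_fun (\<lambda>x. f x + g x) = pdistr_of_fun f + pdistr_of_fun g"
    "pdistr_of_fun (\<lambda>x. f x - g x) = pdistr_of_fun f - pdistr_of_fun g"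
  by (rule pdistr_eqI; simp add: fourier_coeff_linear fourier_coeff_of_fun cper_add cper_diff assms
      fc_add[OF cper_of_real cper_of_real] fc_diff[OF cper_of_real cper_of_real])+

lemma pderivative_of_fun:
  assumes "C1p f f'"
  shows "pderivative (pdistr_of_fun f) = pdistr_of_fun f'"
  by (rule pdistr_eqI)
     (simp add: fourier_coeff_deriv fourier_coeff_of_fun C1pD[OF assms] rfc_deriv[OF assms])

text \<open>Dominated convergence with majorant \<open>B * \<bar>d x\<bar>\<close>. It is the device
  by which vanishing against one class of functions passes to a larger class.\<close>

lemma integral_zero_limit:
  fixes d :: "real \<Rightarrow> real" and B :: real
  assumes d: "integrable lborel d"
    and f: "\<And>n. f n \<in> borel_measurable borel" "\<And>n x. \<bar>f n x\<bar> \<le> B" "\<And>x. (\<lambda>n. f n x) \<longlonglongrightarrow> g x"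
    and z: "\<And>n. (LINT x|lborel. d x * f n x) = 0"
  shows "(LINT x|lborel. d x * g x) = 0"
proof -
  have g: "g \<in> borel_measurable borel" by (rule borel_measurable_LIMSEQ_real[OF f(3) f(1)])
  have "(\<lambda>n. LINT x|lborel. d x * f n x) \<longlonglongrightarrow> (LINT x|lborel. d x * g x)"
  proof (rule integral_dominated_convergence[where w="\<lambda>x. B * \<bar>d x\<bar>"])
    show "AE x in lborel. norm (d x * f i x) \<le> B * \<bar>d x\<bar>" for i
      using f(2)[of i] by (intro AE_I2) (simp add: abs_mult mult.commute[of B] mult_left_mono)
    show "AE x in lborel. (\<lambda>i. d x * f i x) \<longlonglongrightarrow> d x * g x"
      by (intro AE_I2 tendsto_intros f)
  qed (use d f(1) g in \<open>auto intro!: integrable_abs borel_measurable_times borel_measurable_integrable\<close>)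
  thus ?thesis using z LIMSEQ_unique[OF _ tendsto_const[of 0]] by simp
qed

lemma cos_less_aux:
  fixes t a :: real
  assumes "a < t" "t < 2 * pi - a" "0 \<le> a"
  shows "cos t < cos a"
proof (cases "t \<le> pi")
  case True thus ?thesis using assms by (intro cos_monotone_0_pi) auto
next
  case False
  have "cos (2 * pi - t) < cos a" using assms False by (intro cos_monotone_0_pi) auto
  thus ?thesis by simp
qed

text \<open>
  The sigmoids \<open>1 / (1 + exp (- n * \<rho>))\<close> of \<open>\<rho> y = cos (2 * pi * y - pi * a) - cos (pi * a)\<close> are periodic, of class
  \<open>C\<^sup>1\<close>, bounded by 1, and converge almost everywhere on \<open>[0,1]\<close> to the indicator of \<open>(0,a)\<close>.
\<close>

lemma AE_zero_if_fourier_zero: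
  assumes d: "set_integrable lborel {0..1} d"
    and z: "pdistr_of_fun d = 0"
  shows "AE x in lborel. x \<in> {0..1} \<longrightarrow> d x = 0"
proof -
  define dd where "dd x = indicator {0..1} x * d x" for x
  have dd: "integrable lborel dd" using d by (simp add: set_integrable_def dd_def[abs_def])
  have dd0: "x \<notin> {0..1} \<Longrightarrow> dd x = 0" for x by (auto simp: dd_def)
  have test: "(LINT x|lborel. dd x * f x) = 0" if "f \<in> test_fun" for f
  proof -
    have "pairing (pdistr_of_fun d) f = 0" by (simp add: z zero_pdistr.rep_eq)
    thus ?thesis using that d
      by (simp add: pdistr_of_fun.rep_eq set_lebesgue_integral_def dd_def mult.assoc)
  qed
  \<comment> \<open>The sigmoids used below are only shown to be C^1; Fourier partial sums bridge
    the gap to test functions. They are bounded by \<open>B + M\<close> because the rate is at most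
    \<open>M\<close>.\<close>
  have C1: "(LINT x|lborel. dd x * h x) = 0" if h: "C1p h h'" for h h'
  proof -
    obtain M where M: "0 \<le> M" "\<And>x. \<bar>h' x\<bar> \<le> M" using cper_bounded[OF C1pD(2)[OF h]] by auto
    obtain B where B: "\<And>x. \<bar>h x\<bar> \<le> B" using cper_bounded[OF C1pD(1)[OF h]] by auto
    have r: "\<bar>h x - tpoly (rfc h) (Suc n) x\<bar> \<le> M / sqrt (real (Suc n))" for n x
      by (rule real_fourier_rate[OF h M(2)]) simp
    show ?thesis
    proof (rule integral_zero_limit[OF dd, where f="\<lambda>n. tpoly (rfc h) (Suc n)" and B="B + M"])
      show "tpoly (rfc h) (Suc n) \<in> borel_measurable borel" for n
        by (rule test_fun_measurable[OF tpoly_test_fun])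
      show "\<bar>tpoly (rfc h) (Suc n) x\<bar> \<le> B + M" for n x
      proof -
        have "M / sqrt (real (Suc n)) \<le> M / 1" by (rule divide_left_mono) (use M in auto)
        thus ?thesis using r[of x n] B[of x] by linarith
      qed
      show "(LINT x|lborel. dd x * tpoly (rfc h) (Suc n) x) = 0" for n
        by (rule test[OF tpoly_test_fun])
      show "(\<lambda>n. tpoly (rfc h) (Suc n) x) \<longlonglongrightarrow> h x" for x
      proof (rule LIM_zero_cancel, rule Lim_null_comparison)
        show "(\<lambda>n. M / sqrt (real (Suc n))) \<longlonglongrightarrow> 0" by real_asymp
        show "\<forall>\<^sub>F n in sequentially. norm (tpoly (rfc h) (Suc n) x - h x) \<le> M / sqrt (real (Suc n))"
          using r by (intro always_eventually) (auto simp: abs_minus_commute)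
      qed
    qed
  qed
  have total: "(LINT x|lborel. dd x) = 0"
    using C1[of "\<lambda>x. 1" "\<lambda>x. 0"] by (simp add: C1p_def cper_const)
  have part: "(LINT x|lborel. dd x * indicator {0<..<a} x) = 0" if a: "0 < a" "a \<le> 1" for a
  proof -
    define \<rho> where "\<rho> y = cos (2 * pi * y - pi * a) - cos (pi * a)" for y
    define F where "F n y = 1 / (1 + exp (- real n * \<rho> y))" for n y
    define g where "g y = (if \<rho> y > 0 then 1 else if \<rho> y < 0 then 0 else 1/2 :: real)" for y
    have per: "\<rho> (y + 1) = \<rho> y" for y
    proof -
      have "2 * pi * (y + 1) - pi * a = (2 * pi * y - pi * a) + 2 * pi" by (simp add: algebra_simps)
      thus ?thesis unfolding \<rho>_def by (simp only: cos_periodic)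
    qed
    have "(LINT x|lborel. dd x * g x) = 0"
    proof (rule integral_zero_limit[OF dd, where f=F and B=1])
      fix n
      define F' where "F' y = - (exp (- real n * \<rho> y) * (- real n * - (sin (2 * pi * y - pi * a) * (2 * pi)))) / (1 + exp (- real n * \<rho> y))\<^sup>2" for y
      have pos: "0 < 1 + exp (- real n * \<rho> y)" for y by (simp add: add_pos_pos)
      have D: "(F n has_real_derivative F' y) (at y)" for y
        unfolding F_def[abs_def] F'_def \<rho>_def
        by (rule derivative_eq_intros refl | simp add: add_pos_pos power2_eq_square field_simps
              less_imp_neq[OF add_pos_pos, symmetric])+
      have c: "continuous_on UNIV F'"
        unfolding F'_def[abs_def] \<rho>_def by (intro continuous_intros ballI)
          (simp add: less_imp_neq[OF add_pos_pos, symmetric])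
      have s: "sin (2 * pi * (y + 1) - pi * a) = sin (2 * pi * y - pi * a)" for y
        using sin_periodic[of "2 * pi * y - pi * a"] by (simp add: algebra_simps)
      have "continuous_on UNIV (F n)"
        using D DERIV_isCont by (blast intro: continuous_at_imp_continuous_on)
      hence "C1p (F n) F'"
        unfolding C1p_def cper_def using D c
        by (simp add: has_real_derivative_iff_has_vector_derivative) (simp add: F_def F'_def per s)
      thus "(LINT x|lborel. dd x * F n x) = 0" by (rule C1)
      show "F n \<in> borel_measurable borel"
        by (rule borel_measurable_continuous_onI, rule continuous_at_imp_continuous_on)
           (use D DERIV_isCont in blast)
      show "\<bar>F n x\<bar> \<le> 1" for x
        using pos[of x] by (simp add: F_def divide_simps)
    next
      fix x
      show "(\<lambda>n. F n x) \<longlonglongrightarrow> g x"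
      proof -
        consider "\<rho> x > 0" | "\<rho> x < 0" | "\<rho> x = 0" by linarith
        thus ?thesis
        proof cases
          case 1
          hence "(\<lambda>n. 1 / (1 + exp (- real n * \<rho> x))) \<longlonglongrightarrow> 1" by real_asymp
          thus ?thesis using 1 by (simp add: F_def g_def)
        next
          case 2
          hence "(\<lambda>n. 1 / (1 + exp (- real n * \<rho> x))) \<longlonglongrightarrow> 0" by real_asymp
          thus ?thesis using 2 by (simp add: F_def g_def)
        next
          case 3 thus ?thesis by (simp add: F_def g_def)
        qed
      qed
    qed
    moreover have "(LINT x|lborel. dd x * g x) = (LINT x|lborel. dd x * indicator {0<..<a} x)"
    proof (rule integral_cong_AE)
      have "g \<in> borel_measurable borel" unfolding g_def[abs_def] \<rho>_def by measurable
      thus "(\<lambda>x. dd x * g x) \<in> borel_measurable lborel"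
        using dd by (intro borel_measurable_times) auto
      show "(\<lambda>x. dd x * indicator {0<..<a} x) \<in> borel_measurable lborel"
        using dd by (intro borel_measurable_times borel_measurable_indicator) auto
      have eq: "dd x * g x = dd x * indicator {0<..<a} x" if n: "x \<noteq> 0" "x \<noteq> a" "x \<noteq> 1" for x
      proof -
        consider "x \<notin> {0..1}" | "0 < x" "x < a" | "a < x" "x < 1" using n by fastforce
        thus ?thesis
        proof cases
          case 2
          have "pi * \<bar>2 * x - a\<bar> < pi * a" "pi * a \<le> pi * 1"
            using 2 a by (intro mult_strict_left_mono mult_left_mono, auto)+
          hence "cos (pi * a) < cos (pi * \<bar>2 * x - a\<bar>)" by (intro cos_monotone_0_pi) auto
          also have "cos (pi * \<bar>2 * x - a\<bar>) = cos (2 * pi * x - pi * a)"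
            by (cases "2 * x - a \<ge> 0") (auto simp: algebra_simps abs_if, metis cos_minus minus_diff_eq)
          finally show ?thesis using 2 by (simp add: g_def \<rho>_def)
        next
          case 3
          have "pi * a < pi * x" "pi * x < pi * 1" using 3 by (intro mult_strict_left_mono; simp)+
          hence "cos (2 * pi * x - pi * a) < cos (pi * a)"
            using a by (intro cos_less_aux) (auto simp: algebra_simps)
          thus ?thesis using 3 by (simp add: g_def \<rho>_def)
        qed (simp add: dd0)
      qed
      show "AE x in lborel. dd x * g x = dd x * indicator {0<..<a} x"
        using AE_lborel_singleton[of "0::real"] AE_lborel_singleton[of a] AE_lborel_singleton[of "1::real"]
        by eventually_elim (rule eq)
    qed
    ultimately show ?thesis by simp
  qed
  \<comment> \<open>Since \<open>dd\<close> vanishes off \<open>[0,1]\<close>, its integral over a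
    ray with \<open>0 < a \<le> 1\<close> is the total minus the integral over \<open>(0,a)\<close>.
    Rays suffice because they determine a finite measure on the line.\<close>
  have ray: "(LINT x|lborel. dd x * indicator {a<..} x) = 0" for a
  proof -
    have im: "(\<lambda>x. dd x * indicator A x) \<in> borel_measurable lborel" if "A \<in> sets borel" for A
      using that dd by (intro borel_measurable_times borel_measurable_indicator) auto
    consider "a \<le> 0" | "0 < a" "a \<le> 1" | "1 < a" by linarith
    thus ?thesis
    proof cases
      case 1
      have "AE x in lborel. dd x * indicator {a<..} x = dd x"
        using AE_lborel_singleton[of "0::real"]
        by eventually_elim (use 1 dd0 in \<open>auto simp: indicator_def\<close>)
      hence "(LINT x|lborel. dd x * indicator {a<..} x) = (LINT x|lborel. dd x)"
        using im dd by (intro integral_cong_AE) auto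
      thus ?thesis using total by simp
    next
      case 2
      have int: "integrable lborel (\<lambda>x. dd x * indicator {0<..<a} x)"
        using integrable_mult_indicator[OF _ dd, of "{0<..<a}"] by (simp add: mult.commute)
      have "AE x in lborel. dd x * indicator {a<..} x = dd x - dd x * indicator {0<..<a} x"
        using AE_lborel_singleton[of "0::real"] AE_lborel_singleton[of a]
        by eventually_elim (use 2 dd0 in \<open>auto simp: indicator_def\<close>)
      hence "(LINT x|lborel. dd x * indicator {a<..} x) = (LINT x|lborel. dd x - dd x * indicator {0<..<a} x)"
        using im dd int by (intro integral_cong_AE) auto
      also have "\<dots> = 0" using total part[OF 2] dd int by simp
      finally show ?thesis .
    next
      case 3
      hence "(\<lambda>x. dd x * indicator {a<..} x) = (\<lambda>x. 0)"
        using dd0 by (fastforce simp: indicator_def fun_eq_iff)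
      thus ?thesis by (simp only: Bochner_Integration.integral_zero)
    qed
  qed
  have em: "emeasure (density lborel (\<lambda>x. ennreal (f x))) {a<..} = ennreal (LINT x|lborel. max 0 (f x) * indicator {a<..} x)"
    if "integrable lborel f" for f :: "real \<Rightarrow> real" and a
  proof -
    have int: "integrable lborel (\<lambda>x. max 0 (f x) * indicator {a<..} x)"
      using integrable_mult_indicator[OF _ integrable_max[OF _ that, of "\<lambda>x. 0"], of "{a<..}"] by (simp add: mult.commute)
    have "emeasure (density lborel (\<lambda>x. ennreal (f x))) {a<..} = (\<integral>\<^sup>+x. ennreal (f x) * indicator {a<..} x \<partial>lborel)"
      using that by (intro emeasure_density) auto
    also have "\<dots> = (\<integral>\<^sup>+x. ennreal (max 0 (f x) * indicator {a<..} x) \<partial>lborel)"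
      by (intro nn_integral_cong) (auto simp: indicator_def max_def ennreal_neg)
    also have "\<dots> = ennreal (LINT x|lborel. max 0 (f x) * indicator {a<..} x)"
      by (rule nn_integral_eq_integral[OF int]) (auto intro!: AE_I2)
    finally show ?thesis .
  qed
  \<comment> \<open>\<open>ennreal\<close> sends negative numbers to 0, so the two sides have the
    positive and the negative part of \<open>dd\<close> as densities. Equality of the measures makes
    both parts agree almost everywhere, hence vanish.\<close>
  have "density lborel (\<lambda>x. ennreal (dd x)) = density lborel (\<lambda>x. ennreal (- dd x))"
  proof (rule measure_eqI_lessThan)
    fix a
    have i: "integrable lborel (\<lambda>x. max 0 (f x) * indicator {a<..} x)" if "integrable lborel f" for f :: "real \<Rightarrow> real"
      using integrable_mult_indicator[OF _ integrable_max[OF _ that, of "\<lambda>x. 0"], of "{a<..}"] by (simp add: mult.commute)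
    have "(LINT x|lborel. max 0 (dd x) * indicator {a<..} x) - (LINT x|lborel. max 0 (- dd x) * indicator {a<..} x) =
        (LINT x|lborel. max 0 (dd x) * indicator {a<..} x - max 0 (- dd x) * indicator {a<..} x)"
      using i[OF dd] i[of "\<lambda>x. - dd x"] dd by simp
    also have "\<dots> = (LINT x|lborel. dd x * indicator {a<..} x)"
      by (intro Bochner_Integration.integral_cong) (auto simp: indicator_def max_def)
    finally show "emeasure (density lborel (\<lambda>x. ennreal (dd x))) {a<..} = emeasure (density lborel (\<lambda>x. ennreal (- dd x))) {a<..}"
      using dd by (simp add: em ray)
    show "emeasure (density lborel (\<lambda>x. ennreal (dd x))) {a<..} < \<infinity>" using dd by (simp add: em)
  qed auto
  hence "AE x in lborel. ennreal (dd x) = ennreal (- dd x)"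
    using dd by (intro sigma_finite_measure.density_unique[OF lborel.sigma_finite_measure_axioms]) auto
  thus ?thesis
  proof eventually_elim
    case (elim x)
    hence "dd x = 0" by (cases "dd x \<ge> 0") (auto simp: ennreal_neg ennreal_eq_0_iff not_le)
    thus ?case by (auto simp: dd_def)
  qed
qed


lemma cper_AE_eq:
  fixes f g :: "real \<Rightarrow> real"
  assumes "cper f" "cper g" "AE x in lborel. x \<in> {0..1} \<longrightarrow> f x = g x"
  shows "f = g"
proof
  fix x :: real
  define d where "d x = (f x - g x)\<^sup>2" for x
  have d: "cper d" unfolding d_def[abs_def] power2_eq_square by (intro cper_mult cper_diff assms)
  have "integral {0..1} d = (LINT x:{0..1}|lborel. d x)"
    by (rule set_borel_integral_eq_integral(2)[symmetric, OF cper_set_integrable[OF d]])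
  also have "\<dots> = (LINT x|(lborel :: real measure). (0::real))"
    unfolding set_lebesgue_integral_def
  proof (rule integral_cong_AE)
    show "(\<lambda>x. indicator {0..1} x *\<^sub>R d x) \<in> borel_measurable lborel"
      using cper_measurable[OF d] by simp
    show "AE x in lborel. indicator {0..1} x *\<^sub>R d x = 0"
      using assms(3) by eventually_elim (auto simp: d_def indicator_def)
  qed simp
  finally have "integral {0..1} d = 0" by simp
  hence "\<forall>y\<in>{0..1}. d y = 0"
    using integral_eq_0_iff[OF cperD(1)[OF d]] by (auto simp: d_def)
  moreover have "frac x \<in> {0..1}" using frac_lt_1[of x] by (simp add: less_imp_le)
  moreover have "f x = f (frac x)" "g x = g (frac x)"
    using cper_int[OF assms(1), of "frac x" "\<lfloor>x\<rfloor>"] cper_int[OF assms(2), of "frac x" "\<lfloor>x\<rfloor>"] by (simp_all add: frac_def)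
  ultimately show "f x = g x" by (simp add: d_def)
qed

lemma pdistr_of_fun_AE_eq:
  assumes f: "set_integrable lborel {0..1} f" and g: "set_integrable lborel {0..1} g"
    and eq: "pdistr_of_fun f = pdistr_of_fun g"
  shows "AE x in lborel. x \<in> {0..1} \<longrightarrow> f x = g x"
proof -
  have fg: "set_integrable lborel {0..1} (\<lambda>x. f x - g x)" by (rule set_integral_diff(1)[OF f g])
  have "pairing (pdistr_of_fun (\<lambda>x. f x - g x)) h = pairing 0 h" for h
  proof (cases "h \<in> test_fun")
    case True
    note i = set_integrable_times_test_fun[OF _ True]
    have "pairing (pdistr_of_fun (\<lambda>x. f x - g x)) h = (LINT x:{0..1}|lborel. f x * h x - g x * h x)"
      using True by (simp add: pdistr_of_fun.rep_eq fg left_diff_distrib)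
    also have "\<dots> = pairing (pdistr_of_fun f) h - pairing (pdistr_of_fun g) h"
      using True by (simp add: pdistr_of_fun.rep_eq f g set_integral_diff(2)[OF i i])
    finally show ?thesis by (simp add: eq zero_pdistr.rep_eq)
  qed (simp add: pdistr_of_fun.rep_eq zero_pdistr.rep_eq)
  hence "pdistr_of_fun (\<lambda>x. f x - g x) = 0" by (simp add: pairing_inject[symmetric] fun_eq_iff)
  from AE_zero_if_fourier_zero[OF fg this] show ?thesis by simp
qed

lemma rfc_inject:
  assumes "cper f" "cper g" "\<And>k. rfc f k = rfc g k"
  shows "f = g"
proof (rule cper_AE_eq[OF assms(1,2)], rule pdistr_of_fun_AE_eq)
  show "pdistr_of_fun f = pdistr_of_fun g"
    by (rule pdistr_eqI) (simp add: fourier_coeff_of_fun assms)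
qed (auto intro: cper_set_integrable assms)

text \<open>The choice in \<open>fun_of_pdistr\<close> may return any integrable representative;
  since the distribution determines the function almost everywhere, the continuous one is recovered
  up to a null set.\<close>

lemma fun_of_pdistr_AE:
  assumes "cper f"
  shows "set_integrable lborel {0..1} (fun_of_pdistr (pdistr_of_fun f))"
    "AE x in lborel. x \<in> {0..1} \<longrightarrow> fun_of_pdistr (pdistr_of_fun f) x = f x"
proof -
  have "\<exists>g. set_integrable lborel {0..1} g \<and> pdistr_of_fun g = pdistr_of_fun f"
    using cper_set_integrable[OF assms] by blast
  from someI_ex[OF this] have *: "set_integrable lborel {0..1} (fun_of_pdistr (pdistr_of_fun f))"
      "pdistr_of_fun (fun_of_pdistr (pdistr_of_fun f)) = pdistr_of_fun f"
    unfolding fun_of_pdistr_def by auto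
  show "set_integrable lborel {0..1} (fun_of_pdistr (pdistr_of_fun f))"
    "AE x in lborel. x \<in> {0..1} \<longrightarrow> fun_of_pdistr (pdistr_of_fun f) x = f x"
    using * pdistr_of_fun_AE_eq[OF *(1) cper_set_integrable[OF assms] *(2)] by auto
qed

text \<open>\<open>lborel\<close> is not complete, so agreement almost everywhere with a Borel
  function does not give measurability; hence the separate assumption on the function cut off to
  \<open>[0,1]\<close>.\<close>

lemma pdistr_of_fun_cong_AE:
  assumes f: "cper f" and m: "(\<lambda>x. indicator {0..1} x * g x) \<in> borel_measurable lborel"
    and eq: "AE x in lborel. x \<in> {0..1} \<longrightarrow> g x = f x"
  shows "pdistr_of_fun g = pdistr_of_fun f"
proof -
  have ae: "AE x in lborel. indicator {0..1} x *\<^sub>R g x = indicator {0..1} x *\<^sub>R f x"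
    using eq by eventually_elim (auto simp: indicator_def)
  have fi: "set_integrable lborel {0..1} f" by (rule cper_set_integrable[OF f])
  have gi: "set_integrable lborel {0..1} g"
    using fi m ae unfolding set_integrable_def
    by (subst integrable_cong_AE) (auto dest: borel_measurable_integrable)
  have "pairing (pdistr_of_fun g) h = pairing (pdistr_of_fun f) h" for h
  proof (cases "h \<in> test_fun")
    case True
    have "(LINT x:{0..1}|lborel. g x * h x) = (LINT x:{0..1}|lborel. f x * h x)"
      unfolding set_lebesgue_integral_def
    proof (rule integral_cong_AE)
      show "(\<lambda>x. indicator {0..1} x *\<^sub>R (g x * h x)) \<in> borel_measurable lborel"
        using set_integrable_times_test_fun[OF gi True] by (auto simp: set_integrable_def)
      show "(\<lambda>x. indicator {0..1} x *\<^sub>R (f x * h x)) \<in> borel_measurable lborel"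
        using set_integrable_times_test_fun[OF fi True] by (auto simp: set_integrable_def)
      show "AE x in lborel. indicator {0..1} x *\<^sub>R (g x * h x) = indicator {0..1} x *\<^sub>R (f x * h x)"
        using eq by eventually_elim (auto simp: indicator_def)
    qed
    thus ?thesis using True by (simp add: pdistr_of_fun.rep_eq fi gi)
  qed (simp add: pdistr_of_fun.rep_eq)
  thus ?thesis by (simp add: pairing_inject[symmetric] fun_eq_iff)
qed

text \<open>On coefficients the operator multiplies by \<open>1 + (2 * pi * k)\<^sup>2 > 0\<close>,
  so it is injective on all periodic distributions; this is the uniqueness that the definite
  description asks for.\<close>

lemma helmholtz_inv_of_fun:
  assumes U: "C1p U U'" and U': "C1p U' (\<lambda>x. U x - f x)" and f: "cper f"
  shows "helmholtz_inv (pdistr_of_fun f) = pdistr_of_fun U"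
  unfolding helmholtz_inv_def
proof (rule the_equality)
  have "pdistr_of_fun (\<lambda>x. U x - f x) = pdistr_of_fun U - pdistr_of_fun f"
    by (rule pdistr_of_fun_lincomb(2)[OF C1pD(1)[OF U] f])
  thus "pdistr_of_fun U - pderivative (pderivative (pdistr_of_fun U)) = pdistr_of_fun f"
    by (simp add: pderivative_of_fun[OF U] pderivative_of_fun[OF U'])
  moreover fix v assume "v - pderivative (pderivative v) = pdistr_of_fun f"
  ultimately have e: "v - pderivative (pderivative v) = pdistr_of_fun U - pderivative (pderivative (pdistr_of_fun U))" by simp
  show "v = pdistr_of_fun U"
  proof (rule pdistr_eqI)
    fix k
    have *: "fourier_coeff (w - pderivative (pderivative w)) k = of_real (1 + (2 * pi * of_int k)\<^sup>2) * fourier_coeff w k" for w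
      by (simp add: fourier_coeff_linear fourier_coeff_deriv power2_eq_square algebra_simps)
    have "0 < 1 + (2 * pi * real_of_int k)\<^sup>2" by (rule add_pos_nonneg) simp_all
    hence "1 + (2 * pi * of_int k)\<^sup>2 \<noteq> 0" by linarith
    thus "fourier_coeff v k = fourier_coeff (pdistr_of_fun U) k"
      using arg_cong[OF e, of "\<lambda>w. fourier_coeff w k"] unfolding * by (simp only: mult_cancel_left of_real_eq_0_iff) blast
  qed
qed

lemma mch_flux_of_fun:
  assumes U: "C1p U U'" and U': "C1p U' (\<lambda>x. U x - f x)" and f: "cper f"
  shows "mch_flux (pdistr_of_fun f) = pdistr_of_fun (\<lambda>x. ((U x)\<^sup>2 - (U' x)\<^sup>2) * f x)"
proof -
  note c = C1pD(1)[OF U] C1pD(2)[OF U] f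
  let ?F = "\<lambda>f. fun_of_pdistr (pdistr_of_fun f)"
  have m: "(\<lambda>x. indicator {0..1} x * ?F g x) \<in> borel_measurable lborel" if "cper g" for g
    using fun_of_pdistr_AE(1)[OF that] by (auto simp: set_integrable_def)
  \<comment> \<open>The chosen representatives are known to be measurable only after being cut off
    to \<open>[0,1]\<close>, so the indicator is moved onto each factor.\<close>
  have "(\<lambda>x. indicator {0..1} x * (((?F U x)\<^sup>2 - (?F U' x)\<^sup>2) * ?F f x)) =
    (\<lambda>x. ((indicator {0..1} x * ?F U x)\<^sup>2 - (indicator {0..1} x * ?F U' x)\<^sup>2) * (indicator {0..1} x * ?F f x))"
    by (auto simp: indicator_def)
  also have "\<dots> \<in> borel_measurable lborel"
    by (intro borel_measurable_times borel_measurable_diff borel_measurable_power m c)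
  finally have "pdistr_of_fun (\<lambda>x. ((?F U x)\<^sup>2 - (?F U' x)\<^sup>2) * ?F f x) = pdistr_of_fun (\<lambda>x. ((U x)\<^sup>2 - (U' x)\<^sup>2) * f x)"
  proof (rule pdistr_of_fun_cong_AE[rotated])
    show "cper (\<lambda>x. ((U x)\<^sup>2 - (U' x)\<^sup>2) * f x)"
      unfolding power2_eq_square by (intro cper_mult cper_diff c)
    show "AE x in lborel. x \<in> {0..1} \<longrightarrow> ((?F U x)\<^sup>2 - (?F U' x)\<^sup>2) * ?F f x = ((U x)\<^sup>2 - (U' x)\<^sup>2) * f x"
      using c[THEN fun_of_pdistr_AE(2)] by eventually_elim auto
  qed
  thus ?thesis
    unfolding mch_flux_def Let_def helmholtz_inv_of_fun[OF U U' f] pderivative_of_fun[OF U] .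
qed


lemma uniform_series_cper:
  fixes g :: "nat \<Rightarrow> real \<Rightarrow> real"
  assumes g: "\<And>n. cper (g n)" and b: "\<And>n x. \<bar>g n x\<bar> \<le> a n" and a: "summable a"
    and f: "\<And>x. (\<lambda>n. g n x) sums f x"
  shows "cper f" "(\<lambda>N. \<Sum>n<N. rfc (g n) k) \<longlonglongrightarrow> rfc f k"
proof -
  have u: "uniform_limit UNIV (\<lambda>N x. \<Sum>n<N. g n x) f sequentially"
  proof -
    have fe: "f = (\<lambda>x. \<Sum>n. g n x)" using sums_unique[OF f] by (simp add: fun_eq_iff)
    show ?thesis unfolding fe using Weierstrass_m_test[of UNIV g a] b a by simp
  qed
  have "continuous_on UNIV f"
    by (rule uniform_limit_theorem[OF _ u]) (auto intro!: always_eventually continuous_on_sum cperD(1)[OF g])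
  moreover have "f (x + 1) = f x" for x
    using f[of "x + 1"] f[of x] cperD(2)[OF g] by (simp add: sums_unique2)
  ultimately show c: "cper f" by (simp add: cper_def)
  have cs: "cper (\<lambda>x. \<Sum>n<N. g n x)" for N by (intro cper_sum g)
  have eq: "rfc (\<lambda>x. \<Sum>n<N. g n x) k = (\<Sum>n<N. rfc (g n) k)" for N
    by (simp add: fc_sum cper_of_real g)
  show "(\<lambda>N. \<Sum>n<N. rfc (g n) k) \<longlonglongrightarrow> rfc f k"
  proof (rule LIM_zero_cancel, rule tendstoI)
    fix e :: real assume "e > 0"
    with u have "\<forall>\<^sub>F N in sequentially. \<forall>x\<in>UNIV. dist (\<Sum>n<N. g n x) (f x) < e / 2"
      unfolding uniform_limit_iff by (meson half_gt_zero)
    thus "\<forall>\<^sub>F N in sequentially. dist ((\<Sum>n<N. rfc (g n) k) - rfc f k) 0 < e"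
    proof eventually_elim
      case (elim N)
      have "(\<Sum>n<N. rfc (g n) k) - rfc f k = integral {0..1} (\<lambda>x. (of_real (\<Sum>n<N. g n x) - of_real (f x)) * ee (-k) x)"
        unfolding eq[symmetric] fc_diff[OF cper_of_real[OF cs] cper_of_real[OF c], symmetric] by (simp add: fc_def)
      also have "norm \<dots> \<le> e / 2 * (1 - 0)"
        by (rule integral_bound)
           (use elim in \<open>auto simp: norm_mult ee_simps(3) dist_norm simp flip: of_real_diff of_real_sum
             intro!: continuous_intros cperD(1)[OF cs] cperD(1)[OF c] less_imp_le\<close>)
      finally show ?case using \<open>e > 0\<close> by simp
    qed
  qed
qed

section \<open>Besov norms of Fourier coefficient sequences\<close>

text \<open>The shift by one matches the numbering of blocks from 0: block \<open>n\<close> is the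
  dyadic block of index \<open>n - 1\<close>.\<close>

definition wt :: "real \<Rightarrow> nat \<Rightarrow> real" where
  "wt s n = 2 powr ((real n - 1) * s)"

text \<open>A symmetric finite window containing the frequencies of block \<open>n\<close>: these
  satisfy \<open>\<bar>k\<bar> \<le> 4/3\<close> for \<open>n = 0\<close> and
  \<open>\<bar>k\<bar> \<le> 8/3 * 2 ^ (n - 1)\<close> otherwise. Symmetry keeps sums over it real
  when the coefficients are conjugate symmetric.\<close>

definition freqs :: "nat \<Rightarrow> int set" where
  "freqs n = {- (2 ^ (n + 1))..2 ^ (n + 1)}"

lemma freqs: "finite (freqs n)" "k \<in> freqs n \<longleftrightarrow> \<bar>real_of_int k\<bar> \<le> 2 ^ (n + 1)" "uminus ` freqs n = freqs n"
proof -
  have "k \<in> freqs n \<longleftrightarrow> \<bar>k\<bar> \<le> 2 ^ (n + 1)" by (auto simp: freqs_def abs_le_iff)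
  also have "\<dots> \<longleftrightarrow> real_of_int \<bar>k\<bar> \<le> real_of_int (2 ^ (n + 1))" by (simp only: of_int_le_iff)
  finally show "k \<in> freqs n \<longleftrightarrow> \<bar>real_of_int k\<bar> \<le> 2 ^ (n + 1)" by simp
  show "uminus ` freqs n = freqs n" unfolding freqs_def by simp
qed (simp add: freqs_def)

lemma wt_pos: "0 < wt s n" by (simp add: wt_def)

lemma wt_half: "wt (1/2) n = sqrt 2 ^ n / sqrt 2"
proof -
  have "wt (1/2) n = 2 powr (1/2 * real n - 1/2)" by (simp add: wt_def diff_divide_distrib)
  also have "\<dots> = (2 powr (1/2)) powr real n / 2 powr (1/2)" by (simp only: powr_diff powr_powr)
  also have "(2 powr (1/2)) powr real n = (2 powr (1/2)) ^ n" by (rule powr_realpow) simp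
  finally show ?thesis by (simp add: powr_half_sqrt)
qed

lemma wt_neg_half: "wt (-1/2) n = 2 / 2 ^ n * wt (1/2) n"
proof -
  have "wt (-1/2) n = 2 powr (1 - real n + (real n - 1) * (1/2))" by (simp add: wt_def diff_divide_distrib)
  also have "\<dots> = 2 powr (1 - real n) * wt (1/2) n" by (simp only: powr_add wt_def)
  also have "2 powr (1 - real n) = 2 / 2 ^ n" by (simp add: powr_diff powr_realpow)
  finally show ?thesis .
qed

locale lp_pair =
  fixes chi phi :: "real \<Rightarrow> real"
  assumes lp: "littlewood_paley_pair chi phi"
begin

text \<open>
  The block \<open>\<Delta>\<^sub>q\<close> has index \<open>n = q + 1\<close>. The relation \<open>nle s c B\<close> says that the \<open>B\<^sup>s\<^sub>2\<^sub>,\<^sub>1\<close>-norm of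
  the coefficient sequence \<open>c\<close> is finite and at most \<open>B\<close>, without reference to a possibly divergent sum.
\<close>

definition sg :: "nat \<Rightarrow> int \<Rightarrow> real" where
  "sg n k = lp_symbol chi phi (int n - 1) (of_int k)"

definition blk :: "nat \<Rightarrow> (int \<Rightarrow> complex) \<Rightarrow> real" where
  "blk n c = L2_set (\<lambda>k. sg n k * norm (c k)) (freqs n)"

definition nle :: "real \<Rightarrow> (int \<Rightarrow> complex) \<Rightarrow> real \<Rightarrow> bool" where
  "nle s c B \<longleftrightarrow> (\<forall>K. (\<Sum>n<K. wt s n * blk n c) \<le> B)"

lemma sg_0: "sg 0 k = chi (of_int k)"
  by (simp add: sg_def lp_symbol_def)

lemma sg_Suc: "sg (Suc n) k = phi (of_int k / 2 ^ n)"
  by (simp add: sg_def lp_symbol_def power_int_minus divide_inverse mult.commute)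

lemma sg_bounds: "0 \<le> sg n k" "sg n k \<le> 1" and sg_minus: "sg n (- k) = sg n k"
  using lp unfolding littlewood_paley_pair_def
  by (cases n; simp add: sg_0 sg_Suc; metis minus_divide_left)+

lemma sg_sums: "(\<lambda>n. sg n k) sums 1"
proof -
  have "(\<lambda>n. sg (Suc n) k) sums (1 - sg 0 k)"
    using lp by (simp add: littlewood_paley_pair_def sg_0 sg_Suc)
  thus ?thesis using sums_Suc_iff[of "\<lambda>n. sg n k" "1 - sg 0 k"] by simp
qed

lemma sg_supp:
  assumes "sg n k \<noteq> 0"
  shows "k \<in> freqs n" "n \<noteq> 0 \<Longrightarrow> 3 * 2 ^ n \<le> 8 * \<bar>real_of_int k\<bar>"
proof -
  have *: "(n = 0 \<longrightarrow> \<bar>real_of_int k\<bar> \<le> 4/3) \<and> (\<forall>m. n = Suc m \<longrightarrow> 3/4 \<le> \<bar>real_of_int k\<bar> / 2 ^ m \<and> \<bar>real_of_int k\<bar> / 2 ^ m \<le> 8/3)"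
    using lp assms unfolding littlewood_paley_pair_def
    by (cases n) (auto simp: sg_0 sg_Suc abs_divide)
  show "k \<in> freqs n" using * by (cases n) (auto simp: freqs(2) field_simps)
  show "n \<noteq> 0 \<Longrightarrow> 3 * 2 ^ n \<le> 8 * \<bar>real_of_int k\<bar>" using * by (cases n) (auto simp: field_simps)
qed

lemma blk_nonneg: "0 \<le> blk n c" by (simp add: blk_def L2_set_nonneg)

lemma nle_nonneg: "nle s c B \<Longrightarrow> 0 \<le> B"
  unfolding nle_def by (metis lessThan_0 sum.empty)

lemma nle_mono: "nle s c A \<Longrightarrow> A \<le> B \<Longrightarrow> nle s c B"
  unfolding nle_def by (meson order_trans)

lemma blk_add: "blk n (\<lambda>k. c k + d k) \<le> blk n c + blk n d"
proof -
  have "blk n (\<lambda>k. c k + d k) \<le> L2_set (\<lambda>k. sg n k * norm (c k) + sg n k * norm (d k)) (freqs n)"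
    unfolding blk_def
    by (rule L2_set_mono) (auto simp: sg_bounds norm_triangle_ineq mult_left_mono simp flip: distrib_left)
  also have "\<dots> \<le> blk n c + blk n d" unfolding blk_def by (rule L2_set_triangle_ineq)
  finally show ?thesis .
qed

lemma blk_mono:
  assumes "\<And>k. k \<in> freqs n \<Longrightarrow> sg n k \<noteq> 0 \<Longrightarrow> norm (c k) \<le> a * norm (d k)" "0 \<le> a"
  shows "blk n c \<le> a * blk n d"
proof -
  have "sg n k * norm (c k) \<le> a * (sg n k * norm (d k))" if "k \<in> freqs n" for k
    using mult_left_mono[OF assms(1)[OF that] sg_bounds(1)[of n k]] by (cases "sg n k = 0") (auto simp: mult_ac)
  hence "blk n c \<le> L2_set (\<lambda>k. a * (sg n k * norm (d k))) (freqs n)"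
    unfolding blk_def by (intro L2_set_mono) (auto simp: sg_bounds)
  also have "\<dots> = a * blk n d" unfolding blk_def using assms(2) by (simp add: L2_set_right_distrib)
  finally show ?thesis .
qed

lemma nle_add:
  assumes "nle s c A" "nle s d B"
  shows "nle s (\<lambda>k. c k + d k) (A + B)"
  unfolding nle_def
proof
  fix K
  have "(\<Sum>n<K. wt s n * blk n (\<lambda>k. c k + d k)) \<le> (\<Sum>n<K. wt s n * blk n c + wt s n * blk n d)"
    using blk_add wt_pos by (intro sum_mono) (simp flip: distrib_left)
  also have "\<dots> \<le> A + B"
    using assms by (simp add: sum.distrib nle_def add_mono)
  finally show "(\<Sum>n<K. wt s n * blk n (\<lambda>k. c k + d k)) \<le> A + B" .
qed

lemma nle_dominated:
  assumes "nle s c B" "\<And>k. norm (d k) \<le> a * norm (c k)" "0 \<le> a"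
  shows "nle s d (a * B)"
  unfolding nle_def
proof
  fix K
  have "(\<Sum>n<K. wt s n * blk n d) \<le> (\<Sum>n<K. a * (wt s n * blk n c))"
  proof (rule sum_mono)
    fix n
    show "wt s n * blk n d \<le> a * (wt s n * blk n c)"
      using mult_left_mono[OF blk_mono[of n d a c] less_imp_le[OF wt_pos[of s n]]] assms by (simp add: mult_ac)
  qed
  also have "\<dots> \<le> a * B"
    using assms by (simp add: nle_def mult_left_mono flip: sum_distrib_left)
  finally show "(\<Sum>n<K. wt s n * blk n d) \<le> a * B" .
qed

lemma nle_cmult: "nle s c B \<Longrightarrow> nle s (\<lambda>k. a * c k) (norm a * B)"
  by (rule nle_dominated) (auto simp: norm_mult)

lemma nle_uminus: "nle s c B \<Longrightarrow> nle s (\<lambda>k. - c k) B"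
  using nle_dominated[of s c B "\<lambda>k. - c k" 1] by simp

lemma nle_diff: "nle s c A \<Longrightarrow> nle s d B \<Longrightarrow> nle s (\<lambda>k. c k - d k) (A + B)"
  using nle_add[OF _ nle_uminus, of s c A d B] by simp

text \<open>A Fatou property: each partial sum involves finitely many coefficients and is continuous
  in them, so the bound survives coefficientwise limits.\<close>

lemma nle_limit:
  assumes "\<And>j::nat. nle s (c j) B" "\<And>k. (\<lambda>j. c j k) \<longlonglongrightarrow> d k"
  shows "nle s d B"
  unfolding nle_def
proof
  fix K
  have "(\<lambda>j. \<Sum>n<K. wt s n * blk n (c j)) \<longlonglongrightarrow> (\<Sum>n<K. wt s n * blk n d)"
    unfolding blk_def L2_set_def by (intro tendsto_intros assms(2))
  thus "(\<Sum>n<K. wt s n * blk n d) \<le> B"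
    by (rule LIMSEQ_le_const2) (use assms(1) in \<open>auto simp: nle_def\<close>)
qed

lemma nle_zero: "nle s (\<lambda>k. 0) 0"
  by (simp add: nle_def blk_def L2_set_def)

lemma nle_sum:
  assumes "\<And>n::nat. nle s (c n) (B n)"
  shows "nle s (\<lambda>k. \<Sum>n<N. c n k) (\<Sum>n<N. B n)"
proof (induction N)
  case (Suc N)
  thus ?case using nle_add[OF Suc assms[of N]] by simp
qed (simp add: nle_zero)

lemma nle_half_weaken: "nle (1/2) c B \<Longrightarrow> nle (-1/2) c (2 * B)"
proof -
  assume c: "nle (1/2) c B"
  show ?thesis unfolding nle_def
  proof
    fix K
    have "(\<Sum>n<K. wt (-1/2) n * blk n c) \<le> (\<Sum>n<K. 2 * (wt (1/2) n * blk n c))"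
    proof (rule sum_mono)
      fix n
      have "2 / 2 ^ n \<le> (2::real)" by (simp add: divide_le_eq)
      thus "wt (-1/2) n * blk n c \<le> 2 * (wt (1/2) n * blk n c)"
        unfolding wt_neg_half using wt_pos[of "1/2" n] blk_nonneg[of n c]
        by (metis mult.assoc mult_nonneg_nonneg mult_right_mono less_imp_le)
    qed
    also have "\<dots> \<le> 2 * B" using c by (simp add: nle_def flip: sum_distrib_left)
    finally show "(\<Sum>n<K. wt (-1/2) n * blk n c) \<le> 2 * B" .
  qed
qed

text \<open>On the window of block \<open>n\<close> the multiplier is at most
  \<open>16 * 2 ^ n\<close>, and the weights for -1/2 and 1/2 differ by the factor
  \<open>2 / 2 ^ n\<close>; the product is 32.\<close>

lemma nle_derivative: "nle (1/2) c B \<Longrightarrow> nle (-1/2) (\<lambda>k. 2 * pi * \<i> * of_int k * c k) (32 * B)"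
proof -
  assume c: "nle (1/2) c B"
  show ?thesis unfolding nle_def
  proof
    fix K
    have "(\<Sum>n<K. wt (-1/2) n * blk n (\<lambda>k. 2 * pi * \<i> * of_int k * c k)) \<le> (\<Sum>n<K. 32 * (wt (1/2) n * blk n c))"
    proof (rule sum_mono)
      fix n
      have "blk n (\<lambda>k. 2 * pi * \<i> * of_int k * c k) \<le> (16 * 2 ^ n) * blk n c"
      proof (rule blk_mono)
        fix k assume "k \<in> freqs n"
        hence "2 * pi * \<bar>real_of_int k\<bar> \<le> 2 * 4 * 2 ^ (n + 1)"
          unfolding freqs(2) using pi_less_4 pi_gt_zero by (intro mult_mono) auto
        hence "2 * pi * \<bar>real_of_int k\<bar> * norm (c k) \<le> 2 * 4 * 2 ^ (n + 1) * norm (c k)"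
          by (rule mult_right_mono) simp
        thus "norm (2 * pi * \<i> * of_int k * c k) \<le> 16 * 2 ^ n * norm (c k)"
          by (simp add: norm_mult)
      qed simp
      hence "wt (-1/2) n * blk n (\<lambda>k. 2 * pi * \<i> * of_int k * c k) \<le> wt (-1/2) n * (16 * 2 ^ n * blk n c)"
        using wt_pos[of "-1/2" n] by simp
      also have "\<dots> = 32 * (wt (1/2) n * blk n c)" unfolding wt_neg_half by simp
      finally show "wt (-1/2) n * blk n (\<lambda>k. 2 * pi * \<i> * of_int k * c k) \<le> 32 * (wt (1/2) n * blk n c)" .
    qed
    also have "\<dots> \<le> 32 * B" using c by (simp add: nle_def flip: sum_distrib_left)
    finally show "(\<Sum>n<K. wt (-1/2) n * blk n (\<lambda>k. 2 * pi * \<i> * of_int k * c k)) \<le> 32 * B" .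
  qed
qed

text \<open>At a fixed \<open>k\<close> only finitely many symbols are nonzero and they add up to 1,
  so the coefficient is recovered from finitely many blocks. It turns convergence in the Besov norm
  into convergence of every coefficient.\<close>

lemma nle_coeff_bound: "\<exists>C. \<forall>c B. nle s c B \<longrightarrow> norm (c k) \<le> C * B"
proof -
  obtain N where N: "8 * \<bar>real_of_int k\<bar> < 2 ^ N" using real_arch_pow[of 2 "8 * \<bar>real_of_int k\<bar>"] by auto
  have z: "sg n k = 0" if "N + 1 \<le> n" for n
  proof (rule ccontr)
    assume "sg n k \<noteq> 0"
    hence "3 * 2 ^ n \<le> 8 * \<bar>real_of_int k\<bar>" using sg_supp(2) that by auto
    moreover have "(2::real) ^ N \<le> 2 ^ n" using that by (intro power_increasing) auto
    ultimately show False using N zero_less_power[of "2::real" n] by linarith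
  qed
  have "(\<lambda>n. sg n k) sums (\<Sum>n<N+1. sg n k)"
    by (rule sums_finite) (use z in \<open>auto simp: not_less\<close>)
  hence 1: "(\<Sum>n<N+1. sg n k) = 1" using sg_sums sums_unique2 by blast
  have "norm (c k) \<le> (\<Sum>n<N+1. 1 / wt s n) * B" if c: "nle s c B" for c B
  proof -
    have "norm (c k) = (\<Sum>n<N+1. sg n k * norm (c k))" using 1 by (metis mult_1 sum_distrib_right)
    also have "\<dots> \<le> (\<Sum>n<N+1. 1 / wt s n * B)"
    proof (rule sum_mono)
      fix n
      have "sg n k * norm (c k) \<le> blk n c"
      proof (cases "sg n k = 0")
        case False
        show ?thesis unfolding blk_def
          by (rule member_le_L2_set[OF freqs(1) sg_supp(1)[OF False], where f="\<lambda>k. sg n k * norm (c k)"])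
      qed (simp add: blk_nonneg)
      moreover have "wt s n * blk n c \<le> B"
      proof -
        have "wt s n * blk n c \<le> (\<Sum>n<Suc n. wt s n * blk n c)"
          using wt_pos blk_nonneg by (simp add: sum_nonneg less_imp_le)
        thus ?thesis using c unfolding nle_def by (meson order_trans)
      qed
      hence "blk n c \<le> 1 / wt s n * B"
        using wt_pos[of s n] by (simp add: pos_le_divide_eq mult.commute)
      ultimately show "sg n k * norm (c k) \<le> 1 / wt s n * B" by (rule order_trans)
    qed
    finally show ?thesis by (simp only: sum_distrib_right)
  qed
  thus ?thesis by blast
qed


text \<open>
  Atoms realise \<open>B\<^sup>1\<^sup>/\<^sup>2\<^sub>2\<^sub>,\<^sub>1\<close> as the interpolation space between \<open>L\<^sup>2\<close> and \<open>H\<^sup>1\<close>: \<open>\<alpha>\<close> is the norm, up to a constant, and \<open>2\<^sup>n\<close> the frequency.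
\<close>

definition atom :: "nat \<Rightarrow> real \<Rightarrow> (real \<Rightarrow> real) \<Rightarrow> bool" where
  "atom n \<alpha> f \<longleftrightarrow> (\<exists>f'. C1p f f' \<and> (\<forall>x. \<bar>f x\<bar> \<le> \<alpha>) \<and>
     integral {0..1} (\<lambda>x. (f x)\<^sup>2) \<le> \<alpha>\<^sup>2 / 2 ^ n \<and> integral {0..1} (\<lambda>x. (f' x)\<^sup>2) \<le> \<alpha>\<^sup>2 * 2 ^ n)"

lemma blk_le_coeff:
  assumes "\<And>K. finite K \<Longrightarrow> (\<Sum>k\<in>K. (norm (c k))\<^sup>2) \<le> A" "0 \<le> A"
  shows "blk n c \<le> sqrt A"
proof -
  have "(\<Sum>k\<in>freqs n. (sg n k * norm (c k))\<^sup>2) \<le> (\<Sum>k\<in>freqs n. (norm (c k))\<^sup>2)"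
    by (intro sum_mono power_mono mult_left_le_one_le) (auto simp: sg_bounds)
  also have "\<dots> \<le> A" by (rule assms(1)[OF freqs(1)])
  finally show ?thesis unfolding blk_def L2_set_def by simp
qed

lemma sqrt2_power_square: "(sqrt 2 ^ n)\<^sup>2 = 2 ^ n"
  by (simp add: power_mult[symmetric] mult.commute[of n] power_mult)

text \<open>Splitting at \<open>m = n\<close> leaves two finite pieces of the geometric series with
  ratio \<open>1 / sqrt 2 < 5/7\<close>, each at most 4.\<close>

lemma geometric_two_sided:
  "(\<Sum>m<K. if m \<le> n then sqrt 2 ^ m / sqrt 2 ^ n else sqrt 2 ^ n / sqrt 2 ^ m) \<le> 8"
proof -
  define r where "r = 1 / sqrt 2"
  have "1.4 < sqrt (2::real)" by (rule real_less_rsqrt) (simp add: power2_eq_square)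
  hence r: "0 < r" "r < 5/7" by (auto simp: r_def field_simps)
  have fin: "(\<Sum>j\<in>J. r ^ j) \<le> 4" if "finite J" for J
  proof -
    have "(\<Sum>j\<in>J. r ^ j) \<le> (\<Sum>j. r ^ j)"
      using r by (intro sum_le_suminf summable_geometric that) auto
    also have "\<dots> = 1 / (1 - r)" using r by (intro suminf_geometric) auto
    also have "\<dots> \<le> 4" using r by (simp add: field_simps)
    finally show ?thesis .
  qed
  have "(\<Sum>m<K. if m \<le> n then sqrt 2 ^ m / sqrt 2 ^ n else sqrt 2 ^ n / sqrt 2 ^ m) =
      (\<Sum>m\<in>{..<K} \<inter> {m. m \<le> n}. r ^ (n - m)) + (\<Sum>m\<in>{..<K} \<inter> - {m. m \<le> n}. r ^ (m - n))"
    by (subst sum.If_cases) (auto simp: r_def power_diff power_divide intro!: arg_cong2[of _ _ _ _ "(+)"] sum.cong)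
  also have "(\<Sum>m\<in>{..<K} \<inter> {m. m \<le> n}. r ^ (n - m)) = (\<Sum>j\<in>(\<lambda>m. n - m) ` ({..<K} \<inter> {m. m \<le> n}). r ^ j)"
    by (subst sum.reindex) (auto simp: inj_on_def)
  also have "\<dots> \<le> 4" by (rule fin) auto
  also have "(\<Sum>m\<in>{..<K} \<inter> - {m. m \<le> n}. r ^ (m - n)) = (\<Sum>j\<in>(\<lambda>m. m - n) ` ({..<K} \<inter> - {m. m \<le> n}). r ^ j)"
    by (subst sum.reindex) (auto simp: inj_on_def)
  also have "\<dots> \<le> 4" by (rule fin) auto
  finally show ?thesis by simp
qed

text \<open>The L2 bound controls the blocks with \<open>m \<le> n\<close> and the bound on the
  derivative those with \<open>m > n\<close>. Either way the weighted block decays geometrically in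
  the distance between \<open>m\<close> and \<open>n\<close>, so the sum over blocks does not depend
  on \<open>n\<close>.\<close>

lemma atom_nle:
  assumes "atom n \<alpha> f"
  shows "nle (1/2) (rfc f) (8 * \<alpha>)"
proof -
  obtain f' where f: "C1p f f'" and b: "\<And>x. \<bar>f x\<bar> \<le> \<alpha>" and
    i: "integral {0..1} (\<lambda>x. (f x)\<^sup>2) \<le> \<alpha>\<^sup>2 / 2 ^ n" "integral {0..1} (\<lambda>x. (f' x)\<^sup>2) \<le> \<alpha>\<^sup>2 * 2 ^ n"
    using assms unfolding atom_def by blast
  have \<alpha>: "0 \<le> \<alpha>" using b[of 0] by linarith
  define w where "w = sqrt (2::real)"
  have w: "1 \<le> w" "0 < w" by (simp_all add: w_def)
  have w2: "(w ^ n)\<^sup>2 = 2 ^ n" for n unfolding w_def by (rule sqrt2_power_square)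
  have s1: "(\<Sum>k\<in>K. (norm (rfc f k))\<^sup>2) \<le> (\<alpha> / w ^ n)\<^sup>2" if "finite K" for K
    using order_trans[OF bessel[OF cper_of_real[OF C1pD(1)[OF f]] that]] i(1) by (simp add: power_divide w2)
  have s2: "(\<Sum>k\<in>K. (norm (rfc f' k))\<^sup>2) \<le> (\<alpha> * w ^ n)\<^sup>2" if "finite K" for K
    using order_trans[OF bessel[OF cper_of_real[OF C1pD(2)[OF f]] that]] i(2) by (simp add: power_mult_distrib w2)
  have b1: "blk m (rfc f) \<le> \<alpha> / w ^ n" for m
    using blk_le_coeff[OF s1, of m] \<alpha> w by simp
  \<comment> \<open>Block 0 contains the zero frequency, where the derivative gives no information;
    there the first bound already suffices.\<close>
  have b2: "blk m (rfc f) \<le> \<alpha> * w ^ n / 2 ^ m" for m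
  proof (cases "m = 0")
    case True
    have "\<alpha> / w ^ n \<le> \<alpha> * w ^ n"
      using \<alpha> w one_le_power[OF w(1), of n]
      by (simp add: divide_le_eq) (metis mult_left_mono mult.assoc mult.right_neutral mult_mono' one_le_power order.trans zero_le_one)
    thus ?thesis using b1[of m] True by simp
  next
    case False
    have "blk m (rfc f) \<le> (1 / 2 ^ m) * blk m (rfc f')"
    proof (rule blk_mono)
      fix k assume "sg m k \<noteq> 0"
      hence "3 * 2 ^ m \<le> 8 * \<bar>real_of_int k\<bar>" using sg_supp(2) False by blast
      hence "2 ^ m \<le> 2 * 3 * \<bar>real_of_int k\<bar>" by simp
      also have "\<dots> \<le> 2 * pi * \<bar>real_of_int k\<bar>" using pi_gt3 by (intro mult_right_mono mult_left_mono) auto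
      finally have "2 ^ m * norm (rfc f k) \<le> 2 * pi * \<bar>real_of_int k\<bar> * norm (rfc f k)" by (rule mult_right_mono) simp
      thus "norm (rfc f k) \<le> 1 / 2 ^ m * norm (rfc f' k)"
        by (simp add: rfc_deriv[OF f] norm_mult field_simps)
    qed simp
    also have "\<dots> \<le> (1 / 2 ^ m) * (\<alpha> * w ^ n)"
      using blk_le_coeff[OF s2, of m] \<alpha> w by (intro mult_left_mono) auto
    finally show ?thesis by simp
  qed
  have summand: "wt (1/2) m * blk m (rfc f) \<le> \<alpha> * (if m \<le> n then w ^ m / w ^ n else w ^ n / w ^ m)" for m
  proof -
    have "wt (1/2) m \<le> w ^ m" unfolding wt_half w_def[symmetric] using w by (simp add: divide_le_eq)
    hence *: "wt (1/2) m * blk m (rfc f) \<le> w ^ m * blk m (rfc f)" by (rule mult_right_mono) (rule blk_nonneg)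
    have "w ^ m * blk m (rfc f) \<le> w ^ m * (\<alpha> / w ^ n)" "w ^ m * blk m (rfc f) \<le> w ^ m * (\<alpha> * w ^ n / 2 ^ m)"
      by (rule mult_left_mono[OF b1] mult_left_mono[OF b2], use w in simp)+
    moreover have "w ^ m * (\<alpha> * w ^ n / 2 ^ m) = \<alpha> * (w ^ n / w ^ m)"
      unfolding w2[symmetric] using w by (simp add: power2_eq_square)
    ultimately show ?thesis using * by (auto simp: mult_ac)
  qed
  show ?thesis unfolding nle_def
  proof
    fix K
    have "(\<Sum>m<K. wt (1/2) m * blk m (rfc f)) \<le> (\<Sum>m<K. \<alpha> * (if m \<le> n then w ^ m / w ^ n else w ^ n / w ^ m))"
      by (rule sum_mono) (rule summand)
    also have "\<dots> \<le> \<alpha> * 8"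
      unfolding w_def sum_distrib_left[symmetric] by (rule mult_left_mono[OF geometric_two_sided \<alpha>])
    finally show "(\<Sum>m<K. wt (1/2) m * blk m (rfc f)) \<le> 8 * \<alpha>" by simp
  qed
qed

lemma real_trig_poly:
  assumes I: "finite I" "uminus ` I = I" and c: "\<And>k. c (- k) = cnj (c k)"
  defines "S \<equiv> \<lambda>x. \<Sum>k\<in>I. c k * ee k x"
  shows "of_real (Re (S x)) = S x"
proof -
  have "cnj (S x) = (\<Sum>k\<in>I. c (- k) * ee (- k) x)" by (simp add: S_def c ee_simps(4))
  also have "\<dots> = (\<Sum>k\<in>uminus ` I. c k * ee k x)" by (subst sum.reindex) (auto simp: inj_on_def)
  also have "\<dots> = S x" by (simp add: I S_def)
  finally show ?thesis by (simp add: complex_eq_iff)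
qed

text \<open>The Littlewood-Paley blocks are themselves the atoms: Bernstein's inequality bounds the
  derivative, and Cauchy-Schwarz over the frequencies of the window bounds the sup norm.\<close>

lemma lp_atoms:
  fixes c :: "int \<Rightarrow> complex"
  assumes B: "nle (1/2) c B" and c: "\<And>k. c (- k) = cnj (c k)"
  obtains f \<alpha> where "\<And>n. atom n (\<alpha> n) (f n)" "\<And>n. 0 \<le> \<alpha> n" "\<And>K. (\<Sum>n<K. \<alpha> n) \<le> 20 * B"
    "\<And>n k. rfc (f n) k = sg n k * c k"
proof -
  \<comment> \<open>The factor 13 covers both \<open>2 * pi * \<bar>k\<bar> \<le> 13 * 2 ^ n\<close>
    on the window and the square root of its \<open>2 ^ (n + 2) + 1\<close> elements. Relative to
    the Besov weight it becomes \<open>13 * sqrt 2\<close>, which is at most 20.\<close>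
  define \<alpha> where "\<alpha> n = 13 * (sqrt 2 ^ n * blk n c)" for n
  define d :: "nat \<Rightarrow> int \<Rightarrow> complex" where "d n k = of_real (sg n k) * c k" for n k
  define f where "f n x = Re (\<Sum>k\<in>freqs n. d n k * ee k x)" for n x
  have dm: "d n (- k) = cnj (d n k)" for n k by (simp add: d_def sg_minus c)
  have fS: "of_real (f n x) = (\<Sum>k\<in>freqs n. d n k * ee k x)" for n x
    unfolding f_def by (rule real_trig_poly[OF freqs(1,3)]) (rule dm)
  have bl: "(\<Sum>k\<in>freqs n. (norm (d n k))\<^sup>2) = (blk n c)\<^sup>2" for n
    by (simp add: blk_def L2_set_def sum_nonneg d_def norm_mult power_mult_distrib sg_bounds)
  have \<alpha>0: "0 \<le> \<alpha> n" for n by (simp add: \<alpha>_def blk_nonneg)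
  have \<alpha>2: "(\<alpha> n)\<^sup>2 = 169 * 2 ^ n * (blk n c)\<^sup>2" for n
    unfolding \<alpha>_def power_mult_distrib sqrt2_power_square by simp
  have rf: "rfc (f n) k = sg n k * c k" for n k
  proof -
    have "rfc (f n) k = (if k \<in> freqs n then d n k else 0)"
      unfolding fS by (rule fc_trig_poly[OF freqs(1)])
    thus ?thesis using sg_supp(1)[of n k] by (auto simp: d_def)
  qed
  have "atom n (\<alpha> n) (f n)" for n
  proof -
    define D where "D x = (\<Sum>k\<in>freqs n. (2 * pi * \<i> * of_int k * d n k) * ee k x)" for x
    define f' where "f' x = Re (D x)" for x
    have Dr: "of_real (f' x) = D x" for x
      unfolding f'_def D_def by (rule real_trig_poly[OF freqs(1,3)]) (simp add: dm)
    have "((\<lambda>x. \<Sum>k\<in>freqs n. d n k * ee k x) has_vector_derivative D x) (at x)" for x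
    proof -
      have "((\<lambda>x. \<Sum>k\<in>freqs n. d n k * ee k x) has_vector_derivative (\<Sum>k\<in>freqs n. d n k * ((2 * pi * of_int k) *\<^sub>R (\<i> * ee k x)))) (at x)"
        by (intro has_vector_derivative_sum has_vector_derivative_mult_right ee_deriv)
      thus ?thesis by (simp add: D_def scaleR_conv_of_real mult_ac)
    qed
    hence der: "(f n has_vector_derivative f' x) (at x)" for x
      unfolding f_def f'_def by (rule bounded_linear.has_vector_derivative[OF bounded_linear_Re])
    have "cper (f n)" "cper f'"
      using cper_trig[of "d n" "freqs n"] cper_trig[of "\<lambda>k. 2 * pi * \<i> * of_int k * d n k" "freqs n"]
      unfolding cper_def f_def[abs_def] f'_def[abs_def] D_def by (auto intro!: continuous_intros)
    hence C: "C1p (f n) f'" using der by (simp add: C1p_def)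
    have sq: "(f n x)\<^sup>2 = (norm (\<Sum>k\<in>freqs n. d n k * ee k x))\<^sup>2" for x
      unfolding fS[symmetric] by simp
    have sq': "(f' x)\<^sup>2 = (norm (\<Sum>k\<in>freqs n. (2 * pi * \<i> * of_int k * d n k) * ee k x))\<^sup>2" for x
      unfolding D_def[symmetric] Dr[symmetric] by simp
    have 1: "integral {0..1} (\<lambda>x. (f n x)\<^sup>2) = (blk n c)\<^sup>2"
      unfolding sq parseval_trig[OF freqs(1)] by (rule bl)
    have "integral {0..1} (\<lambda>x. (f' x)\<^sup>2) = (\<Sum>k\<in>freqs n. (norm (2 * pi * \<i> * of_int k * d n k))\<^sup>2)"
      unfolding sq' by (rule parseval_trig[OF freqs(1)])
    also have "\<dots> \<le> (\<Sum>k\<in>freqs n. (13 * 2 ^ n)\<^sup>2 * (norm (d n k))\<^sup>2)"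
    proof (rule sum_mono)
      fix k assume "k \<in> freqs n"
      hence "2 * pi * \<bar>real_of_int k\<bar> \<le> 2 * (13/4) * 2 ^ (n + 1)"
        unfolding freqs(2) using pi_approx by (intro mult_mono) auto
      hence "2 * pi * \<bar>real_of_int k\<bar> * norm (d n k) \<le> 13 * 2 ^ n * norm (d n k)"
        by (intro mult_right_mono) auto
      hence "norm (2 * pi * \<i> * of_int k * d n k) \<le> 13 * 2 ^ n * norm (d n k)"
        by (simp add: norm_mult)
      thus "(norm (2 * pi * \<i> * of_int k * d n k))\<^sup>2 \<le> (13 * 2 ^ n)\<^sup>2 * (norm (d n k))\<^sup>2"
        unfolding power_mult_distrib[symmetric] by (rule power_mono) simp
    qed
    also have "\<dots> = (13 * 2 ^ n)\<^sup>2 * (blk n c)\<^sup>2" by (simp only: bl flip: sum_distrib_left)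
    also have "\<dots> = (\<alpha> n)\<^sup>2 * 2 ^ n" unfolding \<alpha>2 by (simp add: power2_eq_square)
    finally have 2: "integral {0..1} (\<lambda>x. (f' x)\<^sup>2) \<le> (\<alpha> n)\<^sup>2 * 2 ^ n" .
    have 3: "\<bar>f n x\<bar> \<le> \<alpha> n" for x
    proof -
      have "\<bar>f n x\<bar> = norm (\<Sum>k\<in>freqs n. d n k * ee k x)" by (simp flip: fS)
      also have "\<dots> \<le> (\<Sum>k\<in>freqs n. \<bar>1\<bar> * \<bar>norm (d n k)\<bar>)"
        by (rule order_trans[OF norm_sum]) (simp add: norm_mult ee_simps(3))
      also have "\<dots> \<le> L2_set (\<lambda>k. 1) (freqs n) * L2_set (\<lambda>k. norm (d n k)) (freqs n)"
        by (rule L2_set_mult_ineq)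
      also have "L2_set (\<lambda>k. norm (d n k)) (freqs n) = blk n c"
        unfolding L2_set_def bl using blk_nonneg by simp
      also have "L2_set (\<lambda>k. 1) (freqs n) \<le> 13 * sqrt 2 ^ n"
      proof -
        have "card (freqs n) = nat (2 ^ (n + 2) + 1)" by (simp add: freqs_def)
        hence "real (card (freqs n)) = 2 ^ (n + 2) + 1" by (simp add: nat_add_distrib nat_power_eq)
        also have "\<dots> \<le> (13 * sqrt 2 ^ n)\<^sup>2"
          unfolding power_mult_distrib sqrt2_power_square power_add
          using two_realpow_ge_one[of n] by (simp only: power2_eq_square)
        finally show ?thesis unfolding L2_set_def by (simp add: real_le_lsqrt)
      qed
      finally show ?thesis using blk_nonneg[of n c] by (simp add: \<alpha>_def mult_right_mono mult.assoc)
    qed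
    have "(blk n c)\<^sup>2 * 1 \<le> (blk n c)\<^sup>2 * 169" by (intro mult_left_mono) auto
    hence "(blk n c)\<^sup>2 \<le> (\<alpha> n)\<^sup>2 / 2 ^ n" by (simp add: \<alpha>2)
    thus ?thesis unfolding atom_def using C 1 2 3 by auto
  qed
  moreover have "(\<Sum>n<K. \<alpha> n) \<le> 20 * B" for K
  proof -
    have "\<alpha> n = 13 * sqrt 2 * (wt (1/2) n * blk n c)" for n
      by (simp add: \<alpha>_def wt_half)
    hence "(\<Sum>n<K. \<alpha> n) = 13 * sqrt 2 * (\<Sum>n<K. wt (1/2) n * blk n c)"
      by (simp flip: sum_distrib_left)
    also have "\<dots> \<le> 20 * B"
    proof (rule mult_mono)
      have "sqrt 2 \<le> (20/13::real)" by (rule real_le_lsqrt) (auto simp: power2_eq_square)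
      thus "13 * sqrt 2 \<le> (20::real)" by simp
    qed (use B in \<open>auto simp: nle_def intro!: sum_nonneg mult_nonneg_nonneg less_imp_le[OF wt_pos] blk_nonneg\<close>)
    finally show ?thesis .
  qed
  ultimately show ?thesis using that \<alpha>0 rf by blast
qed

end


section \<open>The algebra \<open>B\<^sup>1\<^sup>/\<^sup>2\<^sub>2\<^sub>,\<^sub>1\<close>\<close>

lemma cper_rfc_cnj: "rfc f (- k) = cnj (rfc f k)"
proof -
  have "cnj (integral {0..1} (\<lambda>x. complex_of_real (f x) * ee (-k) x)) = integral {0..1} (\<lambda>x. cnj (complex_of_real (f x) * ee (-k) x))"
    by (rule integral_cnj)
  thus ?thesis by (simp add: fc_def ee_simps(4))
qed

lemma integral_square_cper:
  fixes f :: "real \<Rightarrow> real"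
  shows "cper f \<Longrightarrow> (\<lambda>x. (f x)\<^sup>2) integrable_on {a..b}"
  by (intro integrable_continuous_real continuous_intros cperD)

lemma integral_square_bound:
  fixes f :: "real \<Rightarrow> real"
  assumes "cper f" "\<And>x. \<bar>f x\<bar> \<le> M"
  shows "integral {0..1} (\<lambda>x. (f x)\<^sup>2) \<le> M\<^sup>2"
proof -
  have M: "0 \<le> M" using assms(2)[of 0] by linarith
  have "integral {0..1} (\<lambda>x. (f x)\<^sup>2) \<le> integral {0..1} (\<lambda>x::real. M\<^sup>2)"
  proof (rule integral_le[OF integral_square_cper[OF assms(1)]])
    show "(f x)\<^sup>2 \<le> M\<^sup>2" for x
      using assms(2)[of x] M by (simp add: abs_le_square_iff[symmetric])
  qed (intro integrable_continuous_real continuous_intros)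
  thus ?thesis by simp
qed

lemma C1p_real: "C1p f f' \<Longrightarrow> (f has_real_derivative f' x) (at x)"
  by (simp add: C1p_def has_real_derivative_iff_has_vector_derivative)

lemma C1pI:
  fixes f f' :: "real \<Rightarrow> real"
  assumes "\<And>x. (f has_real_derivative f' x) (at x)" "continuous_on UNIV f'" "\<And>x. f (x + 1) = f x" "\<And>x. f' (x + 1) = f' x"
  shows "C1p f f'"
proof -
  have "continuous_on UNIV f"
    using assms(1) DERIV_isCont by (blast intro: continuous_at_imp_continuous_on)
  thus ?thesis
    using assms by (simp add: C1p_def cper_def has_real_derivative_iff_has_vector_derivative[symmetric])
qed

lemma C1p_lincomb:
  fixes f g :: "real \<Rightarrow> real"
  assumes "C1p f f'" "C1p g g'"
  shows "C1p (\<lambda>x. f x - g x) (\<lambda>x. f' x - g' x)" "C1p (\<lambda>x. f x + g x) (\<lambda>x. f' x + g' x)"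
    "C1p (\<lambda>x. f x * g x) (\<lambda>x. f' x * g x + f x * g' x)" "C1p (\<lambda>x. c * f x) (\<lambda>x. c * f' x)"
proof -
  note c = C1pD(1,2)[OF assms(1)] C1pD(1,2)[OF assms(2)]
  note d = C1p_real[OF assms(1)] C1p_real[OF assms(2)]
  note D = DERIV_diff[OF d] DERIV_add[OF d] DERIV_mult[OF d] DERIV_cmult[OF d(1)]
  show "C1p (\<lambda>x. f x - g x) (\<lambda>x. f' x - g' x)"
    using D(1) c by (simp add: C1p_def has_real_derivative_iff_has_vector_derivative cper_diff)
  show "C1p (\<lambda>x. f x + g x) (\<lambda>x. f' x + g' x)"
    using D(2) c by (simp add: C1p_def has_real_derivative_iff_has_vector_derivative cper_add)
  show "C1p (\<lambda>x. f x * g x) (\<lambda>x. f' x * g x + f x * g' x)"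
    using D(3) c by (simp add: C1p_def has_real_derivative_iff_has_vector_derivative cper_add cper_mult mult.commute)
  show "C1p (\<lambda>x. c * f x) (\<lambda>x. c * f' x)"
    using D(4) c by (simp add: C1p_def has_real_derivative_iff_has_vector_derivative cper_mult cper_const)
qed

lemma derivative_lipschitz:
  fixes f f' :: "real \<Rightarrow> real"
  assumes "\<And>x. (f has_real_derivative f' x) (at x)" "\<And>x. \<bar>f' x\<bar> \<le> L"
  shows "\<bar>f x - f y\<bar> \<le> L * \<bar>x - y\<bar>"
  using field_differentiable_bound[of UNIV f f' L x y] assms by (auto intro: has_field_derivative_at_within)

text \<open>\<open>Y\<close> is the lift to the line of a diffeomorphism of the circle.\<close>

definition circle_diffeo :: "(real \<Rightarrow> real) \<Rightarrow> (real \<Rightarrow> real) \<Rightarrow> bool" where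
  "circle_diffeo Y Y' \<longleftrightarrow> (\<forall>x. (Y has_real_derivative Y' x) (at x)) \<and> continuous_on UNIV Y' \<and>
     (\<forall>x. Y (x + 1) = Y x + 1) \<and> (\<forall>x. Y' (x + 1) = Y' x) \<and> (\<forall>x. 1/2 \<le> Y' x \<and> Y' x \<le> 2)"

lemma circle_diffeoD:
  assumes "circle_diffeo Y Y'"
  shows "(Y has_real_derivative Y' x) (at x)" "cper Y'" "Y (x + 1) = Y x + 1" "1/2 \<le> Y' x" "Y' x \<le> 2"
    "continuous_on S Y" "mono Y"
proof -
  have d: "\<And>x. (Y has_real_derivative Y' x) (at x)" using assms by (simp add: circle_diffeo_def)
  show "(Y has_real_derivative Y' x) (at x)" "cper Y'" "Y (x + 1) = Y x + 1" "1/2 \<le> Y' x" "Y' x \<le> 2"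
    using assms by (auto simp: circle_diffeo_def cper_def)
  show "continuous_on S Y" using d DERIV_isCont by (blast intro: continuous_at_imp_continuous_on)
  show "mono Y"
  proof (rule monoI)
    fix x y :: real assume "x \<le> y"
    moreover have "0 \<le> Y' z" for z using assms by (auto simp: circle_diffeo_def intro: order_trans[of _ "1/2"])
    ultimately show "Y x \<le> Y y" using d by (intro DERIV_nonneg_imp_nondecreasing[of x y Y]) blast+
  qed
qed

lemma substitution_mono:
  fixes f :: "real \<Rightarrow> 'a::euclidean_space"
  assumes Y: "circle_diffeo Y Y'" and f: "continuous_on UNIV f" and ab: "a \<le> b"
  shows "integral {a..b} (\<lambda>x. Y' x *\<^sub>R f (Y x)) = integral {Y a..Y b} f"
proof (rule integral_unique, rule has_integral_substitution[OF ab])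
  show "Y a \<le> Y b" using circle_diffeoD(7)[OF Y] ab by (simp add: mono_def)
  show "Y ` {a..b} \<subseteq> {Y a..Y b}" using circle_diffeoD(7)[OF Y] by (auto simp: mono_def)
qed (use f circle_diffeoD(1)[OF Y] in \<open>auto intro: continuous_on_subset has_field_derivative_at_within\<close>)

lemma substitution_period:
  fixes f :: "real \<Rightarrow> 'a::euclidean_space"
  assumes Y: "circle_diffeo Y Y'" and f: "cper f"
  shows "integral {0..1} (\<lambda>x. Y' x *\<^sub>R f (Y x)) = integral {0..1} f"
  using substitution_mono[OF Y cperD(1)[OF f], of 0 1] integral_period[OF f, of "Y 0"] circle_diffeoD(3)[OF Y, of 0]
  by simp

lemma cper_compose:
  fixes f :: "real \<Rightarrow> 'a::real_normed_vector"
  assumes Y: "circle_diffeo Y Y'" and f: "cper f"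
  shows "cper (\<lambda>x. f (Y x))"
  using continuous_on_compose2[OF cperD(1)[OF f, of UNIV] circle_diffeoD(6)[OF Y, of UNIV]] cperD(2)[OF f] circle_diffeoD(3)[OF Y]
  by (auto simp: cper_def)

lemma C1p_compose:
  assumes Y: "circle_diffeo Y Y'" and f: "C1p f f'"
  shows "C1p (\<lambda>x. f (Y x)) (\<lambda>x. f' (Y x) * Y' x)"
proof -
  have "((\<lambda>x. f (Y x)) has_real_derivative f' (Y x) * Y' x) (at x)" for x
    by (rule DERIV_chain2[OF C1p_real[OF f] circle_diffeoD(1)[OF Y]])
  thus ?thesis
    using cper_compose[OF Y C1pD(1)[OF f]] cper_mult[OF cper_compose[OF Y C1pD(2)[OF f]] circle_diffeoD(2)[OF Y]]
    by (simp add: C1p_def has_real_derivative_iff_has_vector_derivative)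
qed

lemma rfc_add: "cper f \<Longrightarrow> cper g \<Longrightarrow> rfc (\<lambda>x. f x + g x) = (\<lambda>k. rfc f k + rfc g k)"
  by (simp add: fc_add[OF cper_of_real cper_of_real] fun_eq_iff)

lemma rfc_diff: "cper f \<Longrightarrow> cper g \<Longrightarrow> rfc (\<lambda>x. f x - g x) = (\<lambda>k. rfc f k - rfc g k)"
  by (simp add: fc_diff[OF cper_of_real cper_of_real] fun_eq_iff)

lemma rfc_cmult: "rfc (\<lambda>x. a * f x) = (\<lambda>k. of_real a * rfc f k)"
  by (simp add: fc_cmult fun_eq_iff)

context lp_pair
begin

text \<open>\<open>BN f B\<close>: the function \<open>f\<close> has \<open>B\<^sup>1\<^sup>/\<^sup>2\<^sub>2\<^sub>,\<^sub>1\<close>-norm at most \<open>B\<close>.\<close>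

definition BN :: "(real \<Rightarrow> real) \<Rightarrow> real \<Rightarrow> bool" where
  "BN f B \<longleftrightarrow> cper f \<and> nle (1/2) (rfc f) B"

lemma atom_C1: "atom n \<alpha> f \<Longrightarrow> cper f" "atom n \<alpha> f \<Longrightarrow> \<bar>f x\<bar> \<le> \<alpha>"
  by (auto simp: atom_def C1p_def)

text \<open>The sup norms of the atoms are summable, so the block series converges uniformly to a
  continuous function, with coefficients \<open>c\<close> since the symbols add up to 1. This is the
  embedding into continuous functions, with constant 20.\<close>

lemma lp_function:
  assumes B: "nle (1/2) c B" and c: "\<And>k. c (- k) = cnj (c k)"
  obtains g f \<alpha> where "\<And>n. atom n (\<alpha> n) (f n)" "\<And>n. 0 \<le> \<alpha> n" "\<And>K. (\<Sum>n<K. \<alpha> n) \<le> 20 * B"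
    "\<And>x. (\<lambda>n. f n x) sums g x" "cper g" "\<And>k. rfc g k = c k" "\<And>x. \<bar>g x\<bar> \<le> 20 * B"
proof -
  obtain f \<alpha> where f: "\<And>n. atom n (\<alpha> n) (f n)" "\<And>n. 0 \<le> \<alpha> n" "\<And>K. (\<Sum>n<K. \<alpha> n) \<le> 20 * B"
    "\<And>n k. rfc (f n) k = sg n k * c k"
    by (rule lp_atoms[OF assms]) (rule that)
  have s\<alpha>: "summable \<alpha>" by (rule summableI_nonneg_bounded) (rule f(2) f(3))+
  have "summable (\<lambda>n. f n x)" for x
    by (rule summable_comparison_test'[OF s\<alpha>, of 0]) (use atom_C1(2)[OF f(1)] in auto)
  define g where "g x = (\<Sum>n. f n x)" for x
  have g: "(\<lambda>n. f n x) sums g x" for x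
    unfolding g_def by (rule summable_sums) fact
  note u = uniform_series_cper[OF atom_C1(1)[OF f(1)] atom_C1(2)[OF f(1)] s\<alpha> g]
  have "rfc g k = c k" for k
  proof (rule LIMSEQ_unique[OF u(2)])
    have "(\<lambda>N. of_real (\<Sum>n<N. sg n k) * c k) \<longlonglongrightarrow> of_real 1 * c k"
      using sg_sums[of k] by (intro tendsto_intros) (simp add: sums_def)
    thus "(\<lambda>N. \<Sum>n<N. rfc (f n) k) \<longlonglongrightarrow> c k" by (simp add: f(4) sum_distrib_right)
  qed
  moreover have "\<bar>g x\<bar> \<le> 20 * B" for x
  proof -
    have "(\<lambda>N. \<bar>\<Sum>n<N. f n x\<bar>) \<longlonglongrightarrow> \<bar>g x\<bar>" using g[of x] by (intro tendsto_intros) (simp add: sums_def)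
    moreover have "\<bar>\<Sum>n<N. f n x\<bar> \<le> 20 * B" for N
      using order_trans[OF sum_abs sum_mono[of "{..<N}" "\<lambda>n. \<bar>f n x\<bar>" \<alpha>]] atom_C1(2)[OF f(1)] f(3)[of N] by (meson order_trans)
    ultimately show ?thesis by (auto intro: LIMSEQ_le_const2)
  qed
  ultimately show ?thesis by (intro that[OF f(1,2,3) g u(1)])
qed

text \<open>A continuous function is determined by its coefficients, so the function synthesised
  from them is \<open>g\<close> itself. Together with \<open>BN_series\<close> this reduces
  estimates for products and compositions to single atoms.\<close>

lemma BN_decompose:
  assumes "BN g B"
  obtains f \<alpha> where "\<And>n. atom n (\<alpha> n) (f n)" "\<And>n. 0 \<le> \<alpha> n" "\<And>K. (\<Sum>n<K. \<alpha> n) \<le> 20 * B"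
    "\<And>x. (\<lambda>n. f n x) sums g x" "\<And>x. \<bar>g x\<bar> \<le> 20 * B"
proof -
  obtain g' f \<alpha> where *: "\<And>n. atom n (\<alpha> n) (f n)" "\<And>n. 0 \<le> \<alpha> n" "\<And>K. (\<Sum>n<K. \<alpha> n) \<le> 20 * B"
    "\<And>x. (\<lambda>n. f n x) sums g' x" "cper g'" "\<And>k. rfc g' k = rfc g k" "\<And>x. \<bar>g' x\<bar> \<le> 20 * B"
  proof (rule lp_function[of "rfc g" B])
    show "nle (1/2) (rfc g) B" using assms by (simp add: BN_def)
  qed (rule cper_rfc_cnj, rule that)
  have "g' = g" by (rule rfc_inject[OF *(5) _ *(6)]) (use assms in \<open>simp add: BN_def\<close>)
  with * show ?thesis by (intro that[of \<alpha> f]) simp_all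
qed

lemma BN_cper: "BN f B \<Longrightarrow> cper f" and BN_nonneg: "BN f B \<Longrightarrow> 0 \<le> B"
  by (auto simp: BN_def nle_nonneg)

lemma BN_sup: "BN f B \<Longrightarrow> \<bar>f x\<bar> \<le> 20 * B"
  by (rule BN_decompose)

lemma BN_mono: "BN f A \<Longrightarrow> A \<le> B \<Longrightarrow> BN f B"
  by (auto simp: BN_def intro: nle_mono)

lemma BN_add: "BN f A \<Longrightarrow> BN g B \<Longrightarrow> BN (\<lambda>x. f x + g x) (A + B)"
  unfolding BN_def by (auto simp only: rfc_add intro: nle_add cper_add)

lemma BN_diff: "BN f A \<Longrightarrow> BN g B \<Longrightarrow> BN (\<lambda>x. f x - g x) (A + B)"
  unfolding BN_def by (auto simp only: rfc_diff intro: nle_diff cper_diff)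

lemma BN_cmult: "BN f A \<Longrightarrow> BN (\<lambda>x. c * f x) (\<bar>c\<bar> * A)"
  unfolding BN_def rfc_cmult using nle_cmult[of "1/2" "rfc f" A "complex_of_real c"]
  by (auto intro: cper_mult[OF cper_const])

lemma BN_uminus: "BN f A \<Longrightarrow> BN (\<lambda>x. - f x) A"
  using BN_cmult[of f A "-1"] by simp

lemma BN_series:
  assumes g: "\<And>n. BN (g n) (b n)" and b: "\<And>K. (\<Sum>n<K. b n) \<le> A" and f: "\<And>x. (\<lambda>n. g n x) sums f x"
  shows "BN f A"
proof -
  have "summable b" by (rule summableI_nonneg_bounded) (rule BN_nonneg[OF g] b)+
  hence s: "summable (\<lambda>n. 20 * b n)" by (rule summable_mult)
  note u = uniform_series_cper[OF BN_cper[OF g] BN_sup[OF g] s f]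
  have "nle (1/2) (rfc f) A"
  proof (rule nle_limit[OF _ u(2)])
    fix N show "nle (1/2) (\<lambda>k. \<Sum>n<N. rfc (g n) k) A"
      by (rule nle_mono[OF nle_sum b]) (use g in \<open>simp add: BN_def\<close>)
  qed
  thus ?thesis using u(1) by (simp add: BN_def)
qed

lemma BN_atom: "atom n \<alpha> f \<Longrightarrow> BN f (8 * \<alpha>)"
  by (simp add: BN_def atom_nle atom_C1)

text \<open>Amplitude \<open>M / 2 ^ n\<close> against slope \<open>M\<close> is exactly the profile
  of an atom of frequency \<open>n\<close> and size \<open>M / sqrt 2 ^ n\<close>. Smallness in sup
  norm with a merely bounded derivative thus gives smallness in the Besov norm.\<close>

lemma BN_small_C1:
  assumes "C1p f f'" "\<And>x. \<bar>f x\<bar> \<le> M / 2 ^ n" "\<And>x. \<bar>f' x\<bar> \<le> M"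
  shows "BN f (8 * (M / sqrt 2 ^ n))"
proof (rule BN_atom[of n], unfold atom_def, intro exI[of _ f'] conjI allI)
  have M: "0 \<le> M" using assms(3)[of 0] by linarith
  show "C1p f f'" by fact
  have "sqrt 2 ^ n * 1 \<le> sqrt 2 ^ n * (sqrt 2 ^ n::real)" by (intro mult_left_mono) auto
  hence "sqrt 2 ^ n \<le> (2::real) ^ n" using sqrt2_power_square[of n] by (simp only: power2_eq_square mult_1_right)
  hence "M / 2 ^ n \<le> M / sqrt 2 ^ n" using M by (intro divide_left_mono) auto
  thus "\<bar>f x\<bar> \<le> M / sqrt 2 ^ n" for x using assms(2)[of x] by linarith
  have "(M / sqrt 2 ^ n)\<^sup>2 / 2 ^ n = (M / 2 ^ n)\<^sup>2" "(M / sqrt 2 ^ n)\<^sup>2 * 2 ^ n = M\<^sup>2"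
    unfolding power_divide sqrt2_power_square by (simp_all add: power2_eq_square)
  thus "integral {0..1} (\<lambda>x. (f x)\<^sup>2) \<le> (M / sqrt 2 ^ n)\<^sup>2 / 2 ^ n" "integral {0..1} (\<lambda>x. (f' x)\<^sup>2) \<le> (M / sqrt 2 ^ n)\<^sup>2 * 2 ^ n"
    using integral_square_bound[OF C1pD(1)[OF assms(1)] assms(2)] integral_square_bound[OF C1pD(2)[OF assms(1)] assms(3)] by simp_all
qed

lemma BN_C1:
  assumes "C1p f f'" "\<And>x. \<bar>f x\<bar> \<le> M" "\<And>x. \<bar>f' x\<bar> \<le> M"
  shows "BN f (8 * M)"
  using BN_small_C1[of f f' M 0] assms by simp

lemma BN_const: "BN (\<lambda>x. c) (8 * \<bar>c\<bar>)"
  by (rule BN_C1[of _ "\<lambda>x. 0"]) (auto simp: C1p_def cper_const)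

text \<open>In the product rule the derivative falls on either factor, and on the one of lower
  frequency it costs only \<open>2 ^ m \<le> 2 ^ n\<close>. The factor 2 comes from squaring a sum
  of two terms.\<close>

lemma atom_mult:
  assumes f: "atom n \<alpha> f" and g: "atom m \<beta> g" and nm: "m \<le> n"
  shows "atom n (2 * (\<alpha> * \<beta>)) (\<lambda>x. f x * g x)"
proof -
  obtain f' where f: "C1p f f'" "\<And>x. \<bar>f x\<bar> \<le> \<alpha>" "integral {0..1} (\<lambda>x. (f x)\<^sup>2) \<le> \<alpha>\<^sup>2 / 2 ^ n"
     "integral {0..1} (\<lambda>x. (f' x)\<^sup>2) \<le> \<alpha>\<^sup>2 * 2 ^ n" using f unfolding atom_def by blast
  obtain g' where g: "C1p g g'" "\<And>x. \<bar>g x\<bar> \<le> \<beta>" "integral {0..1} (\<lambda>x. (g x)\<^sup>2) \<le> \<beta>\<^sup>2 / 2 ^ m"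
     "integral {0..1} (\<lambda>x. (g' x)\<^sup>2) \<le> \<beta>\<^sup>2 * 2 ^ m" using g unfolding atom_def by blast
  have p: "0 \<le> \<alpha>" "0 \<le> \<beta>" using f(2)[of 0] g(2)[of 0] by linarith+
  note c = C1pD(1)[OF f(1)] C1pD(2)[OF f(1)] C1pD(1)[OF g(1)] C1pD(2)[OF g(1)]
  have sq: "(f x)\<^sup>2 \<le> \<alpha>\<^sup>2" "(g x)\<^sup>2 \<le> \<beta>\<^sup>2" for x
    using f(2)[of x] g(2)[of x] p by (simp_all add: abs_le_square_iff[symmetric])
  have 1: "C1p (\<lambda>x. f x * g x) (\<lambda>x. f' x * g x + f x * g' x)" by (rule C1p_lincomb[OF f(1) g(1)])
  have 2: "\<bar>f x * g x\<bar> \<le> 2 * (\<alpha> * \<beta>)" for x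
  proof -
    have "\<bar>f x * g x\<bar> \<le> \<alpha> * \<beta>" unfolding abs_mult by (intro mult_mono f g p) auto
    moreover have "0 \<le> \<alpha> * \<beta>" using p by simp
    ultimately show ?thesis by linarith
  qed
  have "integral {0..1} (\<lambda>x. (f x * g x)\<^sup>2) \<le> integral {0..1} (\<lambda>x. \<beta>\<^sup>2 * (f x)\<^sup>2)"
    using sq(2) by (intro integral_le integral_square_cper cper_mult c integrable_on_mult_right)
       (auto simp: power_mult_distrib mult.commute[of "\<beta>\<^sup>2"] intro: mult_left_mono)
  also have "\<dots> \<le> \<beta>\<^sup>2 * (\<alpha>\<^sup>2 / 2 ^ n)" using mult_left_mono[OF f(3), of "\<beta>\<^sup>2"] by simp
  also have "\<dots> \<le> (2 * (\<alpha> * \<beta>))\<^sup>2 / 2 ^ n"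
    by (simp add: power_mult_distrib divide_le_cancel mult.commute)
  finally have 3: "integral {0..1} (\<lambda>x. (f x * g x)\<^sup>2) \<le> (2 * (\<alpha> * \<beta>))\<^sup>2 / 2 ^ n" .
  have "integral {0..1} (\<lambda>x. (f' x * g x + f x * g' x)\<^sup>2) \<le> integral {0..1} (\<lambda>x. 2 * \<beta>\<^sup>2 * (f' x)\<^sup>2 + 2 * \<alpha>\<^sup>2 * (g' x)\<^sup>2)"
  proof (intro integral_le integral_square_cper cper_mult cper_add c integrable_add integrable_on_mult_right)
    fix x
    have "(f' x * g x + f x * g' x)\<^sup>2 \<le> 2 * (f' x * g x)\<^sup>2 + 2 * (f x * g' x)\<^sup>2"
      using zero_le_power2[of "f' x * g x - f x * g' x"] by (simp add: power2_eq_square algebra_simps)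
    also have "\<dots> \<le> 2 * \<beta>\<^sup>2 * (f' x)\<^sup>2 + 2 * \<alpha>\<^sup>2 * (g' x)\<^sup>2"
      using mult_right_mono[OF sq(2)[of x], of "(f' x)\<^sup>2"] mult_right_mono[OF sq(1)[of x], of "(g' x)\<^sup>2"]
      by (simp add: power_mult_distrib mult_ac)
    finally show "(f' x * g x + f x * g' x)\<^sup>2 \<le> 2 * \<beta>\<^sup>2 * (f' x)\<^sup>2 + 2 * \<alpha>\<^sup>2 * (g' x)\<^sup>2" .
  qed
  also have "\<dots> = 2 * \<beta>\<^sup>2 * integral {0..1} (\<lambda>x. (f' x)\<^sup>2) + 2 * \<alpha>\<^sup>2 * integral {0..1} (\<lambda>x. (g' x)\<^sup>2)"
    by (subst integral_add) (simp_all add: integral_square_cper c integrable_on_mult_right)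
  also have "\<dots> \<le> 2 * \<beta>\<^sup>2 * (\<alpha>\<^sup>2 * 2 ^ n) + 2 * \<alpha>\<^sup>2 * (\<beta>\<^sup>2 * 2 ^ n)"
  proof (intro add_mono mult_left_mono f(4))
    have "\<beta>\<^sup>2 * 2 ^ m \<le> \<beta>\<^sup>2 * 2 ^ n" using nm by (intro mult_left_mono power_increasing) auto
    thus "integral {0..1} (\<lambda>x. (g' x)\<^sup>2) \<le> \<beta>\<^sup>2 * 2 ^ n" using g(4) by linarith
  qed auto
  also have "\<dots> = (2 * (\<alpha> * \<beta>))\<^sup>2 * 2 ^ n" by (simp add: power_mult_distrib)
  finally show ?thesis unfolding atom_def using 1 2 3 by blast
qed

text \<open>A product of atoms is an atom at the higher of the two frequencies, so the double series
  can be summed one factor at a time. The constant is \<open>8 * 2 * 20 * 20\<close>: norm of an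
  atom, product of atoms, two decompositions.\<close>

lemma BN_mult:
  assumes f: "BN f A" and g: "BN g B"
  shows "BN (\<lambda>x. f x * g x) (6400 * A * B)"
proof -
  obtain F \<alpha> where F: "\<And>n. atom n (\<alpha> n) (F n)" "\<And>n. 0 \<le> \<alpha> n" "\<And>K. (\<Sum>n<K. \<alpha> n) \<le> 20 * A"
    "\<And>x. (\<lambda>n. F n x) sums f x" by (rule BN_decompose[OF f]) (rule that)
  obtain G \<beta> where G: "\<And>n. atom n (\<beta> n) (G n)" "\<And>n. 0 \<le> \<beta> n" "\<And>K. (\<Sum>n<K. \<beta> n) \<le> 20 * B"
    "\<And>x. (\<lambda>n. G n x) sums g x" by (rule BN_decompose[OF g]) (rule that)
  have FG: "BN (\<lambda>x. F n x * G m x) (16 * \<beta> m * \<alpha> n)" for n m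
  proof (cases "m \<le> n")
    case True
    thus ?thesis using BN_atom[OF atom_mult[OF F(1) G(1)], of m n] by (simp add: mult_ac)
  next
    case False
    thus ?thesis using BN_atom[OF atom_mult[OF G(1) F(1)], of n m] by (simp add: mult_ac)
  qed
  have fG: "BN (\<lambda>x. f x * G m x) (320 * A * \<beta> m)" for m
  proof (rule BN_series[OF FG])
    show "(\<Sum>n<K. 16 * \<beta> m * \<alpha> n) \<le> 320 * A * \<beta> m" for K
      using mult_left_mono[OF F(3)[of K], of "16 * \<beta> m"] G(2)[of m]
      unfolding sum_distrib_left[symmetric] by (simp add: algebra_simps)
    show "(\<lambda>n. F n x * G m x) sums (f x * G m x)" for x by (rule sums_mult2[OF F(4)])
  qed
  show ?thesis
  proof (rule BN_series[OF fG])
    show "(\<Sum>m<K. 320 * A * \<beta> m) \<le> 6400 * A * B" for K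
      using mult_left_mono[OF G(3)[of K], of "320 * A"] BN_nonneg[OF f]
      unfolding sum_distrib_left[symmetric] by (simp add: algebra_simps)
    show "(\<lambda>m. f x * G m x) sums (f x * g x)" for x by (rule sums_mult[OF G(4)])
  qed
qed

text \<open>Since \<open>Y'\<close> lies between 1/2 and 2, trading it in or out costs a factor 2 in
  either integral, and the substitution then restores the integrals of \<open>f\<close>. Only first
  derivatives of \<open>Y\<close> enter.\<close>

lemma atom_compose:
  assumes f: "atom n \<alpha> f" and Y: "circle_diffeo Y Y'"
  shows "atom n (2 * \<alpha>) (\<lambda>x. f (Y x))"
proof -
  obtain f' where f: "C1p f f'" "\<And>x. \<bar>f x\<bar> \<le> \<alpha>" "integral {0..1} (\<lambda>x. (f x)\<^sup>2) \<le> \<alpha>\<^sup>2 / 2 ^ n"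
     "integral {0..1} (\<lambda>x. (f' x)\<^sup>2) \<le> \<alpha>\<^sup>2 * 2 ^ n" using f unfolding atom_def by blast
  note Yd = circle_diffeoD[OF Y]
  have sub: "integral {0..1} (\<lambda>x. Y' x * (h (Y x))\<^sup>2) = integral {0..1} (\<lambda>x. (h x)\<^sup>2)" if "cper h" for h :: "real \<Rightarrow> real"
    using substitution_period[OF Y cper_mult[OF that that]] by (simp add: power2_eq_square)
  have ci: "(\<lambda>x. 2 * (Y' x * (h (Y x))\<^sup>2)) integrable_on {0..1}" if "cper h" for h :: "real \<Rightarrow> real"
    unfolding power2_eq_square by (intro integrable_cper cper_mult cper_const Yd cper_compose[OF Y] that)
  have "integral {0..1} (\<lambda>x. (f (Y x))\<^sup>2) \<le> integral {0..1} (\<lambda>x. 2 * (Y' x * (f (Y x))\<^sup>2))"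
  proof (intro integral_le integral_square_cper cper_compose[OF Y] ci C1pD(1)[OF f(1)])
    fix x
    have "(1/2) * (f (Y x))\<^sup>2 \<le> Y' x * (f (Y x))\<^sup>2" by (intro mult_right_mono Yd) auto
    thus "(f (Y x))\<^sup>2 \<le> 2 * (Y' x * (f (Y x))\<^sup>2)" by simp
  qed
  also have "\<dots> = 2 * integral {0..1} (\<lambda>x. (f x)\<^sup>2)" by (simp add: sub C1pD(1)[OF f(1)])
  also have "\<dots> \<le> (2 * \<alpha>)\<^sup>2 / 2 ^ n" 
  proof -
    have "0 \<le> \<alpha>\<^sup>2 / 2 ^ n" by simp
    moreover have "(2 * \<alpha>)\<^sup>2 / 2 ^ n = 4 * (\<alpha>\<^sup>2 / 2 ^ n)" by (simp add: power_mult_distrib)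
    ultimately show ?thesis using f(3) by linarith
  qed
  finally have 1: "integral {0..1} (\<lambda>x. (f (Y x))\<^sup>2) \<le> (2 * \<alpha>)\<^sup>2 / 2 ^ n" .
  have "integral {0..1} (\<lambda>x. (f' (Y x) * Y' x)\<^sup>2) \<le> integral {0..1} (\<lambda>x. 2 * (Y' x * (f' (Y x))\<^sup>2))"
  proof (intro integral_le integral_square_cper cper_mult cper_compose[OF Y] ci C1pD(2)[OF f(1)] Yd)
    fix x
    have "Y' x * Y' x \<le> 2 * Y' x" using Yd(4)[of x] Yd(5)[of x] by (intro mult_right_mono) linarith+
    hence "Y' x * Y' x * (f' (Y x))\<^sup>2 \<le> 2 * Y' x * (f' (Y x))\<^sup>2" by (rule mult_right_mono) simp
    thus "(f' (Y x) * Y' x)\<^sup>2 \<le> 2 * (Y' x * (f' (Y x))\<^sup>2)" by (simp add: power2_eq_square mult_ac)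
  qed
  also have "\<dots> = 2 * integral {0..1} (\<lambda>x. (f' x)\<^sup>2)" by (simp add: sub C1pD(2)[OF f(1)])
  also have "\<dots> \<le> (2 * \<alpha>)\<^sup>2 * 2 ^ n" 
  proof -
    have "0 \<le> \<alpha>\<^sup>2 * 2 ^ n" by simp
    moreover have "(2 * \<alpha>)\<^sup>2 * 2 ^ n = 4 * (\<alpha>\<^sup>2 * 2 ^ n)" by (simp add: power_mult_distrib)
    ultimately show ?thesis using f(4) by linarith
  qed
  finally have 2: "integral {0..1} (\<lambda>x. (f' (Y x) * Y' x)\<^sup>2) \<le> (2 * \<alpha>)\<^sup>2 * 2 ^ n" .
  have "\<bar>f (Y x)\<bar> \<le> 2 * \<alpha>" for x using f(2)[of "Y x"] by linarith
  thus ?thesis unfolding atom_def using 1 2 C1p_compose[OF Y f(1)] by blast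
qed

text \<open>Summed over atoms, the constant is \<open>8 * 2 * 20\<close>.\<close>

lemma BN_compose:
  assumes f: "BN f A" and Y: "circle_diffeo Y Y'"
  shows "BN (\<lambda>x. f (Y x)) (320 * A)"
proof -
  obtain F \<alpha> where F: "\<And>n. atom n (\<alpha> n) (F n)" "\<And>n. 0 \<le> \<alpha> n" "\<And>K. (\<Sum>n<K. \<alpha> n) \<le> 20 * A"
    "\<And>x. (\<lambda>n. F n x) sums f x" by (rule BN_decompose[OF f]) (rule that)
  show ?thesis
  proof (rule BN_series[OF BN_atom[OF atom_compose[OF F(1) Y]] _ F(4)])
    show "(\<Sum>n<K. 8 * (2 * \<alpha> n)) \<le> 320 * A" for K
      using F(3)[of K] by (simp flip: sum_distrib_left)
  qed
qed

text \<open>The tail of the atomic series is small uniformly in the diffeomorphism, and the finitely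
  many remaining atoms are C^1, so \<open>BN_small_C1\<close> applies to them once \<open>Y\<close>
  and \<open>Z\<close> are close. There is no rate, because the number of atoms to be kept depends
  on \<open>f\<close>.\<close>

lemma BN_compose_continuous:
  assumes f: "BN f A" and e: "0 < e"
  obtains d where "0 < d"
    "\<And>Y Y' Z Z'. circle_diffeo Y Y' \<Longrightarrow> circle_diffeo Z Z' \<Longrightarrow> (\<And>x. \<bar>Y x - Z x\<bar> \<le> d) \<Longrightarrow> BN (\<lambda>x. f (Y x) - f (Z x)) e"
proof -
  obtain F \<alpha> where F: "\<And>n. atom n (\<alpha> n) (F n)" "\<And>n. 0 \<le> \<alpha> n" "\<And>K. (\<Sum>n<K. \<alpha> n) \<le> 20 * A"
    "\<And>x. (\<lambda>n. F n x) sums f x" by (rule BN_decompose[OF f]) (rule that)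
  have s: "summable \<alpha>" by (rule summableI_nonneg_bounded) (rule F(2) F(3))+
  \<comment> \<open>A tail atom enters twice, each time with norm at most
    \<open>16 * \<alpha> n\<close>, so a tail of \<open>e / 64\<close> contributes at most
    \<open>e / 2\<close>.\<close>
  obtain N where N0: "norm ((\<Sum>n<N. \<alpha> n) - suminf \<alpha>) < e / 64"
    using LIMSEQ_D[OF summable_LIMSEQ[OF s], of "e / 64"] e by auto
  have N: "(\<Sum>n<K. if n < N then 0 else \<alpha> n) \<le> e / 64" for K
  proof -
    have "(\<Sum>n<N. \<alpha> n) + (\<Sum>n<K. if n < N then 0 else \<alpha> n) \<le> (\<Sum>n<max N K. \<alpha> n)"
    proof -
      have "(\<Sum>n<K. if n < N then 0 else \<alpha> n) = (\<Sum>n\<in>{..<K} - {..<N}. \<alpha> n)"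
        by (simp add: sum.If_cases) (rule sum.cong, auto)
      moreover have "(\<Sum>n<N. \<alpha> n) + (\<Sum>n\<in>{..<K} - {..<N}. \<alpha> n) = (\<Sum>n\<in>{..<N} \<union> ({..<K} - {..<N}). \<alpha> n)"
        by (rule sum.union_disjoint[symmetric]) auto
      moreover have "\<dots> \<le> (\<Sum>n<max N K. \<alpha> n)" by (rule sum_mono2) (auto simp: F(2))
      ultimately show ?thesis by linarith
    qed
    moreover have "(\<Sum>n<max N K. \<alpha> n) \<le> suminf \<alpha>" by (rule sum_le_suminf[OF s]) (auto simp: F(2))
    ultimately show ?thesis using N0 unfolding real_norm_def by linarith
  qed
  have "\<exists>d>0. \<forall>Y Y' Z Z'. circle_diffeo Y Y' \<longrightarrow> circle_diffeo Z Z' \<longrightarrow> (\<forall>x. \<bar>Y x - Z x\<bar> \<le> d) \<longrightarrow>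
      BN (\<lambda>x. F n (Y x) - F n (Z x)) e'" if e': "0 < e'" for n e'
  proof -
    obtain f' where f': "C1p (F n) f'" using F(1)[of n] unfolding atom_def by blast
    obtain L where L: "0 \<le> L" "\<And>x. \<bar>f' x\<bar> \<le> L" using cper_bounded[OF C1pD(2)[OF f']] by auto
    \<comment> \<open>The two derivatives are at most \<open>2 * L\<close> each; the added 1 keeps
      \<open>M\<close> positive when \<open>L = 0\<close>.\<close>
    define M where "M = 4 * L + 1"
    have M: "0 < M" using L by (simp add: M_def)
    obtain p where "8 * M / e' < sqrt 2 ^ p" using real_arch_pow[of "sqrt 2" "8 * M / e'"] by auto
    hence p: "8 * (M / sqrt 2 ^ p) \<le> e'" using e' by (simp add: field_simps)
    have "BN (\<lambda>x. F n (Y x) - F n (Z x)) e'"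
      if YZ: "circle_diffeo Y Y'" "circle_diffeo Z Z'" "\<And>x. \<bar>Y x - Z x\<bar> \<le> 1 / 2 ^ p" for Y Y' Z Z'
    proof (rule BN_mono[OF BN_small_C1 p])
      show "C1p (\<lambda>x. F n (Y x) - F n (Z x)) (\<lambda>x. f' (Y x) * Y' x - f' (Z x) * Z' x)"
        by (intro C1p_lincomb C1p_compose YZ f')
      have "\<bar>F n (Y x) - F n (Z x)\<bar> \<le> L * \<bar>Y x - Z x\<bar>" for x
        by (rule derivative_lipschitz[OF C1p_real[OF f'] L(2)])
      also have "L * \<bar>Y x - Z x\<bar> \<le> M * (1 / 2 ^ p)" for x
        using L by (intro mult_mono YZ) (auto simp: M_def)
      finally show "\<bar>F n (Y x) - F n (Z x)\<bar> \<le> M / 2 ^ p" for x by simp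
      have b: "\<bar>f' (Y x) * Y' x\<bar> \<le> L * 2" if "circle_diffeo Y Y'" for x Y Y'
        unfolding abs_mult using circle_diffeoD(4,5)[OF that, of x] L by (intro mult_mono) auto
      show "\<bar>f' (Y x) * Y' x - f' (Z x) * Z' x\<bar> \<le> M" for x
        using b[OF YZ(1), of x] b[OF YZ(2), of x] unfolding M_def by linarith
    qed
    thus ?thesis by (intro exI[of _ "1 / 2 ^ p"]) auto
  qed
  hence "\<forall>n. \<exists>d>0. \<forall>Y Y' Z Z'. circle_diffeo Y Y' \<longrightarrow> circle_diffeo Z Z' \<longrightarrow> (\<forall>x. \<bar>Y x - Z x\<bar> \<le> d) \<longrightarrow>
      BN (\<lambda>x. F n (Y x) - F n (Z x)) (e / (2 * real (Suc N)))"
    using e by simp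
  from choice[OF this] obtain d where d: "\<forall>n. 0 < d n \<and> (\<forall>Y Y' Z Z'. circle_diffeo Y Y' \<longrightarrow> circle_diffeo Z Z' \<longrightarrow> (\<forall>x. \<bar>Y x - Z x\<bar> \<le> d n) \<longrightarrow>
      BN (\<lambda>x. F n (Y x) - F n (Z x)) (e / (2 * real (Suc N))))"
    by (rule exE)
  define D where "D = Min (d ` {..N})"
  have D: "0 < D" "\<And>n. n \<le> N \<Longrightarrow> D \<le> d n" using d by (auto simp: D_def)
  show ?thesis
  proof (rule that[OF D(1)])
    fix Y Y' Z Z' assume YZ: "circle_diffeo Y Y'" "circle_diffeo Z Z'" "\<And>x. \<bar>Y x - Z x\<bar> \<le> D"
    define b where "b n = (if n < N then e / (2 * real (Suc N)) else 32 * \<alpha> n)" for n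
    show "BN (\<lambda>x. f (Y x) - f (Z x)) e"
    proof (rule BN_series[where g="\<lambda>n x. F n (Y x) - F n (Z x)" and b=b])
      fix n show "BN (\<lambda>x. F n (Y x) - F n (Z x)) (b n)"
      proof (cases "n < N")
        case True
        have "\<forall>x. \<bar>Y x - Z x\<bar> \<le> d n" using YZ(3) D(2)[of n] True by (meson less_imp_le order_trans)
        hence "BN (\<lambda>x. F n (Y x) - F n (Z x)) (e / (2 * real (Suc N)))"
          using d[rule_format, of n] YZ(1,2) by blast
        thus ?thesis using True by (simp only: b_def if_True)
      next
        case False
        have "BN (\<lambda>x. F n (Y x) - F n (Z x)) (8 * (2 * \<alpha> n) + 8 * (2 * \<alpha> n))"
          by (rule BN_diff[OF BN_atom[OF atom_compose[OF F(1) YZ(1)]] BN_atom[OF atom_compose[OF F(1) YZ(2)]]])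
        thus ?thesis using False by (simp add: b_def)
      qed
    next
      fix K
      have "(\<Sum>n<K. b n) = (\<Sum>n<K. (if n < N then e / (2 * real (Suc N)) else 0) + 32 * (if n < N then 0 else \<alpha> n))"
        by (rule sum.cong) (auto simp: b_def)
      also have "\<dots> = (\<Sum>n\<in>{..<K} \<inter> {..<N}. e / (2 * real (Suc N))) + 32 * (\<Sum>n<K. if n < N then 0 else \<alpha> n)"
        unfolding sum.distrib sum_distrib_left[symmetric] sum.inter_restrict[OF finite_lessThan] lessThan_iff ..
      also have "(\<Sum>n\<in>{..<K} \<inter> {..<N}. e / (2 * real (Suc N))) \<le> (\<Sum>n<Suc N. e / (2 * real (Suc N)))"
        using e by (intro sum_mono2) auto
      also have "\<dots> = e / 2" by (simp add: field_simps)
      finally show "(\<Sum>n<K. b n) \<le> e" using N[of K] by linarith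
      show "(\<lambda>n. F n (Y x) - F n (Z x)) sums (f (Y x) - f (Z x))" for x
        by (intro sums_diff F(4))
    qed
  qed
qed

text \<open>The Neumann series: each multiplication by \<open>q\<close> costs a factor
  \<open>6400 * \<theta> \<le> 1/2\<close>, so the powers have norms at most
  \<open>8 * (1/2) ^ n\<close>, starting from the constant 1, with total 16.\<close>

lemma BN_inverse:
  assumes q: "BN q \<theta>" and small: "6400 * \<theta> \<le> 1/2"
  shows "BN (\<lambda>x. 1 / (1 + q x)) 16"
proof (rule BN_series[where g="\<lambda>n x. (- q x) ^ n" and b="\<lambda>n. 8 * (1/2) ^ n"])
  have \<theta>: "0 \<le> \<theta>" by (rule BN_nonneg[OF q])
  show "BN (\<lambda>x. (- q x) ^ n) (8 * (1/2) ^ n)" for n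
  proof (induction n)
    case 0 show ?case using BN_const[of 1] by simp
  next
    case (Suc n)
    have "6400 * \<theta> * (8 * (1/2) ^ n) \<le> 1/2 * (8 * (1/2) ^ n)"
      by (rule mult_right_mono[OF small]) simp
    thus ?case using BN_mono[OF BN_mult[OF BN_uminus[OF q] Suc]] by simp
  qed
  show "(\<Sum>n<K. 8 * (1 / 2) ^ n) \<le> (16::real)" for K
    using sum_gp_strict[of "1/2::real" K] by (simp flip: sum_distrib_left)
  show "(\<lambda>n. (- q x) ^ n) sums (1 / (1 + q x))" for x
  proof -
    have "\<bar>q x\<bar> < 1" using BN_sup[OF q, of x] small \<theta> by linarith
    thus ?thesis using geometric_sums[of "- q x"] by simp
  qed
qed

end


section \<open>Besov spaces of distributions\<close>

lemma fourier_coeff_cnj: "fourier_coeff T (- k) = cnj (fourier_coeff T k)"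
proof -
  have "trig 1 0 (- k) = trig 1 0 k" "trig 0 1 (- k) = (\<lambda>x. (-1) * trig 0 1 k x)"
    by (simp_all add: trig_def fun_eq_iff)
  thus ?thesis using pairing_scale[OF trig_test_fun[of 0 1 k], of T "-1"]
    by (simp add: fourier_coeff_trig complex_eq_iff)
qed

lemma shift_bij: "bij_betw (\<lambda>n. int n - 1) UNIV {-1..}"
proof (rule bij_betwI')
  fix y :: int assume "y \<in> {-1..}"
  thus "\<exists>n\<in>UNIV. y = int n - 1" by (intro bexI[of _ "nat (y + 1)"]) auto
qed auto

context lp_pair
begin

text \<open>The symbol vanishes off \<open>freqs n\<close>, so the block is a trigonometric
  polynomial and Parseval's identity turns its L2 norm into a finite sum.\<close>

lemma besov_term_blk: "besov_term chi phi s 2 T (int n - 1) = wt s n * blk n (fourier_coeff T)"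
proof -
  define d :: "int \<Rightarrow> complex" where "d k = of_real (sg n k) * fourier_coeff T k" for k
  have S: "lp_block chi phi (int n - 1) T x = (\<Sum>k\<in>freqs n. d k * ee k x)" for x
  proof -
    have "lp_block chi phi (int n - 1) T x = (\<Sum>\<^sub>\<infinity>k\<in>freqs n. d k * ee k x)"
      unfolding lp_block_def using sg_supp(1)
      by (intro infsum_cong_neutral) (auto simp: d_def sg_def ee_def)
    thus ?thesis by (simp add: freqs(1))
  qed
  define N where "N x = (norm (\<Sum>k\<in>freqs n. d k * ee k x))\<^sup>2" for x
  have c: "continuous_on {0..1} N"
    unfolding N_def[abs_def] by (intro continuous_intros)
  have "(LINT x:{0..1}|lborel. norm (lp_block chi phi (int n - 1) T x) powr 2) = (LINT x:{0..1}|lborel. N x)"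
    unfolding S N_def by (intro set_lebesgue_integral_cong) auto
  also have "\<dots> = integral {0..1} N"
    by (rule set_borel_integral_eq_integral(2)[OF borel_integrable_atLeastAtMost'[OF c]])
  also have "\<dots> = (\<Sum>k\<in>freqs n. (norm (d k))\<^sup>2)"
    unfolding N_def[abs_def] by (rule parseval_trig[OF freqs(1)])
  also have "\<dots> = (\<Sum>k\<in>freqs n. (sg n k * norm (fourier_coeff T k))\<^sup>2)"
    by (simp add: d_def norm_mult sg_bounds)
  finally have "Lp_norm 2 (lp_block chi phi (int n - 1) T) = blk n (fourier_coeff T)"
    by (simp add: Lp_norm_def blk_def L2_set_def powr_half_sqrt sum_nonneg)
  thus ?thesis by (simp add: besov_term_def wt_def)
qed

lemma besov_summable_iff:
  "T \<in> besov_space chi phi s 2 1 \<longleftrightarrow> summable (\<lambda>n. wt s n * blk n (fourier_coeff T))"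
proof -
  have nn: "0 \<le> wt s n * blk n (fourier_coeff T)" for n
    using wt_pos[of s n] blk_nonneg by simp
  have "T \<in> besov_space chi phi s 2 1 \<longleftrightarrow> (\<lambda>n. besov_term chi phi s 2 T (int n - 1) powr 1) summable_on UNIV"
    unfolding besov_space_def mem_Collect_eq
    using summable_on_reindex_bij_betw[OF shift_bij, of "\<lambda>q. besov_term chi phi s 2 T q powr 1"] by simp
  also have "\<dots> \<longleftrightarrow> (\<lambda>n. wt s n * blk n (fourier_coeff T)) summable_on UNIV"
    by (simp add: besov_term_blk nn)
  also have "\<dots> \<longleftrightarrow> summable (\<lambda>n. wt s n * blk n (fourier_coeff T))"
    by (rule summable_on_UNIV_nonneg_real_iff) (rule nn)
  finally show ?thesis .
qed

lemma besov_norm_suminf: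
  assumes "T \<in> besov_space chi phi s 2 1"
  shows "besov_norm chi phi s 2 1 T = (\<Sum>n. wt s n * blk n (fourier_coeff T))"
proof -
  have nn: "0 \<le> wt s n * blk n (fourier_coeff T)" for n
    using wt_pos[of s n] blk_nonneg by simp
  have "(\<Sum>\<^sub>\<infinity>q\<in>{-1..}. besov_term chi phi s 2 T q powr 1) = (\<Sum>\<^sub>\<infinity>n\<in>UNIV. besov_term chi phi s 2 T (int n - 1) powr 1)"
    by (rule infsum_reindex_bij_betw[OF shift_bij, symmetric])
  also have "\<dots> = (\<Sum>\<^sub>\<infinity>n\<in>UNIV. wt s n * blk n (fourier_coeff T))"
    by (simp add: besov_term_blk nn)
  also have "\<dots> = (\<Sum>n. wt s n * blk n (fourier_coeff T))"
    using assms nn unfolding besov_summable_iff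
    by (intro sums_unique has_sum_imp_sums has_sum_infsum) (simp add: summable_on_UNIV_nonneg_real_iff)
  finally show ?thesis
    using suminf_nonneg[of "\<lambda>n. wt s n * blk n (fourier_coeff T)"] assms nn
    by (simp add: besov_norm_def besov_summable_iff)
qed

lemma nle_imp_besov:
  assumes "nle s (fourier_coeff T) B"
  shows "T \<in> besov_space chi phi s 2 1" "besov_norm chi phi s 2 1 T \<le> B"
proof -
  have nn: "0 \<le> wt s n * blk n (fourier_coeff T)" for n
    using wt_pos[of s n] blk_nonneg by simp
  have b: "\<And>K. (\<Sum>n<K. wt s n * blk n (fourier_coeff T)) \<le> B" using assms by (simp add: nle_def)
  have s: "summable (\<lambda>n. wt s n * blk n (fourier_coeff T))"
    by (rule summableI_nonneg_bounded) (rule nn b)+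
  show sp: "T \<in> besov_space chi phi s 2 1" using s by (simp add: besov_summable_iff)
  show "besov_norm chi phi s 2 1 T \<le> B"
    unfolding besov_norm_suminf[OF sp] by (rule suminf_le_const[OF s b])
qed

lemma besov_imp_nle:
  assumes "T \<in> besov_space chi phi s 2 1"
  shows "nle s (fourier_coeff T) (besov_norm chi phi s 2 1 T)"
proof -
  have nn: "0 \<le> wt s n * blk n (fourier_coeff T)" for n
    using wt_pos[of s n] blk_nonneg by simp
  show ?thesis
    unfolding nle_def besov_norm_suminf[OF assms]
    using assms nn unfolding besov_summable_iff by (auto intro: sum_le_suminf)
qed

lemma besov_norm_nonneg: "0 \<le> besov_norm chi phi s 2 1 T"
  by (simp add: besov_norm_def)

lemma besov_continuousI:
  assumes "\<And>t. t \<in> I \<Longrightarrow> \<exists>B. nle s (fourier_coeff (m t)) B"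
    and "\<And>t e. t \<in> I \<Longrightarrow> 0 < e \<Longrightarrow> \<forall>\<^sub>F \<tau> in at t within I. nle s (\<lambda>k. fourier_coeff (m \<tau>) k - fourier_coeff (m t) k) e"
  shows "besov_continuous chi phi s 2 1 I m"
  unfolding besov_continuous_def
proof (intro ballI conjI)
  fix t assume t: "t \<in> I"
  show "m t \<in> besov_space chi phi s 2 1" using assms(1)[OF t] nle_imp_besov by blast
  show "((\<lambda>\<tau>. besov_norm chi phi s 2 1 (m \<tau> - m t)) \<longlongrightarrow> 0) (at t within I)"
  proof (rule tendstoI)
    fix e :: real assume "0 < e"
    hence "0 < e / 2" by simp
    from assms(2)[OF t this] show "\<forall>\<^sub>F \<tau> in at t within I. dist (besov_norm chi phi s 2 1 (m \<tau> - m t)) 0 < e"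
    proof eventually_elim
      case (elim \<tau>)
      hence "nle s (fourier_coeff (m \<tau> - m t)) (e / 2)" by (simp add: fourier_coeff_linear[abs_def])
      from nle_imp_besov(2)[OF this] show ?case using \<open>0 < e\<close> besov_norm_nonneg[of s] by simp
    qed
  qed
qed

text \<open>A divergent infinite sum has the value 0 by convention, so a small
  \<open>besov_norm\<close> carries information only on the space; the last assumption supplies
  membership.\<close>

lemma besov_tendsto_nle:
  assumes "((\<lambda>\<tau>. besov_norm chi phi s 2 1 (w \<tau>)) \<longlongrightarrow> 0) (at t within I)" "0 < e"
    "\<And>\<tau>. \<tau> \<in> I \<Longrightarrow> \<exists>B. nle s (fourier_coeff (w \<tau>)) B"
  shows "\<forall>\<^sub>F \<tau> in at t within I. nle s (fourier_coeff (w \<tau>)) e"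
proof -
  have "\<forall>\<^sub>F \<tau> in at t within I. dist (besov_norm chi phi s 2 1 (w \<tau>)) 0 < e"
    by (rule tendstoD[OF assms(1,2)])
  moreover have "\<forall>\<^sub>F \<tau> in at t within I. \<tau> \<in> I" by (simp add: eventually_at_filter)
  ultimately show ?thesis
  proof eventually_elim
    case (elim \<tau>)
    obtain B where "nle s (fourier_coeff (w \<tau>)) B" using assms(3) elim by blast
    from besov_imp_nle[OF nle_imp_besov(1)[OF this]] show ?case
      by (rule nle_mono) (use elim in auto)
  qed
qed

lemma besov_continuousD:
  assumes "besov_continuous chi phi s 2 1 I m" "t \<in> I"
  shows "nle s (fourier_coeff (m t)) (besov_norm chi phi s 2 1 (m t))"
    "0 < e \<Longrightarrow> \<forall>\<^sub>F \<tau> in at t within I. nle s (\<lambda>k. fourier_coeff (m \<tau>) k - fourier_coeff (m t) k) e"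
proof -
  have n: "nle s (fourier_coeff (m \<tau>)) (besov_norm chi phi s 2 1 (m \<tau>))" if "\<tau> \<in> I" for \<tau>
    using assms(1) that by (intro besov_imp_nle) (auto simp: besov_continuous_def)
  show "nle s (fourier_coeff (m t)) (besov_norm chi phi s 2 1 (m t))" by (rule n[OF assms(2)])
  assume e: "0 < e"
  have "\<forall>\<^sub>F \<tau> in at t within I. nle s (fourier_coeff (m \<tau> - m t)) e"
  proof (rule besov_tendsto_nle[OF _ e])
    show "((\<lambda>\<tau>. besov_norm chi phi s 2 1 (m \<tau> - m t)) \<longlongrightarrow> 0) (at t within I)"
      using assms by (auto simp: besov_continuous_def)
    show "\<exists>B. nle s (fourier_coeff (m \<tau> - m t)) B" if "\<tau> \<in> I" for \<tau>
      using nle_diff[OF n[OF that] n[OF assms(2)]] by (auto simp: fourier_coeff_linear[abs_def])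
  qed
  thus "\<forall>\<^sub>F \<tau> in at t within I. nle s (\<lambda>k. fourier_coeff (m \<tau>) k - fourier_coeff (m t) k) e"
    by (simp add: fourier_coeff_linear[abs_def])
qed

lemma besov_half_function:
  assumes "T \<in> besov_space chi phi (1/2) 2 1"
  obtains g where "BN g (besov_norm chi phi (1/2) 2 1 T)" "T = pdistr_of_fun g"
proof -
  let ?B = "besov_norm chi phi (1/2) 2 1 T"
  have n: "nle (1/2) (fourier_coeff T) ?B" by (rule besov_imp_nle[OF assms])
  obtain g where g: "cper g" "\<And>k. rfc g k = fourier_coeff T k"
    by (rule lp_function[OF n fourier_coeff_cnj]) (rule that)
  have "rfc g = fourier_coeff T" using g(2) by (simp add: fun_eq_iff)
  hence "BN g ?B" using g(1) n by (simp add: BN_def)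
  moreover have "T = pdistr_of_fun g"
    by (rule pdistr_eqI) (simp add: fourier_coeff_of_fun g)
  ultimately show ?thesis by (rule that)
qed

text \<open>
  The weighted norm is a supremum of real linear functionals; applying the scalar mean value theorem
  to the functional that norms the difference quotient gives the vector-valued inequality.
\<close>

lemma nle_mean_value:
  assumes ab: "a < b"
    and D: "\<And>\<sigma> k. \<sigma> \<in> {a..b} \<Longrightarrow> ((\<lambda>\<sigma>. c \<sigma> k) has_vector_derivative d \<sigma> k) (at \<sigma> within {a..b})"
    and le: "\<And>\<sigma>. \<sigma> \<in> {a..b} \<Longrightarrow> nle s (\<lambda>k. d \<sigma> k - e k) \<delta>"
  shows "nle s (\<lambda>k. (1 / (b - a)) *\<^sub>R (c b k - c a k) - e k) \<delta>"
  unfolding nle_def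
proof
  fix K
  define v where "v k = (1 / (b - a)) *\<^sub>R (c b k - c a k) - e k" for k
  \<comment> \<open>The norming functional pairs block \<open>n\<close> with the same block of
    \<open>v\<close>, divided by its norm. If that block vanishes, the quotient is 0 by convention
    and so is the term.\<close>
  define \<mu> where "\<mu> n = wt s n / blk n v" for n
  have \<mu>: "0 \<le> \<mu> n" for n using wt_pos[of s n] blk_nonneg[of n v] by (simp add: \<mu>_def)
  define \<phi> where "\<phi> w = (\<Sum>n<K. \<mu> n * (\<Sum>k\<in>freqs n. (sg n k)\<^sup>2 * Re (cnj (v k) * w k)))" for w
  have v: "\<phi> v = (\<Sum>n<K. wt s n * blk n v)"
  proof -
    have "(\<Sum>k\<in>freqs n. (sg n k)\<^sup>2 * Re (cnj (v k) * v k)) = (blk n v)\<^sup>2" for n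
      by (simp add: blk_def L2_set_def sum_nonneg power_mult_distrib cmod_power2) (simp add: power2_eq_square)
    hence "\<mu> n * (\<Sum>k\<in>freqs n. (sg n k)\<^sup>2 * Re (cnj (v k) * v k)) = wt s n * blk n v" for n
      by (simp add: \<mu>_def power2_eq_square)
    thus ?thesis by (simp add: \<phi>_def)
  qed
  have w: "\<phi> w \<le> (\<Sum>n<K. wt s n * blk n w)" for w
    unfolding \<phi>_def
  proof (rule sum_mono)
    fix n
    have "(\<Sum>k\<in>freqs n. (sg n k)\<^sup>2 * Re (cnj (v k) * w k)) \<le> (\<Sum>k\<in>freqs n. \<bar>sg n k * norm (v k)\<bar> * \<bar>sg n k * norm (w k)\<bar>)"
    proof (rule sum_mono)
      fix k
      have "Re (cnj (v k) * w k) \<le> norm (v k) * norm (w k)"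
        using complex_Re_le_cmod[of "cnj (v k) * w k"] by (simp add: norm_mult)
      hence "(sg n k)\<^sup>2 * Re (cnj (v k) * w k) \<le> (sg n k)\<^sup>2 * (norm (v k) * norm (w k))" by (rule mult_left_mono) simp
      thus "(sg n k)\<^sup>2 * Re (cnj (v k) * w k) \<le> \<bar>sg n k * norm (v k)\<bar> * \<bar>sg n k * norm (w k)\<bar>"
        by (simp add: power2_eq_square abs_mult sg_bounds mult_ac)
    qed
    also have "\<dots> \<le> blk n v * blk n w" unfolding blk_def by (rule L2_set_mult_ineq)
    finally have "\<mu> n * (\<Sum>k\<in>freqs n. (sg n k)\<^sup>2 * Re (cnj (v k) * w k)) \<le> \<mu> n * (blk n v * blk n w)"
      by (rule mult_left_mono) (rule \<mu>)
    also have "\<dots> \<le> wt s n * blk n w"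
      using wt_pos[of s n] blk_nonneg[of n w] by (cases "blk n v = 0") (simp_all add: \<mu>_def)
    finally show "\<mu> n * (\<Sum>k\<in>freqs n. (sg n k)\<^sup>2 * Re (cnj (v k) * w k)) \<le> wt s n * blk n w" .
  qed
  \<comment> \<open>The linear correction makes the derivative of \<open>\<psi>\<close> the
    functional of \<open>d \<sigma> k - e k\<close>, which the hypothesis bounds, while the
    increment over the interval is \<open>b - a\<close> times the functional of
    \<open>v\<close>.\<close>
  define \<psi> where "\<psi> \<sigma> = \<phi> (\<lambda>k. c \<sigma> k - \<sigma> *\<^sub>R e k)" for \<sigma>
  have "(\<psi> has_vector_derivative \<phi> (\<lambda>k. d \<sigma> k - e k)) (at \<sigma> within {a..b})" if "\<sigma> \<in> {a..b}" for \<sigma>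
  proof -
    have "((\<lambda>\<sigma>. \<sigma> *\<^sub>R e k) has_vector_derivative 1 *\<^sub>R e k) (at \<sigma> within {a..b})" for k
      by (simp add: has_vector_derivative_def bounded_linear_imp_has_derivative bounded_linear_scaleR_left)
    hence "((\<lambda>\<sigma>. cnj (v k) * (c \<sigma> k - \<sigma> *\<^sub>R e k)) has_vector_derivative cnj (v k) * (d \<sigma> k - e k)) (at \<sigma> within {a..b})" for k
      using D[OF that] by (intro has_vector_derivative_mult_right has_vector_derivative_diff) auto
    from bounded_linear.has_vector_derivative[OF bounded_linear_Re this]
    show ?thesis unfolding \<psi>_def \<phi>_def
      by (intro has_vector_derivative_sum has_vector_derivative_mult_right)
  qed
  hence "(\<psi> has_derivative (\<lambda>h. h *\<^sub>R \<phi> (\<lambda>k. d \<sigma> k - e k))) (at \<sigma> within {a..b})" if "a \<le> \<sigma>" "\<sigma> \<le> b" for \<sigma>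
    using that by (simp add: has_vector_derivative_def)
  from mvt_simple[OF ab this] obtain \<sigma> where \<sigma>: "\<sigma> \<in> {a<..<b}" "\<psi> b - \<psi> a = (b - a) *\<^sub>R \<phi> (\<lambda>k. d \<sigma> k - e k)"
    by blast
  have "\<psi> b - \<psi> a = (b - a) * \<phi> v"
  proof -
    have diff: "\<phi> x - \<phi> y = \<phi> (\<lambda>k. x k - y k)" for x y
      unfolding \<phi>_def by (simp only: right_diff_distrib minus_complex.sel sum_subtractf)
    have scale: "\<phi> (\<lambda>k. r *\<^sub>R x k) = r * \<phi> x" for r x
      unfolding \<phi>_def sum_distrib_left mult_scaleR_right scaleR_complex.sel
      by (intro sum.cong refl) (simp only: mult.left_commute)
    have "(c b k - b *\<^sub>R e k) - (c a k - a *\<^sub>R e k) = (b - a) *\<^sub>R v k" for k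
      using ab by (simp add: v_def scaleR_diff_right scaleR_left_diff_distrib)
    thus ?thesis unfolding \<psi>_def diff by (simp only: scale)
  qed
  hence "\<phi> v = \<phi> (\<lambda>k. d \<sigma> k - e k)" using \<sigma>(2) ab by simp
  also have "\<dots> \<le> \<delta>"
    using order_trans[OF w] le[of \<sigma>] \<sigma>(1) unfolding nle_def by auto
  finally have "(\<Sum>n<K. wt s n * blk n v) \<le> \<delta>" by (simp only: v)
  thus "(\<Sum>n<K. wt s n * blk n (\<lambda>k. (1 / (b - a)) *\<^sub>R (c b k - c a k) - e k)) \<le> \<delta>"
    unfolding v_def[abs_def] .
qed

end

section \<open>The Green kernel along a flow\<close>

text \<open>
  On \<open>[0,1]\<close>, \<open>kap\<close> is the periodic Green function of \<open>1 - \<partial>\<^sub>x\<^sup>2\<close>. If the density \<open>h\<close> is carried by the flow \<open>H\<close>,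
  then \<open>KP H h\<close> and \<open>KQ H h\<close> are \<open>u\<close> and \<open>u\<^sub>x\<close> in Lagrangian coordinates. The argument \<open>H y - H z\<close> stays in
  \<open>[0,1]\<close>, so that the jump of the derivative of the Green function never enters.
\<close>

definition kap :: "real \<Rightarrow> real" where "kap s = cosh (s - 1/2) / (2 * sinh (1/2))"
definition kap' :: "real \<Rightarrow> real" where "kap' s = sinh (s - 1/2) / (2 * sinh (1/2))"

definition KP :: "(real \<Rightarrow> real) \<Rightarrow> (real \<Rightarrow> real) \<Rightarrow> real \<Rightarrow> real" where
  "KP H h y = integral {y - 1..y} (\<lambda>z. kap (H y - H z) * h z)"
definition KQ :: "(real \<Rightarrow> real) \<Rightarrow> (real \<Rightarrow> real) \<Rightarrow> real \<Rightarrow> real" where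
  "KQ H h y = integral {y - 1..y} (\<lambda>z. kap' (H y - H z) * h z)"

lemma sinh_half_pos: "0 < sinh (1/2::real)" by simp

lemma kap_deriv:
  "(kap has_real_derivative kap' s) (at s)" "(kap' has_real_derivative kap s) (at s)"
  unfolding kap_def[abs_def] kap'_def[abs_def] by (auto intro!: derivative_eq_intros)

lemma kap_cont [continuous_intros]:
  fixes f :: "'a::topological_space \<Rightarrow> real"
  shows "continuous_on S f \<Longrightarrow> continuous_on S (\<lambda>x. kap (f x))"
  "continuous_on S f \<Longrightarrow> continuous_on S (\<lambda>x. kap' (f x))"
  unfolding kap_def kap'_def by (intro continuous_intros; simp)+

lemma kap_bounds:
  assumes "0 \<le> s" "s \<le> 1"
  shows "\<bar>kap s\<bar> \<le> 2" "\<bar>kap' s\<bar> \<le> 2"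
proof -
  have "cosh (1/2::real) \<le> 4 * sinh (1/2)"
  proof -
    \<comment> \<open>In terms of \<open>x = exp (1/2)\<close> the claim reads
      \<open>5 \<le> 3 * (x * x)\<close>, and \<open>x * x = exp 1 \<ge> 2\<close>.\<close>
    define x where "x = exp (1/2::real)"
    have x: "0 < x" "x * x = exp 1" by (simp_all add: x_def flip: exp_add)
    have "2 \<le> exp (1::real)" using exp_ge_add_one_self[of "1::real"] by simp
    hence "5 \<le> 3 * (x * x)" using x by simp
    hence "5 / x \<le> 3 * x" using x by (simp add: field_simps)
    thus ?thesis by (simp add: cosh_def sinh_def exp_minus x_def field_simps)
  qed
  moreover have "cosh (s - 1/2) \<le> cosh (1/2)"
  proof -
    have "\<bar>s - 1/2\<bar> \<le> 1/2" using assms by linarith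
    thus ?thesis using cosh_real_nonneg_le_iff[of "\<bar>s - 1/2\<bar>" "1/2"] by simp
  qed
  ultimately have "cosh (s - 1/2) \<le> 4 * sinh (1/2)" by linarith
  thus 1: "\<bar>kap s\<bar> \<le> 2" using sinh_half_pos by (simp add: kap_def divide_le_eq)
  have "\<bar>sinh (s - 1/2)\<bar> \<le> cosh (s - 1/2)"
    by (simp add: sinh_def cosh_def abs_le_iff field_simps)
  hence "\<bar>kap' s\<bar> \<le> kap s" using sinh_half_pos by (simp add: kap_def kap'_def abs_divide divide_right_mono)
  thus "\<bar>kap' s\<bar> \<le> 2" using 1 by linarith
qed

lemma kap_lipschitz:
  assumes "s \<in> {0..1}" "r \<in> {0..1}"
  shows "\<bar>kap s - kap r\<bar> \<le> 2 * \<bar>s - r\<bar>" "\<bar>kap' s - kap' r\<bar> \<le> 2 * \<bar>s - r\<bar>"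
proof -
  show "\<bar>kap s - kap r\<bar> \<le> 2 * \<bar>s - r\<bar>"
    using field_differentiable_bound[of "{0..1}" kap kap' 2 s r] assms kap_bounds
    by (auto intro: has_field_derivative_at_within kap_deriv)
  show "\<bar>kap' s - kap' r\<bar> \<le> 2 * \<bar>s - r\<bar>"
    using field_differentiable_bound[of "{0..1}" kap' kap 2 s r] assms kap_bounds
    by (auto intro: has_field_derivative_at_within kap_deriv)
qed

lemma circle_diffeo_range:
  assumes "circle_diffeo H J" "z \<in> {y - 1..y}"
  shows "H y - H z \<in> {0..1}"
proof -
  have "H z \<le> H y" "H (y - 1) \<le> H z" using assms(2) circle_diffeoD(7)[OF assms(1)] by (auto simp: mono_def)
  moreover have "H (y - 1) = H y - 1" using circle_diffeoD(3)[OF assms(1), of "y - 1"] by simp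
  ultimately show ?thesis by simp
qed

lemma K_integrable:
  assumes "circle_diffeo H J" "cper h"
  shows "(\<lambda>z. kap (a - H z) * h z) integrable_on {c..d}" "(\<lambda>z. kap' (a - H z) * h z) integrable_on {c..d}"
  by (intro integrable_continuous_real continuous_intros circle_diffeoD(6)[OF assms(1)] cperD(1)[OF assms(2)])+

lemma K_bound:
  assumes H: "circle_diffeo H J" and h: "cper h" "\<And>x. \<bar>h x\<bar> \<le> M"
  shows "\<bar>KP H h y\<bar> \<le> 2 * M" "\<bar>KQ H h y\<bar> \<le> 2 * M"
proof -
  have b: "\<bar>kap (H y - H z) * h z\<bar> \<le> 2 * M" "\<bar>kap' (H y - H z) * h z\<bar> \<le> 2 * M" if "z \<in> {y - 1..y}" for z
    using circle_diffeo_range[OF H that] kap_bounds[of "H y - H z"] h(2)[of z]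
    by (auto simp: abs_mult intro!: mult_mono)
  have "norm (integral {y-1..y} (\<lambda>z. kap (H y - H z) * h z)) \<le> 2 * M * (y - (y - 1))"
    by (rule integral_bound) (use b in \<open>auto intro!: continuous_intros circle_diffeoD(6)[OF H] cperD(1)[OF h(1)]\<close>)
  thus "\<bar>KP H h y\<bar> \<le> 2 * M" by (simp add: KP_def)
  have "norm (integral {y-1..y} (\<lambda>z. kap' (H y - H z) * h z)) \<le> 2 * M * (y - (y - 1))"
    by (rule integral_bound) (use b in \<open>auto intro!: continuous_intros circle_diffeoD(6)[OF H] cperD(1)[OF h(1)]\<close>)
  thus "\<bar>KQ H h y\<bar> \<le> 2 * M" by (simp add: KQ_def)
qed

lemma K_diff:
  assumes H: "circle_diffeo H J" "circle_diffeo H2 J2" and h: "cper h" "\<And>x. \<bar>h x\<bar> \<le> M"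
    and d: "\<And>z. z \<in> {y - 1..y} \<Longrightarrow> \<bar>(H y - H z) - (H2 y - H2 z)\<bar> \<le> \<delta>"
  shows "\<bar>KP H h y - KP H2 h y\<bar> \<le> 2 * \<delta> * M" "\<bar>KQ H h y - KQ H2 h y\<bar> \<le> 2 * \<delta> * M"
proof -
  have b: "\<bar>(kap (H y - H z) - kap (H2 y - H2 z)) * h z\<bar> \<le> 2 * \<delta> * M"
     "\<bar>(kap' (H y - H z) - kap' (H2 y - H2 z)) * h z\<bar> \<le> 2 * \<delta> * M" if z: "z \<in> {y - 1..y}" for z
  proof -
    have dd: "2 * \<bar>(H y - H z) - (H2 y - H2 z)\<bar> \<le> 2 * \<delta>" using d[OF z] by simp
    note kl = kap_lipschitz[OF circle_diffeo_range[OF H(1) z] circle_diffeo_range[OF H(2) z]]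
    have "\<bar>kap (H y - H z) - kap (H2 y - H2 z)\<bar> \<le> 2 * \<delta>" "\<bar>kap' (H y - H z) - kap' (H2 y - H2 z)\<bar> \<le> 2 * \<delta>"
      by (rule order_trans[OF kl(1) dd] order_trans[OF kl(2) dd])+
    moreover have "0 \<le> \<delta>" using d[OF z] by linarith
    ultimately show "\<bar>(kap (H y - H z) - kap (H2 y - H2 z)) * h z\<bar> \<le> 2 * \<delta> * M"
     "\<bar>(kap' (H y - H z) - kap' (H2 y - H2 z)) * h z\<bar> \<le> 2 * \<delta> * M"
      unfolding abs_mult using h(2)[of z] by (auto intro!: mult_mono)
  qed
  have "norm (integral {y-1..y} (\<lambda>z. (kap (H y - H z) - kap (H2 y - H2 z)) * h z)) \<le> 2 * \<delta> * M * (y - (y - 1))"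
    by (rule integral_bound) (use b in \<open>auto intro!: continuous_intros circle_diffeoD(6)[OF H(1)] circle_diffeoD(6)[OF H(2)] cperD(1)[OF h(1)]\<close>)
  thus "\<bar>KP H h y - KP H2 h y\<bar> \<le> 2 * \<delta> * M"
    unfolding KP_def left_diff_distrib using K_integrable(1)[OF H(1) h(1)] K_integrable(1)[OF H(2) h(1)]
    by (simp add: integral_diff)
  have "norm (integral {y-1..y} (\<lambda>z. (kap' (H y - H z) - kap' (H2 y - H2 z)) * h z)) \<le> 2 * \<delta> * M * (y - (y - 1))"
    by (rule integral_bound) (use b in \<open>auto intro!: continuous_intros circle_diffeoD(6)[OF H(1)] circle_diffeoD(6)[OF H(2)] cperD(1)[OF h(1)]\<close>)
  thus "\<bar>KQ H h y - KQ H2 h y\<bar> \<le> 2 * \<delta> * M"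
    unfolding KQ_def left_diff_distrib using K_integrable(2)[OF H(1) h(1)] K_integrable(2)[OF H(2) h(1)]
    by (simp add: integral_diff)
qed

lemma K_periodic:
  assumes H: "circle_diffeo H J" and h: "cper h"
  shows "KP H h (y + 1) = KP H h y" "KQ H h (y + 1) = KQ H h y"
proof -
  have *: "integral {y..y + 1} f = integral {y - 1..y} (\<lambda>z. f (z + 1))" for f :: "real \<Rightarrow> real"
    using integral_shift_real_ivl[of y 1 "y + 1" f] by simp
  show "KP H h (y + 1) = KP H h y" "KQ H h (y + 1) = KQ H h y"
    by (simp_all add: KP_def KQ_def * circle_diffeoD(3)[OF H] cperD(2)[OF h])
qed

lemma sliding_integral_deriv:
  fixes f :: "real \<Rightarrow> real"
  assumes "continuous_on UNIV f"
  shows "((\<lambda>y. integral {y - 1..y} f) has_real_derivative f y - f (y - 1)) (at y)"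
proof -
  obtain G where G: "\<And>x. (G has_vector_derivative f x) (at x)" "\<And>a b. a \<le> b \<Longrightarrow> integral {a..b} f = G b - G a"
    using antiderivative_UNIV[OF assms] by blast
  have G1: "(G has_real_derivative f x) (at x)" for x using G(1) by (simp add: has_real_derivative_iff_has_vector_derivative)
  have "((\<lambda>y. G y - G (y - 1)) has_real_derivative f y - f (y - 1) * 1) (at y)"
    by (intro DERIV_diff G1 DERIV_chain2[OF G1]) (auto intro!: derivative_eq_intros)
  thus ?thesis using G(2) by simp
qed

text \<open>The addition theorems separate \<open>y\<close> from \<open>z\<close>, so the kernel
  integrals become combinations of two sliding integrals. The endpoint contributions carry
  \<open>kap 0 - kap 1 = 0\<close> in the first case and \<open>kap' 0 - kap' 1 = -1\<close> in the
  second, whence the term \<open>- h y\<close>: this is u_xx = u - m in Lagrangian form.\<close>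

lemma K_deriv:
  assumes H: "circle_diffeo H J" and h: "cper h"
  shows "(KP H h has_real_derivative J y * KQ H h y) (at y)"
    "(KQ H h has_real_derivative J y * KP H h y - h y) (at y)"
proof -
  define c where "c = 1 / (2 * sinh (1/2::real))"
  have c: "c * sinh (1/2) = 1/2" using sinh_half_pos by (simp add: c_def)
  define Ch where "Ch y = integral {y - 1..y} (\<lambda>z. cosh (H z) * h z)" for y
  define Sh where "Sh y = integral {y - 1..y} (\<lambda>z. sinh (H z) * h z)" for y
  note Hc = circle_diffeoD(6)[OF H] and hc = cperD(1)[OF h]
  have i: "(\<lambda>z. a * (cosh (H z) * h z)) integrable_on {x..y}" "(\<lambda>z. a * (sinh (H z) * h z)) integrable_on {x..y}" for a x y
    by (intro integrable_continuous_real continuous_intros Hc hc)+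
  have P: "KP H h y = c * (cosh (H y - 1/2) * Ch y - sinh (H y - 1/2) * Sh y)" for y
  proof -
    have "kap (H y - H z) * h z = (c * cosh (H y - 1/2)) * (cosh (H z) * h z) - (c * sinh (H y - 1/2)) * (sinh (H z) * h z)" for z
    proof -
      have "H y - H z - 1/2 = (H y - 1/2) - H z" by simp
      thus ?thesis by (simp only: kap_def c_def cosh_diff) (simp add: field_simps)
    qed
    thus ?thesis unfolding KP_def by (simp only: integral_diff[OF i] integral_mult_right Ch_def[symmetric] Sh_def[symmetric]) (simp add: algebra_simps)
  qed
  have Q: "KQ H h y = c * (sinh (H y - 1/2) * Ch y - cosh (H y - 1/2) * Sh y)" for y
  proof -
    have "kap' (H y - H z) * h z = (c * sinh (H y - 1/2)) * (cosh (H z) * h z) - (c * cosh (H y - 1/2)) * (sinh (H z) * h z)" for z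
    proof -
      have "H y - H z - 1/2 = (H y - 1/2) - H z" by simp
      thus ?thesis by (simp only: kap'_def c_def sinh_diff) (simp add: field_simps)
    qed
    thus ?thesis unfolding KQ_def by (simp only: integral_diff[OF i] integral_mult_right Ch_def[symmetric] Sh_def[symmetric]) (simp add: algebra_simps)
  qed
  have H1: "H (y - 1) = H y - 1" for y using circle_diffeoD(3)[OF H, of "y - 1"] by simp
  have dC: "(Ch has_real_derivative (cosh (H y) - cosh (H y - 1)) * h y) (at y)"
    unfolding Ch_def[abs_def] using sliding_integral_deriv[of "\<lambda>z. cosh (H z) * h z" y]
    by (simp add: H1 cper_minus1[OF h] algebra_simps continuous_intros Hc hc)
  have dS: "(Sh has_real_derivative (sinh (H y) - sinh (H y - 1)) * h y) (at y)"
    unfolding Sh_def[abs_def] using sliding_integral_deriv[of "\<lambda>z. sinh (H z) * h z" y]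
    by (simp add: H1 cper_minus1[OF h] algebra_simps continuous_intros Hc hc)
  define t where "t = H y - 1/2"
  have add: "cosh t * (cosh p - cosh q) - sinh t * (sinh p - sinh q) = cosh (t - p) - cosh (t - q)"
    "sinh t * (cosh p - cosh q) - cosh t * (sinh p - sinh q) = sinh (t - p) - sinh (t - q)" for p q
    unfolding cosh_diff[of t] sinh_diff[of t] by (simp_all add: algebra_simps)
  have "t - H y = - (1/2)" "t - (H y - 1) = 1/2" by (simp_all add: t_def)
  hence e1: "cosh t * (cosh (H y) - cosh (H y - 1)) - sinh t * (sinh (H y) - sinh (H y - 1)) = 0"
    and "sinh t * (cosh (H y) - cosh (H y - 1)) - cosh t * (sinh (H y) - sinh (H y - 1)) = - (2 * sinh (1/2))"
    unfolding add by (simp_all only: cosh_minus sinh_minus)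
  hence e2: "c * (sinh t * (cosh (H y) - cosh (H y - 1)) - cosh t * (sinh (H y) - sinh (H y - 1))) = -1"
    using c by simp
  have "((\<lambda>y. c * (cosh (H y - 1/2) * Ch y - sinh (H y - 1/2) * Sh y)) has_real_derivative
     c * ((sinh t * J y) * Ch y + cosh t * ((cosh (H y) - cosh (H y - 1)) * h y) - ((cosh t * J y) * Sh y + sinh t * ((sinh (H y) - sinh (H y - 1)) * h y)))) (at y)"
    unfolding t_def by (auto intro!: derivative_eq_intros dC dS circle_diffeoD(1)[OF H])
  moreover have "c * ((sinh t * J y) * Ch y + cosh t * ((cosh (H y) - cosh (H y - 1)) * h y) - ((cosh t * J y) * Sh y + sinh t * ((sinh (H y) - sinh (H y - 1)) * h y)))
     = J y * KQ H h y + c * h y * (cosh t * (cosh (H y) - cosh (H y - 1)) - sinh t * (sinh (H y) - sinh (H y - 1)))"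
    unfolding Q t_def[symmetric] by (simp add: algebra_simps)
  ultimately show "(KP H h has_real_derivative J y * KQ H h y) (at y)"
    unfolding P[abs_def] by (simp only: e1) simp
  have "((\<lambda>y. c * (sinh (H y - 1/2) * Ch y - cosh (H y - 1/2) * Sh y)) has_real_derivative
     c * ((cosh t * J y) * Ch y + sinh t * ((cosh (H y) - cosh (H y - 1)) * h y) - ((sinh t * J y) * Sh y + cosh t * ((sinh (H y) - sinh (H y - 1)) * h y)))) (at y)"
    unfolding t_def by (auto intro!: derivative_eq_intros dC dS circle_diffeoD(1)[OF H])
  moreover have "c * ((cosh t * J y) * Ch y + sinh t * ((cosh (H y) - cosh (H y - 1)) * h y) - ((sinh t * J y) * Sh y + cosh t * ((sinh (H y) - sinh (H y - 1)) * h y)))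
     = J y * KP H h y + h y * (c * (sinh t * (cosh (H y) - cosh (H y - 1)) - cosh t * (sinh (H y) - sinh (H y - 1))))"
    unfolding P t_def[symmetric] by (simp add: algebra_simps)
  ultimately show "(KQ H h has_real_derivative J y * KP H h y - h y) (at y)"
    unfolding Q[abs_def] by (simp only: e2) simp
qed

lemma K_C1p:
  assumes H: "circle_diffeo H J" and h: "cper h"
  shows "C1p (KP H h) (\<lambda>y. J y * KQ H h y)" "C1p (KQ H h) (\<lambda>y. J y * KP H h y - h y)"
proof -
  have c: "cper (KP H h)" "cper (KQ H h)"
    using DERIV_isCont[OF K_deriv(1)[OF H h]] DERIV_isCont[OF K_deriv(2)[OF H h]] K_periodic[OF H h]
    by (auto simp: cper_def intro!: continuous_at_imp_continuous_on)
  show "C1p (KP H h) (\<lambda>y. J y * KQ H h y)" "C1p (KQ H h) (\<lambda>y. J y * KP H h y - h y)"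
    using c K_deriv[OF H h] circle_diffeoD(2)[OF H] h
    by (simp_all add: C1p_def cper_mult cper_diff has_real_derivative_iff_has_vector_derivative)
qed

lemma circle_diffeo_id: "circle_diffeo (\<lambda>x. x) (\<lambda>_. 1)"
  by (simp add: circle_diffeo_def)

text \<open>The density \<open>h\<close> is the mass of \<open>m\<close> per unit of label, so a
  change of variables by \<open>H\<close> identifies the Lagrangian integrals with those of the
  identity flow, which give the Helmholtz inverse of \<open>m\<close> and its derivative.\<close>

lemma K_substitution:
  assumes H: "circle_diffeo H J" and m: "cper m" and mh: "\<And>z. J z * m (H z) = h z"
  shows "KP (\<lambda>x. x) m (H y) = KP H h y" "KQ (\<lambda>x. x) m (H y) = KQ H h y"
proof -
  have H1: "H (y - 1) = H y - 1" using circle_diffeoD(3)[OF H, of "y - 1"] by simp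
  have eq: "J z *\<^sub>R (g (H y - H z) * m (H z)) = g (H y - H z) * h z" for g :: "real \<Rightarrow> real" and z
    using mh[of z] by (simp add: mult_ac)
  have "continuous_on UNIV (\<lambda>x. kap (H y - x) * m x)" "continuous_on UNIV (\<lambda>x. kap' (H y - x) * m x)"
    by (intro continuous_intros cperD(1)[OF m])+
  from substitution_mono[OF H this(1), of "y - 1" y] substitution_mono[OF H this(2), of "y - 1" y]
  show "KP (\<lambda>x. x) m (H y) = KP H h y" "KQ (\<lambda>x. x) m (H y) = KQ H h y"
    unfolding eq H1 KP_def KQ_def by simp_all
qed


section \<open>The Lagrangian flow\<close>

text \<open>A slope of at least 1/2 makes \<open>H\<close> injective with a 2-Lipschitz inverse, and
  advancing by 1 over each period makes it unbounded in both directions, hence onto.\<close>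

lemma circle_diffeo_inverse:
  assumes H: "circle_diffeo H J"
  obtains Y where "circle_diffeo Y (\<lambda>x. 1 / J (Y x))" "\<And>x. H (Y x) = x" "\<And>y. Y (H y) = y"
proof -
  note Hd = circle_diffeoD[OF H]
  have lower: "b - a \<le> 2 * (H b - H a)" if ab: "a \<le> b" for a b
  proof (cases "a = b")
    case False
    hence "a < b" using ab by simp
    then obtain z where "H b - H a = (b - a) * J z"
      using MVT2[of a b H J] Hd(1) by blast
    moreover have "(b - a) * (1/2) \<le> (b - a) * J z" using ab Hd(4) by (intro mult_left_mono) auto
    ultimately show ?thesis by simp
  qed simp
  have inj: "a = b" if "H a = H b" for a b
  proof (cases "a \<le> b")
    case True
    have "b \<le> a" using lower[OF True] that by simp
    thus ?thesis using True by simp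
  next
    case False
    hence "b \<le> a" by simp
    from lower[OF this] have "a \<le> b" using that by simp
    thus ?thesis using False by simp
  qed
  have int: "H (of_int n) = H 0 + of_int n" for n
  proof (induction n rule: int_induct[where k=0])
    case (step1 i) thus ?case using Hd(3)[of "of_int i"] by simp
  next
    case (step2 i) thus ?case using Hd(3)[of "of_int i - 1"] by simp
  qed simp
  have "\<exists>y. H y = x" for x
  proof -
    define n where "n = \<lceil>\<bar>x - H 0\<bar>\<rceil>"
    have "\<bar>x - H 0\<bar> \<le> of_int n" by (simp add: n_def)
    hence "H (of_int (- n)) \<le> x" "x \<le> H (of_int n)" "of_int (- n) \<le> (of_int n :: real)"
      unfolding int by (auto simp: abs_le_iff)
    from IVT'[of H, OF this Hd(6)] show ?thesis by blast
  qed
  then obtain Y where HY: "\<And>x. H (Y x) = x" by metis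
  have YH: "Y (H y) = y" for y by (rule inj) (rule HY)
  have lip: "\<bar>Y x - Y x'\<bar> \<le> 2 * \<bar>x - x'\<bar>" for x x'
  proof (cases "Y x \<le> Y x'")
    case True show ?thesis using lower[OF True] True unfolding HY by simp
  next
    case False
    hence "Y x' \<le> Y x" by simp
    from lower[OF this] show ?thesis using False unfolding HY by simp
  qed
  have cont: "continuous_on UNIV Y"
    unfolding continuous_on_iff
  proof (intro ballI allI impI)
    fix x e :: real assume "0 < e"
    thus "\<exists>d>0. \<forall>x'\<in>UNIV. dist x' x < d \<longrightarrow> dist (Y x') (Y x) < e"
      by (intro exI[of _ "e / 2"]) (auto simp: dist_real_def intro: le_less_trans[OF lip])
  qed
  have der: "(Y has_real_derivative inverse (J (Y x))) (at x)" for x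
  proof (rule DERIV_inverse_function[where f=H and a="x - 1" and b="x + 1"])
    show "J (Y x) \<noteq> 0" using Hd(4)[of "Y x"] by linarith
    show "isCont Y x" using cont by (simp add: continuous_on_eq_continuous_at)
  qed (auto simp: HY intro: Hd(1))
  have Y1: "Y (x + 1) = Y x + 1" for x
    by (rule inj) (simp add: HY Hd(3))
  have "continuous_on UNIV (\<lambda>x. 1 / J (Y x))"
  proof (rule continuous_on_divide[OF continuous_on_const])
    show "continuous_on UNIV (\<lambda>x. J (Y x))"
      by (rule continuous_on_compose2[OF cperD(1)[OF Hd(2), of UNIV] cont]) auto
    show "\<forall>x\<in>UNIV. J (Y x) \<noteq> 0" using Hd(4) by (metis less_le_not_le order_less_le_trans zero_less_divide_1_iff zero_less_numeral)
  qed
  moreover have "1/2 \<le> 1 / J (Y x)" "1 / J (Y x) \<le> 2" for x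
    using Hd(4)[of "Y x"] Hd(5)[of "Y x"] by (simp_all add: divide_simps)
  ultimately have "circle_diffeo Y (\<lambda>x. 1 / J (Y x))"
    using der Y1 cperD(2)[OF Hd(2)] by (simp add: circle_diffeo_def inverse_eq_divide)
  thus ?thesis by (rule that[OF _ HY YH])
qed

definition prim :: "(real \<Rightarrow> real) \<Rightarrow> real \<Rightarrow> real" where
  "prim f y = integral {0..y} f - integral {y..0} f"

lemma prim:
  assumes "continuous_on UNIV f"
  shows "(prim f has_real_derivative f y) (at y)" "a \<le> b \<Longrightarrow> prim f b - prim f a = integral {a..b} f"
    "prim f 0 = 0"
proof -
  obtain G where G: "\<And>x. (G has_vector_derivative f x) (at x)" "\<And>a b. a \<le> b \<Longrightarrow> integral {a..b} f = G b - G a"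
    using antiderivative_UNIV[OF assms] by blast
  have eq: "prim f = (\<lambda>y. G y - G 0)"
  proof
    fix y show "prim f y = G y - G 0"
      using G(2)[of 0 y] G(2)[of y 0] by (cases "0 < y"; cases "y < 0") (auto simp: prim_def)
  qed
  have "((\<lambda>y. G y - G 0) has_real_derivative f y - 0) (at y)"
    using G(1)[of y] by (intro DERIV_diff DERIV_const) (simp add: has_real_derivative_iff_has_vector_derivative)
  thus "(prim f has_real_derivative f y) (at y)" by (simp add: eq)
  show "a \<le> b \<Longrightarrow> prim f b - prim f a = integral {a..b} f" "prim f 0 = 0" by (simp_all add: eq G(2))
qed

lemma lipschitz2_continuous:
  fixes f :: "real \<times> real \<Rightarrow> real"
  assumes "\<And>t t' y y'. \<bar>f (t, y) - f (t', y')\<bar> \<le> a * \<bar>t - t'\<bar> + b * \<bar>y - y'\<bar>"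
  shows "continuous_on UNIV f"
  unfolding continuous_on_def
proof
  fix p :: "real \<times> real"
  obtain t y where p: "p = (t, y)" by (cases p)
  have "((\<lambda>z. a * \<bar>fst z - t\<bar> + b * \<bar>snd z - y\<bar>) \<longlongrightarrow> a * \<bar>fst p - t\<bar> + b * \<bar>snd p - y\<bar>) (at p within UNIV)"
    by (intro tendsto_intros)
  hence "((\<lambda>z. a * \<bar>fst z - t\<bar> + b * \<bar>snd z - y\<bar>) \<longlongrightarrow> 0) (at p within UNIV)"
    by (simp add: p)
  moreover have "\<forall>\<^sub>F z in at p within UNIV. norm (f z - f p) \<le> a * \<bar>fst z - t\<bar> + b * \<bar>snd z - y\<bar>"
    using assms[of _ _ t y] by (intro always_eventually) (auto simp: p)
  ultimately have "((\<lambda>z. f z - f p) \<longlongrightarrow> 0) (at p within UNIV)"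
    by (rule Lim_null_comparison[rotated])
  thus "(f \<longlongrightarrow> f p) (at p within UNIV)" by (simp add: Lim_null[symmetric])
qed

text \<open>The smallness condition says that \<open>2 * M * (M / lam) \<le> 1/2\<close>. It serves
  twice: to keep the Jacobian within 1/2 of 1, and to make \<open>\<Theta>\<close> a contraction
  with factor 1/2.\<close>

locale flow_data =
  fixes h0 :: "real \<Rightarrow> real" and M lam :: real
  assumes h0: "cper h0" and M: "\<And>x. \<bar>h0 x\<bar> \<le> M" and lam: "0 < lam" and small: "4 * M\<^sup>2 \<le> lam"
begin

lemma M_nonneg: "0 \<le> M" using M[of 0] by linarith

text \<open>
  \<open>q\<close> stands for \<open>exp (lam * t) * u\<^sub>x\<close> along the flow; it determines the Jacobian \<open>J\<close>, hence the flow up to a translation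
  (\<open>H\<close>), hence again \<open>u\<^sub>x\<close>: a solution is a fixed point of \<open>\<Theta>\<close>. The last condition in \<open>admissible\<close> makes \<open>J\<close> have mean 1.
\<close>

definition A :: "(real \<times> real \<Rightarrow> real) \<Rightarrow> real \<Rightarrow> real \<Rightarrow> real" where
  "A q t y = integral {0..t} (\<lambda>s. exp (- (2 * lam) * s) * q (s, y))"
definition J :: "(real \<times> real \<Rightarrow> real) \<Rightarrow> real \<Rightarrow> real \<Rightarrow> real" where
  "J q t y = 1 + 2 * h0 y * A q t y"
definition H :: "(real \<times> real \<Rightarrow> real) \<Rightarrow> real \<Rightarrow> real \<Rightarrow> real" where
  "H q t y = y + 2 * prim (\<lambda>z. h0 z * A q t z) y"
definition \<Theta> :: "(real \<times> real \<Rightarrow> real) \<Rightarrow> real \<times> real \<Rightarrow> real" where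
  "\<Theta> q = (\<lambda>(t, y). KQ (H q t) h0 y)"

definition admissible :: "(real \<times> real \<Rightarrow> real) \<Rightarrow> bool" where
  "admissible q \<longleftrightarrow> continuous_on UNIV q \<and> (\<forall>p. \<bar>q p\<bar> \<le> 2 * M) \<and> (\<forall>t y. q (t, y + 1) = q (t, y)) \<and>
     (\<forall>t. integral {0..1} (\<lambda>y. h0 y * q (t, y)) = 0)"

lemma admissibleD:
  assumes "admissible q"
  shows "continuous_on UNIV q" "\<bar>q p\<bar> \<le> 2 * M" "cper (\<lambda>y. q (t, y))" "continuous_on S (\<lambda>s. q (s, y))"
    "integral {0..1} (\<lambda>y. h0 y * q (t, y)) = 0"
proof -
  show c: "continuous_on UNIV q" "\<bar>q p\<bar> \<le> 2 * M" "integral {0..1} (\<lambda>y. h0 y * q (t, y)) = 0"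
    using assms unfolding admissible_def by blast+
  have "continuous_on UNIV (\<lambda>y. q (t, y))"
    by (rule continuous_on_compose2[OF c(1)]) (auto intro!: continuous_intros)
  thus "cper (\<lambda>y. q (t, y))" using assms by (auto simp: cper_def admissible_def)
  show "continuous_on S (\<lambda>s. q (s, y))"
    by (rule continuous_on_compose2[OF c(1)]) (auto intro!: continuous_intros)
qed

section \<open>Estimates for the fixed point map\<close>

lemma exp_weight_integral:
  "((\<lambda>s. exp (- (2 * lam) * s)) has_integral (1 - exp (- (2 * lam) * t)) / (2 * lam)) {0..t}" if "0 \<le> t"
proof -
  have "((\<lambda>s. exp (- (2 * lam) * s)) has_integral (- exp (- (2 * lam) * t) / (2 * lam) - - exp (- (2 * lam) * 0) / (2 * lam))) {0..t}"
    by (rule fundamental_theorem_of_calculus[OF that])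
       (use lam in \<open>auto simp: has_real_derivative_iff_has_vector_derivative[symmetric] intro!: derivative_eq_intros\<close>)
  thus ?thesis by (simp add: diff_divide_distrib)
qed

text \<open>The weight has total mass at most \<open>1 / (2 * lam)\<close> whatever \<open>t\<close>
  is. This uniformity is the effect of the damping and makes the construction global in a single
  step.\<close>

lemma weighted_bound:
  assumes f: "continuous_on {0..t} f" and b: "\<And>s. s \<in> {0..t} \<Longrightarrow> \<bar>f s\<bar> \<le> B" and B: "0 \<le> B"
  shows "\<bar>integral {0..t} (\<lambda>s. exp (- (2 * lam) * s) * f s)\<bar> \<le> B / (2 * lam)"
proof (cases "0 \<le> t")
  case True
  have "norm (integral {0..t} (\<lambda>s. exp (- (2 * lam) * s) * f s)) \<le> integral {0..t} (\<lambda>s. exp (- (2 * lam) * s) * B)"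
    by (rule integral_norm_bound_integral)
       (auto intro!: integrable_continuous_real continuous_intros f simp: abs_mult b)
  also have "\<dots> = (1 - exp (- (2 * lam) * t)) / (2 * lam) * B"
    by (rule integral_unique[OF has_integral_mult_left[OF exp_weight_integral[OF True]]])
  also have "\<dots> \<le> 1 / (2 * lam) * B" using lam B by (intro mult_right_mono divide_right_mono) auto
  finally show ?thesis by simp
next
  case False thus ?thesis using lam B by simp
qed

lemma A_integrable: "admissible q \<Longrightarrow> (\<lambda>s. exp (- (2 * lam) * s) * q (s, y)) integrable_on {a..b}"
  by (intro integrable_continuous_real continuous_intros admissibleD(4))

lemma A_cper:
  assumes q: "admissible q"
  shows "cper (A q t)"
proof -
  have "continuous_on UNIV (\<lambda>y. integral (cbox 0 t) (\<lambda>s. exp (- (2 * lam) * s) * q (s, y)))"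
    by (rule integral_continuous_on_param)
       (auto simp: split_beta intro!: continuous_intros continuous_on_compose2[OF admissibleD(1)[OF q]])
  moreover have "q (s, y + 1) = q (s, y)" for s y using q by (simp add: admissible_def)
  ultimately show ?thesis by (simp add: cper_def A_def[abs_def])
qed

lemma A_bound: "admissible q \<Longrightarrow> \<bar>A q t y\<bar> \<le> M / lam"
  using weighted_bound[of t "\<lambda>s. q (s, y)" "2 * M"] M_nonneg lam
  by (simp add: A_def admissibleD)

lemma A_lipschitz:
  assumes q: "admissible q"
  shows "\<bar>A q t y - A q t' y\<bar> \<le> 2 * M * \<bar>t - t'\<bar>"
proof -
  have pos: "\<bar>A q t y - A q t' y\<bar> \<le> 2 * M * (t - t')" if "0 \<le> t'" "t' \<le> t" for t t'
  proof -
    have "A q t y - A q t' y = integral {t'..t} (\<lambda>s. exp (- (2 * lam) * s) * q (s, y))"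
      using Henstock_Kurzweil_Integration.integral_combine[OF that A_integrable[OF q, of y]] by (simp add: A_def)
    also have "\<bar>\<dots>\<bar> \<le> 2 * M * (t - t')"
    proof -
      have "norm (integral {t'..t} (\<lambda>s. exp (- (2 * lam) * s) * q (s, y))) \<le> 2 * M * (t - t')"
      proof (rule integral_bound[OF that(2)])
        show "continuous_on {t'..t} (\<lambda>s. exp (- (2 * lam) * s) * q (s, y))"
          by (intro continuous_intros admissibleD(4)[OF q])
        fix s assume "s \<in> {t'..t}"
        hence "exp (- (2 * lam) * s) \<le> 1" using lam that by simp
        hence "exp (- (2 * lam) * s) * \<bar>q (s, y)\<bar> \<le> 1 * (2 * M)"
          by (intro mult_mono admissibleD(2)[OF q]) auto
        thus "norm (exp (- (2 * lam) * s) * q (s, y)) \<le> 2 * M" by (simp add: abs_mult)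
      qed
      thus ?thesis by simp
    qed
    finally show ?thesis .
  qed
  \<comment> \<open>For negative times the interval of integration is empty and \<open>A q t\<close>
    vanishes, so times may be clamped at 0 and the estimate holds on the whole line.\<close>
  have max: "A q t y = A q (max 0 t) y" for t by (auto simp: A_def max_def)
  have "\<bar>A q (max 0 t) y - A q (max 0 t') y\<bar> \<le> 2 * M * \<bar>max 0 t - max 0 t'\<bar>"
  proof -
    have "\<bar>A q a y - A q b y\<bar> \<le> 2 * M * \<bar>a - b\<bar>" if "0 \<le> a" "0 \<le> b" for a b
      using pos[of a b] pos[of b a] that by (cases "a \<le> b") (simp_all add: abs_minus_commute)
    thus ?thesis by simp
  qed
  also have "\<dots> \<le> 2 * M * \<bar>t - t'\<bar>" using M_nonneg by (intro mult_left_mono) auto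
  finally show ?thesis using max by metis
qed

text \<open>Exchanging the integrals reduces this to the mean condition at each time. It makes
  \<open>H q t\<close> advance by exactly 1 over a period, as the lift of a circle map must.\<close>

lemma A_mean: 
  assumes q: "admissible q"
  shows "integral {0..1} (\<lambda>y. h0 y * A q t y) = 0"
proof -
  have "integral {0..1} (\<lambda>y. h0 y * A q t y) = integral (cbox 0 1) (\<lambda>y. integral (cbox 0 t) (\<lambda>s. h0 y * (exp (- (2 * lam) * s) * q (s, y))))"
    by (simp add: A_def)
  also have "\<dots> = integral (cbox 0 t) (\<lambda>s. integral (cbox 0 1) (\<lambda>y. h0 y * (exp (- (2 * lam) * s) * q (s, y))))"
    by (rule integral_swap_continuous)
       (auto simp: split_beta intro!: continuous_intros continuous_on_compose2[OF admissibleD(1)[OF q]]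
         continuous_on_compose2[OF cperD(1)[OF h0, of UNIV]])
  also have "\<dots> = integral (cbox 0 t) (\<lambda>s. exp (- (2 * lam) * s) * integral {0..1} (\<lambda>y. h0 y * q (s, y)))"
  proof -
    have "h0 y * (exp (- (2 * lam) * s) * q (s, y)) = exp (- (2 * lam) * s) * (h0 y * q (s, y))" for s y by simp
    thus ?thesis by (simp only: integral_mult_right cbox_interval)
  qed
  also have "\<dots> = 0" by (simp add: admissibleD(5)[OF q])
  finally show ?thesis .
qed

lemma M_small: "2 * M * (M / lam) \<le> 1/2"
  using small lam by (simp add: power2_eq_square field_simps)

lemma J_bounds:
  assumes q: "admissible q"
  shows "1/2 \<le> J q t y" "J q t y \<le> 3/2"
proof -
  have "\<bar>2 * h0 y * A q t y\<bar> \<le> 2 * M * (M / lam)"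
    unfolding abs_mult using M[of y] A_bound[OF q, of t y] M_nonneg by (intro mult_mono) auto
  thus "1/2 \<le> J q t y" "J q t y \<le> 3/2" using M_small by (auto simp: J_def)
qed

lemma h0A: "admissible q \<Longrightarrow> cper (\<lambda>y. h0 y * A q t y)"
  by (rule cper_mult[OF h0 A_cper])

lemma H_diff:
  assumes "admissible q" "a \<le> b"
  shows "H q t b - H q t a = b - a + 2 * integral {a..b} (\<lambda>z. h0 z * A q t z)"
  using prim(2)[OF cperD(1)[OF h0A[OF assms(1)]] assms(2), of t] by (simp add: H_def)

lemma H_circle:
  assumes q: "admissible q"
  shows "circle_diffeo (H q t) (J q t)"
  unfolding circle_diffeo_def
proof (intro conjI allI)
  note c = h0A[OF q, of t]
  show "(H q t has_real_derivative J q t x) (at x)" for x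
    unfolding H_def[abs_def] J_def by (auto intro!: derivative_eq_intros prim(1) cperD(1)[OF c])
  show "continuous_on UNIV (J q t)"
    unfolding J_def[abs_def] by (intro continuous_intros cperD(1)[OF h0] cperD(1)[OF A_cper[OF q]])
  show "J q t (x + 1) = J q t x" for x
    by (simp add: J_def cperD(2)[OF h0] cperD(2)[OF A_cper[OF q]])
  show "1/2 \<le> J q t x" "J q t x \<le> 2" for x using J_bounds[OF q, of t x] by auto
  show "H q t (x + 1) = H q t x + 1" for x
    using H_diff[OF q, of x "x + 1" t] integral_period[OF c, of x] A_mean[OF q, of t] by simp
qed

lemma H_lipschitz_time:
  assumes q: "admissible q" and z: "z \<in> {y - 1..y}"
  shows "\<bar>(H q t y - H q t z) - (H q t' y - H q t' z)\<bar> \<le> 4 * M * M * \<bar>t - t'\<bar>"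
proof -
  have zy: "z \<le> y" using z by simp
  have i: "(\<lambda>x. h0 x * A q t x) integrable_on {z..y}" for t by (rule integrable_cper[OF h0A[OF q]])
  have eq: "(H q t y - H q t z) - (H q t' y - H q t' z) = 2 * integral {z..y} (\<lambda>x. h0 x * (A q t x - A q t' x))"
    unfolding H_diff[OF q zy] by (simp add: right_diff_distrib integral_diff i)
  have i1: "norm (integral {z..y} (\<lambda>x. h0 x * (A q t x - A q t' x))) \<le> M * (2 * M * \<bar>t - t'\<bar>) * (y - z)"
  proof (rule integral_bound[OF zy])
    show "continuous_on {z..y} (\<lambda>x. h0 x * (A q t x - A q t' x))"
      by (intro continuous_intros cperD(1)[OF h0] cperD(1)[OF A_cper[OF q]])
    show "norm (h0 x * (A q t x - A q t' x)) \<le> M * (2 * M * \<bar>t - t'\<bar>)" for x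
      unfolding real_norm_def abs_mult by (intro mult_mono M A_lipschitz[OF q] M_nonneg) auto
  qed
  have i2: "M * (2 * M * \<bar>t - t'\<bar>) * (y - z) \<le> M * (2 * M * \<bar>t - t'\<bar>) * 1"
    using z M_nonneg by (intro mult_left_mono) auto
  have "norm (integral {z..y} (\<lambda>x. h0 x * (A q t x - A q t' x))) \<le> M * (2 * M * \<bar>t - t'\<bar>)"
    using order_trans[OF i1 i2] by (simp only: mult_1_right)
  thus ?thesis unfolding eq by (simp add: abs_mult)
qed

text \<open>In \<open>y\<close> the derivatives are at most \<open>2 * (2 * M) + M\<close>. In
  \<open>t\<close> the kernels are 2-Lipschitz in the difference of two flow positions, which
  changes at a rate of at most \<open>4 * M * M\<close>.\<close>

lemma K_lipschitz:
  assumes q: "admissible q"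
  shows "\<bar>KP (H q t) h0 y - KP (H q t') h0 y'\<bar> \<le> 8 * M * M * M * \<bar>t - t'\<bar> + 5 * M * \<bar>y - y'\<bar>"
    "\<bar>KQ (H q t) h0 y - KQ (H q t') h0 y'\<bar> \<le> 8 * M * M * M * \<bar>t - t'\<bar> + 5 * M * \<bar>y - y'\<bar>"
proof -
  note Hc = H_circle[OF q]
  have JM: "\<bar>J q t x\<bar> * a \<le> 4 * M" if "a \<le> 2 * M" "0 \<le> a" for t x a
  proof -
    have "\<bar>J q t x\<bar> * a \<le> 2 * (2 * M)"
      using J_bounds[OF q, of t x] that by (intro mult_mono) auto
    thus ?thesis by simp
  qed
  have y: "\<bar>KP (H q t) h0 y - KP (H q t) h0 y'\<bar> \<le> 5 * M * \<bar>y - y'\<bar>" "\<bar>KQ (H q t) h0 y - KQ (H q t) h0 y'\<bar> \<le> 5 * M * \<bar>y - y'\<bar>"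
  proof -
    have "\<bar>J q t x * KQ (H q t) h0 x\<bar> \<le> 5 * M" for x
    proof -
      have "\<bar>J q t x * KQ (H q t) h0 x\<bar> \<le> 4 * M"
        unfolding abs_mult by (rule JM[OF K_bound(2)[OF Hc h0 M]]) simp
      thus ?thesis using M_nonneg by linarith
    qed
    thus "\<bar>KP (H q t) h0 y - KP (H q t) h0 y'\<bar> \<le> 5 * M * \<bar>y - y'\<bar>"
      by (rule derivative_lipschitz[OF K_deriv(1)[OF Hc h0]])
    have "\<bar>J q t x * KP (H q t) h0 x - h0 x\<bar> \<le> 5 * M" for x
    proof -
      have "\<bar>J q t x * KP (H q t) h0 x\<bar> \<le> 4 * M"
        unfolding abs_mult by (rule JM[OF K_bound(1)[OF Hc h0 M]]) simp
      thus ?thesis using M[of x] by linarith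
    qed
    thus "\<bar>KQ (H q t) h0 y - KQ (H q t) h0 y'\<bar> \<le> 5 * M * \<bar>y - y'\<bar>"
      by (rule derivative_lipschitz[OF K_deriv(2)[OF Hc h0]])
  qed
  note t = K_diff[OF Hc Hc h0 M H_lipschitz_time[OF q], of y' t t']
  show "\<bar>KP (H q t) h0 y - KP (H q t') h0 y'\<bar> \<le> 8 * M * M * M * \<bar>t - t'\<bar> + 5 * M * \<bar>y - y'\<bar>"
    using y(1) t(1) by (simp add: mult_ac)
  show "\<bar>KQ (H q t) h0 y - KQ (H q t') h0 y'\<bar> \<le> 8 * M * M * M * \<bar>t - t'\<bar> + 5 * M * \<bar>y - y'\<bar>"
    using y(2) t(2) by (simp add: mult_ac)
qed

text \<open>With P and Q for the two kernel integrals, \<open>K_deriv\<close> gives 2 P J Q - 2 Q (J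
  P - h0), where the terms with J cancel. This is the Lagrangian form of v_x = 2 u_x m and the
  source of the formula for \<open>J\<close>.\<close>

lemma speed_deriv:
  assumes q: "admissible q"
  shows "((\<lambda>y. (KP (H q t) h0 y)\<^sup>2 - (KQ (H q t) h0 y)\<^sup>2) has_real_derivative 2 * (h0 y * KQ (H q t) h0 y)) (at y)"
proof -
  note K = K_deriv[OF H_circle[OF q, of t] h0]
  show ?thesis
    by (auto intro!: derivative_eq_intros K simp: power2_eq_square algebra_simps)
qed

text \<open>The mean condition is reproduced because \<open>h0\<close> times the new function is
  half the derivative of a periodic function.\<close>

lemma \<Theta>_admissible:
  assumes q: "admissible q"
  shows "admissible (\<Theta> q)"
  unfolding admissible_def
proof (intro conjI allI)
  note Hc = H_circle[OF q]
  show "continuous_on UNIV (\<Theta> q)"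
    by (rule lipschitz2_continuous[of _ "8 * M * M * M" "5 * M"]) (use K_lipschitz(2)[OF q] in \<open>simp add: \<Theta>_def\<close>)
  show "\<bar>\<Theta> q p\<bar> \<le> 2 * M" for p
    using K_bound(2)[OF Hc h0 M] by (simp add: \<Theta>_def split_beta)
  show "\<Theta> q (t, y + 1) = \<Theta> q (t, y)" for t y
    using K_periodic(2)[OF Hc h0] by (simp add: \<Theta>_def)
  fix t
  let ?w = "\<lambda>y. (KP (H q t) h0 y)\<^sup>2 - (KQ (H q t) h0 y)\<^sup>2"
  have "((\<lambda>y. 2 * (h0 y * KQ (H q t) h0 y)) has_integral (?w 1 - ?w 0)) {0..1}"
    by (rule fundamental_theorem_of_calculus)
       (auto simp: has_real_derivative_iff_has_vector_derivative[symmetric]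
         intro: has_field_derivative_at_within speed_deriv[OF q])
  hence "((\<lambda>y. 2 * (h0 y * KQ (H q t) h0 y)) has_integral 0) {0..1}"
    using K_periodic[OF Hc h0, of t 0] by simp
  from integral_unique[OF this] show "integral {0..1} (\<lambda>y. h0 y * \<Theta> q (t, y)) = 0" by (simp add: \<Theta>_def)
qed

text \<open>A difference of size \<open>\<delta>\<close> in \<open>q\<close> becomes
  \<open>\<delta> / (2 * lam)\<close> in \<open>A\<close>, then \<open>M * \<delta> / lam\<close> in
  differences of flow positions within a period, and finally
  \<open>2 * (M * \<delta> / lam) * M\<close> in the kernel integral.\<close>

lemma \<Theta>_contraction:
  assumes q: "admissible q" and r: "admissible r" and d: "\<And>p. \<bar>q p - r p\<bar> \<le> \<delta>"
  shows "\<bar>\<Theta> q p - \<Theta> r p\<bar> \<le> 1/2 * \<delta>"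
proof -
  obtain t y where p: "p = (t, y)" by (cases p)
  have \<delta>: "0 \<le> \<delta>" using d[of p] by linarith
  have Ad: "\<bar>A q t x - A r t x\<bar> \<le> \<delta> / (2 * lam)" for x
  proof -
    have "A q t x - A r t x = integral {0..t} (\<lambda>s. exp (- (2 * lam) * s) * (q (s, x) - r (s, x)))"
      unfolding A_def right_diff_distrib by (rule integral_diff[symmetric, OF A_integrable[OF q] A_integrable[OF r]])
    also have "\<bar>\<dots>\<bar> \<le> \<delta> / (2 * lam)"
      by (rule weighted_bound) (use d \<delta> in \<open>auto intro!: continuous_on_diff admissibleD(4)[OF q] admissibleD(4)[OF r]\<close>)
    finally show ?thesis .
  qed
  have "\<bar>(H q t y - H q t z) - (H r t y - H r t z)\<bar> \<le> M * \<delta> / lam" if z: "z \<in> {y - 1..y}" for z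
  proof -
    have zy: "z \<le> y" using z by simp
    have i: "(\<lambda>x. h0 x * A q t x) integrable_on {z..y}" if "admissible q" for q by (rule integrable_cper[OF h0A[OF that]])
    have "(H q t y - H q t z) - (H r t y - H r t z) = 2 * integral {z..y} (\<lambda>x. h0 x * (A q t x - A r t x))"
      unfolding H_diff[OF q zy] H_diff[OF r zy] by (simp add: right_diff_distrib integral_diff i q r)
    moreover have "norm (integral {z..y} (\<lambda>x. h0 x * (A q t x - A r t x))) \<le> M * (\<delta> / (2 * lam)) * (y - z)"
    proof (rule integral_bound[OF zy])
      show "continuous_on {z..y} (\<lambda>x. h0 x * (A q t x - A r t x))"
        by (intro continuous_intros cperD(1)[OF h0] cperD(1)[OF A_cper[OF q]] cperD(1)[OF A_cper[OF r]])
      show "norm (h0 x * (A q t x - A r t x)) \<le> M * (\<delta> / (2 * lam))" for x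
        unfolding real_norm_def abs_mult by (intro mult_mono M Ad M_nonneg) auto
    qed
    moreover have "M * (\<delta> / (2 * lam)) * (y - z) \<le> M * (\<delta> / (2 * lam)) * 1"
      using z M_nonneg \<delta> lam by (intro mult_left_mono) auto
    ultimately show ?thesis by (simp add: abs_mult)
  qed
  from K_diff(2)[OF H_circle[OF q] H_circle[OF r] h0 M this]
  have "\<bar>\<Theta> q p - \<Theta> r p\<bar> \<le> 2 * (M * \<delta> / lam) * M" by (simp add: \<Theta>_def p)
  also have "\<dots> = 2 * M * (M / lam) * \<delta>" by simp
  also have "\<dots> \<le> 1/2 * \<delta>" by (rule mult_right_mono[OF M_small \<delta>])
  finally show ?thesis .
qed

text \<open>Banach's theorem in the bounded continuous functions on the whole plane of times and
  labels; the admissible ones form a closed set since every condition passes to uniform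
  limits.\<close>

lemma fixed_point_exists: "\<exists>q. admissible q \<and> \<Theta> q = q"
proof -
  define S where "S = {\<phi> :: (real \<times> real) \<Rightarrow>\<^sub>C real. admissible (apply_bcontfun \<phi>)}"
  define F where "F \<phi> = Bcontfun (\<Theta> (apply_bcontfun \<phi>))" for \<phi> :: "(real \<times> real) \<Rightarrow>\<^sub>C real"
  have bc: "apply_bcontfun (Bcontfun q) = q" if "admissible q" for q
    using admissibleD(1,2)[OF that] by (intro Bcontfun_inverse bcontfun_normI[where b="2 * M"]) auto
  have FS: "apply_bcontfun (F \<phi>) = \<Theta> (apply_bcontfun \<phi>)" if "\<phi> \<in> S" for \<phi>
    unfolding F_def using that by (intro bc \<Theta>_admissible) (simp add: S_def)
  have "closed S"
    unfolding closed_sequential_limits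
  proof (intro allI impI)
    fix \<phi> :: "nat \<Rightarrow> (real \<times> real) \<Rightarrow>\<^sub>C real" and l
    assume "(\<forall>n. \<phi> n \<in> S) \<and> \<phi> \<longlonglongrightarrow> l"
    hence ad: "\<And>n. admissible (\<phi> n)" and lim: "\<phi> \<longlonglongrightarrow> l" by (auto simp: S_def)
    have pt: "(\<lambda>n. \<phi> n p) \<longlonglongrightarrow> l p" for p
      using lim unfolding tendsto_dist_iff[of \<phi>] tendsto_dist_iff[of "\<lambda>n. \<phi> n p"]
      by (rule Lim_null_comparison[rotated]) (auto intro!: always_eventually dist_bounded)
    have "admissible l"
      unfolding admissible_def
    proof (intro conjI allI)
      show "continuous_on UNIV l" by simp
      show "\<bar>l p\<bar> \<le> 2 * M" for p
        by (rule LIMSEQ_le_const2[OF tendsto_rabs[OF pt]]) (use admissibleD(2)[OF ad] in auto)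
      show "l (t, y + 1) = l (t, y)" for t y
        by (rule LIMSEQ_unique[OF pt]) (use pt[of "(t, y)"] ad in \<open>simp add: admissible_def\<close>)
      fix t
      have lc: "continuous_on {0..1} (\<lambda>y. l (t, y))"
        by (rule continuous_on_compose2[OF continuous_on_apply_bcontfun[of UNIV l]]) (auto intro!: continuous_intros)
      have "norm (integral {0..1} (\<lambda>y. h0 y * l (t, y))) \<le> M * dist (\<phi> n) l" for n
      proof -
        have "integral {0..1} (\<lambda>y. h0 y * l (t, y)) = integral {0..1} (\<lambda>y. h0 y * l (t, y)) - integral {0..1} (\<lambda>y. h0 y * \<phi> n (t, y))"
          by (simp add: admissibleD(5)[OF ad])
        also have "\<dots> = integral {0..1} (\<lambda>y. h0 y * (l (t, y) - \<phi> n (t, y)))"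
          unfolding right_diff_distrib
          by (rule integral_diff[symmetric])
             (intro integrable_continuous_real continuous_intros lc cperD(1)[OF h0] cperD(1)[OF admissibleD(3)[OF ad]])+
        also have "norm \<dots> \<le> M * dist (\<phi> n) l * (1 - 0)"
        proof (rule integral_bound)
          show "continuous_on {0..1} (\<lambda>y. h0 y * (l (t, y) - \<phi> n (t, y)))"
            by (intro continuous_intros lc cperD(1)[OF h0] cperD(1)[OF admissibleD(3)[OF ad]])
          show "norm (h0 y * (l (t, y) - \<phi> n (t, y))) \<le> M * dist (\<phi> n) l" for y
            unfolding real_norm_def abs_mult
            using dist_bounded[of l "(t, y)" "\<phi> n"] M M_nonneg by (intro mult_mono) (auto simp: dist_real_def dist_commute)
        qed simp
        finally show ?thesis by simp
      qed
      moreover have "(\<lambda>n. M * dist (\<phi> n) l) \<longlonglongrightarrow> M * 0"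
        using lim by (intro tendsto_intros) (simp add: tendsto_dist_iff[symmetric])
      ultimately have "norm (integral {0..1} (\<lambda>y. h0 y * l (t, y))) \<le> M * 0"
        by (intro LIMSEQ_le_const[of _ "M * 0"]) auto
      thus "integral {0..1} (\<lambda>y. h0 y * l (t, y)) = 0" by simp
    qed
    thus "l \<in> S" by (simp add: S_def)
  qed
  hence "complete S" by (simp add: complete_eq_closed)
  moreover have "S \<noteq> {}"
  proof -
    have "admissible (apply_bcontfun 0)" using M_nonneg by (simp add: admissible_def)
    hence "0 \<in> S" by (simp add: S_def)
    thus ?thesis by blast
  qed
  moreover have "F ` S \<subseteq> S"
    using FS \<Theta>_admissible by (auto simp: S_def)
  moreover have "dist (F \<phi>) (F \<psi>) \<le> 1/2 * dist \<phi> \<psi>" if "\<phi> \<in> S" "\<psi> \<in> S" for \<phi> \<psi>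
  proof (rule dist_bound)
    fix p
    have "\<bar>\<Theta> \<phi> p - \<Theta> \<psi> p\<bar> \<le> 1/2 * dist \<phi> \<psi>"
      by (rule \<Theta>_contraction) (use that dist_bounded[of \<phi> _ \<psi>] in \<open>auto simp: S_def dist_real_def\<close>)
    thus "dist (F \<phi> p) (F \<psi> p) \<le> 1/2 * dist \<phi> \<psi>" by (simp add: FS that dist_real_def)
  qed
  ultimately obtain \<phi> where "\<phi> \<in> S" "F \<phi> = \<phi>"
    using Banach_fix[of S "1/2" F] by auto
  thus ?thesis using FS[of \<phi>] by (auto simp: S_def)
qed

end


lemma cper_zero:
  fixes f :: "real \<Rightarrow> 'a::real_normed_vector"
  assumes f: "cper f" and z: "\<And>x. x \<in> {0..1} \<Longrightarrow> f x = 0"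
  shows "f x = 0"
proof -
  have "f x = f (frac x)" using cper_int[OF f, of "frac x" "\<lfloor>x\<rfloor>"] by (simp add: frac_def)
  moreover have "frac x \<in> {0..1}" using frac_lt_1[of x] by (simp add: less_imp_le)
  ultimately show ?thesis using z by simp
qed

lemma abs_le_square_mono:
  fixes a x :: real
  shows "\<bar>x\<bar> \<le> a \<Longrightarrow> x\<^sup>2 \<le> a\<^sup>2"
  using power_mono[of "\<bar>x\<bar>" a 2] by simp

lemma K_cmult: "KP H (\<lambda>x. c * h x) y = c * KP H h y" "KQ H (\<lambda>x. c * h x) y = c * KQ H h y"
  by (simp_all add: KP_def KQ_def mult.left_commute[of _ c])

lemma K_diff_density:
  assumes H: "circle_diffeo H J" and "cper f" "cper g"
  shows "KP H (\<lambda>x. f x - g x) y = KP H f y - KP H g y" "KQ H (\<lambda>x. f x - g x) y = KQ H f y - KQ H g y"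
  using K_integrable[OF H assms(2)] K_integrable[OF H assms(3)]
  by (simp_all add: KP_def KQ_def right_diff_distrib integral_diff)

context flow_data
begin

section \<open>The flow generated by the fixed point\<close>

definition q :: "real \<times> real \<Rightarrow> real" where "q = (SOME q. admissible q \<and> \<Theta> q = q)"

lemma q: "admissible q" and q_eq: "q (t, y) = KQ (H q t) h0 y"
proof -
  have *: "admissible q \<and> \<Theta> q = q" unfolding q_def by (rule someI_ex[OF fixed_point_exists])
  thus "admissible q" by simp
  have "q (t, y) = \<Theta> q (t, y)" using * by simp
  thus "q (t, y) = KQ (H q t) h0 y" by (simp add: \<Theta>_def)
qed

definition w :: "real \<times> real \<Rightarrow> real" where
  "w = (\<lambda>(t, y). (KP (H q t) h0 y)\<^sup>2 - (q (t, y))\<^sup>2)"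
text \<open>\<open>H q t\<close> fixes the label 0, whereas the true particle moves with speed
  \<open>exp (- (2 * lam) * t) * w (t, 0)\<close>; the added integral is the trajectory of that
  particle.\<close>

definition X :: "real \<Rightarrow> real \<Rightarrow> real" where
  "X t y = integral {0..t} (\<lambda>s. exp (- (2 * lam) * s) * w (s, 0)) + H q t y"

lemma P_cont: "continuous_on UNIV (\<lambda>(t, y). KP (H q t) h0 y)"
  by (rule lipschitz2_continuous[of _ "8 * M * M * M" "5 * M"]) (use K_lipschitz(1)[OF q] in simp)

lemma w_cont: "continuous_on UNIV w"
  using P_cont admissibleD(1)[OF q] unfolding w_def split_beta by (auto intro!: continuous_intros)

lemma w_cont1: "continuous_on S (\<lambda>s. w (s, y))"
  by (rule continuous_on_compose2[OF w_cont]) (auto intro!: continuous_intros)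

lemma w_bound: "\<bar>w p\<bar> \<le> 4 * M\<^sup>2"
proof -
  obtain t y where p: "p = (t, y)" by (cases p)
  have "(KP (H q t) h0 y)\<^sup>2 \<le> (2 * M)\<^sup>2" "(q (t, y))\<^sup>2 \<le> (2 * M)\<^sup>2"
    by (rule abs_le_square_mono[OF K_bound(1)[OF H_circle[OF q] h0 M]])
       (rule abs_le_square_mono[OF admissibleD(2)[OF q]])
  moreover have "0 \<le> (KP (H q t) h0 y)\<^sup>2" "0 \<le> (q (t, y))\<^sup>2" by simp_all
  ultimately have "\<bar>(KP (H q t) h0 y)\<^sup>2 - (q (t, y))\<^sup>2\<bar> \<le> (2 * M)\<^sup>2" by linarith
  hence "\<bar>w p\<bar> \<le> (2 * M)\<^sup>2" by (simp only: w_def p split)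
  thus ?thesis by (simp add: power_mult_distrib)
qed

lemma w_per: "w (t, y + 1) = w (t, y)"
  using K_periodic(1)[OF H_circle[OF q] h0, of t y] q by (simp add: w_def admissible_def)

lemma X_circle: "circle_diffeo (X t) (J q t)"
  using H_circle[OF q, of t] unfolding circle_diffeo_def X_def[abs_def]
  by (auto intro!: derivative_eq_intros)

text \<open>The kernel integrals see the flow only through differences of positions, which the
  translation from \<open>H q t\<close> to \<open>X t\<close> leaves unchanged.\<close>

lemma K_X: "KP (X t) h0 y = KP (H q t) h0 y" "KQ (X t) h0 y = q (t, y)"
  by (simp_all add: q_eq X_def KP_def KQ_def)

text \<open>Integrating \<open>speed_deriv\<close> in the label gives
  \<open>w (s, y) - w (s, 0)\<close>, and exchanging the order of integration turns the definition
  of \<open>H\<close> through its Jacobian into a trajectory formula. The computation is done for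
  labels in \<open>[0,1]\<close> and extended by periodicity.\<close>

lemma X_flow:
  assumes t: "0 \<le> t"
  shows "X t y = y + integral {0..t} (\<lambda>s. exp (- (2 * lam) * s) * w (s, y))"
proof -
  define D where "D y = X t y - y - integral {0..t} (\<lambda>s. exp (- (2 * lam) * s) * w (s, y))" for y
  have i: "(\<lambda>s. exp (- (2 * lam) * s) * w (s, y)) integrable_on {0..t}" for y
    by (intro integrable_continuous_real continuous_intros w_cont1)
  have "continuous_on UNIV (\<lambda>y. integral (cbox 0 t) (\<lambda>s. exp (- (2 * lam) * s) * w (s, y)))"
    by (rule integral_continuous_on_param)
       (auto simp: split_beta intro!: continuous_intros continuous_on_compose2[OF w_cont])
  hence "continuous_on UNIV D"
    unfolding D_def[abs_def] by (auto intro!: continuous_intros circle_diffeoD(6)[OF X_circle])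
  hence "cper D" by (simp add: cper_def D_def circle_diffeoD(3)[OF X_circle] w_per)
  moreover have "D y = 0" if y: "y \<in> {0..1}" for y
  proof -
    have y0: "0 \<le> y" using y by simp
    have w: "integral {0..y} (\<lambda>z. 2 * (h0 z * q (s, z))) = w (s, y) - w (s, 0)" for s
    proof (rule integral_unique)
      have "((\<lambda>z. 2 * (h0 z * KQ (H q s) h0 z)) has_integral
          ((KP (H q s) h0 y)\<^sup>2 - (KQ (H q s) h0 y)\<^sup>2 - ((KP (H q s) h0 0)\<^sup>2 - (KQ (H q s) h0 0)\<^sup>2))) {0..y}"
        by (rule fundamental_theorem_of_calculus[OF y0])
           (auto simp: has_real_derivative_iff_has_vector_derivative[symmetric]
             intro: has_field_derivative_at_within speed_deriv[OF q])
      thus "((\<lambda>z. 2 * (h0 z * q (s, z))) has_integral w (s, y) - w (s, 0)) {0..y}"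
        by (simp add: w_def q_eq)
    qed
    have w': "2 * integral {0..y} (\<lambda>z. h0 z * q (s, z)) = w (s, y) - w (s, 0)" for s
      using w[of s] by (simp only: integral_mult_right)
    have "H q t 0 = 0" using prim(3)[OF cperD(1)[OF h0A[OF q]]] by (simp add: H_def)
    hence "H q t y - y = 2 * integral {0..y} (\<lambda>z. h0 z * A q t z)"
      using H_diff[OF q y0, of t] by simp
    also have "\<dots> = integral (cbox 0 y) (\<lambda>z. integral (cbox 0 t) (\<lambda>s. exp (- (2 * lam) * s) * (2 * (h0 z * q (s, z)))))"
    proof -
      have "exp (- (2 * lam) * s) * (2 * (h0 z * q (s, z))) = 2 * h0 z * (exp (- (2 * lam) * s) * q (s, z))" for s z by simp
      thus ?thesis by (simp only: integral_mult_right cbox_interval A_def mult.assoc)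
    qed
    also have "\<dots> = integral (cbox 0 t) (\<lambda>s. integral (cbox 0 y) (\<lambda>z. exp (- (2 * lam) * s) * (2 * (h0 z * q (s, z)))))"
      by (rule integral_swap_continuous)
         (auto simp: split_beta intro!: continuous_intros continuous_on_compose2[OF admissibleD(1)[OF q]]
           continuous_on_compose2[OF cperD(1)[OF h0, of UNIV]])
    also have "\<dots> = integral {0..t} (\<lambda>s. exp (- (2 * lam) * s) * w (s, y) - exp (- (2 * lam) * s) * w (s, 0))"
      by (simp only: integral_mult_right cbox_interval w' right_diff_distrib)
    also have "\<dots> = integral {0..t} (\<lambda>s. exp (- (2 * lam) * s) * w (s, y)) - integral {0..t} (\<lambda>s. exp (- (2 * lam) * s) * w (s, 0))"
      by (rule integral_diff[OF i i])
    finally show ?thesis by (simp add: D_def X_def)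
  qed
  ultimately have "D y = 0" by (rule cper_zero)
  thus ?thesis by (simp add: D_def)
qed

lemma X_deriv:
  assumes t: "t \<in> {0..T}"
  shows "((\<lambda>t. X t y) has_vector_derivative exp (- (2 * lam) * t) * w (t, y)) (at t within {0..T})"
proof (rule has_vector_derivative_transform[OF t])
  have "((\<lambda>t. integral {0..t} (\<lambda>s. exp (- (2 * lam) * s) * w (s, y))) has_vector_derivative exp (- (2 * lam) * t) * w (t, y)) (at t within {0..T})"
    by (rule integral_has_vector_derivative[OF _ t]) (intro continuous_intros w_cont1)
  from has_vector_derivative_add[OF has_vector_derivative_const[of y] this]
  show "((\<lambda>t. y + integral {0..t} (\<lambda>s. exp (- (2 * lam) * s) * w (s, y))) has_vector_derivative exp (- (2 * lam) * t) * w (t, y)) (at t within {0..T})"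
    by simp
qed (simp add: X_flow)

lemma X_lipschitz_time:
  assumes "0 \<le> s" "0 \<le> t"
  shows "\<bar>X t y - X s y\<bar> \<le> 4 * M\<^sup>2 * \<bar>t - s\<bar>"
proof -
  have le: "\<bar>X t y - X s y\<bar> \<le> 4 * M\<^sup>2 * (t - s)" if st: "0 \<le> s" "s \<le> t" for s t
  proof -
    have t: "0 \<le> t" using st by simp
    have "(\<lambda>s. exp (- (2 * lam) * s) * w (s, y)) integrable_on {0..t}"
      by (intro integrable_continuous_real continuous_intros w_cont1)
    from Henstock_Kurzweil_Integration.integral_combine[OF st this]
    have "X t y - X s y = integral {s..t} (\<lambda>s. exp (- (2 * lam) * s) * w (s, y))"
      by (simp add: X_flow[OF st(1)] X_flow[OF t])
    moreover have "norm (integral {s..t} (\<lambda>s. exp (- (2 * lam) * s) * w (s, y))) \<le> 4 * M\<^sup>2 * (t - s)"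
    proof (rule integral_bound[OF st(2)])
      show "continuous_on {s..t} (\<lambda>s. exp (- (2 * lam) * s) * w (s, y))" by (intro continuous_intros w_cont1)
      fix r assume "r \<in> {s..t}"
      hence "exp (- (2 * lam) * r) \<le> 1" using lam st by simp
      hence "exp (- (2 * lam) * r) * \<bar>w (r, y)\<bar> \<le> 1 * (4 * M\<^sup>2)" by (intro mult_mono w_bound) auto
      thus "norm (exp (- (2 * lam) * r) * w (r, y)) \<le> 4 * M\<^sup>2" by (simp add: abs_mult)
    qed
    ultimately show ?thesis by simp
  qed
  show ?thesis using le[of s t] le[of t s] assms by (cases "s \<le> t") (simp_all add: abs_minus_commute)
qed

definition Y :: "real \<Rightarrow> real \<Rightarrow> real" where
  "Y t = (SOME Y. circle_diffeo Y (\<lambda>x. 1 / J q t (Y x)) \<and> (\<forall>x. X t (Y x) = x) \<and> (\<forall>y. Y (X t y) = y))"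

lemma Y: "circle_diffeo (Y t) (\<lambda>x. 1 / J q t (Y t x))" "X t (Y t x) = x" "Y t (X t y) = y"
proof -
  obtain Z where "circle_diffeo Z (\<lambda>x. 1 / J q t (Z x))" "\<And>x. X t (Z x) = x" "\<And>y. Z (X t y) = y"
    by (rule circle_diffeo_inverse[OF X_circle]) (rule that)
  hence "\<exists>Y. circle_diffeo Y (\<lambda>x. 1 / J q t (Y x)) \<and> (\<forall>x. X t (Y x) = x) \<and> (\<forall>y. Y (X t y) = y)"
    by (intro exI[of _ Z]) simp
  from someI_ex[OF this]
  show "circle_diffeo (Y t) (\<lambda>x. 1 / J q t (Y t x))" "X t (Y t x) = x" "Y t (X t y) = y"
    unfolding Y_def[symmetric] by simp_all
qed

text \<open>Writing \<open>Y t x\<close> as \<open>Y s (X s (Y t x))\<close> and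
  \<open>Y s x\<close> as \<open>Y s (X t (Y t x))\<close> reduces this to the motion of
  \<open>X\<close>, doubled by the 2-Lipschitz map \<open>Y s\<close>.\<close>

lemma Y_lipschitz_time:
  assumes "0 \<le> s" "0 \<le> t"
  shows "\<bar>Y t x - Y s x\<bar> \<le> 8 * M\<^sup>2 * \<bar>t - s\<bar>"
proof -
  note Ys = circle_diffeoD[OF Y(1)[of s]]
  have "\<bar>1 / J q s (Y s z)\<bar> \<le> 2" for z
    unfolding abs_le_iff using Ys(4)[of z] Ys(5)[of z] by linarith
  hence "\<bar>Y s (X s (Y t x)) - Y s (X t (Y t x))\<bar> \<le> 2 * \<bar>X s (Y t x) - X t (Y t x)\<bar>"
    by (rule derivative_lipschitz[OF Ys(1)])
  also have "\<dots> \<le> 2 * (4 * M\<^sup>2 * \<bar>s - t\<bar>)" by (rule mult_left_mono[OF X_lipschitz_time]) (use assms in auto)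
  finally show ?thesis by (simp add: Y(2,3) abs_minus_commute)
qed

section \<open>The Eulerian density and its Fourier coefficients\<close>

definition m :: "real \<Rightarrow> real \<Rightarrow> real" where
  "m t x = exp (- lam * t) * (h0 (Y t x) / J q t (Y t x))"

lemma J_pos: "0 < J q t y"
  using J_bounds(1)[OF q, of t y] by linarith

lemma J_cper: "cper (J q t)"
  by (rule circle_diffeoD(2)[OF X_circle])

lemma ratio_cper: "cper (\<lambda>y. h0 y / J q t y)"
  unfolding cper_def
proof (intro conjI allI)
  have "J q t y \<noteq> 0" for y using J_pos[of t y] by linarith
  thus "continuous_on UNIV (\<lambda>y. h0 y / J q t y)"
    by (intro continuous_on_divide cperD(1)[OF h0] cperD(1)[OF J_cper]) simp
qed (simp add: cperD(2)[OF h0] cperD(2)[OF J_cper])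

lemma m_cper: "cper (m t)"
  unfolding m_def[abs_def] by (rule cper_mult[OF cper_const cper_compose[OF Y(1) ratio_cper]])

lemma m_X: "J q t y * m t (X t y) = exp (- lam * t) * h0 y"
  using J_pos[of t y] by (simp add: m_def Y(3))

definition U :: "real \<Rightarrow> real \<Rightarrow> real" where "U t = KP (\<lambda>x. x) (m t)"
definition U' :: "real \<Rightarrow> real \<Rightarrow> real" where "U' t = KQ (\<lambda>x. x) (m t)"
definition F :: "real \<Rightarrow> real \<Rightarrow> real" where "F t x = ((U t x)\<^sup>2 - (U' t x)\<^sup>2) * m t x"

lemma U_X: "U t (X t y) = exp (- lam * t) * KP (H q t) h0 y" "U' t (X t y) = exp (- lam * t) * q (t, y)"
proof -
  note s = K_substitution[OF X_circle[of t] m_cper[of t], of "\<lambda>z. exp (- lam * t) * h0 z" y, OF m_X]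
  show "U t (X t y) = exp (- lam * t) * KP (H q t) h0 y" "U' t (X t y) = exp (- lam * t) * q (t, y)"
    unfolding U_def U'_def s K_cmult K_X by simp_all
qed

lemma velocity_X: "(U t (X t y))\<^sup>2 - (U' t (X t y))\<^sup>2 = exp (- (2 * lam) * t) * w (t, y)"
proof -
  have "(exp (- lam * t))\<^sup>2 = exp (- (2 * lam) * t)"
    by (simp add: power2_eq_square flip: exp_add)
  thus ?thesis unfolding U_X by (simp add: w_def power_mult_distrib right_diff_distrib)
qed

lemma U_C1p: "C1p (U t) (U' t)" "C1p (U' t) (\<lambda>x. U t x - m t x)"
  using K_C1p[OF circle_diffeo_id m_cper[of t]] by (simp_all add: U_def U'_def)

lemma F_cper: "cper (F t)"
  unfolding F_def[abs_def] power2_eq_square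
  by (intro cper_mult cper_diff C1pD(1)[OF U_C1p(1)] C1pD(1)[OF U_C1p(2)] m_cper)

text \<open>In Lagrangian coordinates the time dependence sits in a scalar and in a smooth function
  of \<open>X t y\<close>, while the rough factor \<open>h0\<close> is constant. The coefficients
  can therefore be differentiated in time although no derivative of \<open>m\<close> is
  available.\<close>

lemma rfc_m: "rfc (m t) k = exp (- lam * t) * integral {0..1} (\<lambda>y. ee (-k) (X t y) * h0 y)"
proof -
  have "rfc (m t) k = integral {0..1} (\<lambda>y. J q t y *\<^sub>R (of_real (m t (X t y)) * ee (-k) (X t y)))"
    unfolding fc_def by (rule substitution_period[OF X_circle cper_mult[OF cper_of_real[OF m_cper] cper_ee], symmetric])
  also have "\<dots> = integral {0..1} (\<lambda>y. of_real (exp (- lam * t)) * (ee (-k) (X t y) * of_real (h0 y)))"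
  proof (rule integral_cong)
    fix y
    have "of_real (J q t y) * of_real (m t (X t y)) = (of_real (exp (- lam * t)) * of_real (h0 y) :: complex)"
      using m_X[of t y] by (metis of_real_mult)
    thus "J q t y *\<^sub>R (of_real (m t (X t y)) * ee (-k) (X t y)) = of_real (exp (- lam * t)) * (ee (-k) (X t y) * of_real (h0 y))"
      by (simp add: scaleR_conv_of_real mult.assoc[symmetric])
  qed
  finally show ?thesis by (simp only: integral_mult_right)
qed

lemma rfc_F: "rfc (F t) k = exp (- lam * t) * integral {0..1} (\<lambda>y. ee (-k) (X t y) * of_real (exp (- (2 * lam) * t) * w (t, y)) * h0 y)"
proof -
  have "rfc (F t) k = integral {0..1} (\<lambda>y. J q t y *\<^sub>R (of_real (F t (X t y)) * ee (-k) (X t y)))"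
    unfolding fc_def by (rule substitution_period[OF X_circle cper_mult[OF cper_of_real[OF F_cper] cper_ee], symmetric])
  also have "\<dots> = integral {0..1} (\<lambda>y. of_real (exp (- lam * t)) * (ee (-k) (X t y) * of_real (exp (- (2 * lam) * t) * w (t, y)) * of_real (h0 y)))"
  proof (rule integral_cong)
    fix y
    have "F t (X t y) = (exp (- (2 * lam) * t) * w (t, y)) * m t (X t y)"
      unfolding F_def velocity_X ..
    hence F: "of_real (F t (X t y)) = (of_real (exp (- (2 * lam) * t) * w (t, y)) * of_real (m t (X t y)) :: complex)"
      by (simp only: of_real_mult)
    have e: "of_real (J q t y) * of_real (m t (X t y)) = (of_real (exp (- lam * t)) * of_real (h0 y) :: complex)"
      using m_X[of t y] by (metis of_real_mult)
    have "of_real (J q t y) * of_real (F t (X t y)) = (of_real (exp (- (2 * lam) * t) * w (t, y)) * (of_real (exp (- lam * t)) * of_real (h0 y)) :: complex)"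
      unfolding F e[symmetric] by (rule mult.left_commute)
    thus "J q t y *\<^sub>R (of_real (F t (X t y)) * ee (-k) (X t y)) = of_real (exp (- lam * t)) * (ee (-k) (X t y) * of_real (exp (- (2 * lam) * t) * w (t, y)) * of_real (h0 y))"
      unfolding scaleR_conv_of_real mult.assoc[symmetric] by (simp add: mult_ac)
  qed
  finally show ?thesis by (simp only: integral_mult_right)
qed

lemma X_cont: "continuous_on ({0..T} \<times> {0..1}) (\<lambda>(t, y). X t y)"
proof -
  \<comment> \<open>The Lipschitz estimate in time is available for nonnegative times; clamping the
    time at 0 extends it to the plane.\<close>
  have "continuous_on UNIV (\<lambda>p. X (max 0 (fst p)) (snd p))"
  proof (rule lipschitz2_continuous[of _ "4 * M\<^sup>2" 2])
    fix t t' y y'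
    have "\<bar>X (max 0 t) y - X (max 0 t') y\<bar> \<le> 4 * M\<^sup>2 * \<bar>max 0 t - max 0 t'\<bar>"
      by (rule X_lipschitz_time) auto
    also have "\<dots> \<le> 4 * M\<^sup>2 * \<bar>t - t'\<bar>" by (rule mult_left_mono) auto
    finally have 1: "\<bar>X (max 0 t) y - X (max 0 t') y\<bar> \<le> 4 * M\<^sup>2 * \<bar>t - t'\<bar>" .
    have "\<bar>J q (max 0 t') z\<bar> \<le> 2" for z
      unfolding abs_le_iff using circle_diffeoD(4,5)[OF X_circle[of "max 0 t'"], of z] by linarith
    hence 2: "\<bar>X (max 0 t') y - X (max 0 t') y'\<bar> \<le> 2 * \<bar>y - y'\<bar>"
      by (rule derivative_lipschitz[OF circle_diffeoD(1)[OF X_circle]])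
    show "\<bar>X (max 0 (fst (t, y))) (snd (t, y)) - X (max 0 (fst (t', y'))) (snd (t', y'))\<bar> \<le> 4 * M\<^sup>2 * \<bar>t - t'\<bar> + 2 * \<bar>y - y'\<bar>"
      using 1 2 unfolding fst_conv snd_conv by linarith
  qed
  hence "continuous_on ({0..T} \<times> {0..1}) (\<lambda>p. X (max 0 (fst p)) (snd p))"
    by (rule continuous_on_subset) simp
  thus ?thesis by (rule continuous_on_eq) auto
qed

text \<open>Differentiation under the integral sign hits the mode at \<open>X t y\<close> and brings
  down the velocity, which yields the coefficient of the flux times
  \<open>- 2 * pi * \<i> * k\<close>; the decaying factor yields the damping term.\<close>

lemma coefficient_deriv:
  assumes t: "t \<in> {0..T}"
  shows "((\<lambda>t. rfc (m t) k) has_vector_derivative - (2 * pi * \<i> * of_int k * rfc (F t) k) - lam * rfc (m t) k) (at t within {0..T})"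
proof -
  define I where "I t = integral {0..1} (\<lambda>y. ee (-k) (X t y) * complex_of_real (h0 y))" for t
  define c where "c = - (2 * pi * \<i> * of_int k)"
  define g where "g t y = (exp (- (2 * lam) * t) * w (t, y)) *\<^sub>R ((2 * pi * of_int (-k)) *\<^sub>R (\<i> * ee (-k) (X t y))) * complex_of_real (h0 y)" for t y
  have Xc: "continuous_on ({0..T} \<times> {0..1}) (\<lambda>p. X (fst p) (snd p))"
    using X_cont by (simp add: split_beta)
  have "((\<lambda>t. integral (cbox 0 1) (\<lambda>y. ee (-k) (X t y) * complex_of_real (h0 y))) has_vector_derivative integral (cbox 0 1) (g t)) (at t within {0..T})"
  proof (rule leibniz_rule_vector_derivative[OF _ _ _ t])
    fix s y :: real assume s: "s \<in> {0..T}"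
    have "((ee (-k) \<circ> (\<lambda>t. X t y)) has_vector_derivative (exp (- (2 * lam) * s) * w (s, y)) *\<^sub>R ((2 * pi * of_int (-k)) *\<^sub>R (\<i> * ee (-k) (X s y)))) (at s within {0..T})"
      by (rule vector_diff_chain_within[OF X_deriv[OF s] ee_deriv])
    from has_vector_derivative_mult_left[OF this, of "complex_of_real (h0 y)"]
    show "((\<lambda>t. ee (-k) (X t y) * complex_of_real (h0 y)) has_vector_derivative g s y) (at s within {0..T})"
      by (simp add: g_def o_def)
  next
    fix s assume s: "s \<in> {0..T}"
    show "(\<lambda>y. ee (-k) (X s y) * complex_of_real (h0 y)) integrable_on cbox 0 1"
      unfolding cbox_interval
      by (intro integrable_continuous_real continuous_intros continuous_on_compose2[OF ee_cont circle_diffeoD(6)[OF X_circle]] cperD(1)[OF h0]) auto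
  next
    show "continuous_on ({0..T} \<times> cbox 0 1) (\<lambda>(t, y). g t y)"
      unfolding g_def split_beta cbox_interval
      by (intro continuous_intros continuous_on_compose2[OF w_cont] continuous_on_compose2[OF ee_cont Xc]
          continuous_on_compose2[OF cperD(1)[OF h0, of UNIV]]) auto
  qed simp
  moreover have "integral (cbox 0 1) (g t) = c * integral {0..1} (\<lambda>y. ee (-k) (X t y) * of_real (exp (- (2 * lam) * t) * w (t, y)) * h0 y)"
  proof -
    have "g t = (\<lambda>y. c * (ee (-k) (X t y) * of_real (exp (- (2 * lam) * t) * w (t, y)) * h0 y))"
      by (rule ext) (simp add: g_def c_def scaleR_conv_of_real mult_ac)
    thus ?thesis by (simp only: cbox_interval integral_mult_right)
  qed
  ultimately have dI: "(I has_vector_derivative c * integral {0..1} (\<lambda>y. ee (-k) (X t y) * of_real (exp (- (2 * lam) * t) * w (t, y)) * h0 y)) (at t within {0..T})"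
    by (simp add: I_def[abs_def])
  have "((\<lambda>t. exp (- lam * t)) has_real_derivative - lam * exp (- lam * t)) (at t within {0..T})"
    by (auto intro!: derivative_eq_intros)
  hence de: "((\<lambda>t. complex_of_real (exp (- lam * t))) has_vector_derivative complex_of_real (- lam * exp (- lam * t))) (at t within {0..T})"
    by (rule has_vector_derivative_of_real)
  have D: "((\<lambda>t. of_real (exp (- lam * t)) * I t) has_vector_derivative
     of_real (exp (- lam * t)) * (c * integral {0..1} (\<lambda>y. ee (-k) (X t y) * of_real (exp (- (2 * lam) * t) * w (t, y)) * h0 y))
     + of_real (- lam * exp (- lam * t)) * I t) (at t within {0..T})"
    by (rule has_vector_derivative_mult[OF de dI])
  have e: "of_real (exp (- lam * t)) * (c * integral {0..1} (\<lambda>y. ee (-k) (X t y) * of_real (exp (- (2 * lam) * t) * w (t, y)) * h0 y))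
     + of_real (- lam * exp (- lam * t)) * I t = - (2 * pi * \<i> * of_int k * rfc (F t) k) - lam * rfc (m t) k"
    unfolding rfc_F rfc_m I_def[symmetric] c_def by (simp add: algebra_simps)
  have rm: "(\<lambda>t. rfc (m t) k) = (\<lambda>t. of_real (exp (- lam * t)) * I t)"
    by (simp only: rfc_m I_def)
  show ?thesis using D unfolding e rm[symmetric] .
qed

lemma m_0: "m 0 = h0"
proof
  fix x
  have "A q 0 y = 0" for y by (simp add: A_def)
  hence "J q 0 y = 1" for y by (simp add: J_def)
  moreover have "Y 0 x = x" using Y(2)[of 0 x] X_flow[of 0 "Y 0 x"] by simp
  ultimately show "m 0 x = h0 x" by (simp add: m_def)
qed

end


section \<open>Strong solutions in terms of Fourier coefficients\<close>

text \<open>The kernel integrals along the identity flow are the Helmholtz inverse of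
  \<open>g\<close> and its derivative, so this is the function behind
  \<open>mch_flux\<close>.\<close>

definition flux :: "(real \<Rightarrow> real) \<Rightarrow> real \<Rightarrow> real" where
  "flux g x = ((KP (\<lambda>x. x) g x)\<^sup>2 - (KQ (\<lambda>x. x) g x)\<^sup>2) * g x"

lemma hel_C1p:
  assumes "cper g"
  shows "C1p (KP (\<lambda>x. x) g) (KQ (\<lambda>x. x) g)" "C1p (KQ (\<lambda>x. x) g) (\<lambda>x. KP (\<lambda>x. x) g x - g x)"
  using K_C1p[OF circle_diffeo_id assms] by simp_all

lemma flux_cper: "cper g \<Longrightarrow> cper (flux g)"
  unfolding flux_def[abs_def] power2_eq_square
  by (intro cper_mult cper_diff C1pD(1)[OF hel_C1p(1)] C1pD(1)[OF hel_C1p(2)])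

lemma mch_flux_eq: "cper g \<Longrightarrow> mch_flux (pdistr_of_fun g) = pdistr_of_fun (flux g)"
  unfolding flux_def[abs_def] by (rule mch_flux_of_fun[OF hel_C1p])

context lp_pair
begin

text \<open>Continuity at \<open>t\<close>, within \<open>S\<close>, of a curve in B^{1/2}_{2,1},
  phrased through \<open>BN\<close> so that finiteness of the norm of each difference is part of the
  assertion.\<close>

definition BNc :: "real set \<Rightarrow> (real \<Rightarrow> real \<Rightarrow> real) \<Rightarrow> real \<Rightarrow> bool" where
  "BNc S f t \<longleftrightarrow> (\<exists>B. BN (f t) B) \<and> (\<forall>e>0. \<forall>\<^sub>F \<tau> in at t within S. BN (\<lambda>x. f \<tau> x - f t x) e)"

lemma BNcD: "BNc S f t \<Longrightarrow> \<exists>B. BN (f t) B" "BNc S f t \<Longrightarrow> 0 < e \<Longrightarrow> \<forall>\<^sub>F \<tau> in at t within S. BN (\<lambda>x. f \<tau> x - f t x) e"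
  by (auto simp: BNc_def)

lemma BNc_diff:
  assumes f: "BNc S f t" and g: "BNc S g t"
  shows "BNc S (\<lambda>t x. f t x - g t x) t"
  unfolding BNc_def
proof (intro conjI allI impI)
  obtain A B where "BN (f t) A" "BN (g t) B" using f g BNcD(1) by blast
  from BN_diff[OF this] show "\<exists>B. BN (\<lambda>x. f t x - g t x) B" by blast
  fix e :: real assume "0 < e"
  hence "0 < e / 2" by simp
  from BNcD(2)[OF f this] BNcD(2)[OF g this]
  show "\<forall>\<^sub>F \<tau> in at t within S. BN (\<lambda>x. f \<tau> x - g \<tau> x - (f t x - g t x)) e"
  proof eventually_elim
    case (elim \<tau>)
    from BN_diff[OF this] show ?case by (simp add: algebra_simps)
  qed
qed

lemma BNc_mult:
  assumes f: "BNc S f t" and g: "BNc S g t"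
  shows "BNc S (\<lambda>t x. f t x * g t x) t"
  unfolding BNc_def
proof (intro conjI allI impI)
  obtain A B where A: "BN (f t) A" and B: "BN (g t) B" using f g BNcD(1) by blast
  from BN_mult[OF this] show "\<exists>B. BN (\<lambda>x. f t x * g t x) B" by blast
  note nn = BN_nonneg[OF A] BN_nonneg[OF B]
  fix e :: real assume e: "0 < e"
  \<comment> \<open>The bound \<open>d \<le> 1\<close> lets the quadratic term \<open>d * d\<close>
    be absorbed into a linear one.\<close>
  define d where "d = min 1 (e / (6400 * (1 + A + B)))"
  have D: "0 < 6400 * (1 + A + B)" using nn by simp
  have d: "0 < d" "d \<le> 1" using e D by (simp_all add: d_def)
  have "d \<le> e / (6400 * (1 + A + B))" by (simp add: d_def)
  hence dle: "d * (6400 * (1 + A + B)) \<le> e" using D by (simp add: pos_le_divide_eq)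
  have "d * d \<le> d * 1" using d by (intro mult_left_mono) auto
  hence bound: "6400 * d * d + 6400 * A * d + 6400 * d * B \<le> e"
    using dle by (simp add: algebra_simps)
  from BNcD(2)[OF f d(1)] BNcD(2)[OF g d(1)]
  show "\<forall>\<^sub>F \<tau> in at t within S. BN (\<lambda>x. f \<tau> x * g \<tau> x - f t x * g t x) e"
  proof eventually_elim
    case (elim \<tau>)
    have "(\<lambda>x. f \<tau> x * g \<tau> x - f t x * g t x) = (\<lambda>x. (f \<tau> x - f t x) * (g \<tau> x - g t x) + f t x * (g \<tau> x - g t x) + (f \<tau> x - f t x) * g t x)"
      by (rule ext) (simp add: algebra_simps)
    moreover have "BN \<dots> (6400 * d * d + 6400 * A * d + 6400 * d * B)"
      by (rule BN_add[OF BN_add[OF BN_mult[OF elim] BN_mult[OF A elim(2)]] BN_mult[OF elim(1) B]])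
    ultimately show ?case using BN_mono[OF _ bound] by simp
  qed
qed

text \<open>Both kernel integrals are C^1 with values and derivatives at most \<open>60 * e\<close>:
  the sup norm of the density is at most \<open>20 * e\<close>, the kernels double it, and the
  derivative of the second contains the density itself.\<close>

lemma BN_hel:
  assumes d: "BN d e"
  shows "BN (KP (\<lambda>x. x) d) (480 * e)" "BN (KQ (\<lambda>x. x) d) (480 * e)"
proof -
  note c = BN_cper[OF d] and s = BN_sup[OF d]
  note b = K_bound[OF circle_diffeo_id c s]
  have e: "0 \<le> e" by (rule BN_nonneg[OF d])
  have "BN (KP (\<lambda>x. x) d) (8 * (60 * e))"
  proof (rule BN_C1[OF hel_C1p(1)[OF c]])
    show "\<bar>KP (\<lambda>x. x) d x\<bar> \<le> 60 * e" "\<bar>KQ (\<lambda>x. x) d x\<bar> \<le> 60 * e" for x using b[of x] e by simp_all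
  qed
  thus "BN (KP (\<lambda>x. x) d) (480 * e)" by simp
  have "BN (KQ (\<lambda>x. x) d) (8 * (60 * e))"
  proof (rule BN_C1[OF hel_C1p(2)[OF c]])
    show "\<bar>KQ (\<lambda>x. x) d x\<bar> \<le> 60 * e" for x using b(2)[of x] e by simp
    show "\<bar>KP (\<lambda>x. x) d x - d x\<bar> \<le> 60 * e" for x using b(1)[of x] s[of x] by linarith
  qed
  thus "BN (KQ (\<lambda>x. x) d) (480 * e)" by simp
qed

lemma BNc_hel:
  assumes g: "BNc S g t" and c: "\<And>t. t \<in> S \<Longrightarrow> cper (g t)"
  shows "BNc S (\<lambda>t. KP (\<lambda>x. x) (g t)) t" "BNc S (\<lambda>t. KQ (\<lambda>x. x) (g t)) t"
proof -
  obtain B where B: "BN (g t) B" using BNcD(1)[OF g] by blast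
  have ev: "\<forall>\<^sub>F \<tau> in at t within S. BN (\<lambda>x. KP (\<lambda>x. x) (g \<tau>) x - KP (\<lambda>x. x) (g t) x) e \<and>
     BN (\<lambda>x. KQ (\<lambda>x. x) (g \<tau>) x - KQ (\<lambda>x. x) (g t) x) e" if e: "0 < e" for e
  proof -
    have e2: "0 < e / 480" using e by simp
    have evS: "\<forall>\<^sub>F \<tau> in at t within S. \<tau> \<in> S" by (simp add: eventually_at_filter)
    have gt: "cper (g t)" by (rule BN_cper[OF B])
    from BNcD(2)[OF g e2] evS show ?thesis
    proof eventually_elim
      case (elim \<tau>)
      from BN_hel[OF elim(1)] show ?case
        by (simp add: K_diff_density[OF circle_diffeo_id c[OF elim(2)] gt, abs_def])
    qed
  qed
  show "BNc S (\<lambda>t. KP (\<lambda>x. x) (g t)) t"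
    unfolding BNc_def
  proof (intro conjI allI impI)
    show "\<exists>B. BN (KP (\<lambda>x. x) (g t)) B" by (rule exI) (rule BN_hel(1)[OF B])
    fix e :: real assume "0 < e"
    from ev[OF this] show "\<forall>\<^sub>F \<tau> in at t within S. BN (\<lambda>x. KP (\<lambda>x. x) (g \<tau>) x - KP (\<lambda>x. x) (g t) x) e"
      by eventually_elim simp
  qed
  show "BNc S (\<lambda>t. KQ (\<lambda>x. x) (g t)) t"
    unfolding BNc_def
  proof (intro conjI allI impI)
    show "\<exists>B. BN (KQ (\<lambda>x. x) (g t)) B" by (rule exI) (rule BN_hel(2)[OF B])
    fix e :: real assume "0 < e"
    from ev[OF this] show "\<forall>\<^sub>F \<tau> in at t within S. BN (\<lambda>x. KQ (\<lambda>x. x) (g \<tau>) x - KQ (\<lambda>x. x) (g t) x) e"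
      by eventually_elim simp
  qed
qed

lemma BNc_flux:
  assumes g: "BNc S g t" and c: "\<And>t. t \<in> S \<Longrightarrow> cper (g t)"
  shows "BNc S (\<lambda>t. flux (g t)) t"
  unfolding flux_def[abs_def] power2_eq_square
  by (intro BNc_mult BNc_diff BNc_hel g c)

text \<open>Derivatives of coefficients suffice: the sequence of these derivatives is continuous in
  time in B^{-1/2}_{2,1}, and \<open>nle_mean_value\<close> on short intervals upgrades this to
  convergence of the difference quotients in norm.\<close>

lemma strong_solutionI:
  assumes T: "0 < T" and c: "\<And>t. t \<in> {0..T} \<Longrightarrow> cper (g t)"
    and g: "\<And>t. t \<in> {0..T} \<Longrightarrow> BNc {0..T} g t"
    and D: "\<And>t k. t \<in> {0..T} \<Longrightarrow> ((\<lambda>t. rfc (g t) k) has_vector_derivative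
       - (2 * pi * \<i> * of_int k * rfc (flux (g t)) k) - lam * rfc (g t) k) (at t within {0..T})"
  shows "mch_strong_solution chi phi lam (pdistr_of_fun (g 0)) T (\<lambda>t. pdistr_of_fun (g t))"
proof -
  let ?I = "{0..T}"
  define m where "m t = pdistr_of_fun (g t)" for t
  define m' where "m' t = - pderivative (pdistr_of_fun (flux (g t))) - lam *\<^sub>R m t" for t
  define d where "d t k = - (2 * pi * \<i> * of_int k * rfc (flux (g t)) k) - lam * rfc (g t) k" for t k
  have fm: "fourier_coeff (m t) = rfc (g t)" if "t \<in> ?I" for t
    using fourier_coeff_of_fun[OF c[OF that]] by (simp add: m_def fun_eq_iff)
  have fm': "fourier_coeff (m' t) = d t" if "t \<in> ?I" for t
    using fm[OF that] fourier_coeff_of_fun[OF flux_cper[OF c[OF that]]]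
    by (simp add: m'_def d_def fourier_coeff_linear fourier_coeff_deriv fun_eq_iff)
  have evI: "\<forall>\<^sub>F \<tau> in at t within ?I. \<tau> \<in> ?I" for t by (simp add: eventually_at_filter)
  have bf: "BNc ?I (\<lambda>t. flux (g t)) t" if "t \<in> ?I" for t
    by (rule BNc_flux[OF g[OF that]]) (rule c)
  have gd: "\<forall>\<^sub>F \<tau> in at t within ?I. nle (1/2) (\<lambda>k. rfc (g \<tau>) k - rfc (g t) k) e" if "t \<in> ?I" "0 < e" for t e
    using BNcD(2)[OF g[OF that(1)] that(2)] evI
  proof eventually_elim
    case (elim \<tau>)
    thus ?case using rfc_diff[OF c[OF elim(2)] c[OF that(1)]] by (simp add: BN_def)
  qed
  have fd: "\<forall>\<^sub>F \<tau> in at t within ?I. nle (1/2) (\<lambda>k. rfc (flux (g \<tau>)) k - rfc (flux (g t)) k) e" if "t \<in> ?I" "0 < e" for t e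
    using BNcD(2)[OF bf[OF that(1)] that(2)] evI
  proof eventually_elim
    case (elim \<tau>)
    thus ?case using rfc_diff[OF flux_cper[OF c[OF elim(2)]] flux_cper[OF c[OF that(1)]]] by (simp add: BN_def)
  qed
  have gB: "\<exists>B. nle (1/2) (rfc (g t)) B" if "t \<in> ?I" for t
    using BNcD(1)[OF g[OF that]] by (auto simp: BN_def)
  have fB: "\<exists>B. nle (1/2) (rfc (flux (g t))) B" if "t \<in> ?I" for t
    using BNcD(1)[OF bf[OF that]] by (auto simp: BN_def)
  have dd: "nle (-1/2) (\<lambda>k. d \<tau> k - d t k) (32 * e + norm (complex_of_real lam) * (2 * e))"
    if "nle (1/2) (\<lambda>k. rfc (flux (g \<tau>)) k - rfc (flux (g t)) k) e" "nle (1/2) (\<lambda>k. rfc (g \<tau>) k - rfc (g t) k) e" for \<tau> t e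
    using nle_diff[OF nle_uminus[OF nle_derivative[OF that(1)]] nle_cmult[OF nle_half_weaken[OF that(2)], of "complex_of_real lam"]]
    by (simp add: d_def algebra_simps)
  have dev: "\<forall>\<^sub>F \<tau> in at t within ?I. nle (-1/2) (\<lambda>k. d \<tau> k - d t k) e" if "t \<in> ?I" "0 < e" for t e
  proof -
    define e' where "e' = e / (32 + \<bar>lam\<bar> * 2)"
    have p: "0 < 32 + \<bar>lam\<bar> * 2" by (simp add: add_pos_nonneg)
    have e': "0 < e'" using that p by (simp add: e'_def)
    have "e' * (32 + \<bar>lam\<bar> * 2) = e" using p by (simp add: e'_def)
    hence eq: "32 * e' + norm (complex_of_real lam) * (2 * e') = e" by (simp add: algebra_simps)
    show ?thesis using fd[OF that(1) e'] gd[OF that(1) e']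
      by eventually_elim (use dd[of _ t e'] eq in simp)
  qed
  have dB: "\<exists>B. nle (-1/2) (d t) B" if t: "t \<in> ?I" for t
  proof -
    obtain A B where "nle (1/2) (rfc (flux (g t))) A" "nle (1/2) (rfc (g t)) B" using gB[OF t] fB[OF t] by blast
    from nle_diff[OF nle_uminus[OF nle_derivative[OF this(1)]] nle_cmult[OF nle_half_weaken[OF this(2)], of "complex_of_real lam"]]
    show ?thesis by (auto simp: d_def[abs_def])
  qed
  have c1: "besov_continuous chi phi (1/2) 2 1 ?I m"
  proof (rule besov_continuousI)
    fix t assume t: "t \<in> ?I"
    show "\<exists>B. nle (1/2) (fourier_coeff (m t)) B" using gB[OF t] by (simp add: fm[OF t])
    fix e :: real assume "0 < e"
    from gd[OF t this] evI show "\<forall>\<^sub>F \<tau> in at t within ?I. nle (1/2) (\<lambda>k. fourier_coeff (m \<tau>) k - fourier_coeff (m t) k) e"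
      by eventually_elim (simp add: fm fm[OF t])
  qed
  have c2: "besov_continuous chi phi (-1/2) 2 1 ?I m"
  proof (rule besov_continuousI)
    fix t assume t: "t \<in> ?I"
    show "\<exists>B. nle (-1/2) (fourier_coeff (m t)) B" using gB[OF t] nle_half_weaken by (metis fm[OF t])
    fix e :: real assume e: "0 < e"
    hence "0 < e / 2" by simp
    from gd[OF t this] evI show "\<forall>\<^sub>F \<tau> in at t within ?I. nle (-1/2) (\<lambda>k. fourier_coeff (m \<tau>) k - fourier_coeff (m t) k) e"
    proof eventually_elim
      case (elim \<tau>)
      from nle_half_weaken[OF elim(1)] show ?case by (simp add: fm[OF elim(2)] fm[OF t])
    qed
  qed
  have c3: "besov_continuous chi phi (-1/2) 2 1 ?I m'"
  proof (rule besov_continuousI)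
    fix t assume t: "t \<in> ?I"
    show "\<exists>B. nle (-1/2) (fourier_coeff (m' t)) B" using dB[OF t] by (simp add: fm'[OF t])
    fix e :: real assume "0 < e"
    from dev[OF t this] evI show "\<forall>\<^sub>F \<tau> in at t within ?I. nle (-1/2) (\<lambda>k. fourier_coeff (m' \<tau>) k - fourier_coeff (m' t) k) e"
      by eventually_elim (simp add: fm' fm'[OF t])
  qed
  have quot: "\<forall>\<^sub>F \<tau> in at t within ?I. nle (-1/2) (fourier_coeff ((1 / (\<tau> - t)) *\<^sub>R (m \<tau> - m t) - m' t)) e" if t: "t \<in> ?I" and e: "0 < e" for t e
  proof -
    obtain \<delta> where \<delta>: "0 < \<delta>" "\<And>\<sigma>. \<sigma> \<in> ?I \<Longrightarrow> \<sigma> \<noteq> t \<Longrightarrow> dist \<sigma> t < \<delta> \<Longrightarrow> nle (-1/2) (\<lambda>k. d \<sigma> k - d t k) e"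
      using dev[OF t e] unfolding eventually_at by blast
    have near: "nle (-1/2) (\<lambda>k. d \<sigma> k - d t k) e" if "\<sigma> \<in> ?I" "dist \<sigma> t < \<delta>" for \<sigma>
      using \<delta>(2)[OF that(1) _ that(2)] nle_mono[OF nle_zero[of "-1/2"], of e] e by (cases "\<sigma> = t") auto
    show ?thesis unfolding eventually_at
    proof (intro exI[of _ \<delta>] conjI ballI impI \<delta>(1))
      fix \<tau> assume \<tau>: "\<tau> \<in> ?I" "\<tau> \<noteq> t \<and> dist \<tau> t < \<delta>"
      have Dr: "((\<lambda>t. rfc (g t) k) has_vector_derivative d \<sigma> k) (at \<sigma> within {a..b})" if "\<sigma> \<in> {a..b}" "{a..b} \<subseteq> ?I" for \<sigma> k a b
      proof -
        have "\<sigma> \<in> ?I" using that by (rule subsetD[rotated])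
        from has_vector_derivative_within_subset[OF D[OF this] that(2)] show ?thesis by (simp add: d_def)
      qed
      have mv: "nle (-1/2) (\<lambda>k. (1 / (b - a)) *\<^sub>R (rfc (g b) k - rfc (g a) k) - d t k) e"
        if ab: "a < b" "{a..b} \<subseteq> ?I" "\<And>\<sigma>. \<sigma> \<in> {a..b} \<Longrightarrow> dist \<sigma> t < \<delta>" for a b
      proof (rule nle_mean_value[OF ab(1)])
        show "((\<lambda>t. rfc (g t) k) has_vector_derivative d \<sigma> k) (at \<sigma> within {a..b})" if "\<sigma> \<in> {a..b}" for \<sigma> k
          by (rule Dr[OF that ab(2)])
        show "nle (-1/2) (\<lambda>k. d \<sigma> k - d t k) e" if "\<sigma> \<in> {a..b}" for \<sigma>
          by (rule near[OF subsetD[OF ab(2) that] ab(3)[OF that]])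
      qed
      have "nle (-1/2) (\<lambda>k. (1 / (\<tau> - t)) *\<^sub>R (rfc (g \<tau>) k - rfc (g t) k) - d t k) e"
      proof (cases "t < \<tau>")
        case True
        show ?thesis by (rule mv[OF True]) (use t \<tau> True in \<open>auto simp: dist_real_def\<close>)
      next
        case False
        hence lt: "\<tau> < t" using \<tau> by simp
        \<comment> \<open>The mean value inequality needs an ordered interval; for
          \<open>\<tau> < t\<close> the quotient is the same with both signs reversed.\<close>
        have "nle (-1/2) (\<lambda>k. (1 / (t - \<tau>)) *\<^sub>R (rfc (g t) k - rfc (g \<tau>) k) - d t k) e"
          by (rule mv[OF lt]) (use t \<tau> lt in \<open>auto simp: dist_real_def\<close>)
        moreover have "(1 / (t - \<tau>)) *\<^sub>R (rfc (g t) k - rfc (g \<tau>) k) = (1 / (\<tau> - t)) *\<^sub>R (rfc (g \<tau>) k - rfc (g t) k)" for k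
        proof -
          have "1 / (t - \<tau>) = - (1 / (\<tau> - t))" by (simp add: minus_divide_right)
          thus ?thesis by (simp only: scaleR_minus_left scaleR_minus_right[symmetric] minus_diff_eq)
        qed
        ultimately show ?thesis by simp
      qed
      moreover have "fourier_coeff ((1 / (\<tau> - t)) *\<^sub>R (m \<tau> - m t) - m' t) = (\<lambda>k. (1 / (\<tau> - t)) *\<^sub>R (rfc (g \<tau>) k - rfc (g t) k) - d t k)"
        by (simp add: fun_eq_iff fourier_coeff_linear fm[OF t] fm[OF \<tau>(1)] fm'[OF t] scaleR_conv_of_real)
      ultimately show "nle (-1/2) (fourier_coeff ((1 / (\<tau> - t)) *\<^sub>R (m \<tau> - m t) - m' t)) e" by simp
    qed
  qed
  have "((\<lambda>\<tau>. besov_norm chi phi (-1/2) 2 1 ((1 / (\<tau> - t)) *\<^sub>R (m \<tau> - m t) - m' t)) \<longlongrightarrow> 0) (at t within ?I)" if t: "t \<in> ?I" for t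
  proof (rule tendstoI)
    fix e :: real assume "0 < e"
    hence e2: "0 < e / 2" by simp
    from quot[OF t e2] show "\<forall>\<^sub>F \<tau> in at t within ?I. dist (besov_norm chi phi (-1/2) 2 1 ((1 / (\<tau> - t)) *\<^sub>R (m \<tau> - m t) - m' t)) 0 < e"
    proof eventually_elim
      case (elim \<tau>)
      from nle_imp_besov(2)[OF this] besov_norm_nonneg[of "-1/2" "(1 / (\<tau> - t)) *\<^sub>R (m \<tau> - m t) - m' t"] e2
      show ?case unfolding dist_real_def by linarith
    qed
  qed
  hence "besov_C1_deriv chi phi (-1/2) 2 1 ?I m m'"
    unfolding besov_C1_deriv_def using c2 c3 by blast
  moreover have "m' t + pderivative (mch_flux (m t)) + lam *\<^sub>R m t = 0" if "t \<in> ?I" for t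
    by (simp add: m'_def m_def mch_flux_eq[OF c[OF that]])
  ultimately have "mch_strong_solution chi phi lam (m 0) T m"
    unfolding mch_strong_solution_def using c1 by blast
  thus ?thesis by (simp add: m_def[abs_def])
qed

text \<open>Membership in the space at each time yields continuous representatives, and the bound of
  a coefficient by the Besov norm turns the derivative in B^{-1/2}_{2,1} into derivatives of the
  coefficients.\<close>

lemma strong_solutionD:
  assumes sol: "mch_strong_solution chi phi lam m0 T n"
  obtains g where "\<And>t. t \<in> {0..T} \<Longrightarrow> n t = pdistr_of_fun (g t)" "\<And>t. t \<in> {0..T} \<Longrightarrow> BNc {0..T} g t"
    "\<And>t. cper (g t)"
    "\<And>t k. t \<in> {0..T} \<Longrightarrow> ((\<lambda>t. rfc (g t) k) has_vector_derivative
       - (2 * pi * \<i> * of_int k * rfc (flux (g t)) k) - lam * rfc (g t) k) (at t within {0..T})"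
proof -
  let ?I = "{0..T}"
  have c: "besov_continuous chi phi (1/2) 2 1 ?I n"
    using sol unfolding mch_strong_solution_def by blast
  obtain m' where C1: "besov_C1_deriv chi phi (-1/2) 2 1 ?I n m'"
    and eqn: "\<forall>t\<in>?I. m' t + pderivative (mch_flux (n t)) + lam *\<^sub>R n t = 0"
    using sol unfolding mch_strong_solution_def by blast
  \<comment> \<open>Outside the time interval only \<open>cper\<close> is asked, with a constant as
    witness, so that later facts about \<open>g t\<close> carry no side condition on
    \<open>t\<close>.\<close>
  have "\<forall>t. \<exists>g. cper g \<and> (t \<in> ?I \<longrightarrow> n t = pdistr_of_fun g \<and> (\<exists>B. BN g B))"
  proof
    fix t
    show "\<exists>g. cper g \<and> (t \<in> ?I \<longrightarrow> n t = pdistr_of_fun g \<and> (\<exists>B. BN g B))"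
    proof (cases "t \<in> ?I")
      case True
      hence "n t \<in> besov_space chi phi (1/2) 2 1" using c by (auto simp: besov_continuous_def)
      then obtain g where "BN g (besov_norm chi phi (1/2) 2 1 (n t))" "n t = pdistr_of_fun g"
        by (rule besov_half_function)
      thus ?thesis using BN_cper by blast
    next
      case False thus ?thesis using cper_const[of "0::real"] by blast
    qed
  qed
  from choice[OF this] obtain g where g: "\<forall>t. cper (g t) \<and> (t \<in> ?I \<longrightarrow> n t = pdistr_of_fun (g t) \<and> (\<exists>B. BN (g t) B))" by blast
  have gc: "cper (g t)" for t using g by blast
  have gn: "n t = pdistr_of_fun (g t)" if "t \<in> ?I" for t using g that by blast
  have gB: "\<exists>B. BN (g t) B" if "t \<in> ?I" for t using g that by blast
  have fn: "fourier_coeff (n t) = rfc (g t)" if "t \<in> ?I" for t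
    using fourier_coeff_of_fun[OF gc] by (simp add: gn[OF that] fun_eq_iff)
  have evI: "\<forall>\<^sub>F \<tau> in at t within ?I. \<tau> \<in> ?I" for t by (simp add: eventually_at_filter)
  have bc: "BNc ?I g t" if t: "t \<in> ?I" for t
    unfolding BNc_def
  proof (intro conjI allI impI gB[OF t])
    fix e :: real assume e: "0 < e"
    from besov_continuousD(2)[OF c t e] evI
    show "\<forall>\<^sub>F \<tau> in at t within ?I. BN (\<lambda>x. g \<tau> x - g t x) e"
    proof eventually_elim
      case (elim \<tau>)
      thus ?case unfolding BN_def rfc_diff[OF gc gc] by (simp add: fn[OF elim(2)] fn[OF t] cper_diff[OF gc gc])
    qed
  qed
  define d where "d t k = - (2 * pi * \<i> * of_int k * rfc (flux (g t)) k) - lam * rfc (g t) k" for t k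
  have fm': "fourier_coeff (m' t) k = d t k" if t: "t \<in> ?I" for t k
  proof -
    have "m' t + pderivative (mch_flux (n t)) + lam *\<^sub>R n t = 0" using eqn t by blast
    hence "fourier_coeff (m' t + pderivative (mch_flux (n t)) + lam *\<^sub>R n t) k = fourier_coeff (0 *\<^sub>R n t) k" by simp
    hence "fourier_coeff (m' t) k + 2 * pi * \<i> * of_int k * rfc (flux (g t)) k + lam * rfc (g t) k = 0"
      unfolding fourier_coeff_linear fourier_coeff_deriv fn[OF t]
      unfolding gn[OF t] mch_flux_eq[OF gc] fourier_coeff_of_fun[OF flux_cper[OF gc]] by simp
    moreover have "a = - b - c" if "a + b + c = 0" for a b c :: complex
      using that by algebra
    ultimately show ?thesis unfolding d_def by blast
  qed
  have "((\<lambda>t. rfc (g t) k) has_vector_derivative d t k) (at t within ?I)" if t: "t \<in> ?I" for t k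
    unfolding has_vector_derivative_iff_quotient
  proof (rule LIM_zero_cancel, rule tendstoI)
    obtain C where C: "\<forall>c B. nle (-1/2) c B \<longrightarrow> norm (c k) \<le> C * B" using nle_coeff_bound by blast
    fix e :: real assume e: "0 < e"
    \<comment> \<open>The added 1 keeps the divisor positive and makes the final bound strict:
      \<open>\<bar>C\<bar> * e' = e - e' < e\<close>.\<close>
    define e' where "e' = e / (\<bar>C\<bar> + 1)"
    have p: "0 < \<bar>C\<bar> + 1" by simp
    have e'0: "0 < e'" using e p by (simp add: e'_def)
    have "e' * (\<bar>C\<bar> + 1) = e" using p by (simp add: e'_def)
    hence "\<bar>C\<bar> * e' = e - e'" by (simp add: algebra_simps)
    hence e': "0 < e'" "\<bar>C\<bar> * e' < e" using e'0 by simp_all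
    have lim: "((\<lambda>\<tau>. besov_norm chi phi (-1/2) 2 1 ((1 / (\<tau> - t)) *\<^sub>R (n \<tau> - n t) - m' t)) \<longlongrightarrow> 0) (at t within ?I)"
      using C1 t unfolding besov_C1_deriv_def by blast
    have nB: "nle (-1/2) (fourier_coeff (n t)) (besov_norm chi phi (-1/2) 2 1 (n t))" if "t \<in> ?I" for t
      using C1 that unfolding besov_C1_deriv_def by (intro besov_continuousD(1)) auto
    have mB: "nle (-1/2) (fourier_coeff (m' t)) (besov_norm chi phi (-1/2) 2 1 (m' t))"
      using C1 t unfolding besov_C1_deriv_def by (intro besov_continuousD(1)) auto
    have qB: "\<exists>B. nle (-1/2) (fourier_coeff ((1 / (\<tau> - t)) *\<^sub>R (n \<tau> - n t) - m' t)) B" if "\<tau> \<in> ?I" for \<tau>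
      using nle_diff[OF nle_cmult[OF nle_diff[OF nB[OF that] nB[OF t]], of "complex_of_real (1 / (\<tau> - t))"] mB]
      by (auto simp: fourier_coeff_linear[abs_def])
    have "\<forall>\<^sub>F \<tau> in at t within ?I. nle (-1/2) (fourier_coeff ((1 / (\<tau> - t)) *\<^sub>R (n \<tau> - n t) - m' t)) e'"
      by (rule besov_tendsto_nle[OF lim e'(1)]) (rule qB)
    from this evI
    show "\<forall>\<^sub>F \<tau> in at t within ?I. dist ((1 / (\<tau> - t)) *\<^sub>R (rfc (g \<tau>) k - rfc (g t) k) - d t k) 0 < e"
    proof eventually_elim
      case (elim \<tau>)
      have "norm (fourier_coeff ((1 / (\<tau> - t)) *\<^sub>R (n \<tau> - n t) - m' t) k) \<le> C * e'" using C elim(1) by blast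
      also have "C * e' \<le> \<bar>C\<bar> * e'" using e' by (intro mult_right_mono) auto
      also note e'(2)
      finally show ?case
        by (simp add: fourier_coeff_linear fm'[OF t] fn[OF t] fn[OF elim(2)] scaleR_conv_of_real)
    qed
  qed
  hence dd: "((\<lambda>t. rfc (g t) k) has_vector_derivative
       - (2 * pi * \<i> * of_int k * rfc (flux (g t)) k) - lam * rfc (g t) k) (at t within ?I)" if "t \<in> ?I" for t k
    using that by (simp only: d_def)
  show ?thesis by (rule that[OF gn bc gc dd])
qed

end


section \<open>Existence\<close>

text \<open>The sup bound \<open>20 * N\<close> comes from the embedding constant in
  \<open>BN_sup\<close>. The factor \<open>10 ^ 11\<close> is tailored to
  \<open>inverse_J_norm\<close>; it far exceeds what the flow construction itself asks for.\<close>

locale mch_flow = lp_pair chi phi + flow_data h0 "20 * N" lam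
  for chi phi h0 N lam +
  assumes h0_norm: "BN h0 N" and small_norm: "10 ^ 11 * N\<^sup>2 \<le> lam"
begin

lemma N_nonneg: "0 \<le> N"
  by (rule BN_nonneg[OF h0_norm])

text \<open>By \<open>K_deriv\<close> this is the derivative of \<open>q\<close> in the label. Hence
  \<open>A q t\<close> is C^1 in the label, with derivative \<open>A'\<close>, although
  \<open>h0\<close> need not be, and the Jacobian belongs to the Besov algebra.\<close>

definition R :: "real \<Rightarrow> real \<Rightarrow> real" where
  "R s y = J q s y * KP (H q s) h0 y - h0 y"
definition A' :: "real \<Rightarrow> real \<Rightarrow> real" where
  "A' t y = integral {0..t} (\<lambda>s. exp (- (2 * lam) * s) * R s y)"

lemma A_jointly_continuous: "continuous_on UNIV (\<lambda>(t, y). A q t y)"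
proof (rule lipschitz2_continuous[of _ "40 * N" "100 * N / (2 * lam)"])
  fix t t' y y'
  have 1: "\<bar>A q t y - A q t' y\<bar> \<le> 40 * N * \<bar>t - t'\<bar>"
    using A_lipschitz[OF q, of t y t'] by simp
  have "A q t' y - A q t' y' = integral {0..t'} (\<lambda>s. exp (- (2 * lam) * s) * (q (s, y) - q (s, y')))"
    unfolding A_def right_diff_distrib by (rule integral_diff[symmetric, OF A_integrable[OF q] A_integrable[OF q]])
  also have "\<bar>\<dots>\<bar> \<le> (100 * N * \<bar>y - y'\<bar>) / (2 * lam)"
  proof (rule weighted_bound)
    show "continuous_on {0..t'} (\<lambda>s. q (s, y) - q (s, y'))"
      by (intro continuous_on_diff admissibleD(4)[OF q])
    show "\<bar>q (s, y) - q (s, y')\<bar> \<le> 100 * N * \<bar>y - y'\<bar>" for s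
      using K_lipschitz(2)[OF q, of s y s y'] by (simp add: q_eq)
    show "0 \<le> 100 * N * \<bar>y - y'\<bar>" using N_nonneg by simp
  qed
  finally have 2: "\<bar>A q t' y - A q t' y'\<bar> \<le> 100 * N / (2 * lam) * \<bar>y - y'\<bar>" by simp
  show "\<bar>(case (t, y) of (t, y) \<Rightarrow> A q t y) - (case (t', y') of (t, y) \<Rightarrow> A q t y)\<bar> \<le> 40 * N * \<bar>t - t'\<bar> + 100 * N / (2 * lam) * \<bar>y - y'\<bar>"
    using 1 2 unfolding split by linarith
qed

lemma R_continuous: "continuous_on UNIV (\<lambda>(t, y). R t y)"
  using A_jointly_continuous P_cont unfolding R_def J_def split_beta
  by (intro continuous_intros continuous_on_compose2[OF cperD(1)[OF h0, of UNIV]]) auto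

lemma R_continuous1: "continuous_on S (\<lambda>s. R s y)"
proof -
  have "continuous_on S (\<lambda>s. case (s, y) of (t, y) \<Rightarrow> R t y)"
    by (rule continuous_on_compose2[OF R_continuous]) (auto intro!: continuous_intros)
  thus ?thesis by simp
qed

lemma R_bound: "\<bar>R s y\<bar> \<le> 100 * N"
proof -
  have "\<bar>J q s y * KP (H q s) h0 y\<bar> \<le> 2 * (2 * (20 * N))"
    unfolding abs_mult using J_bounds[OF q, of s y] K_bound(1)[OF H_circle[OF q] h0 M, of s y]
    by (intro mult_mono) auto
  thus ?thesis using M[of y] N_nonneg unfolding R_def by linarith
qed

lemma R_periodic: "R s (y + 1) = R s y"
  by (simp add: R_def cperD(2)[OF J_cper] cperD(2)[OF h0] K_periodic(1)[OF H_circle[OF q] h0])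

lemma A_C1p: "C1p (A q t) (A' t)"
proof (rule C1pI)
  show "A q t (x + 1) = A q t x" for x by (rule cperD(2)[OF A_cper[OF q]])
  show "A' t (x + 1) = A' t x" for x by (simp add: A'_def R_periodic)
  have "continuous_on UNIV (\<lambda>y. integral (cbox 0 t) (\<lambda>s. exp (- (2 * lam) * s) * R s y))"
  proof (rule integral_continuous_on_param)
    have "continuous_on (UNIV \<times> cbox 0 t) (\<lambda>p. case (snd p, fst p) of (t, y) \<Rightarrow> R t y)"
      by (rule continuous_on_compose2[OF R_continuous]) (auto intro!: continuous_intros)
    thus "continuous_on (UNIV \<times> cbox 0 t) (\<lambda>(y, s). exp (- (2 * lam) * s) * R s y)"
      by (auto simp: split_beta intro!: continuous_intros)
  qed
  thus "continuous_on UNIV (A' t)" by (simp add: A'_def[abs_def])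
  fix x
  have "((\<lambda>y. integral (cbox 0 t) (\<lambda>s. exp (- (2 * lam) * s) * q (s, y))) has_field_derivative
     integral (cbox 0 t) (\<lambda>s. exp (- (2 * lam) * s) * R s x)) (at x within UNIV)"
  proof (rule leibniz_rule_field_derivative)
    fix y s :: real
    have "((\<lambda>y. q (s, y)) has_real_derivative R s y) (at y)"
      using K_deriv(2)[OF H_circle[OF q] h0] by (simp add: q_eq R_def)
    thus "((\<lambda>y. exp (- (2 * lam) * s) * q (s, y)) has_field_derivative exp (- (2 * lam) * s) * R s y) (at y within UNIV)"
      by (rule DERIV_cmult)
  next
    show "(\<lambda>s. exp (- (2 * lam) * s) * q (s, y)) integrable_on cbox 0 t" for y
      unfolding cbox_interval by (rule A_integrable[OF q])
  next
    have "continuous_on (UNIV \<times> cbox 0 t) (\<lambda>p. case (snd p, fst p) of (t, y) \<Rightarrow> R t y)"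
      by (rule continuous_on_compose2[OF R_continuous]) (auto intro!: continuous_intros)
    thus "continuous_on (UNIV \<times> cbox 0 t) (\<lambda>(y, s). exp (- (2 * lam) * s) * R s y)"
      by (auto simp: split_beta intro!: continuous_intros)
  qed simp_all
  thus "(A q t has_real_derivative A' t x) (at x)"
    by (simp add: A_def[abs_def] A'_def)
qed

lemma A'_bound: "\<bar>A' t y\<bar> \<le> 50 * N / lam"
proof -
  have "\<bar>A' t y\<bar> \<le> 100 * N / (2 * lam)"
    unfolding A'_def by (rule weighted_bound[OF R_continuous1 R_bound]) (use N_nonneg in simp)
  thus ?thesis by simp
qed

lemma A'_lipschitz:
  assumes "0 \<le> s" "0 \<le> t"
  shows "\<bar>A' t y - A' s y\<bar> \<le> 100 * N * \<bar>t - s\<bar>"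
proof -
  have i: "(\<lambda>s. exp (- (2 * lam) * s) * R s y) integrable_on {a..b}" for a b
    by (intro integrable_continuous_real continuous_intros R_continuous1)
  have le: "\<bar>A' t y - A' s y\<bar> \<le> 100 * N * (t - s)" if st: "0 \<le> s" "s \<le> t" for s t
  proof -
    have "A' t y - A' s y = integral {s..t} (\<lambda>s. exp (- (2 * lam) * s) * R s y)"
      using Henstock_Kurzweil_Integration.integral_combine[OF st i] by (simp add: A'_def)
    moreover have "norm (integral {s..t} (\<lambda>s. exp (- (2 * lam) * s) * R s y)) \<le> 100 * N * (t - s)"
    proof (rule integral_bound[OF st(2)])
      show "continuous_on {s..t} (\<lambda>s. exp (- (2 * lam) * s) * R s y)" by (intro continuous_intros R_continuous1)
      fix r assume "r \<in> {s..t}"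
      hence "exp (- (2 * lam) * r) \<le> 1" using lam st by simp
      hence "exp (- (2 * lam) * r) * \<bar>R r y\<bar> \<le> 1 * (100 * N)" by (intro mult_mono R_bound) auto
      thus "norm (exp (- (2 * lam) * r) * R r y) \<le> 100 * N" by (simp add: abs_mult)
    qed
    ultimately show ?thesis by simp
  qed
  show ?thesis using le[of s t] le[of t s] assms by (cases "s \<le> t") (simp_all add: abs_minus_commute)
qed

lemma A_norm: "BN (A q t) (400 * N / lam)"
proof -
  have "BN (A q t) (8 * (50 * N / lam))"
  proof (rule BN_C1[OF A_C1p _ A'_bound])
    fix x
    have "20 * N / lam \<le> 50 * N / lam" using N_nonneg lam by (intro divide_right_mono) auto
    thus "\<bar>A q t x\<bar> \<le> 50 * N / lam" using A_bound[OF q, of t x] by linarith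
  qed
  thus ?thesis by simp
qed

lemma A_diff_norm:
  assumes "0 \<le> s" "0 \<le> t"
  shows "BN (\<lambda>y. A q t y - A q s y) (800 * N * \<bar>t - s\<bar>)"
proof -
  have "BN (\<lambda>y. A q t y - A q s y) (8 * (100 * N * \<bar>t - s\<bar>))"
  proof (rule BN_C1[OF C1p_lincomb(1)[OF A_C1p A_C1p]])
    fix x
    have "40 * N * \<bar>t - s\<bar> \<le> 100 * N * \<bar>t - s\<bar>" using N_nonneg by (intro mult_right_mono) auto
    thus "\<bar>A q t x - A q s x\<bar> \<le> 100 * N * \<bar>t - s\<bar>" using A_lipschitz[OF q, of t x s] by simp
    show "\<bar>A' t x - A' s x\<bar> \<le> 100 * N * \<bar>t - s\<bar>" by (rule A'_lipschitz[OF assms])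
  qed
  thus ?thesis by (simp add: mult.assoc)
qed

text \<open>One factor 6400 is spent on the product of \<open>h0\<close> and \<open>A\<close>,
  another on the Neumann series, and 400 on the norm of \<open>A\<close>. The total
  \<open>32768000000 * N\<^sup>2 / lam\<close> must stay below 1/2, which is the origin of
  \<open>10 ^ 11\<close>.\<close>

lemma inverse_J_norm: "BN (\<lambda>y. 1 / J q t y) 16"
proof -
  have q: "BN (\<lambda>y. 2 * (h0 y * A q t y)) (\<bar>2\<bar> * (6400 * N * (400 * N / lam)))"
    by (rule BN_cmult[OF BN_mult[OF h0_norm A_norm]])
  have "6400 * (\<bar>2\<bar> * (6400 * N * (400 * N / lam))) = 32768000000 * (N\<^sup>2 / lam)"
    by (simp add: power2_eq_square)
  moreover have "100000000000 * (N\<^sup>2 / lam) \<le> 1"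
  proof -
    have "10 ^ 11 * N\<^sup>2 / lam \<le> 1" using small_norm lam by (simp add: divide_le_eq)
    thus ?thesis by simp
  qed
  ultimately have "6400 * (\<bar>2\<bar> * (6400 * N * (400 * N / lam))) \<le> 1/2" by linarith
  from BN_inverse[OF q this] show ?thesis by (simp add: J_def mult.assoc)
qed

definition r :: "real \<Rightarrow> real \<Rightarrow> real" where "r t y = h0 y / J q t y"

lemma r_norm: "\<exists>B. BN (r t) B"
  using BN_mult[OF h0_norm inverse_J_norm[of t]] by (auto simp: r_def[abs_def])

text \<open>The difference of the two quotients is \<open>h0\<close> times both inverse Jacobians
  times the difference of the Jacobians. All factors lie in the algebra, and the last one is
  Lipschitz in time.\<close>

lemma r_diff_norm: "\<exists>K\<ge>0. \<forall>s\<ge>0. \<forall>t\<ge>0. BN (\<lambda>y. r t y - r s y) (K * \<bar>t - s\<bar>)"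
proof -
  define K where "K = 6400 * (6400 * (6400 * 16 * 16) * N) * (\<bar>2\<bar> * (6400 * N * (800 * N)))"
  have "BN (\<lambda>y. r t y - r s y) (K * \<bar>t - s\<bar>)" if st: "0 \<le> s" "0 \<le> t" for s t
  proof -
    have 1: "BN (\<lambda>y. ((1 / J q t y) * (1 / J q s y)) * h0 y) (6400 * (6400 * 16 * 16) * N)"
      by (rule BN_mult[OF BN_mult[OF inverse_J_norm inverse_J_norm] h0_norm])
    have 2: "BN (\<lambda>y. 2 * (h0 y * (A q s y - A q t y))) (\<bar>2\<bar> * (6400 * N * (800 * N * \<bar>s - t\<bar>)))"
      by (rule BN_cmult[OF BN_mult[OF h0_norm A_diff_norm[OF st(2,1)]]])
    have "r t y - r s y = ((1 / J q t y) * (1 / J q s y)) * h0 y * (2 * (h0 y * (A q s y - A q t y)))" for y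
    proof -
      have "J q s y - J q t y = 2 * (h0 y * (A q s y - A q t y))" by (simp add: J_def algebra_simps)
      moreover have "r t y - r s y = (1 / J q t y) * (1 / J q s y) * h0 y * (J q s y - J q t y)"
        using J_pos[of t y] J_pos[of s y] by (simp add: r_def field_simps)
      ultimately show ?thesis by simp
    qed
    hence "(\<lambda>y. r t y - r s y) = (\<lambda>y. ((1 / J q t y) * (1 / J q s y)) * h0 y * (2 * (h0 y * (A q s y - A q t y))))"
      by (rule ext)
    moreover have "6400 * (6400 * (6400 * 16 * 16) * N) * (\<bar>2\<bar> * (6400 * N * (800 * N * \<bar>s - t\<bar>))) = K * \<bar>t - s\<bar>"
      by (simp add: K_def abs_minus_commute mult_ac)
    ultimately show ?thesis using BN_mult[OF 1 2] by (simp only:)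
  qed
  moreover have "0 \<le> K" using N_nonneg by (simp add: K_def)
  ultimately show ?thesis by blast
qed

lemma m_eq: "m t = (\<lambda>x. exp (- lam * t) * r t (Y t x))"
  by (simp add: m_def r_def fun_eq_iff)

text \<open>Three changes are separated: that of \<open>r\<close> in time, that of the
  diffeomorphism, and that of the exponential. The middle one has no rate and rests on
  \<open>BN_compose_continuous\<close>.\<close>

lemma m_BNc:
  assumes t: "t \<in> {0..T}"
  shows "BNc {0..T} m t"
  unfolding BNc_def
proof (intro conjI allI impI)
  have t0: "0 \<le> t" using t by simp
  obtain B where B: "BN (r t) B" using r_norm by blast
  note rY = BN_compose[OF B Y(1)[of t]]
  have B0: "0 \<le> B" by (rule BN_nonneg[OF B])
  show "\<exists>B. BN (m t) B" using BN_cmult[OF rY, of "exp (- lam * t)"] unfolding m_eq by blast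
  obtain K where K: "0 \<le> K" "\<forall>s\<ge>0. \<forall>t\<ge>0. BN (\<lambda>y. r t y - r s y) (K * \<bar>t - s\<bar>)" using r_diff_norm by blast
  fix e :: real assume "0 < e"
  hence e: "0 < e / 3" by simp
  have "\<exists>d>0. \<forall>Y Y' Z Z'. circle_diffeo Y Y' \<longrightarrow> circle_diffeo Z Z' \<longrightarrow> (\<forall>x. \<bar>Y x - Z x\<bar> \<le> d) \<longrightarrow> BN (\<lambda>x. r t (Y x) - r t (Z x)) (e / 3)"
  proof (rule BN_compose_continuous[OF B e])
    fix d assume d: "0 < d" and *: "\<And>Y Y' Z Z'. circle_diffeo Y Y' \<Longrightarrow> circle_diffeo Z Z' \<Longrightarrow> (\<And>x. \<bar>Y x - Z x\<bar> \<le> d) \<Longrightarrow> BN (\<lambda>x. r t (Y x) - r t (Z x)) (e / 3)"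
    show ?thesis
    proof (intro exI[of _ d] conjI allI impI d)
      fix Y Y' Z Z' assume "circle_diffeo Y Y'" "circle_diffeo Z Z'" "\<forall>x. \<bar>Y x - Z x\<bar> \<le> d"
      thus "BN (\<lambda>x. r t (Y x) - r t (Z x)) (e / 3)" by (intro *[of Y Y' Z Z']) simp_all
    qed
  qed
  then obtain d where d: "0 < d"
    "\<forall>Y Y' Z Z'. circle_diffeo Y Y' \<longrightarrow> circle_diffeo Z Z' \<longrightarrow> (\<forall>x. \<bar>Y x - Z x\<bar> \<le> d) \<longrightarrow> BN (\<lambda>x. r t (Y x) - r t (Z x)) (e / 3)"
    by (elim exE conjE)
  have lim: "((\<lambda>\<tau>. 8 * (20 * N)\<^sup>2 * \<bar>\<tau> - t\<bar>) \<longlongrightarrow> 8 * (20 * N)\<^sup>2 * \<bar>t - t\<bar>) (at t within {0..T})"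
    "((\<lambda>\<tau>. 320 * (K * \<bar>\<tau> - t\<bar>)) \<longlongrightarrow> 320 * (K * \<bar>t - t\<bar>)) (at t within {0..T})"
    "((\<lambda>\<tau>. \<bar>exp (- lam * \<tau>) - exp (- lam * t)\<bar> * (320 * B)) \<longlongrightarrow> \<bar>exp (- lam * t) - exp (- lam * t)\<bar> * (320 * B)) (at t within {0..T})"
    by (intro tendsto_intros)+
  have ev: "\<forall>\<^sub>F \<tau> in at t within {0..T}. 8 * (20 * N)\<^sup>2 * \<bar>\<tau> - t\<bar> < d"
    "\<forall>\<^sub>F \<tau> in at t within {0..T}. 320 * (K * \<bar>\<tau> - t\<bar>) < e / 3"
    "\<forall>\<^sub>F \<tau> in at t within {0..T}. \<bar>exp (- lam * \<tau>) - exp (- lam * t)\<bar> * (320 * B) < e / 3"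
    using order_tendstoD(2)[OF lim(1), of d] order_tendstoD(2)[OF lim(2), of "e / 3"] order_tendstoD(2)[OF lim(3), of "e / 3"] d(1) e by simp_all
  have evI: "\<forall>\<^sub>F \<tau> in at t within {0..T}. \<tau> \<in> {0..T}" by (simp add: eventually_at_filter)
  from ev evI show "\<forall>\<^sub>F \<tau> in at t within {0..T}. BN (\<lambda>x. m \<tau> x - m t x) e"
  proof eventually_elim
    case (elim \<tau>)
    have \<tau>: "0 \<le> \<tau>" using elim(4) by simp
    have ex: "\<bar>exp (- lam * \<tau>)\<bar> \<le> 1" using \<tau> lam by simp
    have "BN (\<lambda>y. r \<tau> y - r t y) (K * \<bar>\<tau> - t\<bar>)" using K(2) t0 \<tau> by blast
    from BN_compose[OF this Y(1)[of \<tau>]]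
    have 1: "BN (\<lambda>x. r \<tau> (Y \<tau> x) - r t (Y \<tau> x)) (e / 3)"
      by (rule BN_mono) (use elim(2) in simp)
    have 2: "BN (\<lambda>x. r t (Y \<tau> x) - r t (Y t x)) (e / 3)"
    proof (rule d(2)[rule_format, OF Y(1) Y(1)])
      show "\<bar>Y \<tau> x - Y t x\<bar> \<le> d" for x
        using Y_lipschitz_time[OF t0 \<tau>, of x] elim(1) by linarith
    qed
    have s: "BN (\<lambda>x. exp (- lam * \<tau>) * f x) (e / 3)" if "BN f (e / 3)" for f
    proof (rule BN_mono[OF BN_cmult[OF that]])
      show "\<bar>exp (- lam * \<tau>)\<bar> * (e / 3) \<le> e / 3" using mult_right_mono[OF ex, of "e / 3"] e by simp
    qed
    have 3: "BN (\<lambda>x. (exp (- lam * \<tau>) - exp (- lam * t)) * r t (Y t x)) (e / 3)"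
      by (rule BN_mono[OF BN_cmult[OF rY]]) (use elim(3) in simp)
    have split: "a * x - b * z = a * (x - y) + a * (y - z) + (a - b) * z" for a b x y z :: real
      by (simp add: algebra_simps)
    have "(\<lambda>x. m \<tau> x - m t x) = (\<lambda>x. exp (- lam * \<tau>) * (r \<tau> (Y \<tau> x) - r t (Y \<tau> x)) + exp (- lam * \<tau>) * (r t (Y \<tau> x) - r t (Y t x))
        + (exp (- lam * \<tau>) - exp (- lam * t)) * r t (Y t x))"
      unfolding m_eq by (rule ext) (rule split)
    moreover have "BN \<dots> (e / 3 + e / 3 + e / 3)"
      by (rule BN_add[OF BN_add[OF s[OF 1] s[OF 2]] 3])
    ultimately show ?case by simp
  qed
qed

lemma m_coefficient:
  assumes "t \<in> {0..T}"
  shows "((\<lambda>t. rfc (m t) k) has_vector_derivative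
       - (2 * pi * \<i> * of_int k * rfc (flux (m t)) k) - lam * rfc (m t) k) (at t within {0..T})"
proof -
  have "F t = flux (m t)" by (simp add: F_def flux_def U_def U'_def fun_eq_iff)
  thus ?thesis using coefficient_deriv[OF assms, of k] by simp
qed

lemma m_solution:
  assumes T: "0 < T"
  shows "mch_strong_solution chi phi lam (pdistr_of_fun h0) T (\<lambda>t. pdistr_of_fun (m t))"
  using strong_solutionI[OF T m_cper m_BNc m_coefficient] by (simp add: m_0)

end


section \<open>Uniqueness\<close>

text \<open>The function \<open>exp (- c * s) * \<phi> s - \<epsilon> * s\<close> starts at 0 and
  has nonpositive derivative, because the exponential is at most 1.\<close>

lemma gronwall_zero:
  fixes \<phi> \<phi>' :: "real \<Rightarrow> real"
  assumes D: "\<And>s. s \<in> {0..T} \<Longrightarrow> (\<phi> has_vector_derivative \<phi>' s) (at s within {0..T})"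
    and le: "\<And>s. s \<in> {0..T} \<Longrightarrow> \<phi>' s \<le> c * \<phi> s + \<epsilon>"
    and c: "0 \<le> c" and \<epsilon>: "0 \<le> \<epsilon>" and z: "\<phi> 0 = 0" and t: "t \<in> {0..T}"
  shows "\<phi> t \<le> exp (c * t) * (\<epsilon> * t)"
proof (cases "t = 0")
  case False
  hence t0: "0 < t" using t by simp
  define \<psi> where "\<psi> s = exp (- c * s) * \<phi> s - \<epsilon> * s" for s
  define \<psi>' where "\<psi>' s = (exp (- c * s) * \<phi>' s + (- c * exp (- c * s)) * \<phi> s) - \<epsilon>" for s
  have "(\<psi> has_vector_derivative \<psi>' s) (at s within {0..t})" if "s \<in> {0..t}" for s
  proof -
    have sub: "{0..t} \<subseteq> {0..T}" and s: "s \<in> {0..T}" using t that by auto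
    have "((\<lambda>s. exp (- c * s)) has_vector_derivative - c * exp (- c * s)) (at s within {0..t})"
      by (auto simp: has_real_derivative_iff_has_vector_derivative[symmetric] intro!: derivative_eq_intros)
    moreover have "((\<lambda>s. \<epsilon> * s) has_vector_derivative \<epsilon>) (at s within {0..t})"
      by (auto simp: has_real_derivative_iff_has_vector_derivative[symmetric] intro!: derivative_eq_intros)
    ultimately show ?thesis unfolding \<psi>_def \<psi>'_def
      by (intro has_vector_derivative_diff has_vector_derivative_mult has_vector_derivative_within_subset[OF D[OF s] sub])
  qed
  hence "(\<psi> has_derivative (\<lambda>h. h *\<^sub>R \<psi>' s)) (at s within {0..t})" if "0 \<le> s" "s \<le> t" for s
    using that by (simp add: has_vector_derivative_def)
  from mvt_simple[OF t0 this] obtain s where s: "s \<in> {0<..<t}" "\<psi> t - \<psi> 0 = (t - 0) *\<^sub>R \<psi>' s" by blast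
  have "\<phi>' s - c * \<phi> s \<le> \<epsilon>" using le[of s] s t by simp
  hence "exp (- c * s) * (\<phi>' s - c * \<phi> s) \<le> exp (- c * s) * \<epsilon>" by (rule mult_left_mono) simp
  also have "\<dots> \<le> 1 * \<epsilon>" using c s \<epsilon> by (intro mult_right_mono) auto
  finally have "\<psi>' s \<le> 0" by (simp add: \<psi>'_def algebra_simps)
  hence "\<psi> t \<le> 0" using s(2) t0 z by (simp add: \<psi>_def mult_nonneg_nonpos)
  hence "exp (c * t) * (exp (- c * t) * \<phi> t) \<le> exp (c * t) * (\<epsilon> * t)"
    by (intro mult_left_mono) (auto simp: \<psi>_def)
  moreover have "exp (c * t) * exp (- c * t) = 1" by (simp flip: exp_add)
  hence "exp (c * t) * (exp (- c * t) * \<phi> t) = \<phi> t" by (simp only: mult.assoc[symmetric] mult_1_left)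
  ultimately show ?thesis by (simp only:)
qed (simp add: z)

text \<open>The Fourier symbol of 1 - d^2/dx^2. If \<open>W\<close> holds the coefficients of a
  density m = u - u_xx, the sum of \<open>(norm (W k))\<^sup>2 / mu k\<close> is the squared H^1
  norm of u.\<close>

definition mu :: "int \<Rightarrow> real" where "mu k = 1 + (2 * pi * of_int k)\<^sup>2"

lemma mu_pos: "0 < mu k"
  unfolding mu_def by (rule add_pos_nonneg) auto

lemma rfc_hel:
  assumes w: "cper w"
  shows "rfc w k = mu k * rfc (KP (\<lambda>x. x) w) k" "rfc (KQ (\<lambda>x. x) w) k = 2 * pi * \<i> * of_int k * rfc (KP (\<lambda>x. x) w) k"
proof -
  note C = hel_C1p[OF w]
  show 1: "rfc (KQ (\<lambda>x. x) w) k = 2 * pi * \<i> * of_int k * rfc (KP (\<lambda>x. x) w) k"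
    by (rule rfc_deriv[OF C(1)])
  have "rfc (KP (\<lambda>x. x) w) k - rfc w k = 2 * pi * \<i> * of_int k * rfc (KQ (\<lambda>x. x) w) k"
    using rfc_deriv[OF C(2), of k] fun_cong[OF rfc_diff[OF C1pD(1)[OF C(1)] w], of k] by simp
  also have "\<dots> = - (of_real ((2 * pi * of_int k)\<^sup>2) * rfc (KP (\<lambda>x. x) w) k)"
    unfolding 1 by (simp add: power2_eq_square algebra_simps)
  finally show "rfc w k = mu k * rfc (KP (\<lambda>x. x) w) k"
    by (simp add: mu_def algebra_simps)
qed

lemma hel_bounds:
  assumes "cper g" "\<And>x. \<bar>g x\<bar> \<le> M"
  shows "\<bar>KP (\<lambda>x. x) g x\<bar> \<le> 2 * M" "\<bar>KQ (\<lambda>x. x) g x\<bar> \<le> 2 * M"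
  by (rule K_bound[OF circle_diffeo_id assms])+

lemma flux_bound:
  assumes g: "cper g" "\<And>x. \<bar>g x\<bar> \<le> M"
  shows "\<bar>flux g x\<bar> \<le> 4 * M\<^sup>2 * M"
proof -
  have "(KP (\<lambda>x. x) g x)\<^sup>2 \<le> (2 * M)\<^sup>2" "(KQ (\<lambda>x. x) g x)\<^sup>2 \<le> (2 * M)\<^sup>2"
    by (rule abs_le_square_mono, rule hel_bounds[OF g])+
  moreover have "0 \<le> (KP (\<lambda>x. x) g x)\<^sup>2" "0 \<le> (KQ (\<lambda>x. x) g x)\<^sup>2" by simp_all
  ultimately have "\<bar>(KP (\<lambda>x. x) g x)\<^sup>2 - (KQ (\<lambda>x. x) g x)\<^sup>2\<bar> \<le> (2 * M)\<^sup>2" by linarith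
  hence "\<bar>(KP (\<lambda>x. x) g x)\<^sup>2 - (KQ (\<lambda>x. x) g x)\<^sup>2\<bar> * \<bar>g x\<bar> \<le> (2 * M)\<^sup>2 * M"
    by (intro mult_mono g) auto
  thus ?thesis by (simp add: flux_def abs_mult power_mult_distrib)
qed

text \<open>
  With \<open>z\<close> the difference of the two functions \<open>u\<close>, the top-order part of the flux difference is
  \<open>v * (z - z\<^sub>x\<^sub>x)\<close>, and \<open>2 * v * (z - z\<^sub>x\<^sub>x) * z\<^sub>x = v * (z\<^sup>2 - z\<^sub>x\<^sup>2)\<^sub>x\<close> loses no derivative after an integration by parts.
\<close>

lemma flux_difference_energy:
  assumes g1: "cper g1" "\<And>x. \<bar>g1 x\<bar> \<le> M" and g2: "cper g2" "\<And>x. \<bar>g2 x\<bar> \<le> M"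
  defines "z \<equiv> KP (\<lambda>x. x) (\<lambda>x. g1 x - g2 x)" and "z' \<equiv> KQ (\<lambda>x. x) (\<lambda>x. g1 x - g2 x)"
  shows "integral {0..1} (\<lambda>x. (flux g1 x - flux g2 x) * z' x) \<le> 10 * M\<^sup>2 * integral {0..1} (\<lambda>x. (z x)\<^sup>2 + (z' x)\<^sup>2)"
proof -
  let ?u1 = "KP (\<lambda>x. x) g1" and ?u1' = "KQ (\<lambda>x. x) g1" and ?u2 = "KP (\<lambda>x. x) g2" and ?u2' = "KQ (\<lambda>x. x) g2"
  have M: "0 \<le> M" using g1(2)[of 0] by linarith
  define w where "w x = g1 x - g2 x" for x
  have w: "cper w" unfolding w_def[abs_def] by (rule cper_diff[OF g1(1) g2(1)])
  have zC: "C1p z z'" "C1p z' (\<lambda>x. z x - w x)"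
    using hel_C1p[OF w] by (simp_all add: z_def z'_def w_def[abs_def])
  have u1C: "C1p ?u1 ?u1'" "C1p ?u1' (\<lambda>x. ?u1 x - g1 x)" by (rule hel_C1p[OF g1(1)])+
  have u2C: "C1p ?u2 ?u2'" by (rule hel_C1p(1)[OF g2(1)])
  have z12: "z x = ?u1 x - ?u2 x" "z' x = ?u1' x - ?u2' x" for x
    unfolding z_def z'_def by (rule K_diff_density[OF circle_diffeo_id g1(1) g2(1)])+
  define v where "v x = (?u1 x)\<^sup>2 - (?u1' x)\<^sup>2" for x
  define v' where "v' x = 2 * (?u1' x * g1 x)" for x
  note cs = C1pD(1)[OF u1C(1)] C1pD(1)[OF u1C(2)] C1pD(1)[OF u2C] C1pD(2)[OF u2C] C1pD(1)[OF zC(1)] C1pD(1)[OF zC(2)] g1(1) g2(1) w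
  have v: "cper v" unfolding v_def[abs_def] power2_eq_square by (intro cper_diff cper_mult cs)
  have v': "cper v'" unfolding v'_def[abs_def] by (intro cper_mult cper_const cs)
  have vd: "(v has_real_derivative v' x) (at x)" for x
    unfolding v_def[abs_def] v'_def
    by (auto intro!: derivative_eq_intros C1p_real[OF u1C(1)] C1p_real[OF u1C(2)] simp: power2_eq_square algebra_simps)
  have v'b: "\<bar>v' x\<bar> \<le> 4 * M\<^sup>2" for x
  proof -
    have "\<bar>?u1' x\<bar> * \<bar>g1 x\<bar> \<le> (2 * M) * M" using M by (intro mult_mono hel_bounds g1) auto
    thus ?thesis by (simp add: v'_def abs_mult power2_eq_square mult_ac)
  qed
  define E where "E x = (z x)\<^sup>2 + (z' x)\<^sup>2" for x
  have E: "cper E" unfolding E_def[abs_def] power2_eq_square by (intro cper_add cper_mult cs)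
  define a where "a x = v' x * ((z x)\<^sup>2 - (z' x)\<^sup>2)" for x
  define b where "b x = 2 * (v x * w x * z' x)" for x
  have a: "cper a" unfolding a_def[abs_def] power2_eq_square by (intro cper_diff cper_mult cs v')
  have b: "cper b" unfolding b_def[abs_def] by (intro cper_mult cper_const cs v)
  \<comment> \<open>Since the derivative of \<open>z'\<close> is \<open>z - w\<close>, that of
    \<open>z\<^sup>2 - z'\<^sup>2\<close> is \<open>2 * w * z'\<close>. Thus \<open>a + b\<close> is
    the exact derivative of a periodic function, and the integral of \<open>b\<close> can be traded
    for that of \<open>- a\<close>.\<close>
  have "((\<lambda>x. v x * ((z x)\<^sup>2 - (z' x)\<^sup>2)) has_real_derivative a x + b x) (at x)" for x
    unfolding a_def b_def
    by (auto intro!: derivative_eq_intros vd C1p_real[OF zC(1)] C1p_real[OF zC(2)] simp: power2_eq_square algebra_simps)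
  hence "((\<lambda>x. a x + b x) has_integral (v 1 * ((z 1)\<^sup>2 - (z' 1)\<^sup>2) - v 0 * ((z 0)\<^sup>2 - (z' 0)\<^sup>2))) {0..1}"
    by (intro fundamental_theorem_of_calculus)
       (auto simp: has_real_derivative_iff_has_vector_derivative intro: has_vector_derivative_at_within)
  moreover have "v 1 = v 0" "z 1 = z 0" "z' 1 = z' 0"
    using cperD(2)[OF v, of 0] cperD(2)[OF cs(5), of 0] cperD(2)[OF cs(6), of 0] by simp_all
  ultimately have "((\<lambda>x. a x + b x) has_integral 0) {0..1}" by simp
  from integral_unique[OF this] have ab: "integral {0..1} a + integral {0..1} b = 0"
    by (simp add: integral_add integrable_cper a b)
  define r where "r x = ((?u1 x)\<^sup>2 - (?u1' x)\<^sup>2 - ((?u2 x)\<^sup>2 - (?u2' x)\<^sup>2)) * g2 x * z' x" for x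
  have r: "cper r" unfolding r_def[abs_def] power2_eq_square by (intro cper_diff cper_mult cs)
  have split: "(flux g1 x - flux g2 x) * z' x = 1/2 * b x + r x" for x
    by (simp add: flux_def b_def r_def v_def w_def algebra_simps)
  \<comment> \<open>The constant is 2 + 8: half the bound \<open>4 * M\<^sup>2\<close> on
    \<open>v'\<close>, plus the contribution of \<open>r\<close>, where the difference of the
    velocities factors through sums bounded by \<open>4 * M\<close> and Young's inequality handles
    the mixed product.\<close>
  have ra: "- (1/2 * a x) + r x \<le> 10 * M\<^sup>2 * E x" for x
  proof -
    have E0: "0 \<le> E x" by (simp add: E_def)
    have "\<bar>(z x)\<^sup>2 - (z' x)\<^sup>2\<bar> \<le> E x" unfolding E_def abs_le_iff by simp
    hence "\<bar>v' x\<bar> * \<bar>(z x)\<^sup>2 - (z' x)\<^sup>2\<bar> \<le> 4 * M\<^sup>2 * E x" by (intro mult_mono v'b) auto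
    hence "\<bar>a x\<bar> \<le> 4 * M\<^sup>2 * E x" by (simp only: a_def abs_mult)
    hence 1: "- (1/2 * a x) \<le> 2 * (M\<^sup>2 * E x)" by (simp add: abs_le_iff)
    have s: "\<bar>?u1 x + ?u2 x\<bar> \<le> 4 * M" "\<bar>?u1' x + ?u2' x\<bar> \<le> 4 * M"
      using hel_bounds[OF g1, of x] hel_bounds[OF g2, of x] by linarith+
    have "(?u1 x)\<^sup>2 - (?u1' x)\<^sup>2 - ((?u2 x)\<^sup>2 - (?u2' x)\<^sup>2) = (?u1 x + ?u2 x) * z x - (?u1' x + ?u2' x) * z' x"
      unfolding z12 by (simp add: power2_eq_square algebra_simps)
    moreover have "\<bar>(?u1 x + ?u2 x) * z x\<bar> \<le> 4 * M * \<bar>z x\<bar>" "\<bar>(?u1' x + ?u2' x) * z' x\<bar> \<le> 4 * M * \<bar>z' x\<bar>"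
      unfolding abs_mult by (rule mult_right_mono[OF s(1) abs_ge_zero], rule mult_right_mono[OF s(2) abs_ge_zero])
    ultimately have "\<bar>(?u1 x)\<^sup>2 - (?u1' x)\<^sup>2 - ((?u2 x)\<^sup>2 - (?u2' x)\<^sup>2)\<bar> \<le> 4 * M * \<bar>z x\<bar> + 4 * M * \<bar>z' x\<bar>"
      by linarith
    hence "\<bar>(?u1 x)\<^sup>2 - (?u1' x)\<^sup>2 - ((?u2 x)\<^sup>2 - (?u2' x)\<^sup>2)\<bar> * \<bar>g2 x\<bar> * \<bar>z' x\<bar> \<le> (4 * M * \<bar>z x\<bar> + 4 * M * \<bar>z' x\<bar>) * M * \<bar>z' x\<bar>"
      using M by (intro mult_mono g2) auto
    hence "\<bar>r x\<bar> \<le> (4 * M * \<bar>z x\<bar> + 4 * M * \<bar>z' x\<bar>) * M * \<bar>z' x\<bar>" by (simp only: r_def abs_mult)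
    also have "\<dots> = M\<^sup>2 * (4 * (\<bar>z x\<bar> * \<bar>z' x\<bar>) + 4 * (\<bar>z' x\<bar> * \<bar>z' x\<bar>))" by (simp add: power2_eq_square algebra_simps)
    also have "\<dots> \<le> M\<^sup>2 * (8 * E x)"
    proof (rule mult_left_mono)
      have "0 \<le> (\<bar>z x\<bar> - \<bar>z' x\<bar>)\<^sup>2" by simp
      hence "2 * (\<bar>z x\<bar> * \<bar>z' x\<bar>) \<le> E x" by (simp add: power2_diff E_def)
      moreover have "\<bar>z' x\<bar> * \<bar>z' x\<bar> \<le> E x" by (simp add: E_def power2_eq_square)
      ultimately show "4 * (\<bar>z x\<bar> * \<bar>z' x\<bar>) + 4 * (\<bar>z' x\<bar> * \<bar>z' x\<bar>) \<le> 8 * E x" using E0 by linarith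
    qed simp
    finally have "\<bar>r x\<bar> \<le> M\<^sup>2 * (8 * E x)" .
    from abs_le_D1[OF this] have 2: "r x \<le> 8 * (M\<^sup>2 * E x)" by (simp only: mult_ac)
    have "10 * M\<^sup>2 * E x = 2 * (M\<^sup>2 * E x) + 8 * (M\<^sup>2 * E x)" by simp
    thus ?thesis using add_mono[OF 1 2] by (simp only:)
  qed
  have "integral {0..1} (\<lambda>x. (flux g1 x - flux g2 x) * z' x) = integral {0..1} (\<lambda>x. 1/2 * b x + r x)"
    unfolding split ..
  also have "\<dots> = 1/2 * integral {0..1} b + integral {0..1} r"
    by (simp only: integral_add[OF integrable_on_mult_right[OF integrable_cper[OF b]] integrable_cper[OF r]] integral_mult_right)
  also have "\<dots> = - (1/2) * integral {0..1} a + integral {0..1} r" using ab by simp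
  also have "\<dots> = integral {0..1} (\<lambda>x. - (1/2) * a x + r x)"
    by (simp only: integral_add[OF integrable_on_mult_right[OF integrable_cper[OF a]] integrable_cper[OF r]] integral_mult_right)
  also have "\<dots> \<le> integral {0..1} (\<lambda>x. 10 * M\<^sup>2 * E x)"
    using ra by (intro integral_le integrable_cper cper_add cper_mult cper_const a r E) simp
  also have "\<dots> = 10 * M\<^sup>2 * integral {0..1} E" by (rule integral_mult_right)
  finally show ?thesis by (simp add: E_def[abs_def])
qed

text \<open>Only single coefficients are known to be differentiable in time, so the energy is
  truncated at \<open>K\<close>. The damping has a favourable sign and is dropped. Truncation costs
  twice, in the pairing with the flux and in comparing the full with the truncated energy, each time
  with an error of order \<open>1 / sqrt K\<close>.\<close>

lemma energy_inequality:
  fixes lam :: real and W G :: "int \<Rightarrow> complex"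
  assumes g1: "cper g1" "\<And>x. \<bar>g1 x\<bar> \<le> M" and g2: "cper g2" "\<And>x. \<bar>g2 x\<bar> \<le> M"
    and K: "1 \<le> K" and lam: "0 \<le> lam"
  defines "W \<equiv> rfc (\<lambda>x. g1 x - g2 x)" and "G \<equiv> rfc (\<lambda>x. flux g1 x - flux g2 x)"
  shows "(\<Sum>k\<in>{- int K..int K}. 1 / mu k * (2 * inner (W k) (- (2 * pi * \<i> * of_int k * G k) - lam * W k)))
    \<le> 20 * M\<^sup>2 * (\<Sum>k\<in>{- int K..int K}. 1 / mu k * (norm (W k))\<^sup>2) + 2000 * M ^ 4 / sqrt K"
proof -
  have M: "0 \<le> M" using g1(2)[of 0] by linarith
  define w where "w x = g1 x - g2 x" for x
  have w: "cper w" unfolding w_def[abs_def] by (rule cper_diff[OF g1(1) g2(1)])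
  have wb: "\<bar>w x\<bar> \<le> 2 * M" for x using g1(2)[of x] g2(2)[of x] unfolding w_def by linarith
  define z where "z = KP (\<lambda>x. x) w"
  define z' where "z' = KQ (\<lambda>x. x) w"
  define f where "f x = flux g1 x - flux g2 x" for x
  have f: "cper f" unfolding f_def[abs_def] by (rule cper_diff[OF flux_cper[OF g1(1)] flux_cper[OF g2(1)]])
  have fb: "\<bar>f x\<bar> \<le> 8 * (M\<^sup>2 * M)" for x
    using flux_bound[OF g1, of x] flux_bound[OF g2, of x] unfolding f_def by linarith
  have zC: "C1p z z'" "C1p z' (\<lambda>x. z x - w x)" using hel_C1p[OF w] by (simp_all add: z_def z'_def)
  have zb: "\<bar>z x\<bar> \<le> 4 * M" "\<bar>z' x\<bar> \<le> 4 * M" for x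
    using hel_bounds[OF w wb, of x] by (simp_all add: z_def z'_def)
  have zwb: "\<bar>z x - w x\<bar> \<le> 6 * M" for x using zb(1)[of x] wb[of x] by linarith
  let ?S = "{- int K..int K}"
  have K0: "0 < real K" "1 \<le> sqrt (real K)" using K by simp_all
  have W: "W k = mu k * rfc z k" "rfc z' k = 2 * pi * \<i> * of_int k * rfc z k" for k
    using rfc_hel[OF w, of k] by (simp_all add: W_def z_def z'_def w_def[abs_def])
  have W0: "W k = rfc w k" "G k = rfc f k" for k by (simp_all add: W_def G_def w_def[abs_def] f_def[abs_def])
  \<comment> \<open>Dividing by \<open>mu k\<close> turns the coefficient of the density into that
    of \<open>z\<close>, and moving the multiplier across the inner product makes it the coefficient
    of \<open>z'\<close>.\<close>
  have summand: "1 / mu k * (2 * inner (W k) (- (2 * pi * \<i> * of_int k * G k) - lam * W k)) =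
      2 * Re (cnj (rfc z' k) * rfc f k) - 2 * lam * (1 / mu k * (norm (W k))\<^sup>2)" for k
  proof -
    have "inner (W k) (- (2 * pi * \<i> * of_int k * G k) - lam * W k) =
        inner (W k) (- (2 * pi * \<i> * of_int k * G k)) - lam * (norm (W k))\<^sup>2"
    proof -
      have "complex_of_real lam * W k = lam *\<^sub>R W k" by (simp add: scaleR_conv_of_real)
      thus ?thesis by (simp only: inner_diff_right inner_scaleR_right power2_norm_eq_inner)
    qed
    also have "inner (W k) (- (2 * pi * \<i> * of_int k * G k)) = mu k * Re (cnj (rfc z' k) * rfc f k)"
      unfolding W W0(2) by (simp add: inner_complex_def algebra_simps)
    finally show ?thesis using mu_pos[of k] by (simp add: right_diff_distrib)
  qed
  have pair: "(\<Sum>k\<in>?S. Re (cnj (rfc z' k) * rfc f k)) = integral {0..1} (\<lambda>x. f x * tpoly (rfc z') K x)"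
  proof -
    have i: "(\<lambda>x. complex_of_real (f x) * cnj (\<Sum>j\<in>?S. rfc z' j * ee j x)) integrable_on {0..1}"
      by (intro integrable_continuous_real continuous_intros cperD(1)[OF f])
    have "(\<Sum>k\<in>?S. Re (cnj (rfc z' k) * rfc f k)) = Re (integral {0..1} (\<lambda>x. complex_of_real (f x) * cnj (\<Sum>j\<in>?S. rfc z' j * ee j x)))"
      by (subst integral_times_trig[OF cper_of_real[OF f]]) simp_all
    also have "\<dots> = integral {0..1} (\<lambda>x. Re (complex_of_real (f x) * cnj (\<Sum>j\<in>?S. rfc z' j * ee j x)))"
      using integral_linear[OF i bounded_linear_Re] by (simp add: o_def)
    finally show ?thesis by (simp add: tpoly_eq)
  qed
  have tc: "cper (tpoly (rfc z') K)" by (rule C1pD(1)[OF test_fun_C1p[OF tpoly_test_fun]])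
  \<comment> \<open>Replacing the partial sum by \<open>z'\<close> costs the bound
    \<open>8 * (M\<^sup>2 * M)\<close> on \<open>f\<close> times the rate
    \<open>6 * M / sqrt K\<close>, as the derivative \<open>z - w\<close> of \<open>z'\<close> is at
    most \<open>6 * M\<close>.\<close>
  have "integral {0..1} (\<lambda>x. f x * tpoly (rfc z') K x) \<le> integral {0..1} (\<lambda>x. f x * z' x + 48 * (M\<^sup>2 * M * M) / sqrt K)"
  proof (intro integral_le integrable_cper cper_mult cper_add cper_const f tc C1pD(1)[OF zC(2)])
    fix x
    have "\<bar>z' x - tpoly (rfc z') K x\<bar> \<le> 6 * M / sqrt K" by (rule real_fourier_rate[OF zC(2) zwb K])
    hence "\<bar>f x\<bar> * \<bar>z' x - tpoly (rfc z') K x\<bar> \<le> (8 * (M\<^sup>2 * M)) * (6 * M / sqrt K)"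
      using M by (intro mult_mono fb) auto
    hence "\<bar>f x * z' x - f x * tpoly (rfc z') K x\<bar> \<le> 48 * (M\<^sup>2 * M * M) / sqrt K"
      by (simp add: abs_mult right_diff_distrib[symmetric])
    thus "f x * tpoly (rfc z') K x \<le> f x * z' x + 48 * (M\<^sup>2 * M * M) / sqrt K" by linarith
  qed
  also have "\<dots> = integral {0..1} (\<lambda>x. f x * z' x) + 48 * (M\<^sup>2 * M * M) / sqrt K"
    by (subst integral_add) (auto intro!: integrable_cper cper_mult cper_const f C1pD(1)[OF zC(2)])
  also have "integral {0..1} (\<lambda>x. f x * z' x) \<le> 10 * M\<^sup>2 * integral {0..1} (\<lambda>x. (z x)\<^sup>2 + (z' x)\<^sup>2)"
    using flux_difference_energy[OF g1 g2] unfolding f_def z_def z'_def w_def[abs_def] .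
  finally have flux: "integral {0..1} (\<lambda>x. f x * tpoly (rfc z') K x) \<le>
     10 * M\<^sup>2 * integral {0..1} (\<lambda>x. (z x)\<^sup>2 + (z' x)\<^sup>2) + 48 * (M\<^sup>2 * M * M) / sqrt K" by simp
  have tail: "integral {0..1} (\<lambda>x. (h x)\<^sup>2) \<le> B\<^sup>2 / K + (\<Sum>k\<in>?S. (norm (rfc h k))\<^sup>2)"
    if h: "C1p h h'" and B: "\<And>x. \<bar>h' x\<bar> \<le> B" for h h' :: "real \<Rightarrow> real" and B
  proof -
    have hc: "cper (\<lambda>x. complex_of_real (h x))" by (rule cper_of_real[OF C1pD(1)[OF h]])
    have "integral {0..1} (\<lambda>x. (norm (complex_of_real (h x) - (\<Sum>j\<in>?S. rfc h j * ee j x)))\<^sup>2) \<le> integral {0..1} (\<lambda>x::real. (B / sqrt K)\<^sup>2)"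
    proof (rule integral_le)
      show "(\<lambda>x. (norm (complex_of_real (h x) - (\<Sum>j\<in>?S. rfc h j * ee j x)))\<^sup>2) integrable_on {0..1}"
        by (intro integrable_continuous_real continuous_intros cperD(1)[OF C1pD(1)[OF h]])
      show "(\<lambda>x::real. (B / sqrt K)\<^sup>2) integrable_on {0..1}" by (intro integrable_continuous_real continuous_intros)
      show "(norm (complex_of_real (h x) - (\<Sum>j\<in>?S. rfc h j * ee j x)))\<^sup>2 \<le> (B / sqrt K)\<^sup>2" for x
        by (rule power_mono[OF fourier_rate[OF C1p_of_real[OF h] _ K]]) (use B in auto)
    qed
    also have "\<dots> = B\<^sup>2 / K" by (simp add: power_divide)
    finally have "integral {0..1} (\<lambda>x. (norm (complex_of_real (h x) - (\<Sum>j\<in>?S. rfc h j * ee j x)))\<^sup>2) \<le> B\<^sup>2 / K" .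
    thus ?thesis using bessel_identity[OF hc, of ?S] by simp
  qed
  have sq: "integral {0..1} (\<lambda>x. (z x)\<^sup>2 + (z' x)\<^sup>2) = integral {0..1} (\<lambda>x. (z x)\<^sup>2) + integral {0..1} (\<lambda>x. (z' x)\<^sup>2)"
    by (rule integral_add) (rule integral_square_cper[OF C1pD(1)[OF zC(1)]], rule integral_square_cper[OF C1pD(1)[OF zC(2)]])
  have nz: "(norm (rfc z k))\<^sup>2 + (norm (rfc z' k))\<^sup>2 = 1 / mu k * (norm (W k))\<^sup>2" for k
  proof -
    have "(norm (rfc z k))\<^sup>2 + (norm (rfc z' k))\<^sup>2 = mu k * (norm (rfc z k))\<^sup>2"
      unfolding W(2) by (simp add: mu_def norm_mult power_mult_distrib distrib_right)
    moreover have "(norm (W k))\<^sup>2 = (mu k)\<^sup>2 * (norm (rfc z k))\<^sup>2"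
      unfolding W(1) by (simp add: norm_mult power_mult_distrib)
    ultimately show ?thesis using mu_pos[of k] by (simp add: power2_eq_square)
  qed
  define EK where "EK = (\<Sum>k\<in>?S. 1 / mu k * (norm (W k))\<^sup>2)"
  have EK: "EK = (\<Sum>k\<in>?S. (norm (rfc z k))\<^sup>2) + (\<Sum>k\<in>?S. (norm (rfc z' k))\<^sup>2)"
    unfolding EK_def nz[symmetric] by (rule sum.distrib)
  have EK0: "0 \<le> EK" unfolding EK_def using mu_pos by (intro sum_nonneg) (simp add: less_imp_le)
  have invK: "1 / real K \<le> 1 / sqrt K"
  proof -
    have "sqrt K * 1 \<le> sqrt K * sqrt K" using K0 by (intro mult_left_mono) auto
    thus ?thesis using K0 by (intro divide_left_mono) auto
  qed
  \<comment> \<open>The constant is 52 = 16 + 36, from the bounds \<open>4 * M\<close> on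
    \<open>z'\<close> and \<open>6 * M\<close> on its derivative.\<close>
  have "integral {0..1} (\<lambda>x. (z x)\<^sup>2 + (z' x)\<^sup>2) \<le> EK + 52 * M\<^sup>2 * (1 / K)"
    using tail[OF zC(1) zb(2)] tail[OF zC(2) zwb] unfolding sq EK by (simp add: power_mult_distrib)
  also have "\<dots> \<le> EK + 52 * M\<^sup>2 * (1 / sqrt K)"
    by (intro add_left_mono mult_left_mono invK) simp
  finally have "10 * M\<^sup>2 * integral {0..1} (\<lambda>x. (z x)\<^sup>2 + (z' x)\<^sup>2) \<le> 10 * M\<^sup>2 * (EK + 52 * M\<^sup>2 * (1 / sqrt K))"
    by (rule mult_left_mono) simp
  hence "integral {0..1} (\<lambda>x. f x * tpoly (rfc z') K x) \<le> 10 * M\<^sup>2 * (EK + 52 * M\<^sup>2 * (1 / sqrt K)) + 48 * (M\<^sup>2 * M * M) / sqrt K"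
    using flux by linarith
  also have "\<dots> = 10 * M\<^sup>2 * EK + 568 * (M ^ 4 / sqrt K)"
    by (simp add: power2_eq_square power4_eq_xxxx algebra_simps)
  finally have main: "integral {0..1} (\<lambda>x. f x * tpoly (rfc z') K x) \<le> 10 * M\<^sup>2 * EK + 568 * (M ^ 4 / sqrt K)" .
  have "(\<Sum>k\<in>?S. 1 / mu k * (2 * inner (W k) (- (2 * pi * \<i> * of_int k * G k) - lam * W k))) =
     2 * integral {0..1} (\<lambda>x. f x * tpoly (rfc z') K x) - 2 * lam * EK"
    unfolding summand sum_subtractf sum_distrib_left[symmetric] pair EK_def ..
  also have "\<dots> \<le> 2 * (10 * M\<^sup>2 * EK + 568 * (M ^ 4 / sqrt K)) - 0"
    using main lam EK0 by (intro diff_mono) auto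
  also have "\<dots> \<le> 20 * M\<^sup>2 * EK + 2000 * (M ^ 4 / sqrt K)"
  proof -
    have "2 * (10 * M\<^sup>2 * EK + 568 * (M ^ 4 / sqrt K)) - 0 = 20 * M\<^sup>2 * EK + 1136 * (M ^ 4 / sqrt K)"
      by (simp add: algebra_simps)
    also have "\<dots> \<le> 20 * M\<^sup>2 * EK + 2000 * (M ^ 4 / sqrt K)"
      by (intro add_left_mono mult_right_mono) simp_all
    finally show ?thesis .
  qed
  finally show ?thesis unfolding EK_def by simp
qed

context lp_pair
begin

text \<open>The curve is continuous into the bounded continuous functions, so the image of the
  compact time interval is bounded. The choice \<open>e / 40\<close> accounts for the embedding
  constant 20.\<close>

lemma BNc_uniform_bound:
  assumes c: "\<And>t. cper (g t)" and g: "\<And>t. t \<in> {0..T} \<Longrightarrow> BNc {0..T} g t"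
  obtains M where "\<And>t x. t \<in> {0..T} \<Longrightarrow> \<bar>g t x\<bar> \<le> M"
proof -
  define \<gamma> where "\<gamma> t = Bcontfun (g t)" for t
  have \<gamma>: "apply_bcontfun (\<gamma> t) = g t" for t
  proof -
    obtain B where "\<And>x. norm (g t x) \<le> B" using cper_bounded[OF c[of t]] by blast
    hence "g t \<in> bcontfun" by (rule bcontfun_normI[OF cperD(1)[OF c]])
    thus ?thesis unfolding \<gamma>_def by (rule Bcontfun_inverse)
  qed
  have "continuous_on {0..T} \<gamma>"
    unfolding continuous_on_def
  proof (intro ballI tendstoI)
    fix t and e :: real assume t: "t \<in> {0..T}" and e: "0 < e"
    have "0 < e / 40" using e by simp
    from BNcD(2)[OF g[OF t] this] show "\<forall>\<^sub>F \<tau> in at t within {0..T}. dist (\<gamma> \<tau>) (\<gamma> t) < e"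
    proof eventually_elim
      case (elim \<tau>)
      have "dist (\<gamma> \<tau>) (\<gamma> t) \<le> e / 2"
      proof (rule dist_bound)
        show "dist (apply_bcontfun (\<gamma> \<tau>) x) (apply_bcontfun (\<gamma> t) x) \<le> e / 2" for x
          using BN_sup[OF elim, of x] by (simp add: \<gamma> dist_real_def)
      qed
      thus ?case using e by simp
    qed
  qed
  hence "bounded (\<gamma> ` {0..T})" by (intro compact_imp_bounded compact_continuous_image) auto
  then obtain M where M: "\<And>t. t \<in> {0..T} \<Longrightarrow> norm (\<gamma> t) \<le> M" unfolding bounded_iff by blast
  have "\<bar>g t x\<bar> \<le> M" if "t \<in> {0..T}" for t x
    using norm_bounded[of "\<gamma> t" x] M[OF that] by (simp add: \<gamma>)
  thus ?thesis by (rule that)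
qed

text \<open>Gronwall's lemma bounds the truncated energy by a multiple of \<open>1 / sqrt K\<close>.
  The share of a fixed frequency lies below this bound for all large \<open>K\<close>, hence
  vanishes.\<close>

lemma solution_unique:
  fixes lam :: real
  assumes lam: "0 \<le> lam"
    and c1: "\<And>t. cper (g1 t)" and c2: "\<And>t. cper (g2 t)"
    and g1: "\<And>t. t \<in> {0..T} \<Longrightarrow> BNc {0..T} g1 t" and g2: "\<And>t. t \<in> {0..T} \<Longrightarrow> BNc {0..T} g2 t"
    and D1: "\<And>t k. t \<in> {0..T} \<Longrightarrow> ((\<lambda>t. rfc (g1 t) k) has_vector_derivative
       - (2 * pi * \<i> * of_int k * rfc (flux (g1 t)) k) - lam * rfc (g1 t) k) (at t within {0..T})"
    and D2: "\<And>t k. t \<in> {0..T} \<Longrightarrow> ((\<lambda>t. rfc (g2 t) k) has_vector_derivative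
       - (2 * pi * \<i> * of_int k * rfc (flux (g2 t)) k) - lam * rfc (g2 t) k) (at t within {0..T})"
    and init: "g1 0 = g2 0" and t: "t \<in> {0..T}"
  shows "g1 t = g2 t"
proof (rule rfc_inject[OF c1 c2])
  fix k
  obtain M1 M2 where M12: "\<And>t x. t \<in> {0..T} \<Longrightarrow> \<bar>g1 t x\<bar> \<le> M1" "\<And>t x. t \<in> {0..T} \<Longrightarrow> \<bar>g2 t x\<bar> \<le> M2"
    using BNc_uniform_bound[OF c1 g1] BNc_uniform_bound[OF c2 g2] by (metis (no_types))
  define M where "M = max M1 M2"
  have M: "\<bar>g1 t x\<bar> \<le> M" "\<bar>g2 t x\<bar> \<le> M" if "t \<in> {0..T}" for t x
    using M12(1)[OF that, of x] M12(2)[OF that, of x] by (auto simp: M_def)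
  define W where "W t k = rfc (\<lambda>x. g1 t x - g2 t x) k" for t k
  define G where "G t k = rfc (\<lambda>x. flux (g1 t) x - flux (g2 t) x) k" for t k
  have Wd: "W t = (\<lambda>k. rfc (g1 t) k - rfc (g2 t) k)" for t by (rule ext) (simp only: W_def rfc_diff[OF c1 c2])
  have Gd: "G t = (\<lambda>k. rfc (flux (g1 t)) k - rfc (flux (g2 t)) k)" for t
    by (rule ext) (simp only: G_def rfc_diff[OF flux_cper[OF c1] flux_cper[OF c2]])
  define E where "E K t = (\<Sum>k\<in>{- int K..int K}. 1 / mu k * (norm (W t k))\<^sup>2)" for K t
  have WD: "((\<lambda>t. W t k) has_vector_derivative - (2 * pi * \<i> * of_int k * G s k) - lam * W s k) (at s within {0..T})"
    if "s \<in> {0..T}" for s k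
    using has_vector_derivative_diff[OF D1[OF that, of k] D2[OF that, of k]]
    by (simp add: Wd Gd algebra_simps)
  have ED: "(E K has_vector_derivative (\<Sum>k\<in>{- int K..int K}. 1 / mu k * (2 * inner (W s k) (- (2 * pi * \<i> * of_int k * G s k) - lam * W s k)))) (at s within {0..T})"
    if s: "s \<in> {0..T}" for s K
    unfolding E_def power2_norm_eq_inner
  proof (intro has_vector_derivative_sum has_vector_derivative_mult_right)
    fix k
    from bounded_bilinear.has_vector_derivative[OF bounded_bilinear_inner WD[OF s, of k] WD[OF s, of k]]
    show "((\<lambda>t. inner (W t k) (W t k)) has_vector_derivative 2 * inner (W s k) (- (2 * pi * \<i> * of_int k * G s k) - lam * W s k)) (at s within {0..T})"
      by (simp only: inner_commute[of _ "W s k"] mult_2)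
  qed
  have small: "E K t \<le> exp (20 * M\<^sup>2 * t) * (2000 * M ^ 4 / sqrt K * t)" if K: "1 \<le> K" for K
  proof (rule gronwall_zero[OF ED _ _ _ _ t])
    fix s assume s: "s \<in> {0..T}"
    show "(\<Sum>k\<in>{- int K..int K}. 1 / mu k * (2 * inner (W s k) (- (2 * pi * \<i> * of_int k * G s k) - lam * W s k)))
        \<le> 20 * M\<^sup>2 * E K s + 2000 * M ^ 4 / sqrt K"
      unfolding E_def W_def G_def
      by (rule energy_inequality[OF c1 M(1)[OF s] c2 M(2)[OF s] K lam])
  next
    show "E K 0 = 0" by (simp add: E_def Wd init)
  qed simp_all
  have "1 / mu k * (norm (W t k))\<^sup>2 \<le> 0"
  proof (rule LIMSEQ_le_const)
    have "(\<lambda>K. exp (20 * M\<^sup>2 * t) * (2000 * M ^ 4 * (1 / sqrt (real K)) * t)) \<longlonglongrightarrow> exp (20 * M\<^sup>2 * t) * (2000 * M ^ 4 * 0 * t)"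
      by (intro tendsto_intros) real_asymp
    thus "(\<lambda>K. exp (20 * M\<^sup>2 * t) * (2000 * M ^ 4 / sqrt (real K) * t)) \<longlonglongrightarrow> 0" by simp
    show "\<exists>N. \<forall>K\<ge>N. 1 / mu k * (norm (W t k))\<^sup>2 \<le> exp (20 * M\<^sup>2 * t) * (2000 * M ^ 4 / sqrt (real K) * t)"
    proof (intro exI[of _ "nat \<bar>k\<bar> + 1"] allI impI)
      fix K assume K: "nat \<bar>k\<bar> + 1 \<le> K"
      have "1 / mu k * (norm (W t k))\<^sup>2 \<le> E K t"
        unfolding E_def using K mu_pos by (intro member_le_sum[where f="\<lambda>k. 1 / mu k * (norm (W t k))\<^sup>2"]) (auto simp: less_imp_le)
      also note small[of K]
      finally show "1 / mu k * (norm (W t k))\<^sup>2 \<le> exp (20 * M\<^sup>2 * t) * (2000 * M ^ 4 / sqrt (real K) * t)" using K by simp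
    qed
  qed
  hence "W t k = 0" using mu_pos[of k] by (simp add: divide_le_0_iff)
  thus "rfc (g1 t) k = rfc (g2 t) k" by (simp add: Wd)
qed

end

lemma pdistr_of_fun_inject:
  assumes "cper f" "cper g" "pdistr_of_fun f = pdistr_of_fun g"
  shows "f = g"
  by (rule rfc_inject[OF assms(1,2)]) (metis assms fourier_coeff_of_fun)

text \<open>The bracket is at least \<open>N\<close>, the exponential at least 1 and
  \<open>ln 2 \<le> 1\<close>, so the hypothesis even forces
  \<open>6 * 10 ^ 12 * N\<^sup>2 \<le> lam\<close>.\<close>

lemma smallness_constant:
  fixes N lam :: real
  assumes N: "0 \<le> N" and lam: "0 < lam"
    and le: "6 * (10 ^ 4) ^ 3 / ln 2 * (N + 4 * (10 ^ 4) ^ 3 / lam * N ^ 3)\<^sup>2 * exp (4 * (10 ^ 4) ^ 3 * N\<^sup>2 / lam) \<le> lam"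
  shows "10 ^ 11 * N\<^sup>2 \<le> lam"
proof -
  have ln2: "0 < ln (2::real)" "ln (2::real) \<le> 1" using ln_le_minus_one[of "2::real"] by simp_all
  have c: "10 ^ 11 \<le> 6 * (10 ^ 4) ^ 3 / ln (2::real)"
  proof -
    have "10 ^ 11 * ln 2 \<le> 10 ^ 11 * (1::real)" using ln2 by (intro mult_left_mono) auto
    thus ?thesis using ln2 by (simp add: le_divide_eq)
  qed
  have "0 \<le> 4 * (10 ^ 4) ^ 3 / lam * N ^ 3" using N lam by simp
  hence s: "N\<^sup>2 \<le> (N + 4 * (10 ^ 4) ^ 3 / lam * N ^ 3)\<^sup>2" using N by (intro power_mono) auto
  have e: "1 \<le> exp (4 * (10 ^ 4) ^ 3 * N\<^sup>2 / lam)" using lam by simp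
  have "10 ^ 11 * N\<^sup>2 * 1 \<le> 6 * (10 ^ 4) ^ 3 / ln 2 * (N + 4 * (10 ^ 4) ^ 3 / lam * N ^ 3)\<^sup>2 * exp (4 * (10 ^ 4) ^ 3 * N\<^sup>2 / lam)"
    using ln2 by (intro mult_mono[OF mult_mono[OF c s] e]) auto
  thus ?thesis using le by simp
qed

theorem corollary1p5:
  fixes chi phi :: "real \<Rightarrow> real"
  assumes "littlewood_paley_pair chi phi"
  shows "\<exists>C>0. \<forall>m0 \<in> besov_space chi phi (1/2) 2 1. \<forall>lam>0.
           (let N = besov_norm chi phi (1/2) 2 1 m0 in
              lam \<ge> 6 * C ^ 3 / ln 2 * (N + 4 * C ^ 3 / lam * N ^ 3)\<^sup>2 * exp (4 * C ^ 3 * N\<^sup>2 / lam))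
           \<longrightarrow> (\<exists>m. \<forall>T>0. mch_strong_solution chi phi lam m0 T m \<and>
                  (\<forall>n. mch_strong_solution chi phi lam m0 T n \<longrightarrow> (\<forall>t\<in>{0..T}. n t = m t)))"
proof -
  interpret lp_pair chi phi by unfold_locales (rule assms)
  have main: "\<exists>m. \<forall>T>0. mch_strong_solution chi phi lam m0 T m \<and>
                  (\<forall>n. mch_strong_solution chi phi lam m0 T n \<longrightarrow> (\<forall>t\<in>{0..T}. n t = m t))"
    if m0: "m0 \<in> besov_space chi phi (1/2) 2 1" and lam: "0 < lam"
      and small: "10 ^ 11 * (besov_norm chi phi (1/2) 2 1 m0)\<^sup>2 \<le> lam" for m0 lam
  proof -
    define N where "N = besov_norm chi phi (1/2) 2 1 m0"
    obtain h0 where h0: "BN h0 N" and m0h: "m0 = pdistr_of_fun h0"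
      unfolding N_def by (rule besov_half_function[OF m0])
    have s: "4 * (20 * N)\<^sup>2 \<le> lam"
    proof -
      have "4 * (20 * N)\<^sup>2 = 1600 * N\<^sup>2" by (simp add: power_mult_distrib)
      also have "\<dots> \<le> 10 ^ 11 * N\<^sup>2" by (rule mult_right_mono) simp_all
      finally show ?thesis using small unfolding N_def by linarith
    qed
    interpret F: mch_flow chi phi h0 N lam
      by unfold_locales (use BN_cper[OF h0] BN_sup[OF h0] lam s h0 small in \<open>auto simp: N_def\<close>)
    show ?thesis
    \<comment> \<open>One curve serves every \<open>T\<close>, because the flow and the density were
      built for all times at once.\<close>
    proof (intro exI[of _ "\<lambda>t. pdistr_of_fun (F.m t)"] allI impI conjI ballI)
      fix T :: real assume T: "0 < T"
      show "mch_strong_solution chi phi lam m0 T (\<lambda>t. pdistr_of_fun (F.m t))"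
        unfolding m0h by (rule F.m_solution[OF T])
      fix n t assume n: "mch_strong_solution chi phi lam m0 T n" and t: "t \<in> {0..T}"
      obtain g where g: "\<And>t. t \<in> {0..T} \<Longrightarrow> n t = pdistr_of_fun (g t)" "\<And>t. t \<in> {0..T} \<Longrightarrow> BNc {0..T} g t"
        "\<And>t. cper (g t)"
        "\<And>t k. t \<in> {0..T} \<Longrightarrow> ((\<lambda>t. rfc (g t) k) has_vector_derivative
           - (2 * pi * \<i> * of_int k * rfc (flux (g t)) k) - lam * rfc (g t) k) (at t within {0..T})"
        by (rule strong_solutionD[OF n]) (rule that)
      have "pdistr_of_fun (g 0) = pdistr_of_fun h0"
        using n g(1)[of 0] T m0h by (simp add: mch_strong_solution_def)
      hence "g 0 = F.m 0"
        unfolding F.m_0 by (rule pdistr_of_fun_inject[OF g(3) BN_cper[OF h0]])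
      from solution_unique[OF less_imp_le[OF lam] g(3) F.m_cper g(2) F.m_BNc g(4) F.m_coefficient this t]
      show "n t = pdistr_of_fun (F.m t)" by (simp add: g(1)[OF t])
    qed
  qed
  show ?thesis
  \<comment> \<open>Any \<open>C\<close> with \<open>6 * C ^ 3 / ln 2 \<ge> 10 ^ 11\<close> would
    serve; with \<open>10 ^ 4\<close> the cube is \<open>10 ^ 12\<close>, and the value is the same
    for all pairs \<open>chi\<close>, \<open>phi\<close>.\<close>
  proof (intro exI[of _ "10 ^ 4"] conjI ballI allI impI)
    fix m0 and lam :: real
    assume m0: "m0 \<in> besov_space chi phi (1/2) 2 1" and lam: "0 < lam"
      and le: "let N = besov_norm chi phi (1/2) 2 1 m0 in
              lam \<ge> 6 * (10 ^ 4) ^ 3 / ln 2 * (N + 4 * (10 ^ 4) ^ 3 / lam * N ^ 3)\<^sup>2 * exp (4 * (10 ^ 4) ^ 3 * N\<^sup>2 / lam)"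
    show "\<exists>m. \<forall>T>0. mch_strong_solution chi phi lam m0 T m \<and>
                  (\<forall>n. mch_strong_solution chi phi lam m0 T n \<longrightarrow> (\<forall>t\<in>{0..T}. n t = m t))"
      by (rule main[OF m0 lam smallness_constant[OF besov_norm_nonneg lam le[unfolded Let_def]]])
  qed simp
qed

end
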